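(* Let $N\geq 2$, let $p=4+\frac{4}{N}$, and let $g:\mathbb{R}\to\mathbb{R}$ satisfy: (g1) $g\in C(\mathbb{R},\mathbb{R})$; (g2) $\lim_{s\to 0} g(s)/s=0$; (g3) $\lim_{|s|\to\infty}|g(s)|/|s|^{p-1}=0$; (g4) there exists $s_0>0$ with $G(s_0)>0$, where $G(s)=\int_0^s g(t)\,dt$; (g5) $g(-s)=-g(s)$ for all $s\in\mathbb{R}$. Then: (1) For every $k\in\mathbb{N}$ there exists $m_k\geq 0$ such that for every $m>m_k$ the problem $(P_{\mu,m})$ has at least $k$ radial solutions. (2) If in addition (g6) holds, namely $\liminf_{s\to 0}\frac{g(s)}{|s|^{q-2}s}=+\infty$ with $q=2+\frac{4}{N}$, then for every $m>0$ the problem $(P_{\mu,m})$ has infinitely many radial solutions.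
   Context: For $m>0$, problem $(P_{\mu,m})$ asks for $\mu\in\mathbb{R}$ and $u\in H^1(\mathbb{R}^N)$ with $\int_{\mathbb{R}^N}u^2|\nabla u|^2dx<\infty$ and $\int_{\mathbb{R}^N}|u|^2dx=m$ such that $-\Delta u+\mu u-\Delta(u^2)u=g(u)$ in $\mathbb{R}^N$ in the weak sense, i.e. $\int_{\mathbb{R}^N}\big[(1+2u^2)\nabla u\cdot\nabla\varphi+2u|\nabla u|^2\varphi+\mu u\varphi-g(u)\varphi\big]dx=0$ for all $\varphi\in C_0^\infty(\mathbb{R}^N)$. A radial solution is a solution $(\mu,u)$ with $u$ radially symmetric; solutions are counted as distinct functions $u$. *)

theory Defs
  imports "HOL-Analysis.Analysis"
begin

definition pd :: "'n::finite \<Rightarrow> (real^'n \<Rightarrow> real) \<Rightarrow> real^'n \<Rightarrow> real" where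
  "pd i f x = frechet_derivative f (at x) (axis i 1)"

definition grad :: "(real^'n::finite \<Rightarrow> real) \<Rightarrow> real^'n \<Rightarrow> real^'n" where
  "grad f x = (\<chi> i. pd i f x)"

fun Ck :: "nat \<Rightarrow> (real^'n::finite \<Rightarrow> real) \<Rightarrow> bool" where
  "Ck 0 f = continuous_on UNIV f"
| "Ck (Suc k) f = (f differentiable_on UNIV \<and> (\<forall>i. Ck k (pd i f)))"

definition smooth :: "(real^'n::finite \<Rightarrow> real) \<Rightarrow> bool" where
  "smooth f = (\<forall>k. Ck k f)"

definition test_fun :: "(real^'n::finite \<Rightarrow> real) \<Rightarrow> bool" where
  "test_fun \<phi> = (smooth \<phi> \<and> bounded {x. \<phi> x \<noteq> 0})"

definition L2 :: "(real^'n::finite \<Rightarrow> real) \<Rightarrow> bool" where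
  "L2 f = (f \<in> borel_measurable lebesgue \<and> integrable lebesgue (\<lambda>x. (f x)\<^sup>2))"

definition weak_grad :: "(real^'n::finite \<Rightarrow> real) \<Rightarrow> (real^'n \<Rightarrow> real^'n) \<Rightarrow> bool" where
  "weak_grad u Du = (\<forall>\<phi> i. test_fun \<phi> \<longrightarrow>
      integrable lebesgue (\<lambda>x. u x * pd i \<phi> x) \<and>
      integrable lebesgue (\<lambda>x. Du x $ i * \<phi> x) \<and>
      (\<integral>x. u x * pd i \<phi> x \<partial>lebesgue) = - (\<integral>x. Du x $ i * \<phi> x \<partial>lebesgue))"

definition is_solution ::
  "(real \<Rightarrow> real) \<Rightarrow> real \<Rightarrow> real \<Rightarrow> (real^'n::finite \<Rightarrow> real) \<Rightarrow> bool" where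
  "is_solution g m \<mu> u = (\<exists>Du.
      L2 u \<and> weak_grad u Du \<and> (\<forall>i. L2 (\<lambda>x. Du x $ i)) \<and>
      integrable lebesgue (\<lambda>x. (u x)\<^sup>2 * (norm (Du x))\<^sup>2) \<and>
      (\<integral>x. (u x)\<^sup>2 \<partial>lebesgue) = m \<and>
      (\<forall>\<phi>. test_fun \<phi> \<longrightarrow>
         (let F = (\<lambda>x. (1 + 2 * (u x)\<^sup>2) * (Du x \<bullet> grad \<phi> x)
                     + 2 * u x * (norm (Du x))\<^sup>2 * \<phi> x
                     + \<mu> * u x * \<phi> x - g (u x) * \<phi> x)
          in integrable lebesgue F \<and> (\<integral>x. F x \<partial>lebesgue) = 0)))"

definition radial :: "(real^'n::finite \<Rightarrow> real) \<Rightarrow> bool" where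
  "radial u = (\<forall>x y. norm x = norm y \<longrightarrow> u x = u y)"

definition radial_solution ::
  "(real \<Rightarrow> real) \<Rightarrow> real \<Rightarrow> (real^'n::finite \<Rightarrow> real) \<Rightarrow> bool" where
  "radial_solution g m u = (radial u \<and> (\<exists>\<mu>. is_solution g m \<mu> u))"

definition at_least_k_radial_solutions ::
  "(real \<Rightarrow> real) \<Rightarrow> real \<Rightarrow> nat \<Rightarrow> (real^'n::finite \<Rightarrow> real) itself \<Rightarrow> bool" where
  "at_least_k_radial_solutions g m k _ = (\<exists>us :: nat \<Rightarrow> (real^'n \<Rightarrow> real).
      (\<forall>i<k. radial_solution g m (us i)) \<and>
      (\<forall>i<k. \<forall>j<k. i \<noteq> j \<longrightarrow> \<not> (AE x in lebesgue. us i x = us j x)))"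

definition infinitely_many_radial_solutions ::
  "(real \<Rightarrow> real) \<Rightarrow> real \<Rightarrow> (real^'n::finite \<Rightarrow> real) itself \<Rightarrow> bool" where
  "infinitely_many_radial_solutions g m _ = (\<exists>us :: nat \<Rightarrow> (real^'n \<Rightarrow> real).
      (\<forall>i. radial_solution g m (us i)) \<and>
      (\<forall>i j. i \<noteq> j \<longrightarrow> \<not> (AE x in lebesgue. us i x = us j x)))"

end

theory Submission
  imports Defs
begin

text \<open>
The dual variable \<open>v = Th u\<close> with \<open>Th' u = sqrt (1 + 2 u^2)\<close> turns the quasilinear operator into the Laplacian.
On a finite radial lattice the energy is decreased by a coordinatewise descent that keeps the mass below \<open>m0\<close>
and never increases the number of sign alternations. Starting from a \<open>k\<close>-parameter family of alternating bumps of negative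
energy, the Poincare--Miranda theorem provides initial data whose iterates keep \<open>k\<close> alternations for as many steps
as needed; a limit of such iterates is a lattice solution with exactly \<open>k\<close> alternations and energy at most \<open>-e0\<close>.
A discrete Gagliardo--Nirenberg inequality bounds these solutions independently of the mesh and the radius, and the
radial decay gives compactness. The limit solves the radial equation, is regular at the origin by a bootstrap, and
its multiplier is positive: otherwise the Pohozaev identity would contradict the negative energy. Positivity of the multiplier
prevents loss of mass at infinity and of all but one alternation, so values of \<open>k\<close> that differ by two give different solutions.
\<close>

section \<open>The theorem of Poincare and Miranda\<close>

text \<open>Minimisation under a mass constraint yields a single solution; the count of sign changes
  is the invariant that separates many. On a lattice it is finite, and updating one coordinate at a
  time keeps it under control: a small update can only copy a sign already present at the index or
  next to it. The constraint is a ball, because projection onto a ball keeps signs, obeys the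
  variational inequality of a convex set and produces a multiplier of known sign; full mass is
  recovered afterwards from the positivity of the multiplier. The level \<open>- e0\<close> has two
  roles: it keeps limits from vanishing and it drives the Pohozaev argument. The exponent
  \<open>4 + 4 / N\<close> is critical because \<open>u^2\<close> is controlled by
  \<open>Th u\<close>, so that the discrete Gagliardo-Nirenberg inequality at this power is linear
  in the Dirichlet energy; (g3) supplies a small coefficient. Under (g6) the same test functions
  have negative energy at every mass, since cost and gain scale alike at the power
  \<open>2 + 4 / N\<close>. The lattice parameter \<open>m0\<close> is the mass \<open>m\<close>
  divided by the area of the unit sphere.\<close>

lemma compact_box_fun: "compact {u::nat => real. \<forall>i. \<bar>u i\<bar> <= B i}"
proof -
 have "compactin (product_topology (%i::nat. euclidean :: real topology) UNIV) (PiE UNIV (%i. {- B i..B i}))"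
  by (subst compactin_PiE) auto
 moreover have "PiE UNIV (%i. {- B i..B i}) = {u::nat => real. \<forall>i. \<bar>u i\<bar> <= B i}"
  by (auto simp: PiE_def Pi_def abs_le_iff minus_le_iff)
 ultimately show ?thesis by (simp add: euclidean_product_topology)
qed

lemma tendsto_fun_coordinate:
 fixes x :: "'a => nat => real"
 assumes "(x \<longlongrightarrow> l) F" shows "((%n. x n i) \<longlongrightarrow> l i) F"
proof -
 have "isCont (%u::nat => real. u i) l"
  using continuous_on_product_coordinates[of i] by (metis UNIV_I continuous_on_eq_continuous_at open_UNIV)
 thus ?thesis using isCont_tendsto_compose assms by blast
qed

text \<open>Lattice functions are modelled as sequences in the product topology, so Tychonoff gives
  a subsequence converging in every coordinate at once. It also replaces the diagonal arguments
  needed later for profiles and nodal points.\<close>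

lemma bounded_fun_subseq:
 fixes x :: "nat => nat => real"
 assumes "!!n i. \<bar>x n i\<bar> <= B i"
 obtains l r where "strict_mono r" "!!i. (%n. x (r n) i) \<longlonglongrightarrow> l i" "(x \<circ> r) \<longlonglongrightarrow> l" "!!i. \<bar>l i\<bar> <= B i"
proof -
 have "seq_compact {u::nat => real. \<forall>i. \<bar>u i\<bar> <= B i}"
  using compact_box_fun compact_imp_seq_compact by blast
 moreover have "!!n. x n \<in> {u::nat => real. \<forall>i. \<bar>u i\<bar> <= B i}" using assms by auto
 ultimately obtain l r where "l \<in> {u::nat => real. \<forall>i. \<bar>u i\<bar> <= B i}" "strict_mono r" "(x \<circ> r) \<longlonglongrightarrow> l"
  using seq_compactE[of "{u::nat => real. \<forall>i. \<bar>u i\<bar> <= B i}" x] by blast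
 thus ?thesis using that tendsto_fun_coordinate[of "x \<circ> r" l sequentially] by (auto simp: o_def)
qed

text \<open>Two sequences at distance \<open>1 / (n + 1)\<close> violating the claim would have a
  common limit in the compact box. As the product topology carries no norm, closeness is measured on
  the first \<open>L\<close> coordinates and the others must agree.\<close>

lemma box_uniformly_continuous:
 fixes f :: "(nat => real) => real"
 assumes f: "continuous_on UNIV f" and e: "e > 0"
 obtains d where "d > 0"
  "!!u w. (!!i. \<bar>u i\<bar> <= B i) ==> (!!i. \<bar>w i\<bar> <= B i) ==> (!!i. i < L ==> \<bar>u i - w i\<bar> <= d)
    ==> (!!i. i >= L ==> u i = w i) ==> \<bar>f u - f w\<bar> < e"
proof (rule ccontr)
 assume c: "\<not> thesis"
 define P where "P d u w \<longleftrightarrow> (\<forall>i. \<bar>u i\<bar> <= B i) \<and> (\<forall>i. \<bar>w i\<bar> <= B i) \<and> (\<forall>i<L. \<bar>u i - w i\<bar> <= d)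
   \<and> (\<forall>i\<ge>L. u i = w i) \<and> \<not> \<bar>f u - f w\<bar> < e" for d u w
 have "\<forall>n. \<exists>p. P (1 / (real n + 1)) (fst p) (snd p)"
 proof (rule ccontr)
  assume "\<not> ?thesis"
  then obtain n where n: "!!u w. \<not> P (1 / (real n + 1)) u w" by auto
  have thesis
  proof (rule that[of "1 / (real n + 1)"])
   show "\<bar>f u - f w\<bar> < e" if "!!i. \<bar>u i\<bar> <= B i" "!!i. \<bar>w i\<bar> <= B i"
    "!!i. i < L ==> \<bar>u i - w i\<bar> <= 1 / (real n + 1)" "!!i. i >= L ==> u i = w i" for u w
    using n[of u w] that unfolding P_def by simp
  qed simp
  thus False using c by blast
 qed
 then obtain p where p: "!!n. P (1 / (real n + 1)) (fst (p n)) (snd (p n))" by metis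
 define u where "u n = fst (p n)" for n
 define w where "w n = snd (p n)" for n
 have P: "P (1 / (real n + 1)) (u n) (w n)" for n using p unfolding u_def w_def by auto
 obtain l r where r: "strict_mono r" and l: "!!i. (%n. u (r n) i) \<longlonglongrightarrow> l i" "(u \<circ> r) \<longlonglongrightarrow> l"
  using bounded_fun_subseq[of u B] P unfolding P_def by metis
 have d0: "(%n. u (r n) i - w (r n) i) \<longlonglongrightarrow> 0" for i
 proof (rule Lim_null_comparison)
  show "\<forall>\<^sub>F n in sequentially. norm (u (r n) i - w (r n) i) <= 1 / (real (r n) + 1)"
  proof (intro always_eventually allI)
   fix n show "norm (u (r n) i - w (r n) i) <= 1 / (real (r n) + 1)"
    using P[of "r n"] unfolding P_def by (cases "i < L") auto
  qed
  have "(%n. 1 / (real n + 1)) \<longlonglongrightarrow> 0" using lim_inverse_n' LIMSEQ_inverse_real_of_nat by (simp add: inverse_eq_divide add.commute)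
  thus "(%n. 1 / (real (r n) + 1)) \<longlonglongrightarrow> 0" using LIMSEQ_subseq_LIMSEQ[OF _ r] by (auto simp: o_def)
 qed
 have "(%n. w (r n) i) \<longlonglongrightarrow> l i" for i
  using tendsto_diff[OF l(1)[of i] d0[of i]] by simp
 moreover have "(!!i. \<bar>w (r n) i\<bar> <= B i)" for n using P[of "r n"] unfolding P_def by auto
 ultimately obtain s where s: "strict_mono s" and ws: "((%n. w (r n)) \<circ> s) \<longlonglongrightarrow> l"
 proof -
  assume a: "!!i. (%n. w (r n) i) \<longlonglongrightarrow> l i" "!!n i. \<bar>w (r n) i\<bar> <= B i"
  obtain l' s where s: "strict_mono s" "!!i. (%n. w (r (s n)) i) \<longlonglongrightarrow> l' i" "((%n. w (r n)) \<circ> s) \<longlonglongrightarrow> l'"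
   using bounded_fun_subseq[of "%n. w (r n)" B] a(2) by metis
  have "l' = l"
   using LIMSEQ_unique[OF s(2) LIMSEQ_subseq_LIMSEQ[OF a(1) s(1), unfolded o_def]] by blast
  thus thesis using that s by metis
 qed
 have us: "(%n. u (r (s n))) \<longlonglongrightarrow> l" using LIMSEQ_subseq_LIMSEQ[OF l(2) s] by (simp add: o_def)
 have fc: "isCont f l" using f by (metis UNIV_I continuous_on_eq_continuous_at open_UNIV)
 have "(%n. f (u (r (s n))) - f (w (r (s n)))) \<longlonglongrightarrow> f l - f l"
  by (intro tendsto_diff isCont_tendsto_compose[OF fc] us) (use ws in \<open>simp add: o_def\<close>)
 hence "(%n. \<bar>f (u (r (s n))) - f (w (r (s n)))\<bar>) \<longlonglongrightarrow> 0" by (simp add: tendsto_rabs_zero)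
 then obtain n where "\<bar>f (u (r (s n))) - f (w (r (s n)))\<bar> < e"
  using e by (metis (no_types, lifting) eventually_sequentially order_refl order_tendstoD(2))
 thus False using P[of "r (s n)"] unfolding P_def by auto
qed

text \<open>Kuhn's combinatorial lemma on a fine grid gives a cell in which every component takes
  both weak signs, hence is small, against a positive lower bound for the largest component. The
  half-side 2 leaves a shell around the unit cube in which a homotopy can be run.\<close>

theorem poincare_miranda:
 fixes F :: "(nat => real) => nat => real"
 assumes cont: "!!j. j < k ==> continuous_on UNIV (%z. F z j)"
  and lo: "!!z j. j < k ==> (!!i. \<bar>z i\<bar> <= 2) ==> z j = -2 ==> F z j <= 0"
  and hi: "!!z j. j < k ==> (!!i. \<bar>z i\<bar> <= 2) ==> z j = 2 ==> F z j >= 0"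
 obtains z where "!!i. \<bar>z i\<bar> <= 2" "!!j. j < k ==> F z j = 0"
proof (rule ccontr)
 assume "\<not> thesis"
 hence nz: "!!z. (!!i. \<bar>z i\<bar> <= 2) ==> \<exists>j<k. F z j \<noteq> 0" using that by blast
 define K where "K = {u::nat => real. \<forall>i. \<bar>u i\<bar> <= 2}"
 define S where "S z = (\<Sum>j<k. \<bar>F z j\<bar>)" for z
 have K: "compact K" "K \<noteq> {}" unfolding K_def using compact_box_fun[of "%_. 2"] by (auto intro: exI[of _ "%_. 0"])
 have "continuous_on K S" unfolding S_def
  by (intro continuous_intros continuous_on_subset[OF cont]) auto
 then obtain z0 where z0: "z0 \<in> K" "!!z. z \<in> K ==> S z0 <= S z" using continuous_attains_inf[OF K] by metis
 have k0: "k > 0" using nz[of "%_. 0"] by auto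
 obtain j0 where "j0 < k" "F z0 j0 \<noteq> 0" using nz[of z0] z0(1) by (auto simp: K_def)
 hence S0: "S z0 > 0" unfolding S_def by (intro sum_pos2[of _ j0]) auto
 \<comment> \<open>The mean of the components at the minimum: if all components were smaller at some
   point, \<open>S\<close> would fall below its minimal value.\<close>
 define e where "e = S z0 / real k"
 have e: "e > 0" unfolding e_def using S0 k0 by simp
 have big: "\<exists>j<k. \<bar>F z j\<bar> >= e" if "z \<in> K" for z
 proof (rule ccontr)
  assume "\<not> ?thesis"
  hence "S z < (\<Sum>j<k. e)" unfolding S_def using k0 by (intro sum_strict_mono) auto
  also have "\<dots> = S z0" using k0 by (simp add: e_def)
  finally show False using z0(2)[OF that] by simp
 qed
 have "\<exists>d>0. \<forall>u w. (\<forall>i. \<bar>u i\<bar> <= 2) --> (\<forall>i. \<bar>w i\<bar> <= 2) --> (\<forall>i<k. \<bar>u i - w i\<bar> <= d) --> (\<forall>i\<ge>k. u i = w i)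
   --> \<bar>F u j - F w j\<bar> < e" if "j < k" for j
  using box_uniformly_continuous[OF cont[OF that] e, of "%_. 2" k] by metis
 then obtain d where d: "!!j. j < k ==> d j > 0"
  "!!j u w. j < k ==> (\<forall>i. \<bar>u i\<bar> <= 2) ==> (\<forall>i. \<bar>w i\<bar> <= 2) ==> (\<forall>i<k. \<bar>u i - w i\<bar> <= d j) ==> (\<forall>i\<ge>k. u i = w i)
   ==> \<bar>F u j - F w j\<bar> < e" by metis
 define D where "D = Min (d ` {..<k})"
 have D: "D > 0" "!!j. j < k ==> D <= d j" unfolding D_def using d(1) k0 by (auto simp: Min_gr_iff lessThan_empty_iff)
 obtain p where p: "4 / D < real p" using reals_Archimedean2 by blast
 hence p0: "p > 0" using D(1) by (metis divide_pos_pos gr0I less_asym of_nat_0 zero_less_numeral)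
 have pD: "4 / real p <= D" using p p0 D(1) by (simp add: field_simps)
 define zz where "zz x i = (if i < k then - 2 + 4 * real (x i) / real p else 0)" for x :: "nat => nat" and i
 have zzK: "\<bar>zz x i\<bar> <= 2" if "\<forall>i<k. x i <= p" for x i
 proof (cases "i < k")
  case True
  hence "4 * real (x i) / real p <= 4" using that p0 by (simp add: field_simps)
  thus ?thesis using p0 by (auto simp: zz_def abs_le_iff)
 qed (simp add: zz_def)
 \<comment> \<open>Kuhn's lemma forces the labels at the two extreme grid values; the face
   hypotheses \<open>lo\<close> and \<open>hi\<close> make them agree with the weak sign of
   \<open>F\<close>.\<close>
 define label where "label x j = (if x j = 0 \<or> x j \<noteq> p \<and> F (zz x) j < 0 then 0 else 1::nat)" for x j
 have l0: "F (zz x) j <= 0" if "\<forall>i<k. x i <= p" "j < k" "label x j = 0" for x j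
 proof (cases "x j = 0")
  case True thus ?thesis using lo[of j "zz x"] that zzK[OF that(1)] by (simp add: zz_def)
 next
  case False thus ?thesis using that by (auto simp: label_def split: if_splits)
 qed
 have l1: "F (zz x) j >= 0" if "\<forall>i<k. x i <= p" "j < k" "label x j \<noteq> 0" for x j
 proof (cases "x j = p")
  case True thus ?thesis using hi[of j "zz x"] that zzK[OF that(1)] p0 by (simp add: zz_def)
 next
  case False thus ?thesis using that by (auto simp: label_def split: if_splits)
 qed
 obtain q where q: "\<forall>i<k. q i < p"
  "\<forall>i<k. \<exists>r s. (\<forall>j<k. q j <= r j \<and> r j <= q j + 1) \<and> (\<forall>j<k. q j <= s j \<and> s j <= q j + 1) \<and> label r i \<noteq> label s i"
  by (rule kuhn_lemma[of p k label]) (use p0 in \<open>auto simp: label_def\<close>)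
 have near: "\<bar>F (zz r) j - F (zz q) j\<bar> < e" if "j < k" "\<forall>j<k. q j <= r j \<and> r j <= q j + 1" for r j
 proof (rule d(2)[OF that(1)])
  show "\<forall>i. \<bar>zz r i\<bar> <= 2" using q(1) that(2) by (intro allI zzK) fastforce
  show "\<forall>i. \<bar>zz q i\<bar> <= 2" using q(1) by (intro allI zzK) (auto intro: less_imp_le)
  show "\<forall>i\<ge>k. zz r i = zz q i" by (simp add: zz_def)
  show "\<forall>i<k. \<bar>zz r i - zz q i\<bar> <= d j"
  proof (intro allI impI)
   fix i assume i: "i < k"
   have "zz r i - zz q i = 4 / real p * (real (r i) - real (q i))" using i by (simp add: zz_def right_diff_distrib diff_divide_distrib)
   moreover have "\<bar>real (r i) - real (q i)\<bar> <= 1" using that(2) i by fastforce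
   ultimately have "\<bar>zz r i - zz q i\<bar> <= 4 / real p * 1" by (simp add: abs_mult divide_right_mono)
   thus "\<bar>zz r i - zz q i\<bar> <= d j" using pD D(2)[OF that(1)] by simp
  qed
 qed
 have "\<bar>F (zz q) j\<bar> < e" if j: "j < k" for j
 proof -
  obtain r s where rs: "\<forall>j<k. q j <= r j \<and> r j <= q j + 1" "\<forall>j<k. q j <= s j \<and> s j <= q j + 1" "label r j \<noteq> label s j"
   using q(2) j by blast
  have rp: "\<forall>i<k. r i <= p" "\<forall>i<k. s i <= p" using rs q(1) by fastforce+
  show ?thesis
  proof (cases "label r j = 0")
   case True
   thus ?thesis using l0[OF rp(1) j] l1[OF rp(2) j] rs near[OF j rs(1)] near[OF j rs(2)] by auto
  next
   case False
   hence "label s j = 0" using rs(3) by (auto simp: label_def split: if_splits)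
   thus ?thesis using l1[OF rp(1) j] l0[OF rp(2) j] False near[OF j rs(1)] near[OF j rs(2)] by auto
  qed
 qed
 moreover have "\<forall>i<k. q i <= p" using q(1) less_imp_le by blast
 hence "zz q \<in> K" unfolding K_def using zzK[of q] by blast
 ultimately show False using big[of "zz q"] by (meson not_le)
qed

section \<open>Sign alternations\<close>

definition alt :: "nat => ('a::linorder => real) => bool" where
 "alt k v \<longleftrightarrow> (\<exists>p s. (s = 1 \<or> s = -1) \<and> (\<forall>j<k. p j < p (Suc j)) \<and> (\<forall>j\<le>k. s * (-1) ^ j * v (p j) > 0))"

lemma altI: "s = 1 \<or> s = -1 ==> (!!j. j < k ==> p j < p (Suc j)) ==> (!!j. j <= k ==> s * (-1) ^ j * v (p j) > 0) ==> alt k v"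
 unfolding alt_def by blast

lemma altE: assumes "alt k v"
 obtains p s where "s = 1 \<or> s = -1" "!!j. j < k ==> p j < p (Suc j)" "!!j. j <= k ==> s * (-1) ^ j * v (p j) > (0::real)"
 using assms unfolding alt_def by blast

lemma sign_cases: "s = 1 \<or> s = -1 ==> s * (-1) ^ j = 1 \<or> s * (-1) ^ j = (-1::real)"
 using minus_one_power_iff[of j, where ?'a = real] by auto

lemma alt_mono: assumes "alt k v" "j <= k" shows "alt j v"
proof -
 obtain p s where "s = 1 \<or> s = -1" "!!j. j < k ==> p j < p (Suc j)" "!!j. j <= k ==> s * (-1) ^ j * v (p j) > 0"
  using altE[OF assms(1)] by metis
 thus ?thesis using assms(2) by (intro altI[of s j p]) auto
qed

lemma alt_sgn_cong: assumes "alt k v" "!!i. sgn (w i) = sgn (v i)" shows "alt k w"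
proof -
 obtain p s where p: "s = 1 \<or> s = -1" "!!j. j < k ==> p j < p (Suc j)" "!!j. j <= k ==> s * (-1) ^ j * v (p j) > 0"
  using altE[OF assms(1)] by metis
 show ?thesis
 proof (rule altI[of s k p])
  show "s = 1 \<or> s = -1" by (rule p(1))
  show "!!j. j < k ==> p j < p (Suc j)" by (rule p(2))
  fix j assume "j <= k"
  thus "s * (-1) ^ j * w (p j) > 0" using p(3)[of j] assms(2)[of "p j"] sign_cases[OF p(1), of j]
   by (auto simp: sgn_if split: if_splits)
 qed
qed

text \<open>A witness at the changed index can be moved to a place that already had its sign:
  \<open>i\<close> itself or a neighbour. The order of the witnesses survives because the adjacent
  witness has the opposite sign and so cannot occupy that neighbour.\<close>

lemma alt_update:
 fixes v :: "nat => real"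
 assumes a: "alt k (v(i := x))"
  and nb: "!!s. s = 1 \<or> s = -1 ==> s * x > 0 ==> s * v i > 0 \<or> (i > 0 \<and> s * v (i - 1) > 0) \<or> s * v (Suc i) > 0"
 shows "alt k v"
proof -
 obtain p s where p: "s = 1 \<or> s = -1" "!!j. j < k ==> p j < p (Suc j)" "!!j. j <= k ==> s * (-1) ^ j * (v(i := x)) (p j) > 0"
  using altE[OF a] by metis
 have mono: "p j < p l" if "j < l" "l <= k" for j l
  using that
 proof (induction l)
  case (Suc l)
  thus ?case using p(2)[of l] by (cases "j = l") (auto intro: less_trans)
 qed simp
 show ?thesis
 proof (cases "\<exists>j\<le>k. p j = i")
  case False
  thus ?thesis using p by (intro altI[of s k p]) (auto simp: fun_upd_def split: if_splits)
 next
  case True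
  then obtain j0 where j0: "j0 <= k" "p j0 = i" by blast
  have oth: "s * (-1) ^ j * v (p j) > 0" if "j <= k" "j \<noteq> j0" for j
   using p(3)[OF that(1)] mono[of j j0] mono[of j0 j] that j0 by (cases "j < j0") auto
  define t where "t = s * (-1) ^ j0"
  have t: "t = 1 \<or> t = -1" unfolding t_def by (rule sign_cases[OF p(1)])
  have "t * x > 0" using p(3)[OF j0(1)] j0(2) unfolding t_def by simp
  then consider "t * v i > 0" | "i > 0" "t * v (i - 1) > 0" | "t * v (Suc i) > 0" using nb[OF t] by blast
  thus ?thesis
  proof cases
   case 1
   hence "s * (-1) ^ j * v (p j) > 0" if "j <= k" for j
    using oth[OF that] j0 unfolding t_def by (cases "j = j0") auto
   thus ?thesis using p by (intro altI[of s k p])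
  next
   case 2
   show ?thesis
   proof (rule altI[OF p(1), of k "p(j0 := i - 1)"])
    fix j assume j: "j < k"
    show "(p(j0 := i - 1)) j < (p(j0 := i - 1)) (Suc j)"
    proof (cases "Suc j = j0")
     case True
     have "p j < i" using p(2)[OF j] True j0 by simp
     moreover have "p j \<noteq> i - 1"
     proof
      assume "p j = i - 1"
      hence "s * (-1) ^ j * v (i - 1) > 0" using oth[of j] True j by auto
      thus False using 2 unfolding t_def True[symmetric] by simp
     qed
     ultimately show ?thesis using True by auto
    next
     case False
     thus ?thesis using p(2)[OF j] j0 by auto
    qed
   next
    fix j assume "j <= k"
    thus "s * (-1) ^ j * v ((p(j0 := i - 1)) j) > 0" using oth 2 by (auto simp: t_def)
   qed
  next
   case 3
   show ?thesis
   proof (rule altI[OF p(1), of k "p(j0 := Suc i)"])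
    fix j assume j: "j < k"
    show "(p(j0 := Suc i)) j < (p(j0 := Suc i)) (Suc j)"
    proof (cases "j = j0")
     case True
     have "p (Suc j) > i" using p(2)[OF j] True j0 by simp
     moreover have "p (Suc j) \<noteq> Suc i"
     proof
      assume "p (Suc j) = Suc i"
      hence "s * (-1) ^ Suc j * v (Suc i) > 0" using oth[of "Suc j"] True j by auto
      thus False using 3 unfolding t_def True[symmetric] by simp
     qed
     ultimately show ?thesis using True by auto
    next
     case False
     thus ?thesis using p(2)[OF j] j0 by auto
    qed
   next
    fix j assume "j <= k"
    thus "s * (-1) ^ j * v ((p(j0 := Suc i)) j) > 0" using oth 3 by (auto simp: t_def)
   qed
  qed
 qed
qed

text \<open>A function whose zeros are genuine sign changes cannot gain strict alternations from weak ones: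
  each zero can be moved to the neighbour of the required sign.\<close>

lemma alt_of_weak_alternation:
 fixes v :: "nat => real"
 assumes s: "s = 1 \<or> s = -1" and p: "!!j. j < k ==> p j < p (Suc j)" and w: "!!j. j <= k ==> s * (-1) ^ j * v (p j) >= 0"
  and z: "!!j. j <= k ==> v (p j) = 0 ==> p j > 0 \<and> v (p j - 1) * v (Suc (p j)) < 0"
 shows "alt k v"
proof -
 have "\<exists>q. s * (-1) ^ j * v q > 0 \<and> (q = p j \<or> (v (p j) = 0 \<and> p j > 0 \<and> (q = p j - 1 \<or> q = Suc (p j))))" if "j <= k" for j
 proof (cases "v (p j) = 0")
  case False
  thus ?thesis using w[OF that] sign_cases[OF s, of j] by (intro exI[of _ "p j"]) auto
 next
  case True
  have z': "p j > 0" "v (p j - 1) * v (Suc (p j)) < 0" using z[OF that True] by auto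
  hence "(s * (-1) ^ j * v (p j - 1)) * (s * (-1) ^ j * v (Suc (p j))) < 0"
   using sign_cases[OF s, of j] by auto
  hence "s * (-1) ^ j * v (p j - 1) > 0 \<or> s * (-1) ^ j * v (Suc (p j)) > 0"
   by (meson linorder_not_less mult_nonpos_nonpos)
  thus ?thesis using True z'(1) by blast
 qed
 then obtain q where q: "!!j. j <= k ==> s * (-1) ^ j * v (q j) > 0"
  "!!j. j <= k ==> q j = p j \<or> (v (p j) = 0 \<and> p j > 0 \<and> (q j = p j - 1 \<or> q j = Suc (p j)))" by metis
 show ?thesis
 proof (rule altI[OF s, of k q])
  fix j assume j: "j < k"
  have ne: "q j \<noteq> q (Suc j)"
  proof
   assume "q j = q (Suc j)"
   thus False using q(1)[of j] q(1)[of "Suc j"] j by simp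
  qed
  have nz: "v (q j) \<noteq> 0" "v (q (Suc j)) \<noteq> 0" using q(1)[of j] q(1)[of "Suc j"] j by auto
  show "q j < q (Suc j)"
  proof (rule ccontr)
   assume "\<not> ?thesis"
   hence lt: "q (Suc j) < q j" using ne by linarith
   have pj: "p j < p (Suc j)" by (rule p[OF j])
   have b1: "q j <= Suc (p j)" and b2: "p (Suc j) <= Suc (q (Suc j))" using q(2)[of j] q(2)[of "Suc j"] j by auto
   have "q j = Suc (p j)" "q (Suc j) = p (Suc j) - 1" "p (Suc j) = Suc (p j)"
    using b1 b2 lt pj q(2)[of j] q(2)[of "Suc j"] j by linarith+
   moreover have "v (p j) = 0" using q(2)[of j] j calculation by auto
   ultimately show False using nz by simp
  qed
 next
  fix j assume "j <= k" thus "s * (-1) ^ j * v (q j) > 0" by (rule q(1))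
 qed
qed

text \<open>Induction along the lattice, with a root placed just before each index where the sign
  flips, so that the polynomial follows the sign of \<open>v\<close>. The last two clauses record
  that \<sigma> is the sign at the last witness, which lies below \<open>L\<close>; this permits the
  next extension.\<close>

lemma sign_polynomial:
 fixes v :: "nat => real"
 shows "(\<forall>i<L. v i = 0) \<or> (\<exists>Y \<sigma> p s. finite Y \<and> (\<forall>y\<in>Y. y < real L - 1/2 \<and> (\<forall>i. real i \<noteq> y)) \<and> (\<sigma> = 1 \<or> \<sigma> = -1) \<and>
   (\<forall>i<L. \<sigma> * (\<Prod>y\<in>Y. real i - y) * v i >= 0) \<and> (s = 1 \<or> s = -1) \<and> (\<forall>j<card Y. p j < p (Suc j)) \<and>
   (\<forall>j\<le>card Y. s * (-1) ^ j * v (p j) > 0) \<and> s * (-1) ^ card Y = \<sigma> \<and> p (card Y) < L)"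
proof (induction L)
 case 0 thus ?case by simp
next
 case (Suc L)
 show ?case
 proof (cases "\<forall>i<L. v i = 0")
  case True
  show ?thesis
  proof (cases "v L = 0")
   case t: True
   hence "\<forall>i<Suc L. v i = 0" using True by (auto simp: less_Suc_eq)
   thus ?thesis by blast
  next
   case False
   have "\<forall>i<Suc L. sgn (v L) * v i >= 0" using True by (auto simp: less_Suc_eq sgn_if)
   moreover have "sgn (v L) = 1 \<or> sgn (v L) = -1" "sgn (v L) * v L > 0" using False by (auto simp: sgn_if)
   ultimately show ?thesis
    by (intro disjI2 exI[of _ "{}"] exI[of _ "sgn (v L)"] exI[of _ "%_. L"]) auto
  qed
 next
  case False
  then obtain Y \<sigma> p s where Y: "finite Y" "\<forall>y\<in>Y. y < real L - 1/2 \<and> (\<forall>i. real i \<noteq> y)" and sg: "\<sigma> = 1 \<or> \<sigma> = -1" and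
   pos: "\<forall>i<L. \<sigma> * (\<Prod>y\<in>Y. real i - y) * v i >= 0" and s: "s = 1 \<or> s = -1" and p: "\<forall>j<card Y. p j < p (Suc j)"
   "\<forall>j\<le>card Y. s * (-1) ^ j * v (p j) > 0" "s * (-1) ^ card Y = \<sigma>" "p (card Y) < L"
   using Suc.IH by blast
  have pr: "(\<Prod>y\<in>Y. real L - y) > 0" using Y(2) by (intro prod_pos) (auto simp: algebra_simps)
  show ?thesis
  proof (cases "\<sigma> * v L >= 0")
   case True
   hence "\<sigma> * (\<Prod>y\<in>Y. real L - y) * v L >= 0" using pr
    by (metis mult.assoc mult.left_commute mult_nonneg_nonneg less_imp_le)
   hence "\<forall>i<Suc L. \<sigma> * (\<Prod>y\<in>Y. real i - y) * v i >= 0" using pos by (auto simp: less_Suc_eq)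
   moreover have "\<forall>y\<in>Y. y < real (Suc L) - 1/2 \<and> (\<forall>i. real i \<noteq> y)" using Y(2) by fastforce
   moreover have "p (card Y) < Suc L" using p(4) by simp
   ultimately show ?thesis using Y(1) sg s p(1-3) by blast
  next
   case False
   \<comment> \<open>A half-integer separates the indices \<open>L - 1\<close> and \<open>L\<close>
     without being a lattice point, so the polynomial has no zero on the lattice.\<close>
   define y0 where "y0 = real L - 1/2"
   have y0: "y0 \<notin> Y" using Y(2) unfolding y0_def by force
   have y0i: "real i \<noteq> y0" for i
   proof
    assume "real i = y0"
    hence "2 * real i = 2 * real L - 1" unfolding y0_def by simp
    hence "real (2 * i + 1) = real (2 * L)" by simp
    hence "2 * i + 1 = 2 * L" by (simp only: of_nat_eq_iff)
    thus False by presburger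
   qed
   define Y' where "Y' = insert y0 Y"
   have cY: "card Y' = Suc (card Y)" unfolding Y'_def using Y(1) y0 by simp
   define p' where "p' = p(Suc (card Y) := L)"
   have 1: "finite Y'" "\<forall>y\<in>Y'. y < real (Suc L) - 1/2 \<and> (\<forall>i. real i \<noteq> y)"
    unfolding Y'_def using Y y0i by (auto simp: y0_def)
   have 2: "\<forall>i<Suc L. (-\<sigma>) * (\<Prod>y\<in>Y'. real i - y) * v i >= 0"
   proof (intro allI impI)
    fix i assume i: "i < Suc L"
    have e: "(-\<sigma>) * (\<Prod>y\<in>Y'. real i - y) * v i = (y0 - real i) * (\<sigma> * (\<Prod>y\<in>Y. real i - y) * v i)"
     unfolding Y'_def using Y(1) y0 by (simp add: algebra_simps)
    show "(-\<sigma>) * (\<Prod>y\<in>Y'. real i - y) * v i >= 0"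
    proof (cases "i = L")
     case True
     have "(y0 - real i) < 0" unfolding True y0_def by simp
     moreover have "\<sigma> * (\<Prod>y\<in>Y. real i - y) * v i <= 0" using False pr unfolding True
      by (metis mult.assoc mult.left_commute mult_nonneg_nonpos less_imp_le linorder_not_le)
     ultimately show ?thesis unfolding e by (intro mult_nonpos_nonpos) auto
    next
     case False
     hence iL: "i < L" using i by simp
     hence "real i + 1 <= real L" by simp
     hence "y0 - real i >= 0" unfolding y0_def by simp
     thus ?thesis unfolding e using pos iL mult_nonneg_nonneg by blast
    qed
   qed
   have 3: "\<forall>j<card Y'. p' j < p' (Suc j)" using p cY unfolding p'_def by (auto simp: less_Suc_eq)
   have 4: "\<forall>j\<le>card Y'. s * (-1) ^ j * v (p' j) > 0"
    using p cY False unfolding p'_def by (auto simp: le_Suc_eq)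
   have 5: "s * (-1) ^ card Y' = -\<sigma>" using p cY by simp
   have 6: "p' (card Y') < Suc L" using cY unfolding p'_def by simp
   have 7: "-\<sigma> = 1 \<or> -\<sigma> = -1" using sg by auto
   show ?thesis using 1 2 3 4 5 6 7 s by blast
  qed
 qed
qed

text \<open>The Lagrange basis polynomial of the nodes \<open>p 0\<close>, ...,
  \<open>p (k - 1)\<close>. The node \<open>p k\<close> is left out and is reached by
  extrapolation.\<close>

definition lag :: "nat => (nat => nat) => nat => real => real" where
 "lag k p j x = (\<Prod>l\<in>{..<k} - {j}. (x - real (p l)) / (real (p j) - real (p l)))"

lemma lag_node: assumes "inj_on p {..<k}" "j < k" "l < k" shows "lag k p j (real (p l)) = (if l = j then 1 else 0)"
proof (cases "l = j")
 case True
 have "real (p j) \<noteq> real (p i)" if "i \<in> {..<k} - {j}" for i using that assms by (auto dest: inj_onD)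
 thus ?thesis unfolding lag_def True by (auto intro!: prod.neutral)
next
 case False
 thus ?thesis unfolding lag_def using assms by (auto intro!: prod_zero bexI[of _ l])
qed

text \<open>The product has degree below \<open>k\<close>, so its values at \<open>k\<close> nodes
  determine it: the difference of the two sides would have too many roots.\<close>

lemma lagrange_interpolation:
 assumes inj: "inj_on p {..<k}" and Y: "finite Y" "card Y < k"
 shows "(\<Prod>y\<in>Y. x - y) = (\<Sum>j<k. (\<Prod>y\<in>Y. real (p j) - y) * lag k p j x)"
proof -
 define P where "P = (\<Prod>y\<in>Y. [:- y, 1:])"
 define Q where "Q j = (\<Prod>l\<in>{..<k} - {j}. smult (1 / (real (p j) - real (p l))) [:- real (p l), 1:])" for j
 define R where "R = P - (\<Sum>j<k. smult (\<Prod>y\<in>Y. real (p j) - y) (Q j))"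
 have PP: "poly P x = (\<Prod>y\<in>Y. x - y)" for x unfolding P_def by (simp add: poly_prod)
 have QQ: "poly (Q j) x = lag k p j x" for j x unfolding Q_def lag_def by (simp add: poly_prod diff_divide_distrib)
 have R: "poly R x = (\<Prod>y\<in>Y. x - y) - (\<Sum>j<k. (\<Prod>y\<in>Y. real (p j) - y) * lag k p j x)" for x
  unfolding R_def by (simp add: PP QQ poly_sum)
 have dP: "degree P < k"
 proof -
  have "degree P <= (\<Sum>y\<in>Y. degree [:- y, 1:])" unfolding P_def using degree_prod_sum_le[OF Y(1), of "%y. [:- y, 1:]"] by (simp add: o_def)
  thus ?thesis using Y(2) by simp
 qed
 have dQ: "degree (Q j) < k" if "j < k" for j
 proof -
  have "degree (Q j) <= (\<Sum>l\<in>{..<k} - {j}. degree (smult (1 / (real (p j) - real (p l))) [:- real (p l), 1:]))"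
   unfolding Q_def
   using degree_prod_sum_le[of "{..<k} - {j}" "%l. smult (1 / (real (p j) - real (p l))) [:- real (p l), 1:]"]
   by (simp add: o_def)
  also have "\<dots> <= (\<Sum>l\<in>{..<k} - {j}. 1)" by (intro sum_mono order_trans[OF degree_smult_le]) simp
  finally show ?thesis using that by simp
 qed
 have "degree (\<Sum>j<k. smult (\<Prod>y\<in>Y. real (p j) - y) (Q j)) < k"
  using dQ Y(2) by (intro degree_sum_less) (auto intro: le_less_trans[OF degree_smult_le])
 hence dR: "degree R < k" unfolding R_def by (rule degree_diff_less[OF dP])
 have "R = 0"
 proof (rule ccontr)
  assume "R \<noteq> 0"
  have "(%l. real (p l)) ` {..<k} \<subseteq> {x. poly R x = 0}"
  proof safe
   fix l assume l: "l < k"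
   have "(\<Sum>j<k. (\<Prod>y\<in>Y. real (p j) - y) * lag k p j (real (p l))) = (\<Sum>j<k. if l = j then (\<Prod>y\<in>Y. real (p j) - y) else 0)"
    by (rule sum.cong) (use lag_node[OF inj] l in auto)
   thus "poly R (real (p l)) = 0" unfolding R using l by simp
  qed
  hence "card ((%l. real (p l)) ` {..<k}) <= card {x. poly R x = 0}"
   using poly_roots_finite[OF \<open>R \<noteq> 0\<close>] by (intro card_mono)
  moreover have "card ((%l. real (p l)) ` {..<k}) = k"
   using inj by (subst card_image) (auto simp: inj_on_def)
  ultimately show False using card_poly_roots_bound[OF \<open>R \<noteq> 0\<close>] dR by linarith
 qed
 thus ?thesis using R[of x] by simp
qed

text \<open>Chebyshev-system argument: vanishing moments make \<open>v\<close> orthogonal to all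
  polynomials of degree below \<open>k\<close>. With fewer than \<open>k\<close> sign changes the
  polynomial of \<open>sign_polynomial\<close> would be one of them, but its pairing with
  \<open>v\<close> is a sum of terms of one sign, nonzero at \<open>i0\<close>.\<close>

lemma moments_alt:
 fixes v :: "nat => real"
 assumes inj: "inj_on p {..<k}" and nz: "i0 < L" "v i0 \<noteq> 0"
  and M: "!!j. j < k ==> (\<Sum>i<L. lag k p j (real i) * v i) = 0"
 shows "alt k v"
proof (rule ccontr)
 assume na: "\<not> alt k v"
 obtain Y \<sigma> p' s where Y: "finite Y" "\<forall>y\<in>Y. y < real L - 1/2 \<and> (\<forall>i. real i \<noteq> y)" and sg: "\<sigma> = 1 \<or> \<sigma> = -1" and
  pos: "\<forall>i<L. \<sigma> * (\<Prod>y\<in>Y. real i - y) * v i >= 0" and s: "s = 1 \<or> s = -1" and p: "\<forall>j<card Y. p' j < p' (Suc j)"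
  "\<forall>j\<le>card Y. s * (-1) ^ j * v (p' j) > 0"
  using sign_polynomial[of L v] nz by blast
 have "alt (card Y) v" using s p by (intro altI[of s _ p']) auto
 hence cY: "card Y < k" using na alt_mono by (metis linorder_not_less)
 have "(\<Sum>i<L. \<sigma> * (\<Prod>y\<in>Y. real i - y) * v i) = (\<Sum>i<L. \<Sum>j<k. \<sigma> * (\<Prod>y\<in>Y. real (p j) - y) * (lag k p j (real i) * v i))"
  by (subst lagrange_interpolation[OF inj Y(1) cY]) (simp add: sum_distrib_left sum_distrib_right mult_ac)
 also have "\<dots> = (\<Sum>j<k. \<sigma> * (\<Prod>y\<in>Y. real (p j) - y) * (\<Sum>i<L. lag k p j (real i) * v i))"
  by (subst sum.swap) (simp add: sum_distrib_left)
 also have "\<dots> = 0" by (simp add: M)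
 finally have "\<sigma> * (\<Prod>y\<in>Y. real i0 - y) * v i0 = 0"
  using pos nz(1) by (subst (asm) sum_nonneg_eq_0_iff) auto
 thus False using nz(2) sg Y by auto
qed

text \<open>Extrapolation to \<open>p k\<close> yields one negative factor for each node
  \<open>p l\<close> with \<open>j < l < k\<close>; the alternating signs of the initial data turn
  this parity into a fixed sign.\<close>

lemma lag_last_sign:
 assumes p: "!!j. j < k ==> p j < p (Suc j)" and j: "j < k"
 shows "(-1) ^ j * lag k p j (real (p k)) * (-1) ^ k < 0"
proof -
 have mono: "p j < p l" if "j < l" "l <= k" for j l
  using that
 proof (induction l)
  case (Suc l)
  thus ?case using p[of l] by (cases "j = l") (auto intro: less_trans)
 qed simp
 define f where "f l = (real (p k) - real (p l)) / (real (p j) - real (p l))" for l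
 have split: "{..<k} - {j} = {..<j} \<union> {Suc j..<k}" using j by auto
 have "lag k p j (real (p k)) = (\<Prod>l<j. f l) * (\<Prod>l\<in>{Suc j..<k}. f l)"
  unfolding lag_def f_def split by (rule prod.union_disjoint) auto
 also have "(\<Prod>l\<in>{Suc j..<k}. f l) = (\<Prod>l\<in>{Suc j..<k}. (-1) * (- f l))" by simp
 also have "\<dots> = (-1) ^ (k - Suc j) * (\<Prod>l\<in>{Suc j..<k}. - f l)" by (subst prod.distrib) simp
 finally have e: "lag k p j (real (p k)) = (-1) ^ (k - Suc j) * ((\<Prod>l<j. f l) * (\<Prod>l\<in>{Suc j..<k}. - f l))" by simp
 have a: "(\<Prod>l<j. f l) > 0" using mono j by (intro prod_pos) (auto simp: f_def)
 have b: "(\<Prod>l\<in>{Suc j..<k}. - f l) > 0"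
  using mono j by (intro prod_pos) (auto simp: f_def divide_less_0_iff minus_divide_right[symmetric] neg_0_less_iff_less simp del: minus_divide_left)
 have "k = Suc (k - Suc j + j)" using j by simp
 hence "(-1::real) ^ j * (-1) ^ (k - Suc j) * (-1) ^ k = (-1) ^ (j + (k - Suc j) + Suc (k - Suc j + j))"
  by (metis power_add)
 also have "j + (k - Suc j) + Suc (k - Suc j + j) = Suc (2 * (j + (k - Suc j)))" by simp
 finally have "(-1::real) ^ j * (-1) ^ (k - Suc j) * (-1) ^ k = -1" by (simp add: power_mult)
 moreover have "(-1) ^ j * lag k p j (real (p k)) * (-1) ^ k =
   ((-1) ^ j * (-1) ^ (k - Suc j) * (-1) ^ k) * ((\<Prod>l<j. f l) * (\<Prod>l\<in>{Suc j..<k}. - f l))"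
  unfolding e by (simp only: mult_ac)
 ultimately have "(-1) ^ j * lag k p j (real (p k)) * (-1) ^ k = - ((\<Prod>l<j. f l) * (\<Prod>l\<in>{Suc j..<k}. - f l))"
  by (simp only: mult_minus1)
 thus ?thesis using mult_pos_pos[OF a b] by simp
qed

primrec negmax :: "nat => (nat => real) => real" where
 "negmax 0 z = 0"
| "negmax (Suc n) z = max (negmax n z) (- z n)"

primrec absmax :: "nat => (nat => real) => real" where
 "absmax 0 z = 0"
| "absmax (Suc n) z = max (absmax n z) \<bar>z n\<bar>"

lemma negmax_nonneg: "negmax n z >= 0" by (induction n) (auto simp: max_def)
lemma negmax_ge: "j < n ==> - z j <= negmax n z" by (induction n) (auto simp: less_Suc_eq le_max_iff_disj)
lemma negmax_attained: "negmax n z = 0 \<or> (\<exists>j<n. negmax n z = - z j)"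
 by (induction n) (auto simp: max_def less_Suc_eq)
lemma absmax_ge: "j < n ==> \<bar>z j\<bar> <= absmax n z" by (induction n) (auto simp: less_Suc_eq le_max_iff_disj)
lemma continuous_on_negmax: "continuous_on UNIV (negmax n)"
 by (induction n) (auto intro!: continuous_intros)
lemma continuous_on_absmax: "continuous_on UNIV (absmax n)"
 by (induction n) (auto intro!: continuous_intros)

text \<open>Give \<open>z\<close> a coordinate 0 at index \<open>k\<close>, push it along the
  diagonal until it touches the boundary of the orthant, and lift it if \<open>z\<close> lies in the
  unit cube. All shifts are diagonal, so coordinates \<open>j\<close> and \<open>k\<close> always
  differ by \<open>z j\<close>; this makes the starting moment map diagonal.\<close>

definition cone_pt :: "nat => (nat => real) => nat => real" where
 "cone_pt k z j = (if j < k then z j else 0) + negmax k z + max 0 (1 - absmax k z)"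

text \<open>The plane of all \<open>z\<close> parametrises the rays of the positive orthant: \<open>cone_pt\<close> reaches its boundary
  exactly outside the unit cube. A homotopy through functions that have fewer than \<open>k\<close> sign changes on the boundary
  keeps the degree of the moment map, so the final function has \<open>k\<close> sign changes for some interior ray.\<close>

theorem alternation_persists:
 fixes Phi :: "real => (nat => real) => nat => real" and c :: "(nat => real) => real"
 assumes p: "!!j. j < k ==> p j < p (Suc j)" "p k < L"
  and cont: "!!i s X. continuous_on UNIV s ==> (!!j. continuous_on UNIV (%z. X z j)) ==> (!!z. 0 <= s z \<and> s z <= 1) ==>
    (!!z j. X z j >= 0) ==> (!!z. \<exists>j\<le>k. X z j > 0) ==> continuous_on UNIV (%z::nat => real. Phi (s z) (X z) i)"
  and start: "!!x i. (!!j. x j >= 0) ==> \<exists>j\<le>k. x j > 0 ==> c x > 0"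
   "!!x i. (!!j. x j >= 0) ==> \<exists>j\<le>k. x j > 0 ==>
    Phi 0 x i = c x * (\<Sum>j\<le>k. if i = p j then (-1) ^ j * (if j < k then \<bar>lag k p j (real (p k))\<bar> else 1) * x j else 0)"
  and nz: "!!s x. 0 <= s ==> s <= 1 ==> (!!j. x j >= 0) ==> \<exists>j\<le>k. x j > 0 ==> \<exists>i<L. Phi s x i \<noteq> 0"
  and bd: "!!s x j. 0 <= s ==> s <= 1 ==> (!!j. x j >= 0) ==> \<exists>j\<le>k. x j > 0 ==> j <= k ==> x j = 0 ==> \<not> alt k (Phi s x)"
 obtains x where "!!j. x j >= 0" "\<exists>j\<le>k. x j > 0" "alt k (Phi 1 x)"
proof -
 have mono: "p j < p l" if "j < l" "l <= k" for j l
  using that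
 proof (induction l)
  case (Suc l)
  thus ?case using p(1)[of l] by (cases "j = l") (auto intro: less_trans)
 qed simp
 have inj: "inj_on p {..k}" using mono by (intro linorder_inj_onI) (auto simp: less_le)
 hence injk: "inj_on p {..<k}" by (rule inj_on_subset) auto
 define X where "X = cone_pt k"
 \<comment> \<open>The homotopy time is read off from \<open>z\<close>: 1 on the unit cube, falling
   to 0 at distance 2. A single map on the large cube thus contains the whole homotopy.\<close>
 define s where "s z = min 1 (max 0 (2 - absmax k z))" for z
 define F where "F z j = (-1) ^ j * (\<Sum>i<L. lag k p j (real i) * Phi (s z) (X z) i)" for z j
 have X0: "X z j >= 0" for z j
  unfolding X_def cone_pt_def using negmax_ge[of j k z] negmax_nonneg[of k z] by (auto simp: max_def)
 have Xp: "\<exists>j\<le>k. X z j > 0" for z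
 proof (cases "absmax k z < 1")
  case True
  hence "X z k > 0" unfolding X_def cone_pt_def using negmax_nonneg[of k z] by auto
  thus ?thesis by blast
 next
  case False
  have "\<exists>j<k. z j \<noteq> 0"
  proof (rule ccontr)
   assume "\<not> ?thesis"
   hence "absmax n z = 0" if "n <= k" for n using that by (induction n) auto
   thus False using False by auto
  qed
  then obtain j where j: "j < k" "z j \<noteq> 0" by blast
  show ?thesis
  proof (cases "z j > 0")
   case True
   hence "X z j > 0" unfolding X_def cone_pt_def using negmax_nonneg[of k z] j by auto
   thus ?thesis using j less_imp_le by blast
  next
   case False
   hence "negmax k z > 0" using negmax_ge[of j k z] j by auto
   hence "X z k > 0" unfolding X_def cone_pt_def by auto
   thus ?thesis by blast
  qed
 qed
 have Xb: "\<exists>j\<le>k. X z j = 0" if "absmax k z >= 1" for z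
  using negmax_attained[of k z]
 proof
  assume "negmax k z = 0"
  hence "X z k = 0" unfolding X_def cone_pt_def using that by auto
  thus ?thesis by blast
 next
  assume "\<exists>j<k. negmax k z = - z j"
  then obtain j where "j < k" "negmax k z = - z j" by blast
  hence "X z j = 0" unfolding X_def cone_pt_def using that by auto
  thus ?thesis using \<open>j < k\<close> less_imp_le by blast
 qed
 have s: "0 <= s z \<and> s z <= 1" for z by (simp add: s_def)
 have sc: "continuous_on UNIV s" unfolding s_def by (intro continuous_intros continuous_on_absmax)
 have Xc: "continuous_on UNIV (%z. X z j)" for j
  unfolding X_def cone_pt_def
  by (cases "j < k") (auto intro!: continuous_intros continuous_on_absmax continuous_on_negmax)
 have Fc: "continuous_on UNIV (%z. F z j)" for j
  unfolding F_def by (intro continuous_intros cont sc Xc s X0 Xp)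
 have s0: "s z = 0" if "\<bar>z j\<bar> = 2" "j < k" for z j
  using absmax_ge[OF that(2), of z] that by (simp add: s_def)
 \<comment> \<open>At time 0 only the nodes carry values: \<open>lag\<close> picks out node
   \<open>j\<close> and extrapolates to \<open>p k\<close>. The weights in \<open>start\<close> give
   the two contributions the same factor with opposite signs, so \<open>z j\<close> remains, times a
   nonnegative factor, and the face conditions are immediate.\<close>
 have F0: "F z j = c (X z) * \<bar>lag k p j (real (p k))\<bar> * z j" if j: "j < k" and "s z = 0" for z j
 proof -
  define a where "a l = (-1) ^ l * (if l < k then \<bar>lag k p l (real (p k))\<bar> else 1) * X z l" for l
  have P: "Phi (s z) (X z) i = c (X z) * (\<Sum>l\<le>k. if i = p l then a l else 0)" for i
   unfolding that(2) a_def using start(2)[of "X z" i] X0 Xp by blast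
  have "(\<Sum>i<L. lag k p j (real i) * Phi (s z) (X z) i) = (\<Sum>i<L. \<Sum>l\<le>k. if i = p l then c (X z) * (lag k p j (real i) * a l) else 0)"
   unfolding P sum_distrib_left by (intro sum.cong) auto
  also have "\<dots> = (\<Sum>l\<le>k. \<Sum>i<L. if i = p l then c (X z) * (lag k p j (real i) * a l) else 0)" by (rule sum.swap)
  also have "\<dots> = (\<Sum>l\<le>k. c (X z) * (lag k p j (real (p l)) * a l))"
  proof (rule sum.cong)
   fix l assume "l \<in> {..k}"
   hence "p l < L" using mono[of l k] p(2) by (cases "l = k") auto
   thus "(\<Sum>i<L. if i = p l then c (X z) * (lag k p j (real i) * a l) else 0) = c (X z) * (lag k p j (real (p l)) * a l)"
    by (simp add: sum.delta)
  qed simp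
  also have "\<dots> = (\<Sum>l<k. c (X z) * (lag k p j (real (p l)) * a l)) + c (X z) * (lag k p j (real (p k)) * a k)"
   by (simp add: lessThan_Suc_atMost[symmetric])
  also have "(\<Sum>l<k. c (X z) * (lag k p j (real (p l)) * a l)) = (\<Sum>l<k. if l = j then c (X z) * a j else 0)"
   by (rule sum.cong) (use lag_node[OF injk j] in auto)
  also have "\<dots> = c (X z) * a j" using j by simp
  finally have M: "(\<Sum>i<L. lag k p j (real i) * Phi (s z) (X z) i) = c (X z) * (a j + lag k p j (real (p k)) * a k)"
   by (simp add: algebra_simps)
  have lg: "(-1) ^ j * lag k p j (real (p k)) * (-1) ^ k = - \<bar>lag k p j (real (p k))\<bar>"
  proof -
   have "\<bar>(-1) ^ j * lag k p j (real (p k)) * (-1) ^ k\<bar> = \<bar>lag k p j (real (p k))\<bar>" by (simp add: abs_mult power_abs)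
   moreover have "(-1) ^ j * lag k p j (real (p k)) * (-1) ^ k < 0" by (rule lag_last_sign[of k p, OF p(1) j])
   ultimately show ?thesis by linarith
  qed
  have "F z j = c (X z) * ((-1) ^ j * a j + ((-1) ^ j * lag k p j (real (p k)) * (-1) ^ k) * X z k)"
   unfolding F_def M by (simp add: a_def algebra_simps)
  also have "(-1) ^ j * a j = \<bar>lag k p j (real (p k))\<bar> * X z j" using j unfolding a_def by (simp add: power_mult_distrib[symmetric] flip: mult.assoc)
  also have "\<bar>lag k p j (real (p k))\<bar> * X z j + ((-1) ^ j * lag k p j (real (p k)) * (-1) ^ k) * X z k = \<bar>lag k p j (real (p k))\<bar> * (X z j - X z k)"
   unfolding lg by (simp add: algebra_simps)
  also have "X z j - X z k = z j" using j by (simp add: X_def cone_pt_def)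
  finally show ?thesis by simp
 qed
 obtain z where z: "!!j. j < k ==> F z j = 0"
 proof (rule poincare_miranda[of k F])
  show "continuous_on UNIV (%z. F z j)" for j by (rule Fc)
  show "F z j <= 0" if "j < k" "z j = -2" for z j
   using F0[OF that(1) s0[of z j]] start(1)[of "X z"] X0 Xp that by (auto simp: mult_le_0_iff zero_le_mult_iff less_imp_le)
  show "F z j >= 0" if "j < k" "z j = 2" for z j
   using F0[OF that(1) s0[of z j]] start(1)[of "X z"] X0 Xp that by (auto simp: zero_le_mult_iff less_imp_le)
 qed blast
 have "(\<Sum>i<L. lag k p j (real i) * Phi (s z) (X z) i) = 0" if "j < k" for j
  using z[OF that] unfolding F_def by simp
 moreover obtain i0 where "i0 < L" "Phi (s z) (X z) i0 \<noteq> 0" using nz[of "s z" "X z"] s X0 Xp by blast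
 ultimately have A: "alt k (Phi (s z) (X z))" by (intro moments_alt[OF injk])
 \<comment> \<open>In the shell some coordinate of the ray is 0, where \<open>bd\<close> forbids
   \<open>k\<close> alternations. So the zero of the moment map lies in the unit cube, where the
   time is 1.\<close>
 have "absmax k z < 1"
 proof (rule ccontr)
  assume "\<not> ?thesis"
  then obtain j where "j <= k" "X z j = 0" using Xb[of z] by auto
  thus False using bd[of "s z" "X z" j] s X0 Xp A by blast
 qed
 hence "s z = 1" by (simp add: s_def)
 thus thesis using that[of "X z"] A X0 Xp by simp
qed

section \<open>The dual variable\<close>

definition dTh :: "real => real" where "dTh u = sqrt (1 + 2 * u\<^sup>2)"

text \<open>The antiderivative of \<open>dTh\<close> that vanishes at 0, in closed form.\<close>

definition Th :: "real => real" where
 "Th u = u * dTh u / 2 + arsinh (sqrt 2 * u) / (2 * sqrt 2)"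

lemma dTh_ge_1: "dTh u >= 1" by (simp add: dTh_def)

lemma dTh_pos [simp]: "dTh u > 0" using dTh_ge_1[of u] by linarith

lemma dTh_nonneg [simp]: "dTh u >= 0" using dTh_pos[of u] by linarith

lemma dTh_nz [simp]: "dTh u \<noteq> 0" using dTh_pos[of u] by linarith

lemma dTh_sq: "(dTh u)\<^sup>2 = 1 + 2 * u\<^sup>2" by (simp add: dTh_def)

lemma dTh_minus [simp]: "dTh (- u) = dTh u" by (simp add: dTh_def)

lemma dTh_le: "dTh u <= 1 + 2 * \<bar>u\<bar>"
proof -
 have "sqrt (1 + 2 * u\<^sup>2) <= sqrt ((1 + 2 * \<bar>u\<bar>)\<^sup>2)"
  by (rule real_sqrt_le_mono) (simp add: power2_sum power_mult_distrib)
 thus ?thesis by (simp add: dTh_def)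
qed

lemma abs_le_dTh: "\<bar>u\<bar> <= dTh u"
proof -
 have "sqrt (u\<^sup>2) <= sqrt (1 + 2 * u\<^sup>2)" by (rule real_sqrt_le_mono) simp
 thus ?thesis by (simp add: dTh_def)
qed

lemma dTh_mono: "\<bar>a\<bar> <= \<bar>b\<bar> ==> dTh a <= dTh b"
 by (simp add: dTh_def abs_le_square_iff)

lemma dTh_has_derivative: "(dTh has_real_derivative 2 * u / dTh u) (at u)"
proof -
 have p: "1 + 2 * u\<^sup>2 > 0" using zero_le_power2[of u] by linarith
 show ?thesis unfolding dTh_def
  by (rule derivative_eq_intros refl p | use p in \<open>simp add: field_simps\<close>)+
qed

lemma continuous_on_dTh [continuous_intros]:
 "continuous_on A f ==> continuous_on A (%x. dTh (f x))"
 unfolding dTh_def by (intro continuous_intros)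

lemma tendsto_dTh [tendsto_intros]:
 "(f \<longlongrightarrow> l) F ==> ((%x. dTh (f x)) \<longlongrightarrow> dTh l) F"
 unfolding dTh_def by (intro tendsto_intros)

lemma Th_has_derivative: "(Th has_real_derivative dTh u) (at u)"
proof -
 have s: "(sqrt 2 * u)\<^sup>2 + 1 = 1 + 2 * u\<^sup>2" by (simp add: power_mult_distrib)
 have q: "dTh u * dTh u = 1 + 2 * u\<^sup>2" using dTh_sq[of u] by (simp add: power2_eq_square)
 have A: "((%u. u * dTh u) has_real_derivative 1 * dTh u + 2 * u / dTh u * u) (at u)"
  by (rule DERIV_mult[OF DERIV_ident dTh_has_derivative])
 have "((%u. sqrt 2 * u) has_real_derivative sqrt 2) (at u)"
  by (auto intro!: derivative_eq_intros)
 from DERIV_chain2[OF arsinh_real_has_field_derivative this]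
 have B: "((%u. arsinh (sqrt 2 * u)) has_real_derivative 1 / sqrt ((sqrt 2 * u)\<^sup>2 + 1) * sqrt 2) (at u)" .
 have "((%u. u * dTh u / 2 + arsinh (sqrt 2 * u) / (2 * sqrt 2)) has_real_derivative
   (1 * dTh u + 2 * u / dTh u * u) / 2 + (1 / sqrt ((sqrt 2 * u)\<^sup>2 + 1) * sqrt 2) / (2 * sqrt 2)) (at u)"
  by (intro DERIV_add DERIV_cdivide A B)
 moreover have "(1 * dTh u + 2 * u / dTh u * u) / 2 + (1 / sqrt ((sqrt 2 * u)\<^sup>2 + 1) * sqrt 2) / (2 * sqrt 2)
   = dTh u"
  unfolding s dTh_def[symmetric] using q by (simp add: field_simps power2_eq_square)
 ultimately show ?thesis unfolding Th_def[abs_def] by simp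
qed

lemma Th_0 [simp]: "Th 0 = 0" by (simp add: Th_def)

lemma Th_minus [simp]: "Th (- u) = - Th u" by (simp add: Th_def)

lemma continuous_on_Th [continuous_intros]:
 "continuous_on A f ==> continuous_on A (%x. Th (f x))"
 using continuous_on_compose2[OF DERIV_continuous_on[of UNIV Th, OF DERIV_subset[OF Th_has_derivative]]]
 by blast

lemma Th_mvt: "\<exists>z. \<bar>z\<bar> <= max \<bar>a\<bar> \<bar>b\<bar> \<and> Th a - Th b = dTh z * (a - b)"
proof (cases a b rule: linorder_cases)
 case less
 then obtain z where "a < z" "z < b" "Th b - Th a = (b - a) * dTh z"
  using MVT2[of a b Th dTh] Th_has_derivative by blast
 thus ?thesis by (intro exI[of _ z]) (auto simp: algebra_simps)
next
 case equal thus ?thesis by (intro exI[of _ a]) auto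
next
 case greater
 then obtain z where "b < z" "z < a" "Th a - Th b = (a - b) * dTh z"
  using MVT2[of b a Th dTh] Th_has_derivative by blast
 thus ?thesis by (intro exI[of _ z]) (auto simp: algebra_simps)
qed

lemma Th_strict_mono: "strict_mono Th"
proof (rule strict_monoI)
 fix a b :: real assume "a < b"
 thus "Th a < Th b"
  by (rule DERIV_pos_imp_increasing) (use Th_has_derivative dTh_pos in blast)
qed

lemma Th_less_iff [simp]: "Th a < Th b \<longleftrightarrow> a < b" using Th_strict_mono strict_mono_less by blast
lemma Th_le_iff [simp]: "Th a <= Th b \<longleftrightarrow> a <= b" using Th_strict_mono strict_mono_less_eq by blast
lemma Th_eq_iff [simp]: "Th a = Th b \<longleftrightarrow> a = b" using Th_strict_mono strict_mono_eq by blast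

lemma Th_pos_iff [simp]: "0 < Th a \<longleftrightarrow> 0 < a" using Th_less_iff[of 0 a] by simp
lemma Th_neg_iff [simp]: "Th a < 0 \<longleftrightarrow> a < 0" using Th_less_iff[of a 0] by simp
lemma Th_nonneg_iff [simp]: "0 <= Th a \<longleftrightarrow> 0 <= a" using Th_le_iff[of 0 a] by simp
lemma Th_nonpos_iff [simp]: "Th a <= 0 \<longleftrightarrow> a <= 0" using Th_le_iff[of a 0] by simp
lemma Th_eq_0_iff [simp]: "Th a = 0 \<longleftrightarrow> a = 0" using Th_eq_iff[of a 0] by simp

lemma sgn_Th [simp]: "sgn (Th a) = sgn a" by (auto simp: sgn_if)

lemma abs_diff_le_Th: "\<bar>a - b\<bar> <= \<bar>Th a - Th b\<bar>"
proof -
 obtain z where "Th a - Th b = dTh z * (a - b)" using Th_mvt by blast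
 thus ?thesis using dTh_ge_1[of z] by (simp add: abs_mult mult_le_cancel_right1)
qed

lemma abs_le_Th: "\<bar>a\<bar> <= \<bar>Th a\<bar>" using abs_diff_le_Th[of a 0] by simp

lemma Th_diff_le: assumes "\<bar>a\<bar> <= T" "\<bar>b\<bar> <= T" shows "\<bar>Th a - Th b\<bar> <= dTh T * \<bar>a - b\<bar>"
proof -
 obtain z where z: "\<bar>z\<bar> <= max \<bar>a\<bar> \<bar>b\<bar>" "Th a - Th b = dTh z * (a - b)" using Th_mvt by blast
 hence "dTh z <= dTh T" using assms by (intro dTh_mono) auto
 thus ?thesis using z by (simp add: abs_mult mult_right_mono)
qed

lemma Th_bound: "\<bar>Th a\<bar> <= \<bar>a\<bar> * dTh a"
 using Th_diff_le[of a "\<bar>a\<bar>" 0] by (simp add: dTh_def mult.commute)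

text \<open>Since \<open>dTh\<close> dominates the absolute value, \<open>2 * Th u\<close> plus or
  minus \<open>u^2\<close> is nondecreasing. So \<open>u^2\<close> inherits every increment bound on
  \<open>Th u\<close>: this is the gain from the quasilinear term and the source of the critical
  power.\<close>

lemma sq_diff_le_Th: "\<bar>a\<^sup>2 - b\<^sup>2\<bar> <= 2 * \<bar>Th a - Th b\<bar>"
proof -
 have *: "b\<^sup>2 - a\<^sup>2 <= 2 * (Th b - Th a) \<and> a\<^sup>2 - b\<^sup>2 <= 2 * (Th b - Th a)" if "a < b" for a b
 proof
  have "\<exists>z>a. z < b \<and> (2 * Th b - b\<^sup>2) - (2 * Th a - a\<^sup>2) = (b - a) * (2 * dTh z - 2 * z)"
   using that by (intro MVT2) (auto intro!: derivative_eq_intros Th_has_derivative)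
  then obtain z where "(2 * Th b - b\<^sup>2) - (2 * Th a - a\<^sup>2) = (b - a) * (2 * dTh z - 2 * z)" by blast
  moreover have "(b - a) * (2 * dTh z - 2 * z) >= 0" using that abs_le_dTh[of z] by (intro mult_nonneg_nonneg) auto
  ultimately show "b\<^sup>2 - a\<^sup>2 <= 2 * (Th b - Th a)" by simp
 next
  have "\<exists>z>a. z < b \<and> (2 * Th b + b\<^sup>2) - (2 * Th a + a\<^sup>2) = (b - a) * (2 * dTh z + 2 * z)"
   using that by (intro MVT2) (auto intro!: derivative_eq_intros Th_has_derivative)
  then obtain z where "(2 * Th b + b\<^sup>2) - (2 * Th a + a\<^sup>2) = (b - a) * (2 * dTh z + 2 * z)" by blast
  moreover have "(b - a) * (2 * dTh z + 2 * z) >= 0" using that abs_le_dTh[of z] by (intro mult_nonneg_nonneg) auto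
  ultimately show "a\<^sup>2 - b\<^sup>2 <= 2 * (Th b - Th a)" by simp
 qed
 show ?thesis using *[of a b] *[of b a] by (cases a b rule: linorder_cases) (auto simp: abs_if)
qed

lemma sq_le_Th: "a\<^sup>2 <= 2 * \<bar>Th a\<bar>" using sq_diff_le_Th[of a 0] by simp

lemma Th_surj: "\<exists>u. Th u = v"
proof -
 have "\<exists>u\<ge>-\<bar>v\<bar>. u <= \<bar>v\<bar> \<and> Th u = v"
  using abs_le_Th[of "\<bar>v\<bar>"] by (intro IVT') (auto intro!: continuous_intros)
 thus ?thesis by blast
qed

definition Thi :: "real => real" where "Thi = inv Th"

lemma Th_Thi [simp]: "Th (Thi v) = v" unfolding Thi_def using Th_surj by (metis f_inv_into_f rangeI)
lemma Thi_Th [simp]: "Thi (Th u) = u" using Th_Thi[of "Th u"] by (simp del: Th_Thi)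
lemma Thi_0 [simp]: "Thi 0 = 0" using Thi_Th[of 0] by simp
lemma sgn_Thi [simp]: "sgn (Thi v) = sgn v" using sgn_Th[of "Thi v"] by simp
lemma abs_Thi_diff_le: "\<bar>Thi a - Thi b\<bar> <= \<bar>a - b\<bar>" using abs_diff_le_Th[of "Thi a" "Thi b"] by simp
lemma abs_Thi_le: "\<bar>Thi a\<bar> <= \<bar>a\<bar>" using abs_Thi_diff_le[of a 0] by simp

lemma isCont_Thi: "isCont Thi v"
 unfolding continuous_at_eps_delta by (metis abs_Thi_diff_le dist_real_def le_less_trans)

lemma continuous_on_Thi [continuous_intros]:
 "continuous_on A f ==> continuous_on A (%x. Thi (f x))"
 using continuous_on_compose2[of UNIV Thi A f] isCont_Thi by (simp add: continuous_at_imp_continuous_on)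

lemma tendsto_Thi [tendsto_intros]:
 "(f \<longlongrightarrow> l) F ==> ((%x. Thi (f x)) \<longlongrightarrow> Thi l) F"
 using isCont_tendsto_compose[OF isCont_Thi] by blast

lemma Thi_has_derivative: "(Thi has_real_derivative 1 / dTh (Thi v)) (at v)"
 using DERIV_inverse_function[of Th "dTh (Thi v)" Thi v "v - 1" "v + 1"]
 by (simp add: Th_has_derivative isCont_Thi divide_inverse)

lemma Th_le_quadratic: fixes x :: real shows "\<bar>Th x\<bar> <= \<bar>x\<bar> + 2 * x\<^sup>2"
proof -
 have "\<bar>Th x\<bar> <= \<bar>x\<bar> * (1 + 2 * \<bar>x\<bar>)" using Th_bound[of x] dTh_le[of x]
  by (meson abs_ge_zero mult_left_mono order_trans)
 thus ?thesis by (simp add: power2_eq_square algebra_simps abs_mult_self_eq)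
qed

section \<open>Energy descent on a weighted lattice\<close>

text \<open>Abel summation. The weight 0 to the left of index 0 is the no-flux condition at the
  origin; the remaining boundary term disappears when \<open>a\<close> vanishes at
  \<open>n\<close>.\<close>

lemma sum_by_parts:
 fixes x a kap :: "nat => real"
 defines "kl \<equiv> %i. if i = 0 then 0 else kap (i - 1)"
 shows "(\<Sum>i<n. kap i * x i * (a i - a (Suc i))) = (\<Sum>i<n. (kap i * x i - kl i * x (i - 1)) * a i) - kl n * x (n - 1) * a n"
proof (induction n)
 case (Suc n)
 have "kl (Suc n) = kap n" by (simp add: kl_def)
 thus ?case using Suc by (simp add: algebra_simps)
qed (simp add: kl_def)

text \<open>The weights stay abstract; later \<open>rho i\<close> is the volume of a radial cell and
  \<open>kap i\<close> the conductance to the next cell, both up to the area of the unit sphere.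
  \<open>g_lin\<close> bounds the reaction term by a multiple of the value itself, so that a small
  step cannot reverse a sign through it.\<close>

locale lattice =
 fixes L :: nat and rho kap :: "nat => real" and g G :: "real => real" and m0 :: real
 assumes rho: "!!i. rho i > 0" and kap: "!!i. kap i > 0" and m0: "m0 > 0"
  and g_cont: "continuous_on UNIV g" and G_deriv: "!!s. (G has_real_derivative g s) (at s)" and G_0: "G 0 = 0"
  and g_lin: "!!T. \<exists>C. \<forall>s. \<bar>s\<bar> <= T --> \<bar>g s\<bar> <= C * \<bar>s\<bar>"
begin

definition kl :: "nat => real" where "kl i = (if i = 0 then 0 else kap (i - 1))"

text \<open>The partial derivative of \<open>EE\<close> in a coordinate \<open>i < L\<close>;
  \<open>lgrad\<close> is the gradient for the inner product weighted by \<open>rho\<close>, in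
  which the mass constraint is a round ball.\<close>

definition dE :: "(nat => real) => nat => real" where
 "dE u i = dTh (u i) * (kap i * (Th (u i) - Th (u (Suc i))) + kl i * (Th (u i) - Th (u (i - 1)))) - rho i * g (u i)"

definition lgrad :: "(nat => real) => nat => real" where "lgrad u i = dE u i / rho i"

text \<open>A Gauss-Seidel sweep: each coordinate uses the values already updated. Changing one
  coordinate at a time is what lets \<open>alt_update\<close> control the alternations.\<close>

fun gs :: "real => nat => (nat => real) => nat => real" where
 "gs \<tau> 0 u = u"
| "gs \<tau> (Suc n) u = (gs \<tau> n u)(n := gs \<tau> n u n - \<tau> * lgrad (gs \<tau> n u) n)"

definition EE :: "(nat => real) => real" where
 "EE u = (\<Sum>i<L. kap i * (Th (u i) - Th (u (Suc i)))\<^sup>2 / 2 - rho i * G (u i))"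

definition Q :: "(nat => real) => real" where "Q u = (\<Sum>i<L. rho i * (u i)\<^sup>2)"

text \<open>The factor of the radial projection onto the ball of mass \<open>m0\<close>. Rescaling
  keeps all signs, and \<open>max\<close> makes the factor continuous and equal to 1 inside the
  ball.\<close>

definition scl :: "(nat => real) => real" where "scl u = sqrt (m0 / max m0 (Q u))"

definition proj :: "(nat => real) => nat => real" where "proj u i = scl u * u i"

definition step :: "real => (nat => real) => nat => real" where "step \<tau> u = proj (gs \<tau> L u)"

definition D :: "(nat => real) set" where "D = {u. (\<forall>i\<ge>L. u i = 0) \<and> Q u <= m0}"

text \<open>A crude pointwise bound for members of \<open>D\<close> plus a margin of 1, which one
  sweep with a small step cannot exhaust.\<close>

definition T0 :: real where "T0 = 1 + (\<Sum>i<L. sqrt (m0 / rho i))"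

lemma kl_nonneg: "kl i >= 0" using kap by (simp add: kl_def less_imp_le)

lemma rho_nz [simp]: "rho i \<noteq> 0" using rho[of i] by simp

lemma continuous_on_g [continuous_intros]: "continuous_on A f ==> continuous_on A (%x. g (f x))"
 using continuous_on_compose2[OF g_cont] by blast

lemma continuous_on_G [continuous_intros]: "continuous_on A f ==> continuous_on A (%x. G (f x))"
 using continuous_on_compose2[OF DERIV_continuous_on[of UNIV G, OF DERIV_subset[OF G_deriv]]] by blast

lemma continuous_on_grad:
 assumes "!!j. continuous_on A (%z. X z j)" shows "continuous_on A (%z. lgrad (X z) i)"
 unfolding lgrad_def dE_def by (intro continuous_intros assms) simp

lemma continuous_on_gs:
 assumes "continuous_on A t" "!!j. continuous_on A (%z. X z j)" shows "continuous_on A (%z. gs (t z) n (X z) i)"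
proof (induction n arbitrary: i)
 case (Suc n)
 have "continuous_on A (%z. gs (t z) n (X z) n - t z * lgrad (gs (t z) n (X z)) n)"
  by (intro continuous_intros continuous_on_grad assms Suc)
 thus ?case using Suc by (cases "i = n") auto
qed (use assms in simp)

lemma continuous_on_EE: assumes "!!j. continuous_on A (%z. X z j)" shows "continuous_on A (%z. EE (X z))"
 unfolding EE_def by (intro continuous_intros assms) simp

lemma continuous_on_Q: assumes "!!j. continuous_on A (%z. X z j)" shows "continuous_on A (%z. Q (X z))"
 unfolding Q_def by (intro continuous_intros assms)

lemma continuous_on_proj:
 assumes "!!j. continuous_on A (%z. X z j)" shows "continuous_on A (%z. proj (X z) i)"
proof -
 have "max m0 (Q (X z)) \<noteq> 0" for z using m0 by (auto simp: max_def)
 thus ?thesis unfolding proj_def scl_def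
  by (intro continuous_intros continuous_on_Q assms) auto
qed

lemma continuous_on_step:
 assumes "continuous_on A t" "!!j. continuous_on A (%z. X z j)" shows "continuous_on A (%z. step (t z) (X z) i)"
 unfolding step_def by (intro continuous_on_proj continuous_on_gs assms)

lemma scl_pos: "scl u > 0" using m0 by (simp add: scl_def)

lemma scl_le_1: "scl u <= 1" using m0 by (simp add: scl_def)

lemma scl_eq_1: "Q u <= m0 ==> scl u = 1" using m0 by (simp add: scl_def max_def)

lemma Q_scale: "Q (%i. c * u i) = c\<^sup>2 * Q u"
 unfolding Q_def by (simp add: sum_distrib_left power_mult_distrib algebra_simps)

lemma Q_proj: "Q (proj u) = min m0 (Q u)"
proof -
 have "Q (proj u) = (scl u)\<^sup>2 * Q u" unfolding proj_def[abs_def] by (rule Q_scale)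
 also have "(scl u)\<^sup>2 = m0 / max m0 (Q u)" using m0 unfolding scl_def by simp
 finally show ?thesis using m0 by (auto simp: max_def min_def)
qed

lemma sgn_proj: "sgn (proj u i) = sgn (u i)" unfolding proj_def using scl_pos[of u] by (simp add: sgn_mult)

lemma proj_in_D: "(!!i. i >= L ==> u i = 0) ==> proj u \<in> D"
 unfolding D_def using Q_proj[of u] by (simp add: proj_def)

lemma proj_id: "u \<in> D ==> proj u = u" unfolding D_def proj_def[abs_def] by (auto simp: scl_eq_1)

lemma T0_ge_1: "T0 >= 1" unfolding T0_def using m0 rho by (simp add: sum_nonneg less_imp_le)

lemma D_bound: assumes "u \<in> D" shows "\<bar>u i\<bar> <= T0 - 1"
proof (cases "i < L")
 case True
 have "rho i * (u i)\<^sup>2 <= Q u" unfolding Q_def using True rho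
  by (intro member_le_sum) (auto simp: less_imp_le)
 hence "(u i)\<^sup>2 <= m0 / rho i" using assms rho[of i] unfolding D_def by (simp add: field_simps)
 hence "\<bar>u i\<bar> <= sqrt (m0 / rho i)" by (rule real_le_rsqrt[of "\<bar>u i\<bar>", simplified])
 also have "\<dots> <= (\<Sum>i<L. sqrt (m0 / rho i))"
  using True m0 rho by (intro member_le_sum) (auto simp: less_imp_le)
 finally show ?thesis by (simp add: T0_def)
next
 case False
 thus ?thesis using assms T0_ge_1 by (simp add: D_def)
qed

text \<open>A discrete maximum principle: if neither neighbour has sign \<open>s\<close>, the
  neighbours pull away from \<open>s\<close>, and what remains in the gradient is at most linear in
  the value at \<open>i\<close>.\<close>

lemma lgrad_bounds:
 obtains C where "C > 0"
  "!!u i s. (!!j. \<bar>u j\<bar> <= T0) ==> i < L ==> \<bar>lgrad u i\<bar> <= C"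
  "!!u i s. (!!j. \<bar>u j\<bar> <= T0) ==> i < L ==> s = 1 \<or> s = -1 ==> s * u (Suc i) <= 0 ==> s * u (i - 1) <= 0 \<or> i = 0
    ==> s * lgrad u i >= - C * \<bar>u i\<bar>"
proof -
 obtain Cg where Cg: "!!s. \<bar>s\<bar> <= T0 ==> \<bar>g s\<bar> <= Cg * \<bar>s\<bar>" using g_lin by blast
 define d where "d = dTh T0"
 have d: "d >= 1" unfolding d_def by (rule dTh_ge_1)
 define S where "S = (\<Sum>i<L. (kap i + kl i) / rho i)"
 have Si: "(kap i + kl i) / rho i <= S" if "i < L" for i
  unfolding S_def using that kap rho kl_nonneg by (intro member_le_sum) (auto intro!: divide_nonneg_pos add_nonneg_nonneg simp: less_imp_le)
 have Sp: "S >= 0" unfolding S_def using kap rho kl_nonneg by (intro sum_nonneg divide_nonneg_pos add_nonneg_nonneg) (auto simp: less_imp_le)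
 define C where "C = 1 + 2 * T0 * d\<^sup>2 * S + \<bar>Cg\<bar> * T0"
 have T0p: "T0 >= 1" by (rule T0_ge_1)
 have C0: "C > 0" unfolding C_def using T0p d Sp by (intro add_pos_nonneg mult_nonneg_nonneg) auto
 have Thb: "\<bar>Th a\<bar> <= d * \<bar>a\<bar>" if "\<bar>a\<bar> <= T0" for a
  using Th_diff_le[OF that, of 0] T0p unfolding d_def by simp
 have dd: "dTh a <= d" if "\<bar>a\<bar> <= T0" for a unfolding d_def using that T0p by (intro dTh_mono) auto
 have g: "lgrad u i = dTh (u i) * ((kap i * (Th (u i) - Th (u (Suc i))) + kl i * (Th (u i) - Th (u (i - 1)))) / rho i) - g (u i)" for u i
  unfolding lgrad_def dE_def by (simp add: diff_divide_distrib)
 have b1: "\<bar>lgrad u i\<bar> <= C" if u: "!!j. \<bar>u j\<bar> <= T0" and i: "i < L" for u i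
 proof -
  have t: "\<bar>Th (u i) - Th (u j)\<bar> <= 2 * d * T0" for j
  proof -
   have q: "\<bar>Th (u l)\<bar> <= d * T0" for l
    using order_trans[OF Thb[OF u[of l]] mult_left_mono[OF u[of l]]] d by simp
   show ?thesis using q[of i] q[of j] by linarith
  qed
  have "\<bar>kap i * (Th (u i) - Th (u (Suc i))) + kl i * (Th (u i) - Th (u (i - 1)))\<bar> <= kap i * (2 * d * T0) + kl i * (2 * d * T0)"
   using t[of "Suc i"] t[of "i - 1"] kap[of i] kl_nonneg[of i]
   by (intro order_trans[OF abs_triangle_ineq] add_mono) (auto simp: abs_mult mult.assoc intro!: mult_left_mono)
  hence "\<bar>(kap i * (Th (u i) - Th (u (Suc i))) + kl i * (Th (u i) - Th (u (i - 1)))) / rho i\<bar> <= (kap i + kl i) / rho i * (2 * d * T0)"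
   using rho[of i] by (simp add: abs_divide divide_right_mono algebra_simps flip: add_divide_distrib)
  also have "\<dots> <= S * (2 * d * T0)" using Si[OF i] d T0p by (intro mult_right_mono) auto
  finally have "\<bar>dTh (u i) * ((kap i * (Th (u i) - Th (u (Suc i))) + kl i * (Th (u i) - Th (u (i - 1)))) / rho i)\<bar> <= d * (S * (2 * d * T0))"
   unfolding abs_mult using dd[OF u] d by (intro mult_mono) auto
  moreover have "\<bar>g (u i)\<bar> <= \<bar>Cg\<bar> * T0"
   by (rule order_trans[OF Cg[OF u[of i]]], rule mult_mono) (use u[of i] T0p in auto)
  ultimately have "\<bar>lgrad u i\<bar> <= d * (S * (2 * d * T0)) + \<bar>Cg\<bar> * T0" unfolding g by linarith
  thus ?thesis unfolding C_def by (simp add: power2_eq_square algebra_simps)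
 qed
 have b2: "s * lgrad u i >= - C * \<bar>u i\<bar>" if u: "!!j. \<bar>u j\<bar> <= T0" and i: "i < L" and s: "s = 1 \<or> s = -1"
  and n: "s * u (Suc i) <= 0" "s * u (i - 1) <= 0 \<or> i = 0" for u i s
 proof -
  have m: "s * Th (u j) <= 0" if "s * u j <= 0" for j using that s by auto
  have e: "s * Th (u i) >= - (d * \<bar>u i\<bar>)"
  proof -
   have "\<bar>s * Th (u i)\<bar> = \<bar>Th (u i)\<bar>" using s by auto
   thus ?thesis using Thb[OF u[of i]] by linarith
  qed
  have "s * Th (u i) - s * Th (u (Suc i)) >= - (d * \<bar>u i\<bar>)" using m[OF n(1)] e by linarith
  hence a: "kap i * (s * Th (u i) - s * Th (u (Suc i))) >= kap i * (- (d * \<bar>u i\<bar>))"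
   using kap[of i] by (intro mult_left_mono) auto
  have b: "kl i * (s * Th (u i) - s * Th (u (i - 1))) >= kl i * (- (d * \<bar>u i\<bar>))"
  proof (cases "i = 0")
   case False
   hence "s * Th (u i) - s * Th (u (i - 1)) >= - (d * \<bar>u i\<bar>)" using m[of "i - 1"] n(2) e by linarith
   thus ?thesis using kl_nonneg[of i] by (intro mult_left_mono)
  qed (simp add: kl_def)
  have "s * (kap i * (Th (u i) - Th (u (Suc i))) + kl i * (Th (u i) - Th (u (i - 1)))) >= - ((kap i + kl i) * (d * \<bar>u i\<bar>))"
   using a b by (simp add: algebra_simps)
  hence "s * ((kap i * (Th (u i) - Th (u (Suc i))) + kl i * (Th (u i) - Th (u (i - 1)))) / rho i) >= - ((kap i + kl i) / rho i * (d * \<bar>u i\<bar>))"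
   using rho[of i] by (simp add: divide_right_mono flip: minus_divide_left add_divide_distrib)
    (metis divide_right_mono less_imp_le minus_divide_left)
  moreover have "(kap i + kl i) / rho i * (d * \<bar>u i\<bar>) <= S * (d * \<bar>u i\<bar>)"
   using Si[OF i] d by (intro mult_right_mono) auto
  ultimately have q: "s * ((kap i * (Th (u i) - Th (u (Suc i))) + kl i * (Th (u i) - Th (u (i - 1)))) / rho i) >= - (S * (d * \<bar>u i\<bar>))" (is "?q >= _") by linarith
  have "dTh (u i) * ?q >= - (d * (S * (d * \<bar>u i\<bar>)))"
  proof -
   have "dTh (u i) * (- (S * (d * \<bar>u i\<bar>))) <= dTh (u i) * ?q" by (rule mult_left_mono[OF q]) simp
   moreover have "dTh (u i) * (S * (d * \<bar>u i\<bar>)) <= d * (S * (d * \<bar>u i\<bar>))"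
    using dd[OF u] d Sp by (intro mult_right_mono mult_nonneg_nonneg) auto
   ultimately show ?thesis by simp
  qed
  moreover have "s * g (u i) <= \<bar>Cg\<bar> * \<bar>u i\<bar>"
  proof -
   have "s * g (u i) <= \<bar>g (u i)\<bar>" using s by auto
   also have "\<dots> <= Cg * \<bar>u i\<bar>" by (rule Cg[OF u[of i]])
   also have "\<dots> <= \<bar>Cg\<bar> * \<bar>u i\<bar>" by (rule mult_right_mono) auto
   finally show ?thesis .
  qed
  moreover have "s * lgrad u i = dTh (u i) * ?q - s * g (u i)" unfolding g by (simp add: algebra_simps)
  moreover have "C * \<bar>u i\<bar> >= (d\<^sup>2 * S + \<bar>Cg\<bar>) * \<bar>u i\<bar>"
  proof (rule mult_right_mono)
   have "d\<^sup>2 * S * 1 <= d\<^sup>2 * S * (2 * T0)" "\<bar>Cg\<bar> * 1 <= \<bar>Cg\<bar> * T0"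
    using T0p Sp by (intro mult_left_mono; simp)+
   thus "d\<^sup>2 * S + \<bar>Cg\<bar> <= C" unfolding C_def by (simp add: algebra_simps)
  qed simp
  ultimately show ?thesis by (simp add: power2_eq_square algebra_simps)
 qed
 show thesis by (rule that[OF C0 b1 b2])
qed

definition lgrad_const :: "real => bool" where
 "lgrad_const C \<longleftrightarrow> C > 0 \<and> (\<forall>u i. (\<forall>j. \<bar>u j\<bar> <= T0) --> i < L --> \<bar>lgrad u i\<bar> <= C \<and>
   (\<forall>s. s = 1 \<or> s = -1 --> s * u (Suc i) <= 0 --> s * u (i - 1) <= 0 \<or> i = 0 --> s * lgrad u i >= - C * \<bar>u i\<bar>))"

text \<open>Fixing one constant lets the later lemmas share the step-size restriction
  \<open>\<tau> * C1 <= 1/2\<close>.\<close>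

definition C1 :: real where "C1 = (SOME C. lgrad_const C)"

lemma lgrad_const_C1: "lgrad_const C1"
proof -
 have "\<exists>C. lgrad_const C"
 proof (rule lgrad_bounds)
  fix C assume C: "C > 0" "!!u i s. (!!j. \<bar>u j\<bar> <= T0) ==> i < L ==> \<bar>lgrad u i\<bar> <= C"
  "!!u i s. (!!j. \<bar>u j\<bar> <= T0) ==> i < L ==> s = 1 \<or> s = -1 ==> s * u (Suc i) <= 0 ==> s * u (i - 1) <= 0 \<or> i = 0
    ==> s * lgrad u i >= - C * \<bar>u i\<bar>"
  have "lgrad_const C" unfolding lgrad_const_def
  proof (intro conjI allI impI)
   fix u :: "nat => real" and i assume u: "\<forall>j. \<bar>u j\<bar> <= T0" "i < L"
   show "\<bar>lgrad u i\<bar> <= C" by (rule C(2)) (use u in auto)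
   fix s :: real assume "s = 1 \<or> s = -1" "s * u (Suc i) <= 0" "s * u (i - 1) <= 0 \<or> i = 0"
   thus "s * lgrad u i >= - C * \<bar>u i\<bar>" by (intro C(3)) (use u in auto)
  qed (rule C(1))
  thus ?thesis ..
 qed
 thus ?thesis unfolding C1_def by (rule someI_ex)
qed

lemma C1: "C1 > 0"
  "(!!j. \<bar>u j\<bar> <= T0) ==> i < L ==> \<bar>lgrad u i\<bar> <= C1"
  "(!!j. \<bar>u j\<bar> <= T0) ==> i < L ==> s = 1 \<or> s = -1 ==> s * u (Suc i) <= 0 ==> s * u (i - 1) <= 0 \<or> i = 0
    ==> s * lgrad u i >= - C1 * \<bar>u i\<bar>"
proof -
 note P = lgrad_const_C1[unfolded lgrad_const_def]
 show "C1 > 0" "(!!j. \<bar>u j\<bar> <= T0) ==> i < L ==> \<bar>lgrad u i\<bar> <= C1" using P by simp_all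
 assume a: "!!j. \<bar>u j\<bar> <= T0" "i < L" "s = 1 \<or> s = -1" "s * u (Suc i) <= 0" "s * u (i - 1) <= 0 \<or> i = 0"
 show "s * lgrad u i >= - C1 * \<bar>u i\<bar>"
  by (rule P[THEN conjunct2, THEN spec, THEN spec, THEN mp, THEN mp, THEN conjunct2, THEN spec, THEN mp, THEN mp, THEN mp])
   (rule allI a)+
qed

lemma gs_untouched: "i >= n ==> gs \<tau> n u i = u i" by (induction n) auto

lemma gs_value: "i < n ==> gs \<tau> n u i = u i - \<tau> * lgrad (gs \<tau> i u) i"
proof (induction n)
 case (Suc n)
 thus ?case using gs_untouched[of n n \<tau> u] by (cases "i = n") auto
qed simp

lemma gs_box:
 assumes u: "!!j. \<bar>u j\<bar> <= T0 - 1" and t: "0 <= \<tau>" "\<tau> * C1 <= 1/2" and n: "n <= L"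
 shows "\<bar>gs \<tau> n u j\<bar> <= T0"
 using n
proof (induction n arbitrary: j)
 case 0 thus ?case using u[of j] by simp
next
 case (Suc n)
 have "\<bar>lgrad (gs \<tau> n u) n\<bar> <= C1" using Suc by (intro C1(2)) auto
 hence "\<bar>\<tau> * lgrad (gs \<tau> n u) n\<bar> <= 1/2" 
  using mult_left_mono[of "\<bar>lgrad (gs \<tau> n u) n\<bar>" C1 \<tau>] t by (simp add: abs_mult)
 thus ?case using Suc u[of n] gs_untouched[of n n \<tau> u] by (cases "j = n") auto
qed

text \<open>A coordinate whose neighbours do not have sign \<open>s\<close> moves towards
  \<open>s\<close> by at most half its size, so it cannot cross zero; this is where the bound 1/2 on
  \<open>\<tau> * C1\<close> enters.\<close>

lemma gs_sign:
 assumes u: "!!j. \<bar>u j\<bar> <= T0" and t: "0 <= \<tau>" "\<tau> * C1 <= 1/2" and i: "i < L" and s: "s = 1 \<or> s = -1"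
  and n: "s * u (Suc i) <= 0" "s * u (i - 1) <= 0 \<or> i = 0"
 shows "s * (u i - \<tau> * lgrad u i) <= s * u i + \<bar>u i\<bar> / 2"
proof -
 have "\<tau> * (s * lgrad u i) >= \<tau> * (- C1 * \<bar>u i\<bar>)" by (rule mult_left_mono[OF C1(3)[OF u i s n] t(1)])
 moreover have "\<tau> * C1 * \<bar>u i\<bar> <= 1/2 * \<bar>u i\<bar>" using t by (intro mult_right_mono) auto
 ultimately show ?thesis by (simp add: algebra_simps)
qed

text \<open>Undo the sweep coordinate by coordinate: by \<open>gs_sign\<close> a new sign was
  already present at the coordinate or next to it, which is the hypothesis of
  \<open>alt_update\<close>.\<close>

lemma alt_gs:
 assumes u: "!!j. \<bar>u j\<bar> <= T0 - 1" and t: "0 <= \<tau>" "\<tau> * C1 <= 1/2" and n: "n <= L" and a: "alt k (gs \<tau> n u)"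
 shows "alt k u"
 using n a
proof (induction n)
 case (Suc n)
 define w where "w = gs \<tau> n u"
 have "alt k w"
 proof (rule alt_update[of k w n "w n - \<tau> * lgrad w n"])
  show "alt k (w(n := w n - \<tau> * lgrad w n))" using Suc.prems(2) unfolding w_def gs.simps .
  fix s :: real assume s: "s = 1 \<or> s = -1" and p: "s * (w n - \<tau> * lgrad w n) > 0"
  show "s * w n > 0 \<or> (n > 0 \<and> s * w (n - 1) > 0) \<or> s * w (Suc n) > 0"
  proof (rule ccontr)
   assume "\<not> ?thesis"
   hence c: "s * w n <= 0" "s * w (n - 1) <= 0 \<or> n = 0" "s * w (Suc n) <= 0" by auto
   have "s * (w n - \<tau> * lgrad w n) <= s * w n + \<bar>w n\<bar> / 2"
    using Suc.prems gs_box[OF u t] unfolding w_def by (intro gs_sign t s c[unfolded w_def]) auto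
   moreover have "s * w n = - \<bar>w n\<bar>" using c(1) s by auto
   ultimately show False using p by simp
  qed
 qed
 thus ?case using Suc by (simp add: w_def)
qed simp

text \<open>Only the update of a last nonzero coordinate could produce the zero function. Its
  neighbours vanish, so \<open>gs_sign\<close> for the opposite sign shows that it keeps at least
  half its size.\<close>

lemma gs_nonzero:
 assumes u: "!!j. \<bar>u j\<bar> <= T0 - 1" and t: "0 <= \<tau>" "\<tau> * C1 <= 1/2" and n: "n <= L" and nz: "\<exists>i<L. u i \<noteq> 0" "!!i. i >= L ==> u i = 0"
 shows "\<exists>i<L. gs \<tau> n u i \<noteq> 0"
 using n
proof (induction n)
 case (Suc n)
 define w where "w = gs \<tau> n u"
 obtain i where i: "i < L" "w i \<noteq> 0" using Suc unfolding w_def by auto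
 show ?case
 proof (cases "\<exists>i<L. i \<noteq> n \<and> w i \<noteq> 0")
  case True
  then obtain i where "i < L" "i \<noteq> n" "w i \<noteq> 0" by blast
  thus ?thesis by (intro exI[of _ i]) (simp add: w_def)
 next
  case False
  hence z: "w j = 0" if "j < L" "j \<noteq> n" for j using that by blast
  have zz: "w j = 0" if "j \<noteq> n" for j
   using z[of j] that nz(2)[of j] gs_untouched[of n j \<tau> u] Suc.prems unfolding w_def by (cases "j < L") auto
  have wn: "w n \<noteq> 0" using i zz by (cases "i = n") auto
  define s where "s = - sgn (w n)"
  have s: "s = 1 \<or> s = -1" "s * w n = - \<bar>w n\<bar>" using wn by (auto simp: s_def sgn_if)
  have "s * (w n - \<tau> * lgrad w n) <= s * w n + \<bar>w n\<bar> / 2"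
   using Suc.prems gs_box[OF u t] zz unfolding w_def by (intro gs_sign t s) auto
  hence "s * (w n - \<tau> * lgrad w n) < 0" using s(2) wn by simp
  hence "w n - \<tau> * lgrad w n \<noteq> 0" by auto
  thus ?thesis using Suc.prems by (intro exI[of _ n]) (simp add: w_def)
 qed
qed (use nz in simp)

lemma gs_outside: "(!!i. i >= L ==> u i = 0) ==> n <= L ==> i >= L ==> gs \<tau> n u i = 0"
 using gs_untouched[of n i \<tau> u] by simp

lemma step_in_D: "u \<in> D ==> step \<tau> u \<in> D"
 unfolding step_def by (rule proj_in_D, rule gs_outside) (auto simp: D_def)

lemma alt_step:
 assumes "u \<in> D" "0 <= \<tau>" "\<tau> * C1 <= 1/2" "alt k (step \<tau> u)" shows "alt k u"
 using alt_gs[of u, OF D_bound[OF assms(1)] assms(2,3) order_refl] alt_sgn_cong[OF assms(4)[unfolded step_def] sgn_proj[symmetric]]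
 by blast

lemma step_nonzero:
 assumes "u \<in> D" "0 <= \<tau>" "\<tau> * C1 <= 1/2" "\<exists>i<L. u i \<noteq> 0" shows "\<exists>i<L. step \<tau> u i \<noteq> 0"
proof -
 obtain i where "i < L" "gs \<tau> L u i \<noteq> 0"
  using gs_nonzero[OF D_bound[OF assms(1)] assms(2,3) order_refl assms(4)] assms(1) unfolding D_def by blast
 thus ?thesis unfolding step_def proj_def using scl_pos[of "gs \<tau> L u"] by auto
qed

section \<open>Weighted norm and first variation of the lattice energy\<close>

definition nrm :: "(nat => real) => real" where "nrm d = sqrt (\<Sum>i<L. rho i * (d i)\<^sup>2)"

lemma nrm_nonneg: "nrm d >= 0" unfolding nrm_def using rho by (intro real_sqrt_ge_zero sum_nonneg) (simp add: less_imp_le)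

lemma nrm_sq: "(nrm d)\<^sup>2 = (\<Sum>i<L. rho i * (d i)\<^sup>2)"
 unfolding nrm_def using rho by (intro real_sqrt_pow2 sum_nonneg) (simp add: less_imp_le)

lemma coord_le_nrm: assumes "i < L" shows "\<bar>d i\<bar> <= nrm d / sqrt (rho i)"
proof -
 have "rho i * (d i)\<^sup>2 <= (\<Sum>i<L. rho i * (d i)\<^sup>2)"
  using assms rho by (intro member_le_sum) (auto simp: less_imp_le)
 hence "sqrt (rho i * (d i)\<^sup>2) <= nrm d" unfolding nrm_def by (rule real_sqrt_le_mono)
 thus ?thesis using rho[of i] by (simp add: real_sqrt_mult field_simps)
qed

definition RR :: real where "RR = sqrt (\<Sum>i<L. rho i)"

lemma nrm_CS: "(\<Sum>i<L. rho i * \<bar>a i * b i\<bar>) <= nrm a * nrm b"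
proof -
 have "(\<Sum>i<L. rho i * \<bar>a i * b i\<bar>) = (\<Sum>i<L. \<bar>sqrt (rho i) * a i\<bar> * \<bar>sqrt (rho i) * b i\<bar>)"
 proof (rule sum.cong)
  fix i assume "i \<in> {..<L}"
  have "sqrt (rho i) * sqrt (rho i) = rho i" using rho[of i] by simp
  thus "rho i * \<bar>a i * b i\<bar> = \<bar>sqrt (rho i) * a i\<bar> * \<bar>sqrt (rho i) * b i\<bar>"
   using rho[of i] by (simp add: abs_mult mult_ac)
 qed simp
 also have "\<dots> <= sqrt (\<Sum>i<L. (sqrt (rho i) * a i)\<^sup>2) * sqrt (\<Sum>i<L. (sqrt (rho i) * b i)\<^sup>2)"
  using L2_set_mult_ineq[of "%i. sqrt (rho i) * a i" "%i. sqrt (rho i) * b i" "{..<L}"] by (simp add: L2_set_def)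
 also have "\<dots> = nrm a * nrm b"
  unfolding nrm_def using rho by (simp add: power_mult_distrib less_imp_le)
 finally show ?thesis .
qed

lemma l1_le_nrm: "(\<Sum>i<L. rho i * \<bar>d i\<bar>) <= RR * nrm d"
 using nrm_CS[of "%_. 1" d] by (simp add: nrm_def RR_def)

lemma EE_deriv:
 assumes d: "!!i. i >= L ==> d i = 0"
 shows "((%t. EE (%i. u i + t * d i)) has_real_derivative (\<Sum>i<L. dE (%i. u i + t * d i) i * d i)) (at t)"
proof -
 define x where "x i = u i + t * d i" for i
 have Thd: "((%t. Th (u i + t * d i)) has_real_derivative dTh (x i) * d i) (at t)" for i
  unfolding x_def by (rule DERIV_chain2[OF Th_has_derivative]) (auto intro!: derivative_eq_intros)
 have Gd: "((%t. G (u i + t * d i)) has_real_derivative g (x i) * d i) (at t)" for i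
  unfolding x_def by (rule DERIV_chain2[OF G_deriv]) (auto intro!: derivative_eq_intros)
 have E': "((%t. EE (%i. u i + t * d i)) has_real_derivative
   (\<Sum>i<L. kap i * (2 * (Th (x i) - Th (x (Suc i))) * (dTh (x i) * d i - dTh (x (Suc i)) * d (Suc i))) / 2 - rho i * (g (x i) * d i))) (at t)"
  unfolding EE_def
  by (rule DERIV_sum) (auto intro!: derivative_eq_intros Thd Gd simp: x_def)
 have "(\<Sum>i<L. kap i * (2 * (Th (x i) - Th (x (Suc i))) * (dTh (x i) * d i - dTh (x (Suc i)) * d (Suc i))) / 2 - rho i * (g (x i) * d i))
   = (\<Sum>i<L. kap i * (Th (x i) - Th (x (Suc i))) * (dTh (x i) * d i - dTh (x (Suc i)) * d (Suc i))) - (\<Sum>i<L. rho i * (g (x i) * d i))"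
 proof -
  have e: "a * (2 * b * c) / 2 = a * b * c" for a b c :: real by simp
  show ?thesis by (simp only: e sum_subtractf)
 qed
 also have "\<dots> = (\<Sum>i<L. (kap i * (Th (x i) - Th (x (Suc i))) - kl i * (Th (x (i - 1)) - Th (x (Suc (i - 1))))) * (dTh (x i) * d i)) - (\<Sum>i<L. rho i * (g (x i) * d i))"
  using sum_by_parts[of kap "%i. Th (x i) - Th (x (Suc i))" "%i. dTh (x i) * d i" L] d[of L] by (simp add: kl_def)
 also have "\<dots> = (\<Sum>i<L. dE x i * d i)"
  unfolding sum_subtractf[symmetric]
 proof (rule sum.cong)
  fix i assume "i \<in> {..<L}"
  have ee: "kl i * (Th (x (i - 1)) - Th (x (Suc (i - 1)))) = - (kl i * (Th (x i) - Th (x (i - 1))))"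
   by (cases "i = 0") (auto simp: kl_def algebra_simps)
  thus "(kap i * (Th (x i) - Th (x (Suc i))) - kl i * (Th (x (i - 1)) - Th (x (Suc (i - 1))))) * (dTh (x i) * d i) - rho i * (g (x i) * d i) = dE x i * d i"
   unfolding ee dE_def by (simp add: algebra_simps)
 qed simp
 finally show ?thesis using E' unfolding x_def[abs_def] by simp
qed

lemma lgrad_uc:
 assumes "e > 0"
 shows "\<exists>\<delta>>0. \<forall>i<L. \<forall>u w. (\<forall>j. \<bar>u j\<bar> <= T0) --> (\<forall>j. \<bar>w j\<bar> <= T0) --> (\<forall>j<L. \<bar>u j - w j\<bar> <= \<delta>) --> (\<forall>j\<ge>L. u j = w j)
   --> \<bar>lgrad u i - lgrad w i\<bar> < e"
proof -
 define P where "P i \<delta> \<longleftrightarrow> (\<forall>u w. (\<forall>j. \<bar>u j\<bar> <= T0) --> (\<forall>j. \<bar>w j\<bar> <= T0) --> (\<forall>j<L. \<bar>u j - w j\<bar> <= \<delta>) --> (\<forall>j\<ge>L. u j = w j)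
   --> \<bar>lgrad u i - lgrad w i\<bar> < e)" for i \<delta>
 have P: "\<exists>\<delta>>0. P i \<delta>" for i
 proof -
  have c: "continuous_on UNIV (%u. lgrad u i)" by (rule continuous_on_grad) simp
  show ?thesis using box_uniformly_continuous[OF c assms, of "%_. T0" L] unfolding P_def by metis
 qed
 have mono: "P i \<delta>'" if "P i \<delta>" "\<delta>' <= \<delta>" for i \<delta> \<delta>' using that unfolding P_def by (meson order_trans)
 have "\<exists>\<delta>>0. \<forall>i<n. P i \<delta>" for n
 proof (induction n)
  case (Suc n)
  obtain a b where "a > 0" "\<forall>i<n. P i a" "b > 0" "P n b" using Suc P[of n] by blast
  hence "min a b > 0 \<and> (\<forall>i<Suc n. P i (min a b))" using mono by (auto simp: less_Suc_eq)
  thus ?case by blast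
 qed (use zero_less_one in blast)
 thus ?thesis unfolding P_def by blast
qed

end

context lattice begin

text \<open>\<open>g\<close> is merely continuous, so the energy is only of class C1 and has no
  quadratic remainder; uniform continuity of the gradient on the box gives a linear remainder of
  arbitrarily small slope instead.\<close>

lemma EE_expand:
 assumes "e > 0"
 obtains \<delta> where "\<delta> > 0"
  "!!u w. (!!j. \<bar>u j\<bar> <= T0) ==> (!!j. \<bar>w j\<bar> <= T0) ==> (!!j. j < L ==> \<bar>w j - u j\<bar> <= \<delta>) ==> (!!j. j >= L ==> w j = u j)
   ==> EE w - EE u <= (\<Sum>i<L. rho i * (lgrad u i * (w i - u i))) + e * (\<Sum>i<L. rho i * \<bar>w i - u i\<bar>)"
proof -
 obtain \<delta> where d: "\<delta> > 0" "\<forall>i<L. \<forall>u w. (\<forall>j. \<bar>u j\<bar> <= T0) --> (\<forall>j. \<bar>w j\<bar> <= T0) --> (\<forall>j<L. \<bar>u j - w j\<bar> <= \<delta>) --> (\<forall>j\<ge>L. u j = w j)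
   --> \<bar>lgrad u i - lgrad w i\<bar> < e" using lgrad_uc[OF assms] by blast
 show thesis
 proof (rule that[OF d(1)])
  fix u w :: "nat => real"
  assume u: "!!j. \<bar>u j\<bar> <= T0" and w: "!!j. \<bar>w j\<bar> <= T0" and c: "!!j. j < L ==> \<bar>w j - u j\<bar> <= \<delta>" and o: "!!j. j >= L ==> w j = u j"
  define dd where "dd i = w i - u i" for i
  define F where "F t = EE (%i. u i + t * dd i)" for t
  have "\<exists>t>0. t < 1 \<and> F 1 - F 0 = (1 - 0) * (\<Sum>i<L. dE (%i. u i + t * dd i) i * dd i)"
   unfolding F_def by (rule MVT2) (use o in \<open>auto intro!: EE_deriv simp: dd_def\<close>)
  then obtain t where t: "0 < t" "t < 1" "F 1 - F 0 = (\<Sum>i<L. dE (%i. u i + t * dd i) i * dd i)" by auto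
  define x where "x i = u i + t * dd i" for i
  have x: "\<bar>x j\<bar> <= T0" for j
  proof -
   have "x j = (1 - t) * u j + t * w j" unfolding x_def dd_def by (simp add: algebra_simps)
   hence "\<bar>x j\<bar> <= \<bar>(1 - t) * u j\<bar> + \<bar>t * w j\<bar>" by (simp only: abs_triangle_ineq)
   also have "\<dots> = (1 - t) * \<bar>u j\<bar> + t * \<bar>w j\<bar>" using t by (simp add: abs_mult)
   also have "\<dots> <= (1 - t) * T0 + t * T0" using t u[of j] w[of j] by (intro add_mono mult_left_mono) auto
   finally show ?thesis by (simp add: algebra_simps)
  qed
  have xu: "\<bar>x j - u j\<bar> <= \<delta>" if "j < L" for j
  proof -
   have "\<bar>x j - u j\<bar> = t * \<bar>w j - u j\<bar>" unfolding x_def dd_def using t by (simp add: abs_mult)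
   also have "\<dots> <= 1 * \<bar>w j - u j\<bar>" using t by (intro mult_right_mono) auto
   finally show ?thesis using c[OF that] by simp
  qed
  have xo: "x j = u j" if "j >= L" for j using o[OF that] by (simp add: x_def dd_def)
  have "EE w - EE u = F 1 - F 0" unfolding F_def dd_def by simp
  also have "\<dots> = (\<Sum>i<L. rho i * (lgrad x i * dd i))" unfolding t(3) x_def[symmetric] lgrad_def by simp
  also have "\<dots> <= (\<Sum>i<L. rho i * (lgrad u i * dd i) + e * (rho i * \<bar>dd i\<bar>))"
  proof (rule sum_mono)
   fix i assume i: "i \<in> {..<L}"
   have "\<bar>lgrad x i - lgrad u i\<bar> < e" using d(2) i x u xu xo by blast
   hence "\<bar>(lgrad x i - lgrad u i) * dd i\<bar> <= e * \<bar>dd i\<bar>" unfolding abs_mult by (intro mult_right_mono) auto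
   hence "lgrad x i * dd i <= lgrad u i * dd i + e * \<bar>dd i\<bar>" by (simp add: algebra_simps abs_le_iff)
   hence "rho i * (lgrad x i * dd i) <= rho i * (lgrad u i * dd i + e * \<bar>dd i\<bar>)" using rho[of i] by (intro mult_left_mono) auto
   thus "rho i * (lgrad x i * dd i) <= rho i * (lgrad u i * dd i) + e * (rho i * \<bar>dd i\<bar>)" by (simp add: algebra_simps)
  qed
  finally show "EE w - EE u <= (\<Sum>i<L. rho i * (lgrad u i * (w i - u i))) + e * (\<Sum>i<L. rho i * \<bar>w i - u i\<bar>)"
   by (simp add: sum.distrib sum_distrib_left dd_def)
 qed
qed

text \<open>The obtuse-angle property of projection onto a convex set; for a ball centred at 0 it
  reduces to Cauchy-Schwarz.\<close>

lemma proj_variational: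
 assumes "u \<in> D" shows "(\<Sum>i<L. rho i * ((z i - proj z i) * (u i - proj z i))) <= 0"
proof (cases "Q z <= m0")
 case True
 thus ?thesis by (simp add: proj_def scl_eq_1)
next
 case False
 define s where "s = scl z"
 have s: "s > 0" "s <= 1" unfolding s_def using scl_pos scl_le_1 by auto
 have qz: "(\<Sum>i<L. rho i * (z i * z i)) = (nrm z)\<^sup>2" unfolding nrm_sq by (simp add: power2_eq_square)
 have qn: "(nrm v)\<^sup>2 = Q v" for v unfolding nrm_sq Q_def ..
 have "(\<Sum>i<L. rho i * (z i * u i)) <= (\<Sum>i<L. rho i * \<bar>z i * u i\<bar>)"
  using rho by (intro sum_mono mult_left_mono) (auto simp: less_imp_le)
 also have "\<dots> <= nrm z * nrm u" by (rule nrm_CS)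
 also have "\<dots> <= nrm z * sqrt m0"
  using assms qn[of u] nrm_nonneg[of z] unfolding D_def by (intro mult_left_mono real_le_rsqrt) auto
 finally have a: "(\<Sum>i<L. rho i * (z i * u i)) <= nrm z * sqrt m0" .
 have nz: "nrm z = sqrt (Q z)" by (simp add: nrm_def Q_def)
 have "s = sqrt m0 / nrm z" unfolding s_def scl_def nz using False by (simp add: max_def real_sqrt_divide)
 moreover have "nrm z > 0" unfolding nz using False m0 by simp
 ultimately have b: "s * (nrm z)\<^sup>2 = nrm z * sqrt m0" by (simp add: power2_eq_square)
 have "(\<Sum>i<L. rho i * ((z i - proj z i) * (u i - proj z i))) = (1 - s) * ((\<Sum>i<L. rho i * (z i * u i)) - s * (\<Sum>i<L. rho i * (z i * z i)))"
  unfolding proj_def s_def[symmetric] by (simp add: sum_distrib_left sum_subtractf[symmetric] algebra_simps)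
 also have "\<dots> <= 0" using a s unfolding qz b by (intro mult_nonneg_nonpos) auto
 finally show ?thesis .
qed

text \<open>A sweep followed by \<open>proj\<close> is nearly a projected gradient step
  \<open>d\<close>, and pairing the sweep gradient with \<open>d\<close> gives at most
  \<open>- (nrm d)^2 / t\<close>. When \<open>nrm d >= e * t\<close> this beats both errors: the
  remainder of \<open>EE_expand\<close> and the use of partly updated values.\<close>

lemma step_descent:
 assumes e: "e > 0"
 obtains t c where "0 < t" "t <= e" "t * C1 <= 1/2" "c > 0"
  "!!u. u \<in> D ==> nrm (%i. step t u i - u i) >= e * t ==> EE (step t u) <= EE u - c"
proof -
 have RR0: "RR >= 0" unfolding RR_def using rho by (intro real_sqrt_ge_zero sum_nonneg) (simp add: less_imp_le)
 \<comment> \<open>Each of the two errors is at most \<open>w0 * RR * nrm d\<close>; with this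
   choice they stay together below half of the gain \<open>e * nrm d\<close>.\<close>
 define w0 where "w0 = e / (4 * (RR + 1))"
 have w0: "w0 > 0" "2 * (w0 * RR) <= e / 2"
  unfolding w0_def using e RR0 by (auto simp: field_simps)
 obtain d1 where d1: "d1 > 0" "\<forall>i<L. \<forall>u w. (\<forall>j. \<bar>u j\<bar> <= T0) --> (\<forall>j. \<bar>w j\<bar> <= T0) --> (\<forall>j<L. \<bar>u j - w j\<bar> <= d1) --> (\<forall>j\<ge>L. u j = w j)
   --> \<bar>lgrad u i - lgrad w i\<bar> < w0" using lgrad_uc[OF w0(1)] by blast
 obtain d2 where d2: "d2 > 0"
  "!!u w. (!!j. \<bar>u j\<bar> <= T0) ==> (!!j. \<bar>w j\<bar> <= T0) ==> (!!j. j < L ==> \<bar>w j - u j\<bar> <= d2) ==> (!!j. j >= L ==> w j = u j)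
   ==> EE w - EE u <= (\<Sum>i<L. rho i * (lgrad u i * (w i - u i))) + w0 * (\<Sum>i<L. rho i * \<bar>w i - u i\<bar>)"
  using EE_expand[OF w0(1)] by blast
 define S where "S = (\<Sum>i<L. 1 / sqrt (rho i))"
 have S: "S >= 0" unfolding S_def using rho by (intro sum_nonneg) (simp add: less_imp_le)
 \<comment> \<open>Dominates every factor whose product with \<open>t\<close> has to be small, so
   one division by \<open>K\<close> yields all four bounds in \<open>tt\<close>.\<close>
 define K where "K = 1 + C1 + (C1 + w0) * RR * S"
 have C1p: "C1 > 0" by (rule C1)
 have K: "K >= 1" "K >= C1" "K >= (C1 + w0) * RR * S" unfolding K_def using C1p w0(1) RR0 S by auto
 define t where "t = min e (min (1/2) (min d1 d2)) / K"
 have t0: "t > 0" unfolding t_def using e d1(1) d2(1) K by simp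
 have tK: "t * K = min e (min (1/2) (min d1 d2))" unfolding t_def using K by simp
 have tle: "t * x <= min e (min (1/2) (min d1 d2))" if "x <= K" for x
  unfolding tK[symmetric] using t0 that by (intro mult_left_mono) auto
 have tt: "t <= e" "t * C1 <= 1/2" "t * C1 <= d1" "t * ((C1 + w0) * RR * S) <= d2"
  using tle[OF K(1)] tle[OF K(2)] tle[OF K(3)] by auto
 show thesis
 proof (rule that[OF t0 tt(1) tt(2)])
  show "e\<^sup>2 * t / 2 > 0" using e t0 by simp
  fix u assume u: "u \<in> D" and big: "nrm (%i. step t u i - u i) >= e * t"
  define w where "w = step t u"
  define d where "d i = w i - u i" for i
  define gg where "gg i = lgrad (gs t i u) i" for i
  have ub: "\<bar>u j\<bar> <= T0 - 1" for j by (rule D_bound[OF u])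
  have ub': "\<bar>u j\<bar> <= T0" for j using ub[of j] by simp
  have wD: "w \<in> D" unfolding w_def by (rule step_in_D[OF u])
  have wb: "\<bar>w j\<bar> <= T0" for j using D_bound[OF wD, of j] by simp
  have out: "u j = 0" "w j = 0" if "j >= L" for j using u wD that by (auto simp: D_def)
  have gb: "\<bar>gs t i u j\<bar> <= T0" if "i <= L" for i j using gs_box[of u t i j] ub t0 tt(2) that by simp
  have ggb: "\<bar>gg i\<bar> <= C1" if "i < L" for i unfolding gg_def using that by (intro C1(2) gb) auto
  have close: "\<bar>gs t i u j - u j\<bar> <= t * C1" if "i <= L" for i j
  proof (cases "j < i")
   case True
   hence "\<bar>gs t i u j - u j\<bar> = t * \<bar>gg j\<bar>" unfolding gs_value[OF True] gg_def using t0 by (simp add: abs_mult)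
   also have "\<dots> <= t * C1" using ggb[of j] True that t0 by (intro mult_left_mono) auto
   finally show ?thesis .
  next
   case False
   thus ?thesis using gs_untouched[of i j t u] C1p t0 by simp
  qed
  have gd: "\<bar>gg i - lgrad u i\<bar> <= w0" if i: "i < L" for i
  proof -
   have "\<bar>lgrad (gs t i u) i - lgrad u i\<bar> < w0"
   proof (rule d1(2)[rule_format, OF i gb ub'])
    show "i <= L" using i by simp
    show "\<bar>gs t i u j - u j\<bar> <= d1" for j using close[of i j] i tt(3) by simp
    show "gs t i u j = u j" if "L <= j" for j using gs_untouched[of i j] i that by simp
   qed
   thus ?thesis unfolding gg_def by simp
  qed
  have z: "gs t L u i = u i - t * gg i" if "i < L" for i unfolding gg_def by (rule gs_value[OF that])
  \<comment> \<open>The variational inequality is tested with the starting point \<open>u\<close>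
    itself; inserting the sweep formula \<open>z\<close> gives the descent inequality
    \<open>A\<close>.\<close>
  have "(\<Sum>i<L. rho i * ((gs t L u i - w i) * (u i - w i))) <= 0"
   unfolding w_def step_def by (rule proj_variational[OF u])
  also have "(\<Sum>i<L. rho i * ((gs t L u i - w i) * (u i - w i))) = (nrm d)\<^sup>2 + t * (\<Sum>i<L. rho i * (gg i * d i))"
   unfolding nrm_sq sum_distrib_left sum.distrib[symmetric]
   by (rule sum.cong) (auto simp: z d_def power2_eq_square algebra_simps)
  finally have A: "t * (\<Sum>i<L. rho i * (gg i * d i)) <= - (nrm d)\<^sup>2" by simp
  have dn: "nrm d >= 0" by (rule nrm_nonneg)
  have gsum: "(\<Sum>i<L. rho i * \<bar>gg i * d i\<bar>) <= C1 * (RR * nrm d)"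
  proof -
   have "(\<Sum>i<L. rho i * \<bar>gg i * d i\<bar>) <= (\<Sum>i<L. C1 * (rho i * \<bar>d i\<bar>))"
   proof (rule sum_mono)
    fix i assume "i \<in> {..<L}"
    hence "rho i * (\<bar>gg i\<bar> * \<bar>d i\<bar>) <= rho i * (C1 * \<bar>d i\<bar>)" using ggb[of i] rho[of i] by (intro mult_left_mono mult_right_mono) auto
    thus "rho i * \<bar>gg i * d i\<bar> <= C1 * (rho i * \<bar>d i\<bar>)" by (simp add: abs_mult mult_ac)
   qed
   also have "\<dots> = C1 * (\<Sum>i<L. rho i * \<bar>d i\<bar>)" by (simp add: sum_distrib_left)
   also have "\<dots> <= C1 * (RR * nrm d)" using l1_le_nrm[of d] C1p by (intro mult_left_mono) auto
   finally show ?thesis .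
  qed
  have nd: "nrm d <= t * (C1 * RR)"
  proof (cases "nrm d = 0")
   case True thus ?thesis using t0 C1p RR0 by simp
  next
   case False
   have "- (\<Sum>i<L. rho i * (gg i * d i)) <= (\<Sum>i<L. rho i * \<bar>gg i * d i\<bar>)"
    unfolding sum_negf[symmetric]
   proof (rule sum_mono)
    fix i
    have "rho i * (- (gg i * d i)) <= rho i * \<bar>gg i * d i\<bar>" using rho[of i] by (intro mult_left_mono abs_ge_minus_self) simp
    thus "- (rho i * (gg i * d i)) <= rho i * \<bar>gg i * d i\<bar>" by simp
   qed
   hence "- (\<Sum>i<L. rho i * (gg i * d i)) <= C1 * (RR * nrm d)" using gsum by linarith
   hence "t * (- (\<Sum>i<L. rho i * (gg i * d i))) <= t * (C1 * (RR * nrm d))" using t0 by (intro mult_left_mono) auto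
   hence "nrm d * nrm d <= (t * (C1 * RR)) * nrm d" using A by (simp add: power2_eq_square algebra_simps)
   thus ?thesis using False dn by (simp add: mult_le_cancel_right)
  qed
  have dc: "\<bar>d j\<bar> <= d2" if j: "j < L" for j
  proof -
   have "\<bar>d j\<bar> <= nrm d * (1 / sqrt (rho j))" using coord_le_nrm[OF j, of d] by simp
   also have "\<dots> <= (t * (C1 * RR)) * S"
    using nd j rho dn t0 C1p RR0 unfolding S_def
    by (intro mult_mono member_le_sum) (auto simp: less_imp_le)
   also have "\<dots> <= t * ((C1 + w0) * RR * S)" using t0 w0(1) RR0 S by (simp add: mult_left_mono mult_right_mono algebra_simps)
   also have "\<dots> <= d2" by (rule tt(4))
   finally show ?thesis .
  qed
  have l1: "w0 * (\<Sum>i<L. rho i * \<bar>d i\<bar>) <= w0 * RR * nrm d"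
   using l1_le_nrm[of d] w0(1) by (simp add: mult_left_mono mult.assoc)
  have "EE w - EE u <= (\<Sum>i<L. rho i * (lgrad u i * d i)) + w0 * (\<Sum>i<L. rho i * \<bar>d i\<bar>)"
   using d2(2)[OF ub' wb] dc out unfolding d_def by simp
  also have "(\<Sum>i<L. rho i * (lgrad u i * d i)) <= (\<Sum>i<L. rho i * (gg i * d i) + w0 * (rho i * \<bar>d i\<bar>))"
  proof (rule sum_mono)
   fix i assume "i \<in> {..<L}"
   hence "\<bar>(gg i - lgrad u i) * d i\<bar> <= w0 * \<bar>d i\<bar>" unfolding abs_mult using gd[of i] by (intro mult_right_mono) auto
   hence "lgrad u i * d i <= gg i * d i + w0 * \<bar>d i\<bar>" by (simp add: algebra_simps abs_le_iff)
   hence "rho i * (lgrad u i * d i) <= rho i * (gg i * d i + w0 * \<bar>d i\<bar>)" using rho[of i] by (intro mult_left_mono) auto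
   thus "rho i * (lgrad u i * d i) <= rho i * (gg i * d i) + w0 * (rho i * \<bar>d i\<bar>)" by (simp add: algebra_simps)
  qed
  also have "\<dots> = (\<Sum>i<L. rho i * (gg i * d i)) + w0 * (\<Sum>i<L. rho i * \<bar>d i\<bar>)" by (simp add: sum.distrib sum_distrib_left)
  finally have B: "EE w - EE u <= (\<Sum>i<L. rho i * (gg i * d i)) + 2 * (w0 * RR * nrm d)" using l1 by simp
  have "(\<Sum>i<L. rho i * (gg i * d i)) <= - (nrm d)\<^sup>2 / t" using A t0 by (simp add: field_simps)
  also have "\<dots> <= - (e * nrm d)"
  proof -
   have "e * t <= nrm d" using big unfolding d_def[abs_def] w_def .
   hence "(e * t) * nrm d <= nrm d * nrm d" using dn by (rule mult_right_mono)
   thus ?thesis using t0 by (simp add: field_simps power2_eq_square)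
  qed
  finally have "EE w - EE u <= - (e * nrm d) + 2 * (w0 * RR) * nrm d" using B by (simp add: algebra_simps)
  also have "\<dots> <= - (e * nrm d) + e / 2 * nrm d" using w0(2) dn by (intro add_left_mono mult_right_mono)
  also have "\<dots> = - (e / 2 * nrm d)" by (simp add: field_simps)
  also have "\<dots> <= - (e / 2 * (e * t))" using big e unfolding d_def[abs_def] w_def by (simp add: mult_left_mono)
  finally show "EE (step t u) <= EE u - e\<^sup>2 * t / 2" unfolding w_def by (simp add: power2_eq_square algebra_simps)
 qed
qed

lemma EE_bounded: obtains M where "!!u. u \<in> D ==> \<bar>EE u\<bar> <= M"
proof -
 have "compact ((%u. EE u) ` {u::nat => real. \<forall>i. \<bar>u i\<bar> <= T0})"
  by (intro compact_continuous_image compact_box_fun continuous_on_EE continuous_on_subset[OF continuous_on_product_coordinates]) simp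
 hence "bounded ((%u. EE u) ` {u::nat => real. \<forall>i. \<bar>u i\<bar> <= T0})" by (rule compact_imp_bounded)
 then obtain M where M: "!!x. x \<in> (%u. EE u) ` {u::nat => real. \<forall>i. \<bar>u i\<bar> <= T0} ==> \<bar>x\<bar> <= M"
  unfolding bounded_iff by auto
 have "\<bar>EE u\<bar> <= M" if "u \<in> D" for u
 proof (rule M, rule imageI, safe)
  fix i show "\<bar>u i\<bar> <= T0" using D_bound[OF that, of i] by simp
 qed
 thus thesis by (rule that)
qed

text \<open>The number of steps is uniform in the starting point, which is what makes a single continuous family of iterates sufficient.\<close>

lemma almost_critical_iterate:
 assumes e: "e > 0"
 obtains t T where "0 < t" "t <= e" "t * C1 <= 1/2"
  "!!u. u \<in> D ==> \<exists>n<T. nrm (%i. step t ((step t ^^ n) u) i - (step t ^^ n) u i) < e * t \<and> EE ((step t ^^ n) u) <= EE u"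
proof -
 obtain t c where t: "0 < t" "t <= e" "t * C1 <= 1/2" "c > 0"
  "!!u. u \<in> D ==> nrm (%i. step t u i - u i) >= e * t ==> EE (step t u) <= EE u - c"
  by (rule step_descent[OF e], rule that)
 obtain M where M: "!!u. u \<in> D ==> \<bar>EE u\<bar> <= M" using EE_bounded by blast
 obtain T :: nat where T: "2 * M / c < real T" using reals_Archimedean2 by blast
 have itD: "(step t ^^ n) u \<in> D" if "u \<in> D" for n u by (induction n) (auto intro: step_in_D that)
 have "\<exists>n<T. nrm (%i. step t ((step t ^^ n) u) i - (step t ^^ n) u i) < e * t \<and> EE ((step t ^^ n) u) <= EE u" if u: "u \<in> D" for u
 proof (rule ccontr)
  assume c: "\<not> ?thesis"
  have "EE ((step t ^^ n) u) <= EE u - real n * c" if "n <= T" for n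
   using that
  proof (induction n)
   case (Suc n)
   hence a: "EE ((step t ^^ n) u) <= EE u - real n * c" "n < T" by auto
   have "real n * c >= 0" using t(4) by (intro mult_nonneg_nonneg) auto
   hence "EE ((step t ^^ n) u) <= EE u" using a(1) by linarith
   hence "nrm (%i. step t ((step t ^^ n) u) i - (step t ^^ n) u i) >= e * t" using c a(2) by force
   hence "EE (step t ((step t ^^ n) u)) <= EE ((step t ^^ n) u) - c" by (rule t(5)[OF itD[OF u]])
   thus ?case using a(1) by (simp add: algebra_simps)
  qed simp
  from this[of T] have "EE ((step t ^^ T) u) <= EE u - real T * c" by simp
  moreover have "real T * c > 2 * M" using T t(4) by (simp add: field_simps)
  ultimately show False using M[OF u] M[OF itD[OF u, of T]] by linarith
 qed
 thus thesis by (rule that[OF t(1-3)])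
qed

end

section \<open>Critical points of the lattice energy\<close>

context lattice begin

lemma D_zero_outside: "u \<in> D ==> i >= L ==> u i = 0" by (simp add: D_def)

lemma g_0: "g 0 = 0"
proof -
 obtain C where "!!s. \<bar>s\<bar> <= 0 ==> \<bar>g s\<bar> <= C * \<bar>s\<bar>" using g_lin[of 0] by blast
 from this[of 0] show ?thesis by simp
qed

lemma EE_0: "EE (%_. 0) = 0" by (simp add: EE_def G_0)

lemma tendsto_coordinatewise:
 fixes f :: "(nat => real) => real"
 assumes "continuous_on UNIV f" "!!j. (%n. X n j) \<longlonglongrightarrow> x j"
 shows "(%n. f (X n)) \<longlonglongrightarrow> f x"
proof -
 have "X \<longlonglongrightarrow> x"
  using assms(2) limitin_componentwise[of "%_. euclidean" UNIV X x sequentially]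
  by (simp add: euclidean_product_topology)
 moreover have "isCont f x" using assms(1) by (simp add: continuous_on_eq_continuous_at)
 ultimately show ?thesis using isCont_tendsto_compose by blast
qed

text \<open>At a zero the reaction and multiplier terms vanish and a linear relation between the two
  neighbouring values of \<open>Th\<close> remains, so two adjacent zeros propagate in both
  directions.\<close>

lemma critical_two_zeros:
 assumes eq: "!!i. i < L ==> dE u i + \<mu> * rho i * u i = 0" and out: "!!i. i >= L ==> u i = 0"
  and z: "u i = 0" "u (Suc i) = 0" "i < L"
 shows "u j = 0"
proof -
 have e0: "kap i * Th (u (Suc i)) + kl i * Th (u (i - 1)) = 0" if "i < L" "u i = 0" for i
  using eq[OF that(1)] that(2) by (simp add: dE_def g_0 dTh_def)
 have fw: "u (i + n) = 0 \<and> u (Suc (i + n)) = 0" for n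
 proof (induction n)
  case (Suc n)
  show ?case
  proof (cases "Suc (i + n) < L")
   case True
   hence "kap (Suc (i + n)) * Th (u (Suc (Suc (i + n)))) = 0" using e0[of "Suc (i + n)"] Suc by (simp add: kl_def)
   thus ?thesis using Suc kap[of "Suc (i + n)"] by simp
  next
   case False thus ?thesis using out Suc by simp
  qed
 qed (use z in simp)
 have bw: "u (i - n) = 0 \<and> u (Suc (i - n)) = 0" for n
 proof (induction n)
  case (Suc n)
  show ?case
  proof (cases "i - n = 0")
   case False
   have "kl (i - n) * Th (u (i - n - 1)) = 0" using e0[of "i - n"] Suc z(3) by simp
   hence "u (i - n - 1) = 0" using False kap[of "i - n - 1"] by (simp add: kl_def)
   moreover have "i - Suc n = i - n - 1" "Suc (i - n - 1) = i - n" using False by auto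
   ultimately show ?thesis using Suc.IH by metis
  next
   case True
   hence "i - Suc n = i - n" by simp
   thus ?thesis using Suc.IH by metis
  qed
 qed (use z in simp)
 show ?thesis
 proof (cases "j >= i")
  case True thus ?thesis using fw[of "j - i"] by simp
 next
  case False thus ?thesis using bw[of "i - j"] by simp
 qed
qed

text \<open>At a zero the weighted sum of the neighbouring values of \<open>Th\<close> is 0, so they
  have opposite signs; at index 0 the only neighbour would have to vanish too. This is the condition
  on zeros in \<open>alt_of_weak_alternation\<close>.\<close>

lemma critical_zero_sign_change:
 assumes eq: "!!i. i < L ==> dE u i + \<mu> * rho i * u i = 0" and out: "!!i. i >= L ==> u i = 0"
  and nz: "u j \<noteq> 0" and z: "u i = 0" "i < L"
 shows "i > 0 \<and> u (i - 1) * u (Suc i) < 0"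
proof -
 have e: "kap i * Th (u (Suc i)) + kl i * Th (u (i - 1)) = 0"
  using eq[OF z(2)] z(1) by (simp add: dE_def g_0 dTh_def)
 have n1: "u (Suc i) \<noteq> 0" using critical_two_zeros[OF eq out z(1) _ z(2)] nz by blast
 have i0: "i > 0" using e n1 kap[of i] by (cases "i = 0") (auto simp: kl_def)
 have "kap i * Th (u (Suc i)) * Th (u (Suc i)) = - (kl i * (Th (u (i - 1)) * Th (u (Suc i))))" using e by algebra
 moreover have "kap i * Th (u (Suc i)) * Th (u (Suc i)) > 0" 
 proof -
  have "Th (u (Suc i)) * Th (u (Suc i)) > 0" using n1 by (auto simp: zero_less_mult_iff neq_iff)
  from mult_pos_pos[OF kap[of i] this] show ?thesis by (simp add: mult.assoc)
 qed
 ultimately have "kl i * (Th (u (i - 1)) * Th (u (Suc i))) < 0" by linarith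
 hence "Th (u (i - 1)) * Th (u (Suc i)) < 0" using kl_nonneg[of i] by (simp add: mult_less_0_iff not_less)
 thus ?thesis using i0 by (auto simp: mult_less_0_iff)
qed

text \<open>Almost fixed points become critical as the step length tends to 0, and the energy level
  keeps the limit away from 0. Strict alternation is an open condition, which bounds the count from
  above; from below, the limit alternates weakly, and its zeros are genuine sign changes.\<close>

lemma critical_limit:
 assumes u: "!!n. u n \<in> D" and t: "!!n. 0 < t n" "!!n. t n <= 1 / (real n + 1)" "!!n. t n * C1 <= 1/2"
  and small: "!!n. nrm (%i. step (t n) (u n) i - u n i) < 1 / (real n + 1) * t n"
  and E: "!!n. EE (u n) <= - e0" "e0 > 0" and alt: "!!n. alt k (u n)" "!!n. \<not> alt (Suc k) (u n)"
 obtains v \<mu> where "v \<in> D" "\<mu> >= 0" "!!i. i < L ==> dE v i + \<mu> * rho i * v i = 0" "\<mu> > 0 ==> Q v = m0"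
  "EE v <= - e0" "alt k v" "\<not> alt (Suc k) v"
proof -
 have inv0: "(%n. 1 / (real n + 1)) \<longlonglongrightarrow> 0"
  using LIMSEQ_inverse_real_of_nat by (simp add: inverse_eq_divide add.commute)
 obtain v r where r: "strict_mono r" and ul0: "!!i. (%n. u (r n) i) \<longlonglongrightarrow> v i" "!!i. \<bar>v i\<bar> <= T0"
 proof (rule bounded_fun_subseq[of u "%_. T0"])
  show "\<bar>u n i\<bar> <= T0" for n i using D_bound[OF u[of n], of i] by simp
 qed blast
 define U where "U n = u (r n)" for n
 define w where "w n = step (t (r n)) (U n)" for n
 define gg where "gg n i = lgrad (gs (t (r n)) i (U n)) i" for n i
 define s where "s n = scl (gs (t (r n)) L (U n))" for n
 \<comment> \<open>The shrinking done by the projection per unit of step length. Its limit is the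
   Lagrange multiplier, nonnegative because the projection never enlarges.\<close>
 define l where "l n = (1 - s n) / t (r n)" for n
 have UD: "U n \<in> D" for n using u by (simp add: U_def)
 have ul: "(%n. U n i) \<longlonglongrightarrow> v i" for i using ul0 by (simp add: U_def)
 have rn: "1 / (real (r n) + 1) <= 1 / (real n + 1)" for n
  using seq_suble[OF r, of n] by (intro divide_left_mono) auto
 have tr: "(%n. t (r n)) \<longlonglongrightarrow> 0"
 proof (rule Lim_null_comparison[OF _ inv0], intro always_eventually allI)
  fix n show "norm (t (r n)) <= 1 / (real n + 1)" using t(1,2)[of "r n"] rn[of n] by simp
 qed
 have s: "0 < s n" "s n <= 1" for n unfolding s_def using scl_pos scl_le_1 by auto
 have dsm: "\<bar>(w n i - U n i) / t (r n)\<bar> <= (1 / (real n + 1)) / sqrt (rho i)" if i: "i < L" for n i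
 proof -
  have "\<bar>w n i - U n i\<bar> <= nrm (%i. w n i - U n i) / sqrt (rho i)" using coord_le_nrm[OF i, of "%i. w n i - U n i"] by simp
  also have "\<dots> <= (1 / (real (r n) + 1) * t (r n)) / sqrt (rho i)"
   using small[of "r n"] rho[of i] unfolding w_def U_def by (intro divide_right_mono) auto
  also have "\<dots> <= (1 / (real n + 1) * t (r n)) / sqrt (rho i)"
   using rn[of n] t(1)[of "r n"] rho[of i] by (intro divide_right_mono mult_right_mono) auto
  finally show ?thesis using t(1)[of "r n"] by (simp add: abs_divide field_simps)
 qed
 have dlim: "(%n. (w n i - U n i) / t (r n)) \<longlonglongrightarrow> 0" if i: "i < L" for i
 proof (rule Lim_null_comparison)
  show "\<forall>\<^sub>F n in sequentially. norm ((w n i - U n i) / t (r n)) <= (1 / (real n + 1)) / sqrt (rho i)"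
   using dsm[OF i] by (intro always_eventually allI) simp
  show "(%n. (1 / (real n + 1)) / sqrt (rho i)) \<longlonglongrightarrow> 0" using tendsto_divide_zero[OF inv0] by blast
 qed
 have gbd: "\<bar>gs (t (r n)) i (U n) j\<bar> <= T0" if "i <= L" for n i j
  using gs_box[of "U n" "t (r n)" i j] D_bound[OF UD] t(1)[of "r n"] t(3) that by simp
 have gsl: "(%n. gs (t (r n)) i (U n) j) \<longlonglongrightarrow> v j" if i: "i <= L" for i j
 proof -
  have "(%n. gs (t (r n)) i (U n) j - U n j) \<longlonglongrightarrow> 0"
  proof (rule Lim_null_comparison)
   show "\<forall>\<^sub>F n in sequentially. norm (gs (t (r n)) i (U n) j - U n j) <= t (r n) * C1"
   proof (intro always_eventually allI)
    fix n show "norm (gs (t (r n)) i (U n) j - U n j) <= t (r n) * C1"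
    proof (cases "j < i")
     case True
     have "\<bar>lgrad (gs (t (r n)) j (U n)) j\<bar> <= C1" using True i by (intro C1(2) gbd) auto
     thus ?thesis unfolding gs_value[OF True] using t(1)[of "r n"] by (simp add: abs_mult mult_left_mono)
    next
     case False
     thus ?thesis using gs_untouched[of i j] C1(1) t(1)[of "r n"] by simp
    qed
   qed
   show "(%n. t (r n) * C1) \<longlonglongrightarrow> 0" using tendsto_mult_left_zero[OF tr] by simp
  qed
  from tendsto_add[OF this ul[of j]] show ?thesis by simp
 qed
 have ggl: "(%n. gg n i) \<longlonglongrightarrow> lgrad v i" if i: "i < L" for i
  unfolding gg_def using i
  by (intro tendsto_coordinatewise[of "%u. lgrad u i"] continuous_on_grad gsl) auto
 have El: "(%n. EE (U n)) \<longlonglongrightarrow> EE v" by (intro tendsto_coordinatewise[of EE] continuous_on_EE ul) simp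
 have Ev: "EE v <= - e0" by (rule LIMSEQ_le_const2[OF El]) (use E(1) in \<open>auto simp: U_def\<close>)
 have Ql: "(%n. Q (U n)) \<longlonglongrightarrow> Q v" by (intro tendsto_coordinatewise[of Q] continuous_on_Q ul) simp
 have vout: "v i = 0" if "i >= L" for i
  using LIMSEQ_unique[OF ul[of i]] D_zero_outside[OF UD that] by simp
 have vD: "v \<in> D" unfolding D_def using vout LIMSEQ_le_const2[OF Ql] UD by (auto simp: D_def)
 have "v \<noteq> (%_. 0)" using Ev E(2) EE_0 by auto
 then obtain a where a: "v a \<noteq> 0" by auto
 have aL: "a < L" using vout a not_le by blast
 have weq: "w n i - U n i = - (t (r n) * l n) * U n i - s n * t (r n) * gg n i" if i: "i < L" for n i
 proof -
  have "w n i = s n * (U n i - t (r n) * gg n i)"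
   unfolding w_def step_def proj_def s_def gg_def gs_value[OF i] by simp
  moreover have "t (r n) * l n = 1 - s n" unfolding l_def using t(1)[of "r n"] by simp
  ultimately show ?thesis by algebra
 qed
 have weq': "(w n i - U n i) / t (r n) = - (l n * U n i) - s n * gg n i" if i: "i < L" for n i
  unfolding weq[OF i] using t(1)[of "r n"] by (simp add: field_simps)
 have l0: "l n >= 0" for n unfolding l_def using s(2)[of n] t(1)[of "r n"] by simp
 have lUb: "(%n. t (r n) * (s n * gg n a)) \<longlonglongrightarrow> 0"
 proof (rule Lim_null_comparison)
  show "\<forall>\<^sub>F n in sequentially. norm (t (r n) * (s n * gg n a)) <= t (r n) * C1"
  proof (intro always_eventually allI)
   fix n
   have "\<bar>gg n a\<bar> <= C1" unfolding gg_def using aL by (intro C1(2) gbd) auto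
   hence "\<bar>s n * gg n a\<bar> <= 1 * C1" unfolding abs_mult using s[of n] by (intro mult_mono) auto
   thus "norm (t (r n) * (s n * gg n a)) <= t (r n) * C1" using t(1)[of "r n"] by (simp add: abs_mult mult_left_mono)
  qed
  show "(%n. t (r n) * C1) \<longlonglongrightarrow> 0" using tendsto_mult_left_zero[OF tr] by simp
 qed
 have sl: "s \<longlonglongrightarrow> 1"
 proof -
  have d: "(%n. - (t (r n) * ((w n a - U n a) / t (r n))) - t (r n) * (s n * gg n a)) \<longlonglongrightarrow> 0"
   using tendsto_diff[OF tendsto_minus[OF tendsto_mult[OF tr dlim[OF aL]]] lUb] by simp
  have "- (t (r n) * ((w n a - U n a) / t (r n))) - t (r n) * (s n * gg n a) = (1 - s n) * U n a" for n
  proof -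
   have e: "t (r n) * ((w n a - U n a) / t (r n)) = w n a - U n a" "1 - s n = t (r n) * l n"
    using t(1)[of "r n"] by (simp_all add: l_def)
   show ?thesis unfolding e unfolding weq[OF aL] by (simp add: algebra_simps)
  qed
  hence "(%n. (1 - s n) * U n a) \<longlonglongrightarrow> 0" using d by simp
  hence "(%n. ((1 - s n) * U n a) / U n a) \<longlonglongrightarrow> 0 / v a" by (rule tendsto_divide[OF _ ul a])
  moreover have "\<forall>\<^sub>F n in sequentially. U n a \<noteq> 0" using ul[of a] a by (rule tendsto_imp_eventually_ne)
  hence "\<forall>\<^sub>F n in sequentially. ((1 - s n) * U n a) / U n a = 1 - s n" by eventually_elim simp
  ultimately have "(%n. 1 - s n) \<longlonglongrightarrow> 0" by (simp add: tendsto_cong)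
  from tendsto_diff[OF tendsto_const this, of 1] show ?thesis by simp
 qed
 \<comment> \<open>The value forced by the limit equation at the coordinate \<open>a\<close>, where
   \<open>v\<close> does not vanish; convergence of \<open>l\<close> is read off there.\<close>
 define \<mu> where "\<mu> = - lgrad v a / v a"
 have ll: "l \<longlonglongrightarrow> \<mu>"
 proof -
  have "(%n. (- ((w n a - U n a) / t (r n)) - s n * gg n a) / U n a) \<longlonglongrightarrow> (- 0 - 1 * lgrad v a) / v a"
   by (intro tendsto_intros dlim sl ggl ul aL a)
  moreover have "\<forall>\<^sub>F n in sequentially. U n a \<noteq> 0" using ul[of a] a by (rule tendsto_imp_eventually_ne)
  hence "\<forall>\<^sub>F n in sequentially. (- ((w n a - U n a) / t (r n)) - s n * gg n a) / U n a = l n"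
   by eventually_elim (simp add: weq'[OF aL])
  ultimately show ?thesis by (simp add: tendsto_cong \<mu>_def)
 qed
 have \<mu>0: "\<mu> >= 0" by (rule LIMSEQ_le_const[OF ll]) (use l0 in auto)
 have eq: "dE v i + \<mu> * rho i * v i = 0" if i: "i < L" for i
 proof -
  have "(%n. - (l n * U n i) - s n * gg n i) \<longlonglongrightarrow> - (\<mu> * v i) - 1 * lgrad v i" by (intro tendsto_intros ll ul sl ggl i)
  hence "- (\<mu> * v i) - 1 * lgrad v i = 0" by (rule LIMSEQ_unique) (rule dlim[OF i, unfolded weq'[OF i]])
  hence "rho i * (lgrad v i + \<mu> * v i) = 0" by simp
  thus ?thesis using rho[of i] by (simp add: lgrad_def algebra_simps)
 qed
 have Qv: "Q v = m0" if "\<mu> > 0"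
 proof -
  have wl: "(%n. w n i) \<longlonglongrightarrow> v i" for i
  proof (cases "i < L")
   case True
   have "(%n. U n i + t (r n) * ((w n i - U n i) / t (r n))) \<longlonglongrightarrow> v i + 0 * 0" by (intro tendsto_intros ul tr dlim True)
   moreover have "U n i + t (r n) * ((w n i - U n i) / t (r n)) = w n i" for n using t(1)[of "r n"] by simp
   ultimately show ?thesis by simp
  next
   case False
   have "w n \<in> D" for n unfolding w_def by (rule step_in_D[OF UD])
   hence "w n i = 0" for n using D_zero_outside False by simp
   thus ?thesis using vout[of i] False by simp
  qed
  have "(%n. Q (w n)) \<longlonglongrightarrow> Q v" by (intro tendsto_coordinatewise[of Q] continuous_on_Q wl) simp
  \<comment> \<open>A positive multiplier means that the projection is active for large
    \<open>n\<close>, and an active projection lands exactly on mass \<open>m0\<close>.\<close>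
  moreover have "\<forall>\<^sub>F n in sequentially. l n > 0" using ll that by (rule order_tendstoD)
  hence "\<forall>\<^sub>F n in sequentially. Q (w n) = m0"
  proof eventually_elim
   fix n assume "l n > 0"
   hence "s n \<noteq> 1" unfolding l_def by auto
   hence "\<not> Q (gs (t (r n)) L (U n)) <= m0" unfolding s_def using scl_eq_1 by blast
   thus "Q (w n) = m0" unfolding w_def step_def Q_proj by simp
  qed
  ultimately have "(%n. m0) \<longlonglongrightarrow> Q v" by (simp add: tendsto_cong)
  thus ?thesis using LIMSEQ_unique tendsto_const by blast
 qed
 have "\<not> alt (Suc k) v"
 proof
  assume "alt (Suc k) v"
  then obtain p \<sigma> where p: "\<sigma> = 1 \<or> \<sigma> = -1" "!!j. j < Suc k ==> p j < p (Suc j)" "!!j. j <= Suc k ==> \<sigma> * (-1) ^ j * v (p j) > 0"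
   by (rule altE) blast
  have "\<forall>\<^sub>F n in sequentially. \<forall>j\<in>{..Suc k}. \<sigma> * (-1) ^ j * U n (p j) > 0"
  proof (rule eventually_ball_finite)
   show "\<forall>j\<in>{..Suc k}. \<forall>\<^sub>F n in sequentially. \<sigma> * (-1) ^ j * U n (p j) > 0"
   proof
    fix j assume "j \<in> {..Suc k}"
    have "(%n. \<sigma> * (-1) ^ j * U n (p j)) \<longlonglongrightarrow> \<sigma> * (-1) ^ j * v (p j)" by (intro tendsto_intros ul)
    thus "\<forall>\<^sub>F n in sequentially. \<sigma> * (-1) ^ j * U n (p j) > 0" by (rule order_tendstoD) (use p \<open>j \<in> _\<close> in auto)
   qed
  qed simp
  then obtain n where "\<forall>j\<in>{..Suc k}. \<sigma> * (-1) ^ j * U n (p j) > 0" using eventually_happens trivial_limit_sequentially by blast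
  hence "alt (Suc k) (U n)" using p(1,2) by (intro altI[of \<sigma> "Suc k" p]) auto
  thus False using alt(2) unfolding U_def by blast
 qed
 moreover have "alt k v"
 proof -
  \<comment> \<open>Witness positions below \<open>L\<close> together with a sign form a finite set,
    so one choice serves infinitely many \<open>n\<close> and passes to the limit as a weak
    alternation.\<close>
  define A where "A = {ps :: nat list \<times> real. set (fst ps) \<subseteq> {..<L} \<and> length (fst ps) = Suc k \<and> snd ps \<in> {1, -1}}"
  have fA: "finite A"
  proof -
   have "A = {xs. set xs \<subseteq> {..<L} \<and> length xs = Suc k} \<times> {1, -1}" unfolding A_def by auto
   thus ?thesis using finite_lists_length_eq[of "{..<L}" "Suc k"] by simp
  qed
  define P where "P n ps \<longleftrightarrow> (\<forall>j<k. fst ps ! j < fst ps ! Suc j) \<and> (\<forall>j\<le>k. snd ps * (-1) ^ j * U n (fst ps ! j) > 0)" for n and ps :: "nat list \<times> real"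
  have "\<exists>ps\<in>A. P n ps" for n
  proof -
   have "alt k (U n)" using alt(1) unfolding U_def by blast
   then obtain p \<sigma> where p: "\<sigma> = 1 \<or> \<sigma> = -1" "!!j. j < k ==> p j < p (Suc j)" "!!j. j <= k ==> \<sigma> * (-1) ^ j * U n (p j) > 0"
    by (rule altE) blast
   have "p j < L" if "j <= k" for j using p(3)[OF that] D_zero_outside[OF UD, of "p j" n] by (cases "p j < L") auto
   hence "(map p [0..<Suc k], \<sigma>) \<in> A" unfolding A_def using p(1) by auto
   moreover have nth: "map p [0..<Suc k] ! j = p j" if "j <= k" for j
    using that by (subst nth_map) (auto simp del: upt_Suc)
   have "P n (map p [0..<Suc k], \<sigma>)" unfolding P_def fst_conv snd_conv
    using p(2,3) nth by (metis Suc_leI less_imp_le)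
   ultimately show ?thesis by blast
  qed
  hence "\<exists>\<^sub>F n in sequentially. \<exists>ps\<in>A. P n ps" by simp
  hence "\<exists>ps\<in>A. \<exists>\<^sub>F n in sequentially. P n ps" by (rule frequently_bex_finite[OF fA])
  then obtain ps where ps: "ps \<in> A" "\<exists>\<^sub>F n in sequentially. P n ps" by blast
  then obtain n0 where n0: "P n0 ps" using frequently_ex by blast
  have pL: "fst ps ! j < L" if "j <= k" for j using ps(1) that unfolding A_def by (auto dest!: subsetD[of _ _ "fst ps ! j"])
  show ?thesis
  proof (rule alt_of_weak_alternation[of "snd ps" k "%j. fst ps ! j"])
   show "snd ps = 1 \<or> snd ps = -1" using ps(1) unfolding A_def by auto
   show "fst ps ! j < fst ps ! Suc j" if "j < k" for j using n0 that unfolding P_def by blast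
   show "snd ps * (-1) ^ j * v (fst ps ! j) >= 0" if j: "j <= k" for j
   proof (rule ccontr)
    assume "\<not> ?thesis"
    hence neg: "snd ps * (-1) ^ j * v (fst ps ! j) < 0" by simp
    have "(%n. snd ps * (-1) ^ j * U n (fst ps ! j)) \<longlonglongrightarrow> snd ps * (-1) ^ j * v (fst ps ! j)" by (intro tendsto_intros ul)
    hence "\<forall>\<^sub>F n in sequentially. snd ps * (-1) ^ j * U n (fst ps ! j) < 0" by (rule order_tendstoD(2)) (rule neg)
    hence "\<forall>\<^sub>F n in sequentially. \<not> P n ps" by eventually_elim (use j in \<open>auto simp: P_def not_less intro: less_imp_le\<close>)
    thus False using ps(2) by (simp add: frequently_def)
   qed
   show "fst ps ! j > 0 \<and> v (fst ps ! j - 1) * v (Suc (fst ps ! j)) < 0" if "j <= k" "v (fst ps ! j) = 0" for j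
    by (rule critical_zero_sign_change[OF eq vout a that(2) pL[OF that(1)]])
  qed
 qed
 ultimately show thesis using that[OF vD \<mu>0 eq Qv Ev] by blast
qed

end

section \<open>Alternating blocks and existence of lattice solutions\<close>

lemma continuous_on_absmax': "(!!j. continuous_on A (%z. X z j)) ==> continuous_on A (%z. absmax n (X z))"
 by (induction n) (auto intro!: continuous_intros)

lemma absmax_attained: "absmax n z = 0 \<or> (\<exists>j<n. absmax n z = \<bar>z j\<bar>)"
 by (induction n) (auto simp: max_def less_Suc_eq)

text \<open>The shape of the initial data: nonnegative pieces with alternating signs in consecutive
  disjoint index blocks. A piece may vanish; the number of pieces that do not vanish limits the
  alternations.\<close>

locale signed_blocks =
 fixes k :: nat and lo :: "nat => nat" and \<beta> :: "nat => nat => real" and v :: "nat => real"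
 assumes lo: "!!j. j <= k ==> lo j <= lo (Suc j)" and nonneg: "!!j i. j <= k ==> \<beta> j i >= 0"
  and supp: "!!j i. j <= k ==> \<beta> j i \<noteq> 0 ==> lo j <= i \<and> i < lo (Suc j)"
  and v: "!!i. v i = (\<Sum>j\<le>k. (-1) ^ j * \<beta> j i)"
begin

lemma lo_mono: assumes "a <= b" "b <= Suc k" shows "lo a <= lo b"
 using assms
proof (induction b)
 case (Suc b)
 show ?case
 proof (cases "a = Suc b")
  case False
  hence "lo a <= lo b" using Suc by simp
  also have "\<dots> <= lo (Suc b)" using lo[of b] Suc.prems by simp
  finally show ?thesis .
 qed simp
qed simp

lemma block_unique: assumes "j <= k" "j' <= k" "lo j <= i" "i < lo (Suc j)" "lo j' <= i" "i < lo (Suc j')" shows "j = j'"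
proof (rule ccontr)
 assume "j \<noteq> j'"
 then consider "j < j'" | "j' < j" by linarith
 thus False
 proof cases
  case 1
  hence "lo (Suc j) <= lo j'" using assms(2) by (intro lo_mono) auto
  thus False using assms(4,5) by linarith
 next
  case 2
  hence "lo (Suc j') <= lo j" using assms(1) by (intro lo_mono) auto
  thus False using assms(3,6) by linarith
 qed
qed

lemma block_value: assumes "j <= k" "lo j <= i" "i < lo (Suc j)" shows "v i = (-1) ^ j * \<beta> j i"
proof -
 have "(\<Sum>l\<le>k. (-1) ^ l * \<beta> l i) = (\<Sum>l\<le>k. if l = j then (-1) ^ j * \<beta> j i else 0)"
 proof (rule sum.cong)
  fix l assume l: "l \<in> {..k}"
  show "(-1) ^ l * \<beta> l i = (if l = j then (-1) ^ j * \<beta> j i else 0)"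
  proof (cases "l = j")
   case False
   have "\<beta> l i = 0"
   proof (rule ccontr)
    assume n: "\<beta> l i \<noteq> 0"
    have "l = j" using l supp[OF _ n] by (intro block_unique[OF _ assms(1) _ _ assms(2,3)]) auto
    thus False using False by simp
   qed
   thus ?thesis using False by simp
  qed simp
 qed simp
 thus ?thesis using assms(1) v by simp
qed

text \<open>The weak sign is constant inside a block, so consecutive witnesses lie in different
  blocks and the block number strictly increases.\<close>

lemma alt_indices:
 assumes "alt n v"
 obtains f where "!!l. l < n ==> f l < f (Suc l)" "!!l. l <= n ==> f l <= k \<and> (\<exists>i. \<beta> (f l) i \<noteq> 0)"
proof -
 obtain q s where q: "s = 1 \<or> s = -1" "!!j. j < n ==> q j < q (Suc j)" "!!j. j <= n ==> s * (-1) ^ j * v (q j) > 0"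
  using altE[OF assms] by metis
 have "\<exists>j\<le>k. \<beta> j (q l) \<noteq> 0" if "l <= n" for l
 proof (rule ccontr)
  assume "\<not> ?thesis"
  hence "v (q l) = 0" unfolding v by (intro sum.neutral) auto
  thus False using q(3)[OF that] by simp
 qed
 then obtain f where f: "!!l. l <= n ==> f l <= k \<and> \<beta> (f l) (q l) \<noteq> 0" by metis
 show thesis
 proof (rule that[of f])
  fix l assume l: "l < n"
  have a: "f l <= k" "\<beta> (f l) (q l) \<noteq> 0" and b: "f (Suc l) <= k" "\<beta> (f (Suc l)) (q (Suc l)) \<noteq> 0"
   using f[of l] f[of "Suc l"] l by auto
  note A = supp[OF a] and B = supp[OF b]
  have "\<not> f (Suc l) < f l"
  proof
   assume "f (Suc l) < f l"
   hence "lo (Suc (f (Suc l))) <= lo (f l)" using a(1) by (intro lo_mono) auto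
   thus False using A B q(2)[OF l] by linarith
  qed
  moreover have "f (Suc l) \<noteq> f l"
  proof
   assume e: "f (Suc l) = f l"
   have 1: "s * (-1) ^ l * v (q l) > 0" "s * (-1) ^ Suc l * v (q (Suc l)) > 0" using q(3)[of l] q(3)[of "Suc l"] l by auto
   have 2: "v (q l) = (-1) ^ f l * \<beta> (f l) (q l)" "v (q (Suc l)) = (-1) ^ f l * \<beta> (f l) (q (Suc l))"
    using block_value[OF a(1), of "q l"] block_value[OF a(1), of "q (Suc l)"] A B e by auto
   have 3: "\<beta> (f l) (q l) > 0" "\<beta> (f l) (q (Suc l)) > 0"
    using nonneg[OF a(1), of "q l"] nonneg[OF a(1), of "q (Suc l)"] a(2) b(2) e by auto
   define t where "t = s * (-1) ^ l * (-1) ^ f l"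
   have "t * \<beta> (f l) (q l) > 0" "- t * \<beta> (f l) (q (Suc l)) > 0" using 1 unfolding 2 t_def by (simp_all add: mult_ac)
   thus False using 3 by (auto simp: zero_less_mult_iff mult_less_0_iff)
  qed
  ultimately show "f l < f (Suc l)" by linarith
 next
  fix l assume "l <= n" thus "f l <= k \<and> (\<exists>i. \<beta> (f l) i \<noteq> 0)" using f by blast
 qed
qed

lemma not_alt_Suc: "\<not> alt (Suc k) v"
proof
 assume "alt (Suc k) v"
 then obtain f where f: "!!l. l < Suc k ==> f l < f (Suc l)" "!!l. l <= Suc k ==> f l <= k \<and> (\<exists>i. \<beta> (f l) i \<noteq> 0)"
  by (rule alt_indices) blast
 have "l <= f l" if "l <= Suc k" for l
  using that
 proof (induction l)
  case (Suc l)
  thus ?case using f(1)[of l] by simp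
 qed simp
 from this[of "Suc k"] show False using f(2)[of "Suc k"] by simp
qed

text \<open>\<open>k\<close> alternations need \<open>k + 1\<close> different blocks out of
  \<open>k + 1\<close>: squeezed from below and above, the increasing block number is the identity,
  so no piece may vanish.\<close>

lemma not_alt: assumes "j0 <= k" "!!i. \<beta> j0 i = 0" shows "\<not> alt k v"
proof
 assume "alt k v"
 then obtain f where f: "!!l. l < k ==> f l < f (Suc l)" "!!l. l <= k ==> f l <= k \<and> (\<exists>i. \<beta> (f l) i \<noteq> 0)"
  by (rule alt_indices) blast
 have a: "l <= f l" if "l <= k" for l
  using that
 proof (induction l)
  case (Suc l)
  thus ?case using f(1)[of l] by simp
 qed simp
 have b: "f (k - l) <= k - l" if "l <= k" for l
  using that
 proof (induction l)
  case 0 thus ?case using f(2)[of k] by simp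
 next
  case (Suc l)
  have "Suc (k - Suc l) = k - l" using Suc.prems by simp
  thus ?case using Suc f(1)[of "k - Suc l"] by simp
 qed
 have "f j0 = j0" using a[OF assms(1)] b[of "k - j0"] assms(1) by simp
 thus False using f(2)[OF assms(1)] assms(2) by simp
qed

end

context lattice begin

lemma iter_in_D: "u \<in> D ==> (step t ^^ n) u \<in> D"
 by (induction n) (auto intro: step_in_D)

lemma alt_iter: assumes "u \<in> D" "0 <= t" "t * C1 <= 1/2" "alt k ((step t ^^ n) u)" shows "alt k u"
 using assms(4)
proof (induction n)
 case (Suc n)
 thus ?case using alt_step[OF iter_in_D[OF assms(1)] assms(2,3)] by simp
qed simp

lemma iter_nonzero: assumes "u \<in> D" "0 <= t" "t * C1 <= 1/2" "\<exists>i<L. u i \<noteq> 0" shows "\<exists>i<L. (step t ^^ n) u i \<noteq> 0"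
proof (induction n)
 case (Suc n)
 thus ?case using step_nonzero[OF iter_in_D[OF assms(1)] assms(2,3)] by simp
qed (use assms in simp)

lemma continuous_on_iter:
 assumes "continuous_on A t" "!!j. continuous_on A (%z. X z j)" shows "continuous_on A (%z. (step (t z) ^^ n) (X z) i)"
proof (induction n arbitrary: i)
 case (Suc n)
 thus ?case by (simp add: continuous_on_step assms(1))
qed (use assms in simp)

text \<open>The homotopy starts at point masses, where moments are explicit, deforms them into the
  bumps \<open>b\<close> and meanwhile switches on the descent. \<open>alternation_persists\<close>
  then gives initial data with \<open>k\<close> alternations after \<open>T\<close> steps; an almost
  critical iterate occurs earlier and has no fewer, while \<open>signed_blocks\<close> bounds its
  count from above.\<close>

theorem discrete_solution:
 fixes b :: "nat => real => nat => real" and lo p :: "nat => nat"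
 assumes p: "!!j. j <= k ==> lo j <= p j \<and> p j < lo (Suc j)" and loL: "lo (Suc k) <= L"
  and b_nonneg: "!!j x i. j <= k ==> 0 <= x ==> b j x i >= 0" and b0: "!!j i. j <= k ==> b j 0 i = 0"
  and b_supp: "!!j x i. j <= k ==> 0 <= x ==> x <= 1 ==> b j x i \<noteq> 0 ==> lo j <= i \<and> i < lo (Suc j)"
  and b_cont: "!!j i. j <= k ==> continuous_on UNIV (%x. b j x i)"
  and neg: "!!y. (!!j. 0 <= y j \<and> y j <= 1) ==> \<exists>j\<le>k. y j = 1 ==>
    EE (%i. \<Sum>j\<le>k. (-1) ^ j * b j (y j) i) <= - e0 \<and> Q (%i. \<Sum>j\<le>k. (-1) ^ j * b j (y j) i) <= m0"
  and e0: "e0 > 0"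
 obtains v \<mu> where "v \<in> D" "\<mu> >= 0" "!!i. i < L ==> dE v i + \<mu> * rho i * v i = 0" "\<mu> > 0 ==> Q v = m0"
  "EE v <= - e0" "alt k v" "\<not> alt (Suc k) v"
proof -
 define cc where "cc j = (if j < k then \<bar>lag k p j (real (p k))\<bar> else 1)" for j
 define mx where "mx x = absmax (Suc k) x" for x
 \<comment> \<open>The weights \<open>cc\<close> are those demanded by
   \<open>alternation_persists\<close>. In the bumps the parameters are divided by their maximum, so
   one of them equals 1 and the hypothesis \<open>neg\<close> applies to every ray.\<close>
 define \<beta> where "\<beta> s x j i = (1 - s) * (if i = p j then cc j * x j else 0) + s * b j (min 1 (x j / mx x)) i" for s x j i
 define init where "init s x i = (\<Sum>j\<le>k. (-1) ^ j * \<beta> s x j i)" for s x i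
 have pm: "p j < p (Suc j)" if "j < k" for j using p[of j] p[of "Suc j"] that by linarith
 have ccp: "cc j > 0" for j
 proof (cases "j < k")
  case True
  thus ?thesis using lag_last_sign[of k p, OF pm True] unfolding cc_def by auto
 qed (simp add: cc_def)
 have mxp: "mx x > 0" if x: "!!j. x j >= 0" "\<exists>j\<le>k. x j > 0" for x
 proof -
  obtain j where "j <= k" "x j > 0" using x(2) by blast
  thus ?thesis using absmax_ge[of j "Suc k" x] unfolding mx_def by auto
 qed
 have y1: "0 <= min 1 (x j / mx x) \<and> min 1 (x j / mx x) <= 1" if "!!j. x j >= 0" "\<exists>j\<le>k. x j > 0" for x j
  using mxp[OF that] that(1)[of j] by simp
 have ymax: "\<exists>j\<le>k. min 1 (x j / mx x) = 1" if x: "!!j. x j >= 0" "\<exists>j\<le>k. x j > 0" for x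
 proof -
  have "mx x > 0" by (rule mxp[OF x])
  then obtain j where "j < Suc k" "mx x = \<bar>x j\<bar>" using absmax_attained[of "Suc k" x] unfolding mx_def by auto
  thus ?thesis using mxp[OF x] x(1)[of j] by (intro exI[of _ j]) auto
 qed
 have SB: "signed_blocks k lo (\<beta> s x) (init s x)" if "0 <= s" "s <= 1" "!!j. x j >= 0" "\<exists>j\<le>k. x j > 0" for s x
 proof
  show "lo j <= lo (Suc j)" if "j <= k" for j using p[OF that] by linarith
  show "\<beta> s x j i >= 0" if "j <= k" for j i
   unfolding \<beta>_def using \<open>0 <= s\<close> \<open>s <= 1\<close> that(1) y1[OF \<open>!!j. x j >= 0\<close> \<open>\<exists>j\<le>k. x j > 0\<close>, of j] b_nonneg[OF that] ccp[of j] \<open>!!j. x j >= 0\<close>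
   by (intro add_nonneg_nonneg mult_nonneg_nonneg) (auto intro: mult_nonneg_nonneg less_imp_le)
  show "lo j <= i \<and> i < lo (Suc j)" if "j <= k" "\<beta> s x j i \<noteq> 0" for j i
  proof (cases "i = p j")
   case False
   hence "b j (min 1 (x j / mx x)) i \<noteq> 0" using that(2) unfolding \<beta>_def by auto
   thus ?thesis using b_supp[OF that(1)] y1[OF \<open>!!j. x j >= 0\<close> \<open>\<exists>j\<le>k. x j > 0\<close>, of j] by blast
  qed (use p[OF that(1)] in simp)
 qed (simp add: init_def)
 have init1: "init 1 x = (%i. \<Sum>j\<le>k. (-1) ^ j * b j (min 1 (x j / mx x)) i)" for x
  unfolding init_def \<beta>_def by auto
 have out: "init s x i = 0" if "0 <= s" "s <= 1" "!!j. x j >= 0" "\<exists>j\<le>k. x j > 0" "i >= L" for s x i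
 proof -
  interpret signed_blocks k lo "\<beta> s x" "init s x" by (rule SB[OF that(1-4)])
  have "\<beta> s x j i = 0" if "j <= k" for j using supp[OF that, of i] lo_mono[of "Suc j" "Suc k"] loL \<open>i >= L\<close> that by force
  thus ?thesis unfolding v by (intro sum.neutral) simp
 qed
 have inD: "proj (init s x) \<in> D" if "0 <= s" "s <= 1" "!!j. x j >= 0" "\<exists>j\<le>k. x j > 0" for s x
  by (rule proj_in_D) (rule out[OF that])
 have in1: "init 1 x \<in> D" "EE (init 1 x) <= - e0" if "!!j. x j >= 0" "\<exists>j\<le>k. x j > 0" for x
 proof -
  have "EE (init 1 x) <= - e0 \<and> Q (init 1 x) <= m0" unfolding init1 using y1[OF that] ymax[OF that] by (intro neg) auto
  thus "init 1 x \<in> D" "EE (init 1 x) <= - e0" unfolding D_def using out[of 1 x] that by auto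
 qed
 have nzi: "\<exists>i<L. init s x i \<noteq> 0" if s: "0 <= s" "s <= 1" and x: "!!j. x j >= 0" "\<exists>j\<le>k. x j > 0" for s x
 proof (cases "s = 1")
  case True
  have "init 1 x \<noteq> (%_. 0)" using in1(2)[OF x] e0 EE_0 by auto
  then obtain i where "init 1 x i \<noteq> 0" by auto
  thus ?thesis using out[OF s x, of i] True by (metis not_le)
 next
  case False
  interpret signed_blocks k lo "\<beta> s x" "init s x" by (rule SB[OF s x])
  obtain j where j: "j <= k" "x j > 0" using x(2) by blast
  have "init s x (p j) = (-1) ^ j * \<beta> s x j (p j)" using p[OF j(1)] by (intro block_value[OF j(1)]) auto
  moreover have "\<beta> s x j (p j) > 0"
   unfolding \<beta>_def using False s j ccp[of j] b_nonneg[OF j(1), of "min 1 (x j / mx x)" "p j"] y1[OF x, of j] by (intro add_pos_nonneg mult_pos_pos mult_nonneg_nonneg) auto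
  moreover have "p j < L" using p[OF j(1)] lo_mono[of "Suc j" "Suc k"] loL j(1) by auto
  ultimately show ?thesis by (intro exI[of _ "p j"]) auto
 qed
 define P where "P n u t \<longleftrightarrow> u \<in> D \<and> 0 < t \<and> t <= 1 / (real n + 1) \<and> t * C1 <= 1/2 \<and>
   nrm (%i. step t u i - u i) < 1 / (real n + 1) * t \<and> EE u <= - e0 \<and> alt k u \<and> \<not> alt (Suc k) u" for n u t
 have main: "\<exists>u t. P n u t" for n
 proof -
  have n0: "1 / (real n + 1) > 0" by simp
  obtain t T where t: "0 < t" "t <= 1 / (real n + 1)" "t * C1 <= 1/2"
   and T: "!!u. u \<in> D ==> \<exists>l<T. nrm (%i. step t ((step t ^^ l) u) i - (step t ^^ l) u i) < 1 / (real n + 1) * t \<and> EE ((step t ^^ l) u) <= EE u"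
   by (rule almost_critical_iterate[OF n0], rule that)
  \<comment> \<open>The step length is scaled by the homotopy time: at time 0 the iteration is the
    identity and only the projection acts, at time 1 it is the descent with step
    \<open>t\<close>.\<close>
  define Phi where "Phi s x = (step (s * t) ^^ T) (proj (init s x))" for s x
  have st: "0 <= s * t" "s * t * C1 <= 1/2" if "0 <= s" "s <= 1" for s
  proof -
   have "s * (t * C1) <= 1 * (t * C1)" using that t C1(1) by (intro mult_right_mono) auto
   thus "s * t * C1 <= 1/2" using t(3) by (simp only: mult.assoc mult_1)
   show "0 <= s * t" using that t by simp
  qed
  have altP: "alt l (init s x)" if "0 <= s" "s <= 1" "!!j. x j >= 0" "\<exists>j\<le>k. x j > 0" "alt l (Phi s x)" for l s x
   using alt_iter[OF inD[OF that(1-4)] st[OF that(1,2)] that(5)[unfolded Phi_def]] alt_sgn_cong[of l "proj (init s x)" "init s x"] sgn_proj by simp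
  obtain x where x: "!!j. x j >= 0" "\<exists>j\<le>k. x j > 0" "alt k (Phi 1 x)"
  proof (rule alternation_persists[of k p L Phi "%x. scl (init 0 x)"])
   show "p j < p (Suc j)" if "j < k" for j by (rule pm[OF that])
   show "p k < L" using p[of k] loL by simp
   show "scl (init 0 x) > 0" for x by (rule scl_pos)
   show "\<exists>i<L. Phi s x i \<noteq> 0" if "0 <= s" "s <= 1" "!!j. x j >= 0" "\<exists>j\<le>k. x j > 0" for s x
   proof -
    have "\<exists>i<L. proj (init s x) i \<noteq> 0" using nzi[OF that] scl_pos[of "init s x"] unfolding proj_def by auto
    thus ?thesis unfolding Phi_def by (rule iter_nonzero[OF inD[OF that] st[OF that(1,2)]])
   qed
   show "\<not> alt k (Phi s x)" if "0 <= s" "s <= 1" "!!j. x j >= 0" "\<exists>j\<le>k. x j > 0" "j <= k" "x j = 0" for s x j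
   proof -
    interpret signed_blocks k lo "\<beta> s x" "init s x" by (rule SB[OF that(1-4)])
    have "\<beta> s x j i = 0" for i unfolding \<beta>_def using that(5,6) b0 by simp
    thus ?thesis using not_alt[OF that(5)] altP[OF that(1-4)] by blast
   qed
   show "Phi 0 x i = scl (init 0 x) * (\<Sum>j\<le>k. if i = p j then (-1) ^ j * (if j < k then \<bar>lag k p j (real (p k))\<bar> else 1) * x j else 0)"
    if "!!j. x j >= 0" "\<exists>j\<le>k. x j > 0" for x i
   proof -
    have s0: "step 0 u = u" if "u \<in> D" for u
    proof -
     have "gs 0 m u = u" for m by (induction m) auto
     thus ?thesis unfolding step_def using proj_id[OF that] by simp
    qed
    have "(step 0 ^^ m) u = u" if "u \<in> D" for m u using that by (induction m) (auto simp: s0)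
    hence "Phi 0 x i = scl (init 0 x) * init 0 x i" unfolding Phi_def using inD[of 0 x] that by (simp add: proj_def)
    also have "init 0 x i = (\<Sum>j\<le>k. if i = p j then (-1) ^ j * (if j < k then \<bar>lag k p j (real (p k))\<bar> else 1) * x j else 0)"
     unfolding init_def \<beta>_def by (intro sum.cong) (auto simp: cc_def)
    finally show ?thesis .
   qed
   show "continuous_on UNIV (%z::nat => real. Phi (s z) (X z) i)"
    if c: "continuous_on UNIV s" "!!j. continuous_on UNIV (%z. X z j)" and r: "!!z. 0 <= s z \<and> s z <= 1"
     "!!z j. X z j >= 0" "!!z. \<exists>j\<le>k. X z j > 0" for i and s :: "(nat => real) => real" and X
   proof -
    have mxc: "continuous_on UNIV (%z. mx (X z))" unfolding mx_def by (intro continuous_on_absmax' c)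
    have mxn: "mx (X z) \<noteq> 0" for z using mxp[of "X z"] r by (metis less_irrefl)
    have q: "continuous_on UNIV (%z. min 1 (X z j / mx (X z)))" for j by (intro continuous_intros c mxc) (use mxn in auto)
    have bc: "continuous_on UNIV (%z. b j (min 1 (X z j / mx (X z))) l)" if "j <= k" for j l
     by (rule continuous_on_compose2[OF b_cont[OF that] q]) simp
    have "continuous_on UNIV (%z. \<beta> (s z) (X z) j l)" if "j <= k" for j l
     unfolding \<beta>_def by (cases "l = p j") (auto intro!: continuous_intros c bc that)
    hence ic: "continuous_on UNIV (%z. init (s z) (X z) l)" for l
     unfolding init_def by (intro continuous_intros) auto
    show ?thesis unfolding Phi_def by (intro continuous_on_iter continuous_on_proj continuous_intros c ic)
   qed
  qed blast
  define u0 where "u0 = init 1 x"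
  have u0: "u0 \<in> D" "EE u0 <= - e0" unfolding u0_def using in1[OF x(1,2)] by auto
  have A: "alt k ((step t ^^ T) u0)" using x(3) proj_id[OF u0(1)] unfolding Phi_def u0_def by simp
  obtain l where l: "l < T" "nrm (%i. step t ((step t ^^ l) u0) i - (step t ^^ l) u0 i) < 1 / (real n + 1) * t"
   "EE ((step t ^^ l) u0) <= EE u0" using T[OF u0(1)] by blast
  define u where "u = (step t ^^ l) u0"
  have uD: "u \<in> D" unfolding u_def by (rule iter_in_D[OF u0(1)])
  \<comment> \<open>Iterate \<open>l\<close> lies on the way to iterate \<open>T\<close>; as
    alternations are never created, it has all those found at the end.\<close>
  have "(step t ^^ T) u0 = (step t ^^ (T - l)) u"
   unfolding u_def using l(1) by (metis comp_apply funpow_add le_add_diff_inverse2 less_imp_le)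
  hence ak: "alt k u" using A alt_iter[OF uD] t by (metis less_imp_le)
  have "\<not> alt (Suc k) u"
  proof
   interpret signed_blocks k lo "\<beta> 1 x" "init 1 x" by (rule SB) (use x in auto)
   assume "alt (Suc k) u"
   hence "alt (Suc k) u0" unfolding u_def using alt_iter[OF u0(1)] t by (metis less_imp_le)
   thus False using not_alt_Suc unfolding u0_def by blast
  qed
  moreover have "EE u <= - e0" using l(3) u0(2) unfolding u_def by linarith
  ultimately show ?thesis unfolding P_def using uD t l(2) ak unfolding u_def by blast
 qed
 then obtain u t where ut: "!!n. P n (u n) (t n)" by metis
 show thesis
 proof (rule critical_limit[of u t e0 k])
  show "u n \<in> D" "0 < t n" "t n <= 1 / (real n + 1)" "t n * C1 <= 1/2" "nrm (%i. step (t n) (u n) i - u n i) < 1 / (real n + 1) * t n"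
   "EE (u n) <= - e0" "alt k (u n)" "\<not> alt (Suc k) (u n)" for n using ut[of n] unfolding P_def by auto
  show "e0 > 0" by (rule e0)
 qed (rule that)
qed

end

section \<open>Radial lattices and bumps\<close>

lemma card_nat_open_interval:
 fixes x y :: real assumes "x <= y"
 shows "finite {i::nat. x < real i \<and> real i < y}" "real (card {i::nat. x < real i \<and> real i < y}) <= y - x + 1"
proof -
 let ?A = "{i::nat. x < real i \<and> real i < y}"
 have sub: "int ` ?A \<subseteq> {\<lfloor>x\<rfloor> + 1..\<lceil>y\<rceil> - 1}"
  by (auto simp: floor_less_iff less_ceiling_iff) linarith+
 hence "finite (int ` ?A)" by (rule finite_subset) simp
 thus "finite ?A" by (rule finite_imageD) simp
 have "card ?A = card (int ` ?A)" by (rule card_image[symmetric]) simp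
 also have "\<dots> <= card {\<lfloor>x\<rfloor> + 1..\<lceil>y\<rceil> - 1}" by (rule card_mono[OF _ sub]) simp
 also have "\<dots> = nat (\<lceil>y\<rceil> - 1 - \<lfloor>x\<rfloor>)" by simp
 finally have "real (card ?A) <= real (nat (\<lceil>y\<rceil> - 1 - \<lfloor>x\<rfloor>))" by simp
 also have "\<dots> <= y - x + 1"
 proof (cases "\<lceil>y\<rceil> - 1 - \<lfloor>x\<rfloor> >= 0")
  case True
  thus ?thesis by (simp add: of_nat_nat) linarith
 qed (use assms in simp)
 finally show "real (card ?A) <= y - x + 1" .
qed

lemma card_nat_closed_interval:
 fixes x y :: real assumes "0 <= x"
 shows "finite {i::nat. x <= real i \<and> real i <= y}" "y - x - 1 <= real (card {i::nat. x <= real i \<and> real i <= y})"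
proof -
 let ?A = "{i::nat. x <= real i \<and> real i <= y}"
 have "?A \<subseteq> {i. i <= nat \<lceil>y\<rceil>}" by (auto) linarith
 thus f: "finite ?A" by (rule finite_subset) simp
 have sub: "nat ` {\<lceil>x\<rceil>..\<lfloor>y\<rfloor>} \<subseteq> ?A"
 proof safe
  fix z assume z: "z \<in> {\<lceil>x\<rceil>..\<lfloor>y\<rfloor>}"
  have "\<lceil>x\<rceil> >= 0" using assms by linarith
  hence "z >= 0" using z by (meson atLeastAtMost_iff order_trans)
  hence "real (nat z) = real_of_int z" by simp
  thus "x <= real (nat z)" "real (nat z) <= y" using z by (auto simp: ceiling_le_iff le_floor_iff)
 qed
 have "\<lceil>x\<rceil> >= 0" using assms by linarith
 hence "inj_on nat {\<lceil>x\<rceil>..\<lfloor>y\<rfloor>}" by (intro inj_onI) (metis atLeastAtMost_iff eq_nat_nat_iff order_trans)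
 hence "card (nat ` {\<lceil>x\<rceil>..\<lfloor>y\<rfloor>}) = card {\<lceil>x\<rceil>..\<lfloor>y\<rfloor>}" by (rule card_image)
 hence "nat (\<lfloor>y\<rfloor> - \<lceil>x\<rceil> + 1) <= card ?A" using card_mono[OF f sub] by simp
 hence "real_of_int (\<lfloor>y\<rfloor> - \<lceil>x\<rceil> + 1) <= real (card ?A)" by linarith
 thus "y - x - 1 <= real (card ?A)" by linarith
qed

locale rlattice = lattice L "%i. h * ((real i + 1) * h) ^ e" "%i. ((real i + 1) * h) ^ e / h" g G m0
 for L e :: nat and h :: real and g G :: "real => real" and m0 :: real +
 fixes d :: nat
 assumes h: "h > 0" and d: "d >= 2" and de: "d = Suc e" and G_even: "!!s. G (- s) = G s"
begin

definition rr :: "nat => real" where "rr i = (real i + 1) * h"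

lemma rr_pos: "rr i > 0" using h by (simp add: rr_def)
lemma rr_Suc: "rr (Suc i) = rr i + h" by (simp add: rr_def algebra_simps)

lemma count_rr:
 assumes "a <= b" shows "finite {i. a < rr i \<and> rr i < b}" "h * real (card {i. a < rr i \<and> rr i < b}) <= b - a + h"
proof -
 have eq: "{i. a < rr i \<and> rr i < b} = {i. a / h - 1 < real i \<and> real i < b / h - 1}"
  using h by (auto simp: rr_def field_simps)
 have "a / h - 1 <= b / h - 1" using assms h by (simp add: divide_right_mono)
 note c = card_nat_open_interval[OF this]
 show "finite {i. a < rr i \<and> rr i < b}" unfolding eq by (rule c)
 have "h * real (card {i. a < rr i \<and> rr i < b}) <= h * ((b / h - 1) - (a / h - 1) + 1)"
  unfolding eq using c(2) h by (intro mult_left_mono) auto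
 also have "h * ((b / h - 1) - (a / h - 1) + 1) = b - a + h" using h by (simp add: field_simps)
 finally show "h * real (card {i. a < rr i \<and> rr i < b}) <= b - a + h" .
qed

lemma count_rr_ge:
 assumes "h <= a" shows "finite {i. a <= rr i \<and> rr i <= b}" "b - a - h <= h * real (card {i. a <= rr i \<and> rr i <= b})"
proof -
 have eq: "{i. a <= rr i \<and> rr i <= b} = {i. a / h - 1 <= real i \<and> real i <= b / h - 1}"
  using h by (auto simp: rr_def field_simps)
 have "0 <= a / h - 1" using assms h by simp
 note c = card_nat_closed_interval[OF this, of "b / h - 1"]
 show "finite {i. a <= rr i \<and> rr i <= b}" unfolding eq by (rule c)
 have "b - a - h = h * ((b / h - 1) - (a / h - 1) - 1)" using h by (simp add: field_simps)
 also have "\<dots> <= h * real (card {i. a <= rr i \<and> rr i <= b})"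
  unfolding eq using c(2) h by (intro mult_left_mono) auto
 finally show "b - a - h <= h * real (card {i. a <= rr i \<and> rr i <= b})" .
qed

definition clamp :: "real => real" where "clamp t = min 1 (max 0 t)"

lemma clamp: "0 <= clamp t" "clamp t <= 1" "t <= 0 ==> clamp t = 0" "t >= 1 ==> clamp t = 1" "\<bar>clamp a - clamp b\<bar> <= \<bar>a - b\<bar>"
 by (auto simp: clamp_def min_def max_def)

text \<open>The test configuration has height \<open>s\<close>, ramp width \<open>w\<close>, length
  scale \<open>l\<close>, and \<Gamma> bounds \<open>- G\<close> along the ramps. In
  \<open>neg\<close> the ramps of \<open>k + 1\<close> bumps, each of length at most
  \<open>8 * w\<close> and weighted with the largest radius, are paid for by the plateau of one full
  bump, with \<open>e0\<close> to spare.\<close>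

context
 fixes k :: nat and s w l \<Gamma> e0 :: real
 assumes s: "s > 0" and w: "h <= w" "4 * w <= l" and Gam: "!!t. 0 <= t ==> t <= s ==> - G t <= \<Gamma>" and Gs: "G s >= 0"
  and L: "(3 * real k + 4) * l <= h * real L" and e0: "e0 > 0"
  and neg: "(real k + 1) * (8 * w * ((3 * real k + 4) * l) ^ e * ((dTh s * s / w)\<^sup>2 / 2 + \<Gamma>)) + e0 <= G s * (l - w) * l ^ e"
  and mass: "((3 * real k + 4) * l) ^ d * s\<^sup>2 <= m0"
begin

text \<open>Centres are \<open>3 * l\<close> apart and bumps reach at most \<open>l\<close> to
  either side, which leaves gaps of length \<open>l\<close>; the offset 2 keeps every bump at radius
  at least \<open>l\<close>.\<close>

definition cen :: "nat => real" where "cen j = (3 * real j + 2) * l"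
definition bump :: "nat => real => nat => real" where "bump j x i = s * clamp ((x * l - \<bar>rr i - cen j\<bar>) / w)"
definition sumbump :: "(nat => real) => nat => real" where "sumbump y i = (\<Sum>j\<le>k. (-1) ^ j * bump j (y j) i)"

lemma wl: "w > 0" "l > 0" "l >= 4 * h" using w h by linarith+

lemma cen_dist: assumes "j \<noteq> j'" shows "\<bar>cen j - cen j'\<bar> >= 3 * l"
proof -
 have "\<bar>real j - real j'\<bar> >= 1" using assms by linarith
 hence "3 * l * 1 <= 3 * l * \<bar>real j - real j'\<bar>" using wl by (intro mult_left_mono) auto
 moreover have "cen j - cen j' = 3 * l * (real j - real j')" by (simp add: cen_def algebra_simps)
 ultimately show ?thesis using wl by (simp add: abs_mult)
qed

lemma bump_zero: assumes "0 <= x" "x <= 1" "\<bar>rr i - cen j\<bar> >= l" shows "bump j x i = 0"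
proof -
 have "x * l <= 1 * l" using assms wl by (intro mult_right_mono) auto
 hence "x * l - \<bar>rr i - cen j\<bar> <= 0" using assms(3) by linarith
 hence "(x * l - \<bar>rr i - cen j\<bar>) / w <= 0" using wl(1) by (rule divide_nonpos_pos)
 thus ?thesis unfolding bump_def using clamp(3) by simp
qed

text \<open>The gaps have length \<open>l >= 4 * h\<close>, so a lattice edge meets at most one
  bump.\<close>

lemma sumbump_local:
 assumes y: "!!j. 0 <= y j \<and> y j <= 1"
 shows "(\<exists>j\<le>k. \<bar>rr i - cen j\<bar> < l + h \<and> sumbump y i = (-1) ^ j * bump j (y j) i \<and> sumbump y (Suc i) = (-1) ^ j * bump j (y j) (Suc i))
   \<or> ((\<forall>j\<le>k. \<bar>rr i - cen j\<bar> >= l + h) \<and> sumbump y i = 0 \<and> sumbump y (Suc i) = 0)"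
proof (cases "\<exists>j\<le>k. \<bar>rr i - cen j\<bar> < l + h")
 case True
 then obtain j where j: "j <= k" "\<bar>rr i - cen j\<bar> < l + h" by blast
 have z: "bump j' (y j') i = 0" "bump j' (y j') (Suc i) = 0" if "j' \<noteq> j" for j'
  using cen_dist[OF that] j(2) wl h y[of j'] by (intro bump_zero; simp add: rr_Suc; linarith)+
 have "sumbump y i' = (-1) ^ j * bump j (y j) i'" if "i' = i \<or> i' = Suc i" for i'
 proof -
  have "sumbump y i' = (\<Sum>l\<le>k. if l = j then (-1) ^ j * bump j (y j) i' else 0)"
   unfolding sumbump_def
  proof (rule sum.cong)
   fix l assume "l \<in> {..k}"
   show "(-1) ^ l * bump l (y l) i' = (if l = j then (-1) ^ j * bump j (y j) i' else 0)"
    using z[of l] that by (cases "l = j") auto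
  qed simp
  thus ?thesis using j(1) by simp
 qed
 thus ?thesis using j by blast
next
 case False
 hence a: "\<bar>rr i - cen j\<bar> >= l + h" if "j <= k" for j using that by force
 have "bump j (y j) i = 0" "bump j (y j) (Suc i) = 0" if "j <= k" for j
  using a[OF that] h y[of j] by (intro bump_zero; simp add: rr_Suc; linarith)+
 hence "sumbump y i = 0" "sumbump y (Suc i) = 0" unfolding sumbump_def by (auto intro!: sum.neutral)
 thus ?thesis using a by blast
qed

definition ee :: "(nat => real) => nat => real" where
 "ee u i = ((Th (u i) - Th (u (Suc i))) / h)\<^sup>2 / 2 - G (u i)"

lemma EE_ee: "EE u = (\<Sum>i<L. h * rr i ^ e * ee u i)"
 unfolding EE_def ee_def rr_def using h by (intro sum.cong) (auto simp: power_divide power2_eq_square field_simps)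

text \<open>The ramp of bump \<open>j\<close> widened by \<open>h\<close> on either side, so that
  outside it both ends of an edge are at height 0 or both at full height.\<close>

definition Tr :: "(nat => real) => nat => nat set" where
 "Tr y j = {i. y j * l - w - h < \<bar>rr i - cen j\<bar> \<and> \<bar>rr i - cen j\<bar> < y j * l + h}"

lemma G_sign: "s' = 1 \<or> s' = -1 ==> G (s' * t) = G t" using G_even by auto

text \<open>Off the ramps an edge is flat and has density 0 or \<open>- G s\<close>. Only the
  plateau of the full bump \<open>j1\<close> is credited; the other plateaus have density
  \<open>- G s <= 0\<close> and are dropped.\<close>

lemma ee_cases:
 assumes y: "!!j. 0 <= y j \<and> y j <= 1" and j1: "j1 <= k" "y j1 = 1"
 shows "ee (sumbump y) i <= (if \<exists>j\<le>k. i \<in> Tr y j then (dTh s * s / w)\<^sup>2 / 2 + \<Gamma> else 0) - (if \<bar>rr i - cen j1\<bar> <= l - w - h then G s else 0)"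
proof -
 have Gam0: "\<Gamma> >= 0" using Gam[of 0] G_0 s by simp
 have A0: "(dTh s * s / w)\<^sup>2 / 2 + \<Gamma> >= 0" using Gam0 by simp
 consider (inn) j where "j <= k" "\<bar>rr i - cen j\<bar> < l + h" "sumbump y i = (-1) ^ j * bump j (y j) i" "sumbump y (Suc i) = (-1) ^ j * bump j (y j) (Suc i)"
  | (out) "\<forall>j\<le>k. \<bar>rr i - cen j\<bar> >= l + h" "sumbump y i = 0" "sumbump y (Suc i) = 0"
  using sumbump_local[of y i, OF y] by blast
 thus ?thesis
 proof cases
  case out
  have "ee (sumbump y) i = 0" unfolding ee_def out by (simp add: G_0)
  moreover have "\<not> \<bar>rr i - cen j1\<bar> <= l - w - h" using out(1) j1(1) w h by (smt (verit))
  ultimately show ?thesis using A0 by simp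
 next
  case (inn j)
  define t where "t i = clamp ((y j * l - \<bar>rr i - cen j\<bar>) / w)" for i
  have u: "sumbump y i = (-1) ^ j * (s * t i)" "sumbump y (Suc i) = (-1) ^ j * (s * t (Suc i))"
   using inn(3,4) by (simp_all add: bump_def t_def)
  have sg: "(-1::real) ^ j = 1 \<or> (-1::real) ^ j = -1" using sign_cases[of 1 j] by simp
  have D: "\<bar>\<bar>rr (Suc i) - cen j\<bar> - \<bar>rr i - cen j\<bar>\<bar> <= h" using h unfolding rr_Suc by linarith
  have e: "ee (sumbump y) i = ((Th (s * t i) - Th (s * t (Suc i))) / h)\<^sup>2 / 2 - G (s * t i)"
   unfolding ee_def u G_sign[OF sg] using sg by (elim disjE) (simp_all add: power2_commute power_divide)
  have t01: "0 <= t i" "t i <= 1" for i unfolding t_def using clamp by auto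
  have plateau: "\<bar>rr i - cen j1\<bar> <= l - w - h ==> j = j1"
   using cen_dist[of j j1] inn(2) w wl h by (cases "j = j1") auto
  show ?thesis
  proof (cases "\<bar>rr i - cen j\<bar> >= y j * l + h")
   case True
   hence "t i = 0" "t (Suc i) = 0" unfolding t_def using D wl h by (intro clamp(3) divide_nonpos_pos; linarith)+
   hence "ee (sumbump y) i = 0" unfolding e by (simp add: G_0)
   moreover have "\<not> \<bar>rr i - cen j1\<bar> <= l - w - h"
   proof
    assume a: "\<bar>rr i - cen j1\<bar> <= l - w - h"
    hence "j = j1" by (rule plateau)
    thus False using a True j1(2) wl h by simp
   qed
   ultimately show ?thesis using A0 by simp
  next
   case F1: False
   show ?thesis
   proof (cases "\<bar>rr i - cen j\<bar> <= y j * l - w - h")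
    case True
    hence "t i = 1" "t (Suc i) = 1" unfolding t_def using D wl h by (intro clamp(4); simp add: le_divide_eq; linarith)+
    hence "ee (sumbump y) i = - G s" unfolding e by simp
    thus ?thesis using A0 Gs by simp
   next
    case False
    hence T: "i \<in> Tr y j" unfolding Tr_def using F1 by auto
    have np: "\<not> \<bar>rr i - cen j1\<bar> <= l - w - h"
     using plateau False j1(2) by auto
    have "\<bar>t i - t (Suc i)\<bar> <= \<bar>(y j * l - \<bar>rr i - cen j\<bar>) / w - (y j * l - \<bar>rr (Suc i) - cen j\<bar>) / w\<bar>"
     unfolding t_def by (rule clamp(5))
    also have "\<dots> = \<bar>\<bar>rr (Suc i) - cen j\<bar> - \<bar>rr i - cen j\<bar>\<bar> / w"
     using wl(1) by (simp add: diff_divide_distrib[symmetric] abs_divide)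
    also have "\<dots> <= h / w" using D wl(1) by (simp add: divide_right_mono)
    finally have dt: "\<bar>t i - t (Suc i)\<bar> <= h / w" .
    have "\<bar>Th (s * t i) - Th (s * t (Suc i))\<bar> <= dTh s * \<bar>s * t i - s * t (Suc i)\<bar>"
     using t01[of i] t01[of "Suc i"] s by (intro Th_diff_le) (auto simp: abs_mult mult_le_cancel_left1)
    also have "\<dots> = dTh s * (s * \<bar>t i - t (Suc i)\<bar>)" using s by (simp add: abs_mult flip: right_diff_distrib)
    also have "\<dots> <= dTh s * (s * (h / w))" using dt s by (intro mult_left_mono) auto
    finally have "\<bar>Th (s * t i) - Th (s * t (Suc i))\<bar> / h <= dTh s * s / w" using h by (simp add: field_simps)
    hence "\<bar>(Th (s * t i) - Th (s * t (Suc i))) / h\<bar> <= \<bar>dTh s * s / w\<bar>" using h s wl by (simp add: abs_divide abs_mult)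
    hence "((Th (s * t i) - Th (s * t (Suc i))) / h)\<^sup>2 <= (dTh s * s / w)\<^sup>2" by (simp only: abs_le_square_iff)
    moreover have "- G (s * t i) <= \<Gamma>" using t01[of i] s by (intro Gam) (auto simp: mult_le_cancel_left1)
    ultimately have "ee (sumbump y) i <= (dTh s * s / w)\<^sup>2 / 2 + \<Gamma>" unfolding e by simp
    thus ?thesis using T inn(1) np by auto
   qed
  qed
 qed
qed

lemma rr_bound: assumes "j <= k" "\<bar>rr i - cen j\<bar> <= l + h" shows "rr i <= (3 * real k + 4) * l"
proof -
 have "3 * l * real j <= 3 * l * real k" using assms wl by (intro mult_left_mono) auto
 moreover have "cen j = 3 * l * real j + 2 * l" "(3 * real k + 4) * l = 3 * l * real k + 4 * l"
  by (simp_all add: cen_def algebra_simps)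
 ultimately show ?thesis using assms(2) wl by linarith
qed

lemma sumbump_energy:
 assumes y: "!!j. 0 <= y j \<and> y j <= 1" and j1: "j1 <= k" "y j1 = 1"
 shows "EE (sumbump y) <= - e0"
proof -
 define R where "R = (3 * real k + 4) * l"
 define A where "A = (dTh s * s / w)\<^sup>2 / 2 + \<Gamma>"
 have Gam0: "\<Gamma> >= 0" using Gam[of 0] G_0 s by simp
 have A0: "A >= 0" using Gam0 by (simp add: A_def)
 define Pl where "Pl = {i. i < L \<and> \<bar>rr i - cen j1\<bar> <= l - w - h}"
 have wt: "h * rr i ^ e >= 0" for i using h rr_pos[of i] by simp
 have yl: "y j * l <= l" "0 <= y j * l" for j using y[of j] wl by (auto simp: mult_le_cancel_right1)
 \<comment> \<open>A ramp region consists of two intervals of length \<open>w + 2 * h\<close>;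
   counting lattice points costs another \<open>h\<close>, and \<open>h <= w\<close> gives
   \<open>4 * w\<close> for each.\<close>
 have Trf: "finite (Tr y j)" and Trc: "h * real (card (Tr y j)) <= 8 * w" for j
 proof -
  let ?a = "{i. cen j + (y j * l - w - h) < rr i \<and> rr i < cen j + (y j * l + h)}"
  let ?b = "{i. cen j - (y j * l + h) < rr i \<and> rr i < cen j - (y j * l - w - h)}"
  have le: "cen j + (y j * l - w - h) <= cen j + (y j * l + h)" "cen j - (y j * l + h) <= cen j - (y j * l - w - h)" using wl h by auto
  have sub: "Tr y j \<subseteq> ?a \<union> ?b" unfolding Tr_def by (auto simp: abs_if split: if_splits)
  have fin: "finite ?a" "finite ?b" using count_rr(1)[OF le(1)] count_rr(1)[OF le(2)] by auto
  thus "finite (Tr y j)" using sub finite_subset by blast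
  have "card (Tr y j) <= card ?a + card ?b" using card_mono[OF _ sub] fin card_Un_le[of ?a ?b] by (meson finite_UnI order_trans)
  hence "h * real (card (Tr y j)) <= h * real (card ?a) + h * real (card ?b)"
   using h by (simp add: flip: distrib_left of_nat_add)
  also have "\<dots> <= (w + 2 * h + h) + (w + 2 * h + h)" using count_rr(2)[OF le(1)] count_rr(2)[OF le(2)] by (intro add_mono) auto
  finally show "h * real (card (Tr y j)) <= 8 * w" using w by simp
 qed
 have "EE (sumbump y) <= (\<Sum>i<L. h * rr i ^ e * ((if \<exists>j\<le>k. i \<in> Tr y j then A else 0) - (if \<bar>rr i - cen j1\<bar> <= l - w - h then G s else 0)))"
  unfolding EE_ee A_def using wt by (intro sum_mono mult_left_mono ee_cases[of y, OF y j1]) auto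
 also have "\<dots> = (\<Sum>i<L. h * rr i ^ e * (if \<exists>j\<le>k. i \<in> Tr y j then A else 0)) - (\<Sum>i<L. if \<bar>rr i - cen j1\<bar> <= l - w - h then h * rr i ^ e * G s else 0)"
  unfolding sum_subtractf[symmetric] by (intro sum.cong) (auto simp: algebra_simps)
 finally have E1: "EE (sumbump y) <= (\<Sum>i<L. h * rr i ^ e * (if \<exists>j\<le>k. i \<in> Tr y j then A else 0)) - (\<Sum>i<L. if \<bar>rr i - cen j1\<bar> <= l - w - h then h * rr i ^ e * G s else 0)" .
 have "(\<Sum>i<L. h * rr i ^ e * (if \<exists>j\<le>k. i \<in> Tr y j then A else 0)) <= (\<Sum>i<L. \<Sum>j\<le>k. if i \<in> Tr y j then h * R ^ e * A else 0)"
 proof (rule sum_mono)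
  fix i
  show "h * rr i ^ e * (if \<exists>j\<le>k. i \<in> Tr y j then A else 0) <= (\<Sum>j\<le>k. if i \<in> Tr y j then h * R ^ e * A else 0)"
  proof (cases "\<exists>j\<le>k. i \<in> Tr y j")
   case True
   then obtain j where j: "j <= k" "i \<in> Tr y j" by blast
   have "rr i <= R" unfolding R_def using j yl[of j] by (intro rr_bound[OF j(1)]) (auto simp: Tr_def)
   hence "h * rr i ^ e * A <= h * R ^ e * A" using h A0 rr_pos[of i] by (intro mult_right_mono mult_left_mono power_mono) auto
   also have "\<dots> = (if i \<in> Tr y j then h * R ^ e * A else 0)" using j by simp
   also have "\<dots> <= (\<Sum>j\<le>k. if i \<in> Tr y j then h * R ^ e * A else 0)"
    using j(1) h A0 wl unfolding R_def by (intro member_le_sum) auto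
   finally show ?thesis using True by simp
  next
   case False
   hence z: "(if \<exists>j\<le>k. i \<in> Tr y j then A else 0) = 0" by (simp only: if_False)
   have "(\<Sum>j\<le>k. if i \<in> Tr y j then h * R ^ e * A else 0) >= 0"
    using h A0 wl unfolding R_def by (intro sum_nonneg) auto
   thus ?thesis unfolding z by simp
  qed
 qed
 also have "\<dots> = (\<Sum>j\<le>k. \<Sum>i<L. if i \<in> Tr y j then h * R ^ e * A else 0)" by (rule sum.swap)
 also have "\<dots> <= (\<Sum>j\<le>k. 8 * w * R ^ e * A)"
 proof (rule sum_mono)
  fix j
  have "(\<Sum>i<L. if i \<in> Tr y j then h * R ^ e * A else 0) = real (card ({..<L} \<inter> Tr y j)) * (h * R ^ e * A)"
   by (simp add: sum.inter_restrict[symmetric])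
  also have "\<dots> <= real (card (Tr y j)) * (h * R ^ e * A)"
   using h A0 wl unfolding R_def by (intro mult_right_mono of_nat_mono card_mono Trf) auto
  also have "\<dots> = h * real (card (Tr y j)) * (R ^ e * A)" by simp
  also have "\<dots> <= 8 * w * (R ^ e * A)" using Trc[of j] A0 wl unfolding R_def by (intro mult_right_mono) auto
  finally show "(\<Sum>i<L. if i \<in> Tr y j then h * R ^ e * A else 0) <= 8 * w * R ^ e * A" by (simp add: mult.assoc)
 qed
 finally have E2: "(\<Sum>i<L. h * rr i ^ e * (if \<exists>j\<le>k. i \<in> Tr y j then A else 0)) <= (real k + 1) * (8 * w * R ^ e * A)" by (simp add: algebra_simps)
 have E3: "G s * (l - w) * l ^ e <= (\<Sum>i<L. if \<bar>rr i - cen j1\<bar> <= l - w - h then h * rr i ^ e * G s else 0)"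
 proof -
  have cj: "cen j1 >= 2 * l" unfolding cen_def using wl by simp
  have le: "h <= cen j1 - (l - w - h)" using cj wl w by linarith
  have Ple: "Pl = {i. cen j1 - (l - w - h) <= rr i \<and> rr i <= cen j1 + (l - w - h)}"
  proof -
   have "i < L" if "rr i <= cen j1 + (l - w - h)" for i
   proof -
    have "3 * l * real j1 <= 3 * l * real k" using j1(1) wl by (intro mult_left_mono) auto
    moreover have "cen j1 = 3 * l * real j1 + 2 * l" "(3 * real k + 4) * l = 3 * l * real k + 4 * l"
     by (simp_all add: cen_def algebra_simps)
    ultimately have "rr i < h * real L" using that L wl w h by linarith
    thus ?thesis unfolding rr_def using h by (simp add: mult.commute)
   qed
   thus ?thesis unfolding Pl_def by (auto simp: abs_le_iff)
  qed
  \<comment> \<open>The plateau has length \<open>2 * (l - w - h)\<close>, counting loses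
    \<open>h\<close>, and \<open>h <= w\<close>, \<open>4 * w <= l\<close> leave at least
    \<open>l - w\<close>.\<close>
  have "l - w <= h * real (card Pl)" using count_rr_ge(2)[OF le, of "cen j1 + (l - w - h)"] w h unfolding Ple by simp
  hence "(l - w) * (l ^ e * G s) <= (h * real (card Pl)) * (l ^ e * G s)" using wl Gs by (intro mult_right_mono) auto
  also have "\<dots> = (\<Sum>i\<in>Pl. h * l ^ e * G s)" by simp
  also have "\<dots> <= (\<Sum>i\<in>Pl. h * rr i ^ e * G s)"
  proof (rule sum_mono)
   fix i assume "i \<in> Pl"
   hence "l <= rr i" using cj wl h unfolding Ple by simp
   thus "h * l ^ e * G s <= h * rr i ^ e * G s" using h Gs wl by (intro mult_right_mono mult_left_mono power_mono) auto
  qed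
  also have "\<dots> = (\<Sum>i<L. if \<bar>rr i - cen j1\<bar> <= l - w - h then h * rr i ^ e * G s else 0)"
  proof -
   have "Pl = {i \<in> {..<L}. \<bar>rr i - cen j1\<bar> <= l - w - h}" unfolding Pl_def by auto
   thus ?thesis by (simp only: sum.inter_filter[OF finite_lessThan])
  qed
  finally show ?thesis by (simp add: mult_ac)
 qed
 show ?thesis using E1 E2 E3 neg unfolding A_def R_def by linarith
qed

lemma sumbump_mass: assumes y: "!!j. 0 <= y j \<and> y j <= 1" shows "Q (sumbump y) <= m0"
proof -
 define R where "R = (3 * real k + 4) * l"
 have R: "R > 0" unfolding R_def using wl by simp
 define N where "N = nat \<lfloor>R / h\<rfloor>"
 have N: "h * real N <= R" using R h unfolding N_def by (simp add: of_nat_nat) (metis floor_divide_lower mult.commute)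
 have b: "h * rr i ^ e * (sumbump y i)\<^sup>2 <= (if i < N then h * R ^ e * s\<^sup>2 else 0)" for i
 proof -
  consider (inn) j where "j <= k" "\<bar>rr i - cen j\<bar> < l + h" "sumbump y i = (-1) ^ j * bump j (y j) i"
   | (out) "sumbump y i = 0" using sumbump_local[of y i, OF y] by blast
  thus ?thesis
  proof cases
   case (inn j)
   have rR: "rr i <= R" unfolding R_def using inn by (intro rr_bound[of j]) auto
   hence "real i + 1 <= R / h" using h by (simp add: rr_def field_simps)
   hence iN: "i < N" unfolding N_def by linarith
   have "(sumbump y i)\<^sup>2 = (bump j (y j) i)\<^sup>2" unfolding inn(3) by (simp add: power_mult_distrib flip: power_mult)
   also have "\<dots> <= s\<^sup>2" unfolding bump_def using s clamp by (intro power_mono) (auto simp: mult_le_cancel_left1)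
   finally have "(sumbump y i)\<^sup>2 <= s\<^sup>2" .
   hence "h * rr i ^ e * (sumbump y i)\<^sup>2 <= h * R ^ e * s\<^sup>2"
    using power_mono[OF rR, of e] rr_pos[of i] h R by (intro mult_mono) auto
   thus ?thesis using iN by simp
  next
   case out
   thus ?thesis using h R by simp
  qed
 qed
 have "Q (sumbump y) <= (\<Sum>i<L. if i < N then h * R ^ e * s\<^sup>2 else 0)"
  unfolding Q_def using b unfolding rr_def by (intro sum_mono) simp
 also have "\<dots> = (\<Sum>i\<in>{i\<in>{..<L}. i < N}. h * R ^ e * s\<^sup>2)" by (rule sum.inter_filter[symmetric]) simp
 also have "\<dots> <= (\<Sum>i<N. h * R ^ e * s\<^sup>2)" using h R by (intro sum_mono2) auto
 also have "\<dots> = (h * real N) * (R ^ e * s\<^sup>2)" by simp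
 also have "\<dots> <= R * (R ^ e * s\<^sup>2)" using N R by (intro mult_right_mono) auto
 also have "\<dots> = R ^ d * s\<^sup>2" by (simp add: de)
 finally show ?thesis using mass unfolding R_def by simp
qed

theorem bump_solution:
 obtains v \<mu> where "v \<in> D" "\<mu> >= 0" "!!i. i < L ==> dE v i + \<mu> * (h * rr i ^ e) * v i = 0" "\<mu> > 0 ==> Q v = m0"
  "EE v <= - e0" "alt k v" "\<not> alt (Suc k) v"
proof -
 \<comment> \<open>Block \<open>j\<close> covers the radii from \<open>(3 * j + 1) * l\<close> to
   \<open>(3 * j + 4) * l\<close>; its first two thirds contain the support of bump
   \<open>j\<close>.\<close>
 define lo where "lo j = nat \<lfloor>(3 * real j + 1) * l / h\<rfloor>" for j
 show thesis
 proof (rule discrete_solution[of k lo lo bump e0])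
  show "lo j <= lo j \<and> lo j < lo (Suc j)" for j
  proof -
   have a: "(3 * real j + 1) * l / h >= 0" using wl h by simp
   have "(3 * real (Suc j) + 1) * l / h = (3 * real j + 1) * l / h + 3 * l / h" by (simp add: add_divide_distrib[symmetric] algebra_simps)
   moreover have "3 * l / h >= 1" using wl h by (simp add: field_simps)
   ultimately have "\<lfloor>(3 * real j + 1) * l / h\<rfloor> < \<lfloor>(3 * real (Suc j) + 1) * l / h\<rfloor>" by linarith
   moreover have "\<lfloor>(3 * real j + 1) * l / h\<rfloor> >= 0" using a by linarith
   ultimately have "nat \<lfloor>(3 * real j + 1) * l / h\<rfloor> < nat \<lfloor>(3 * real (Suc j) + 1) * l / h\<rfloor>" by linarith
   thus ?thesis unfolding lo_def by simp
  qed
  show "lo (Suc k) <= L"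
  proof -
   have "(3 * real (Suc k) + 1) * l / h <= real L" using L h by (simp add: field_simps)
   thus ?thesis unfolding lo_def by linarith
  qed
  show "bump j x i >= 0" for j x i unfolding bump_def using s clamp(1) by simp
  show "bump j 0 i = 0" for j i unfolding bump_def using wl by (simp add: clamp(3) divide_nonpos_pos)
  show "lo j <= i \<and> i < lo (Suc j)" if "0 <= x" "x <= 1" "bump j x i \<noteq> 0" for j x i
  proof -
   have "\<bar>rr i - cen j\<bar> < l" using bump_zero[OF that(1,2), of i j] that(3) by force
   hence "(3 * real j + 1) * l < rr i" "rr i < (3 * real j + 3) * l" unfolding cen_def by (auto simp: abs_less_iff algebra_simps)
   hence "(3 * real j + 1) * l / h < real i + 1" "real i + 1 < (3 * real j + 3) * l / h" using h by (simp_all add: rr_def field_simps)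
   moreover have "(3 * real j + 3) * l / h <= (3 * real (Suc j) + 1) * l / h" using wl h by (intro divide_right_mono mult_right_mono) auto
   moreover have "(3 * real j + 1) * l / h >= 0" using wl h by simp
   ultimately show ?thesis unfolding lo_def by linarith
  qed
  show "continuous_on UNIV (%x. bump j x i)" for j i
   unfolding bump_def clamp_def using wl(1) by (intro continuous_intros) simp
  show "EE (%i. \<Sum>j\<le>k. (-1) ^ j * bump j (y j) i) <= - e0 \<and> Q (%i. \<Sum>j\<le>k. (-1) ^ j * bump j (y j) i) <= m0"
   if "!!j. 0 <= y j \<and> y j <= 1" "\<exists>j\<le>k. y j = 1" for y
   using sumbump_energy[of y, OF that(1)] sumbump_mass[of y, OF that(1)] that(2) unfolding sumbump_def[abs_def] by blast
  show "e0 > 0" by (rule e0)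
 qed (use that in \<open>simp add: rr_def\<close>)
qed

end

end

section \<open>Bounds uniform in the mesh\<close>

text \<open>Comparison with the antiderivative \<open>d * x powr (1 / d)\<close>. The power
  \<open>1 / d - 1\<close> is what radial weight and decay bound leave of the critical term near the
  origin; that it exceeds -1 excludes concentration there.\<close>

lemma sum_root_powers:
 assumes "d >= (1::nat)"
 shows "(\<Sum>i<n. (real i + 1) powr (1 / real d - 1)) <= real d * real n powr (1 / real d)"
proof (induction n)
 case (Suc n)
 define \<beta> where "\<beta> = 1 / real d"
 have b: "0 < \<beta>" "\<beta> <= 1" "real d * \<beta> = 1" using assms by (auto simp: \<beta>_def)
 have "(real n + 1) powr (\<beta> - 1) <= real d * ((real n + 1) powr \<beta> - real n powr \<beta>)"
 proof (cases "n = 0")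
  case True thus ?thesis using assms by simp
 next
  case False
  have "\<exists>z>real n. z < real n + 1 \<and> (real n + 1) powr \<beta> - real n powr \<beta> = (real n + 1 - real n) * (\<beta> * z powr (\<beta> - 1))"
   using False by (intro MVT2) (auto intro!: derivative_eq_intros simp: field_simps)
  then obtain z where z: "real n < z" "z < real n + 1" "(real n + 1) powr \<beta> - real n powr \<beta> = \<beta> * z powr (\<beta> - 1)" by auto
  have "(real n + 1) powr (\<beta> - 1) <= z powr (\<beta> - 1)" using z b False by (intro powr_mono2') auto
  thus ?thesis unfolding z(3) using b(3) by (simp flip: mult.assoc)
 qed
 thus ?case using Suc unfolding \<beta>_def[symmetric] by (simp add: algebra_simps)
qed simp

lemma powr_le_one_le_neg: "1 <= x ==> a <= 0 ==> x powr a <= (1::real)"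
 using powr_mono[of a 0 x] by simp

lemma ge_one_powr_ge_zero_neg: "0 < x ==> x <= 1 ==> a <= 0 ==> 1 <= x powr (a::real)"
 using powr_mono2'[of a x 1] by simp

text \<open>Testing the equation for \<open>Th u\<close> with \<open>Th u\<close> itself produces
  this factor in place of \<open>u\<close>; by \<open>psi_le\<close> and \<open>psi_ge\<close> the
  two are comparable.\<close>

definition psi :: "real => real" where "psi u = Th u / dTh u"

lemma psi_le: "\<bar>psi u\<bar> <= \<bar>u\<bar>"
 using Th_bound[of u] by (simp add: psi_def abs_divide divide_le_eq abs_of_pos)

lemma psi_ge: "u * psi u >= u\<^sup>2 / 2"
proof -
 have "u * arsinh (sqrt 2 * u) >= 0"
 proof (cases "u >= 0")
  case True
  hence "arsinh (sqrt 2 * u) >= 0" using arsinh_real_neg_iff[of "sqrt 2 * u"] by (simp add: mult_less_0_iff not_less[symmetric] del: arsinh_real_neg_iff)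
  thus ?thesis using True by simp
 next
  case False
  hence "arsinh (sqrt 2 * u) < 0" by (simp add: mult_less_0_iff)
  thus ?thesis using False by (intro mult_nonpos_nonpos) linarith+
 qed
 hence "u * Th u >= u\<^sup>2 / 2 * dTh u"
  unfolding Th_def by (simp add: algebra_simps power2_eq_square flip: times_divide_eq_right) (simp add: field_simps)
 thus ?thesis by (simp add: psi_def le_divide_eq)
qed

lemma abs_mult_psi: "\<bar>u\<bar> * \<bar>psi u\<bar> = u * psi u"
 using psi_ge[of u] by (metis abs_mult abs_of_nonneg order_trans zero_le_divide_iff zero_le_numeral zero_le_power2)

context rlattice
begin

abbreviation rho :: "nat => real" where "rho i \<equiv> h * rr i ^ e"
abbreviation kap :: "nat => real" where "kap i \<equiv> rr i ^ e / h"

lemma rho_pos: "rho i > 0" using h rr_pos[of i] by simp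
lemma kap_pos: "kap i > 0" using h rr_pos[of i] by simp

lemma rho_kap: "rho i = h\<^sup>2 * kap i" using h by (simp add: power2_eq_square)

lemma rr_mono: "i <= j ==> rr i <= rr j" using h by (simp add: rr_def)

lemma Q_eq: "Q u = (\<Sum>i<L. rho i * (u i)\<^sup>2)" by (simp add: Q_def rr_def)

definition Kin :: "(nat => real) => real" where "Kin v = (\<Sum>i<L. kap i * (v i - v (Suc i))\<^sup>2)"

lemma Kin_nonneg: "Kin v >= 0" unfolding Kin_def using kap_pos by (intro sum_nonneg mult_nonneg_nonneg) (auto simp: less_imp_le simp del: times_divide_eq_left)

text \<open>Cauchy-Schwarz over the edges from \<open>i\<close> to \<open>j\<close>; the
  conductances increase with the radius, so the one at \<open>i\<close> is the smallest.\<close>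

lemma telescope_bound:
 assumes out: "!!i. i >= L ==> v i = 0" and ij: "i <= j"
 shows "\<bar>v i - v j\<bar> <= sqrt (Kin v * ((real j - real i) * h) / rr i ^ e)"
proof -
 define x where "x l = v l - v (Suc l)" for l
 have "v i - v j = (\<Sum>l\<in>{i..<j}. x l)"
  unfolding x_def using sum_Suc_diff'[OF ij, of "%l. - v l"] by (simp add: sum_negf[symmetric] algebra_simps)
 hence "(v i - v j)\<^sup>2 <= (\<Sum>l\<in>{i..<j}. 1) * (\<Sum>l\<in>{i..<j}. (x l)\<^sup>2)"
  using Cauchy_Schwarz_ineq_sum[of "%_. 1" x "{i..<j}"] by simp
 also have "\<dots> = (real j - real i) * (\<Sum>l\<in>{i..<j}. (x l)\<^sup>2)" using ij by simp
 finally have a: "(v i - v j)\<^sup>2 <= (real j - real i) * (\<Sum>l\<in>{i..<j}. (x l)\<^sup>2)" .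
 have "kap i * (\<Sum>l\<in>{i..<j}. (x l)\<^sup>2) <= (\<Sum>l\<in>{i..<j}. kap l * (x l)\<^sup>2)"
  unfolding sum_distrib_left using rr_mono rr_pos h
  by (intro sum_mono mult_right_mono divide_right_mono power_mono) (auto simp: less_imp_le)
 also have "\<dots> = (\<Sum>l\<in>{i..<j} \<inter> {..<L}. kap l * (x l)\<^sup>2)"
  by (rule sum.mono_neutral_right) (auto simp: x_def out not_less)
 also have "\<dots> <= Kin v" unfolding Kin_def x_def using kap_pos by (intro sum_mono2 mult_nonneg_nonneg) (auto simp: less_imp_le simp del: times_divide_eq_left)
 finally have "(\<Sum>l\<in>{i..<j}. (x l)\<^sup>2) <= Kin v / kap i"
  by (subst pos_le_divide_eq[OF kap_pos]) (simp only: mult.commute)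
 hence "(real j - real i) * (\<Sum>l\<in>{i..<j}. (x l)\<^sup>2) <= (real j - real i) * (Kin v / kap i)" using ij by (intro mult_left_mono) auto
 hence "(v i - v j)\<^sup>2 <= Kin v * ((real j - real i) * h) / rr i ^ e" using a by (simp add: mult_ac)
 thus ?thesis by (simp add: real_le_rsqrt)
qed

text \<open>Averaging: if the square exceeded this value throughout a window of length \<delta>,
  that window alone would carry more mass than \<open>m0\<close>.\<close>

lemma window_small:
 assumes u: "u \<in> D" and \<delta>: "\<delta> > 0"
 shows "\<exists>l\<ge>i. (real l - real i) * h <= \<delta> \<and> (u l)\<^sup>2 <= m0 / (\<delta> * rr i ^ e)"
proof (rule ccontr)
 assume c: "\<not> ?thesis"
 \<comment> \<open>A window of \<open>n\<close> points has total cell length at least \<delta>,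
   while its first and last points are at most \<delta> apart.\<close>
 define n where "n = nat \<lceil>\<delta> / h\<rceil>"
 have pos: "\<delta> / h > 0" using \<delta> h by simp
 have n: "real n >= \<delta> / h" "real n - 1 <= \<delta> / h" unfolding n_def using pos by linarith+
 hence nh: "real n * h >= \<delta>" "(real n - 1) * h <= \<delta>" using h by (simp_all add: field_simps)
 have n0: "n > 0" using n pos by (cases n) auto
 have big: "(u l)\<^sup>2 > m0 / (\<delta> * rr i ^ e)" if "l \<in> {i..<i+n}" for l
 proof -
  have "real l - real i <= real n - 1" using that by auto
  hence "(real l - real i) * h <= (real n - 1) * h" using h by (intro mult_right_mono) auto
  thus ?thesis using c that nh by force
 qed
 have "m0 / \<delta> * \<delta> <= m0 / \<delta> * (real n * h)" using nh m0 \<delta> by (intro mult_left_mono) auto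
 also have "\<dots> = (\<Sum>l\<in>{i..<i+n}. h * rr i ^ e * (m0 / (\<delta> * rr i ^ e)))" using rr_pos[of i] \<delta> by (simp add: field_simps)
 also have "\<dots> < (\<Sum>l\<in>{i..<i+n}. rho i * (u l)\<^sup>2)"
  using n0 by (intro sum_strict_mono mult_strict_left_mono[OF big rho_pos]) auto
 also have "\<dots> <= (\<Sum>l\<in>{i..<i+n}. rho l * (u l)\<^sup>2)"
  using h rr_pos[of i] rr_mono by (intro sum_mono mult_right_mono mult_left_mono power_mono) auto
 also have "\<dots> = (\<Sum>l\<in>{i..<i+n} \<inter> {..<L}. rho l * (u l)\<^sup>2)"
  by (rule sum.mono_neutral_right) (use u in \<open>auto simp: D_def not_less\<close>)
 also have "\<dots> <= Q u" unfolding Q_eq using rho_pos by (intro sum_mono2) (auto simp: less_imp_le)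
 also have "\<dots> <= m0" using u by (simp add: D_def)
 finally show False using \<delta> by simp
qed

definition Vk :: "(nat => real) => real" where "Vk u = Kin (%i. Th (u i))"

lemma Th_telescope:
 assumes u: "u \<in> D" and ij: "i <= j" and \<delta>: "(real j - real i) * h <= \<delta>" and K: "Vk u <= K"
 shows "\<bar>Th (u i) - Th (u j)\<bar> <= sqrt (K * \<delta> / rr i ^ e)"
proof -
 have k0: "Vk u >= 0" unfolding Vk_def by (rule Kin_nonneg)
 have "\<bar>Th (u i) - Th (u j)\<bar> <= sqrt (Vk u * ((real j - real i) * h) / rr i ^ e)"
  unfolding Vk_def using u by (intro telescope_bound[OF _ ij]) (simp add: D_def)
 also have "\<dots> <= sqrt (K * \<delta> / rr i ^ e)"
  using k0 K \<delta> ij h rr_pos[of i] by (intro real_sqrt_le_mono divide_right_mono mult_mono) auto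
 finally show ?thesis .
qed

lemma index_reaching:
 assumes "rr i < \<delta>" obtains j where "i <= j" "\<delta> <= rr j" "rr j < \<delta> + h" "(real j - real i) * h <= \<delta>"
proof -
 define j where "j = nat (\<lceil>\<delta> / h\<rceil> - 1)"
 have "\<delta> / h > real i + 1" using assms h by (simp add: rr_def field_simps)
 hence j: "real j + 1 >= \<delta> / h" "real j + 1 < \<delta> / h + 1" "i <= j" unfolding j_def by linarith+
 hence "\<delta> <= rr j" "rr j < \<delta> + h" using h by (simp_all add: rr_def field_simps)
 moreover have "(real j - real i) * h <= \<delta>"
 proof -
  have "(real j - real i) * h <= real j * h" using h by (simp add: algebra_simps)
  moreover have "real j * h < \<delta>" using j h by (simp add: field_simps)
  ultimately show ?thesis by linarith
 qed
 ultimately show thesis using j by (intro that[of j]) auto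
qed

lemma sum_rr_root:
 assumes \<delta>: "\<delta> > 0"
 shows "(\<Sum>i<L. if rr i < \<delta> then h * rr i powr (1 / real d - 1) else 0) <= real d * \<delta> powr (1 / real d)"
proof -
 define n where "n = nat \<lfloor>\<delta> / h\<rfloor>"
 have nh: "real n * h <= \<delta>" unfolding n_def using \<delta> h by (simp add: of_nat_nat) (metis floor_divide_lower)
 have "(\<Sum>i<L. if rr i < \<delta> then h * rr i powr (1 / real d - 1) else 0) <= (\<Sum>i<L. if i < n then h * rr i powr (1 / real d - 1) else 0)"
 proof (rule sum_mono)
  fix i
  have "i < n" if "rr i < \<delta>"
  proof -
   have "real i + 1 < \<delta> / h" using that h by (simp add: rr_def field_simps)
   thus ?thesis unfolding n_def by linarith
  qed
  thus "(if rr i < \<delta> then h * rr i powr (1 / real d - 1) else 0) <= (if i < n then h * rr i powr (1 / real d - 1) else 0)"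
   using h by auto
 qed
 also have "\<dots> = (\<Sum>i\<in>{i\<in>{..<L}. i < n}. h * rr i powr (1 / real d - 1))" by (simp only: sum.inter_filter[OF finite_lessThan])
 also have "\<dots> <= (\<Sum>i<n. h * rr i powr (1 / real d - 1))" using h by (intro sum_mono2) auto
 also have "\<dots> = (\<Sum>i<n. h powr (1 / real d) * (real i + 1) powr (1 / real d - 1))"
 proof (rule sum.cong)
  fix i
  have "h * h powr (1 / real d - 1) = h powr (1 / real d)" using h by (simp add: powr_diff)
  thus "h * rr i powr (1 / real d - 1) = h powr (1 / real d) * (real i + 1) powr (1 / real d - 1)"
   using h by (simp add: rr_def powr_mult)
 qed simp
 also have "\<dots> <= h powr (1 / real d) * (real d * real n powr (1 / real d))"
  unfolding sum_distrib_left[symmetric] using sum_root_powers[of d n] d by (intro mult_left_mono) auto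
 also have "\<dots> = real d * (real n * h) powr (1 / real d)" using h by (simp add: powr_mult)
 also have "\<dots> <= real d * \<delta> powr (1 / real d)" using nh h by (intro mult_left_mono powr_mono2) auto
 finally show ?thesis .
qed

text \<open>Strauss-type radial decay: find a small value within distance 1 and return by
  Cauchy-Schwarz, whose weight gives the exponent \<open>- (d - 1) / 2\<close>. Points of radius
  below 1 are first joined to a point of radius at least 1.\<close>

lemma pointwise_bound:
 assumes u: "u \<in> D" and K: "Vk u <= K"
 shows "\<bar>Th (u i)\<bar> <= (sqrt m0 + 2 * m0 + 2 * sqrt K) * rr i powr (- (real d - 1) / 2)"
proof -
 have K0: "K >= 0" using K Kin_nonneg unfolding Vk_def by (meson order_trans)
 have sq: "sqrt (x / rr i ^ e) = sqrt x * rr i powr (- (real d - 1) / 2)" for i x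
 proof -
  have "rr i powr (- (real d - 1) / 2) = 1 / sqrt (rr i ^ e)"
  proof -
   have "sqrt (rr i ^ e) = (rr i powr (real d - 1)) powr (1/2)"
    using rr_pos[of i] d by (simp add: powr_half_sqrt powr_realpow[symmetric] de)
   also have "\<dots> = rr i powr ((real d - 1) / 2)" by (simp add: powr_powr)
   finally have "sqrt (rr i ^ e) = rr i powr ((real d - 1) / 2)" .
   moreover have "- (real d - 1) / 2 = - ((real d - 1) / 2)" by (rule minus_divide_left[symmetric])
   ultimately show ?thesis by (simp only: powr_minus_divide)
  qed
  thus ?thesis by (simp add: real_sqrt_divide)
 qed
 have far: "\<bar>Th (u i)\<bar> <= (sqrt m0 + 2 * m0 + sqrt K) * rr i powr (- (real d - 1) / 2)" if r: "rr i >= 1" for i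
 proof -
  obtain l where l: "l >= i" "(real l - real i) * h <= 1" "(u l)\<^sup>2 <= m0 / (1 * rr i ^ e)"
   using window_small[OF u, of 1 i] by auto
  define y where "y = rr i powr (- (real d - 1) / 2)"
  have y: "0 <= y" "y <= 1" unfolding y_def using r d by (auto intro!: powr_le_one_le_neg)
  have "\<bar>u l\<bar> <= sqrt m0 * y" using real_le_rsqrt[of "\<bar>u l\<bar>" "m0 / rr i ^ e"] l(3) sq[of m0 i] unfolding y_def by simp
  moreover have "2 * (u l)\<^sup>2 <= 2 * m0 * y"
  proof -
   have "(u l)\<^sup>2 <= (sqrt m0 * y)\<^sup>2" using calculation y m0 by (intro abs_le_square_iff[THEN iffD1]) auto
   also have "\<dots> = m0 * (y * y)" using m0 by (simp add: power_mult_distrib power2_eq_square[of y])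
   also have "\<dots> <= m0 * (1 * y)" using y m0 by (intro mult_left_mono mult_right_mono) auto
   finally show ?thesis by simp
  qed
  ultimately have "\<bar>Th (u l)\<bar> <= (sqrt m0 + 2 * m0) * y" using Th_le_quadratic[of "u l"] by (simp add: algebra_simps)
  moreover have "\<bar>Th (u i) - Th (u l)\<bar> <= sqrt K * y" using Th_telescope[OF u l(1,2) K] unfolding y_def sq by simp
  ultimately have "\<bar>Th (u i)\<bar> <= (sqrt m0 + 2 * m0) * y + sqrt K * y" by linarith
  thus ?thesis unfolding y_def by (simp add: algebra_simps)
 qed
 define C where "C = sqrt m0 + 2 * m0 + sqrt K"
 have C0: "C >= 0" unfolding C_def using m0 K0 by simp
 show ?thesis
 proof (cases "rr i >= 1")
  case True
  have "(sqrt m0 + 2 * m0 + sqrt K) * rr i powr (- (real d - 1) / 2) <= (sqrt m0 + 2 * m0 + 2 * sqrt K) * rr i powr (- (real d - 1) / 2)"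
   using K0 by (intro mult_right_mono) auto
  thus ?thesis using far[OF True] by linarith
 next
  case False
  then obtain j where j: "i <= j" "1 <= rr j" "(real j - real i) * h <= 1" by (metis index_reaching not_le)
  define y where "y = rr i powr (- (real d - 1) / 2)"
  have y: "y >= 1" unfolding y_def using False rr_pos[of i] d by (intro ge_one_powr_ge_zero_neg) auto
  have "rr j powr (- (real d - 1) / 2) <= 1" using j d by (intro powr_le_one_le_neg) auto
  hence "\<bar>Th (u j)\<bar> <= C * 1" using far[OF j(2)] C0 unfolding C_def[symmetric] by (meson mult_left_mono order_trans)
  also have "\<dots> <= C * y" using y C0 by (intro mult_left_mono)
  finally have "\<bar>Th (u j)\<bar> <= C * y" .
  moreover have "\<bar>Th (u i) - Th (u j)\<bar> <= sqrt K * y" using Th_telescope[OF u j(1,3) K] unfolding y_def sq by simp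
  ultimately have "\<bar>Th (u i)\<bar> <= C * y + sqrt K * y" by linarith
  thus ?thesis unfolding y_def C_def by (simp add: algebra_simps)
 qed
qed

text \<open>Depends on \<open>m0\<close> and \<open>d\<close> only, not on mesh or radius. The
  summands come from the region outside radius \<delta> and from the regular and the singular part
  inside it.\<close>

definition cGN :: real where
 "cGN = (m0 + 2) powr (1 + 2 / real d) * m0 + 8 * ((m0 + 2) powr (2 + 2 / real d) + 4 powr (1 + 1 / real d) * real d)"

text \<open>The sum is cut into windows of length \<open>\<delta>\<close> with \<open>\<delta>\<^sup>d\<^sup>+\<^sup>2 K = 1\<close>.\<close>

lemma gagliardo_nirenberg:
 assumes u: "u \<in> D" and K: "Vk u <= K" "K >= 1"
 shows "(\<Sum>i<L. rho i * \<bar>u i\<bar> powr (4 + 4 / real d)) <= cGN * K"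
proof -
 define \<delta> where "\<delta> = K powr (- 1 / (real d + 2))"
 have \<delta>: "\<delta> > 0" unfolding \<delta>_def using K by simp
 have d0: "real d > 0" using d by simp
 have Kd: "K = \<delta> powr (- (real d + 2))"
 proof -
  have "(- 1 / (real d + 2)) * (- (real d + 2)) = 1" using d0 by (simp add: field_simps)
  thus ?thesis unfolding \<delta>_def powr_powr using K by simp
 qed
 have Kd': "\<delta> powr (- real d - 2) = K"
 proof -
  have "- real d - 2 = - (real d + 2)" by simp
  thus ?thesis using Kd by (simp only:)
 qed
 have Kdd: "K * \<delta> = \<delta> powr (- (real d + 1))"
 proof -
  have "\<delta> powr (- (real d + 2)) * \<delta> powr 1 = \<delta> powr (- (real d + 2) + 1)" by (rule powr_add[symmetric])
  moreover have "- (real d + 2) + 1 = - (real d + 1)" by simp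
  moreover have "K * \<delta> = \<delta> powr (- (real d + 2)) * \<delta> powr 1" using \<delta> by (simp only: Kd[symmetric] powr_one less_imp_le)
  ultimately show ?thesis by (simp only:)
 qed
 \<comment> \<open>For \<open>r >= \<delta>\<close> the mass term
   \<open>m0 / (\<delta> * r ^ e)\<close> and the Dirichlet term
   \<open>sqrt (K * \<delta> / r ^ e)\<close> are both at most a multiple of
   \<open>\<delta> powr (- d)\<close>; \<delta> was chosen to balance them.\<close>
 define B where "B = (m0 + 2) * \<delta> powr (- real d)"
 have B: "B > 0" unfolding B_def using m0 \<delta> by simp
 have rp: "rr i ^ e = rr i powr (real d - 1)" for i
  using rr_pos[of i] d by (simp add: powr_realpow[symmetric] de)
 have far: "(u i)\<^sup>2 <= B" if r: "rr i >= \<delta>" for i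
 proof -
  obtain l where l: "l >= i" "(real l - real i) * h <= \<delta>" "(u l)\<^sup>2 <= m0 / (\<delta> * rr i ^ e)"
   using window_small[OF u \<delta>, of i] by auto
  have pw: "rr i powr (real d - 1) >= \<delta> powr (real d - 1)" using r \<delta> d by (intro powr_mono2) auto
  have "m0 / (\<delta> * rr i ^ e) <= m0 / (\<delta> * \<delta> powr (real d - 1))"
   unfolding rp using pw \<delta> m0 by (intro divide_left_mono mult_left_mono mult_pos_pos) auto
  also have "\<delta> * \<delta> powr (real d - 1) = \<delta> powr real d" using \<delta> by (simp add: powr_diff)
  finally have a: "(u l)\<^sup>2 <= m0 * \<delta> powr (- real d)" using l(3) by (simp add: powr_minus_divide)
  have "K * \<delta> / rr i ^ e <= K * \<delta> / \<delta> powr (real d - 1)"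
   unfolding rp using pw \<delta> K by (intro divide_left_mono mult_pos_pos) auto
  also have "\<dots> = \<delta> powr (- (real d + 1)) * \<delta> powr (- (real d - 1))"
   unfolding Kdd by (simp only: powr_minus_divide[of \<delta> "real d - 1"] times_divide_eq_right mult_1_right)
  also have "\<dots> = (\<delta> powr (- real d))\<^sup>2"
  proof -
   have "- (real d + 1) + - (real d - 1) = - real d + - real d" by simp
   thus ?thesis by (simp only: power2_eq_square powr_add[symmetric])
  qed
  finally have "sqrt (K * \<delta> / rr i ^ e) <= \<delta> powr (- real d)" by (simp add: real_le_lsqrt \<delta>)
  hence "\<bar>Th (u i) - Th (u l)\<bar> <= \<delta> powr (- real d)" using Th_telescope[OF u l(1,2) K(1)] by linarith
  hence "2 * \<bar>Th (u i) - Th (u l)\<bar> <= 2 * \<delta> powr (- real d)" by (intro mult_left_mono) auto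
  from order_trans[OF order_trans[OF abs_ge_self sq_diff_le_Th] this]
  have "(u i)\<^sup>2 - (u l)\<^sup>2 <= 2 * \<delta> powr (- real d)" .
  hence "(u i)\<^sup>2 <= (u l)\<^sup>2 + 2 * \<delta> powr (- real d)" by (simp only: diff_le_eq add.commute)
  thus ?thesis using a unfolding B_def by (simp add: algebra_simps)
 qed
 have near: "(u i)\<^sup>2 <= B + 2 * sqrt (K * \<delta> / rr i ^ e)" if r: "rr i < \<delta>" for i
 proof -
  obtain j where j: "i <= j" "\<delta> <= rr j" "(real j - real i) * h <= \<delta>" using index_reaching[OF r] by metis
  have "\<bar>(u i)\<^sup>2 - (u j)\<^sup>2\<bar> <= 2 * \<bar>Th (u i) - Th (u j)\<bar>" by (rule sq_diff_le_Th)
  also have "\<dots> <= 2 * sqrt (K * \<delta> / rr i ^ e)" using Th_telescope[OF u j(1,3) K(1)] by simp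
  finally have "(u i)\<^sup>2 - (u j)\<^sup>2 <= 2 * sqrt (K * \<delta> / rr i ^ e)" by (rule order_trans[OF abs_ge_self])
  hence "(u i)\<^sup>2 <= (u j)\<^sup>2 + 2 * sqrt (K * \<delta> / rr i ^ e)" by (simp only: diff_le_eq add.commute)
  thus ?thesis using add_right_mono[OF far[OF j(2)]] by (rule order_trans)
 qed
 \<comment> \<open>The critical power of \<open>u\<close> is the power \<open>q\<close> of
   \<open>u^2\<close>. Outside radius \<delta>, one factor \<open>u^2\<close> is summed to the mass
   and the remaining power \<open>1 + 2 / d\<close> is estimated by \<open>B\<close>.\<close>
 define q where "q = 2 + 2 / real d"
 have q: "q = 1 + (1 + 2 / real d)" "q > 0" "q <= 3" using d unfolding q_def by (auto simp: field_simps)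
 have up: "\<bar>t\<bar> powr (4 + 4 / real d) = (t\<^sup>2) powr q" for t :: real
 proof (cases "t = 0")
  case False
  have "t\<^sup>2 = \<bar>t\<bar> powr 2" using False by simp
  hence "(t\<^sup>2) powr q = \<bar>t\<bar> powr (2 * q)" by (simp only: powr_powr)
  moreover have "2 * q = 4 + 4 / real d" unfolding q_def by simp
  ultimately show ?thesis by (simp only:)
 qed simp
 have term_bound: "rho i * \<bar>u i\<bar> powr (4 + 4 / real d) <= B powr (1 + 2 / real d) * (rho i * (u i)\<^sup>2)
   + (if rr i < \<delta> then h * \<delta> powr (real d - 1) * (8 * B powr q) + 8 * (4 * (K * \<delta>)) powr (1 + 1 / real d) * (h * rr i powr (1 / real d - 1)) else 0)" for i
 proof (cases "rr i < \<delta>")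
  case False
  have "(u i)\<^sup>2 powr q = (u i)\<^sup>2 powr (1 + 2 / real d) * (u i)\<^sup>2" unfolding q(1) by (cases "u i = 0") (auto simp: powr_add)
  also have "\<dots> <= B powr (1 + 2 / real d) * (u i)\<^sup>2" using far[of i] False d by (intro mult_right_mono powr_mono2) auto
  finally have "rho i * (u i)\<^sup>2 powr q <= rho i * (B powr (1 + 2 / real d) * (u i)\<^sup>2)" using rho_pos[of i] by (intro mult_left_mono) auto
  thus ?thesis using False unfolding up by (simp add: mult_ac)
 next
  case True
  define b where "b = 2 * sqrt (K * \<delta> / rr i ^ e)"
  have b0: "b >= 0" unfolding b_def using K \<delta> rr_pos[of i] by simp
  have "(u i)\<^sup>2 powr q <= (2 * max B b) powr q" using near[OF True] q(2) unfolding b_def[symmetric] by (intro powr_mono2) auto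
  also have "\<dots> = 2 powr q * (max B b) powr q" using B by (simp add: powr_mult)
  also have "\<dots> <= 8 * (max B b) powr q"
  proof (rule mult_right_mono)
   have "(2::real) powr q <= 2 powr 3" using q by (intro powr_mono) auto
   thus "(2::real) powr q <= 8" by simp
  qed simp
  also have "(max B b) powr q <= B powr q + b powr q" by (auto simp: max_def)
  finally have A: "(u i)\<^sup>2 powr q <= 8 * (B powr q + b powr q)" by simp
  have bq: "b powr q = (4 * (K * \<delta>)) powr (1 + 1 / real d) * rr i powr (- (real d - 1) * (1 + 1 / real d))"
  proof -
   have "b\<^sup>2 = 4 * (K * \<delta>) / rr i ^ e" unfolding b_def using K \<delta> rr_pos[of i] by (simp add: power_mult_distrib)
   also have "\<dots> = 4 * (K * \<delta>) * rr i powr (- (real d - 1))"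
    unfolding rp by (simp only: powr_minus_divide[of "rr i" "real d - 1"] times_divide_eq_right mult_1_right)
   finally have b2: "b\<^sup>2 = 4 * (K * \<delta>) * rr i powr (- (real d - 1))" .
   have bp: "b > 0" unfolding b_def using K \<delta> rr_pos[of i] by simp
   have "b powr q = (b powr 2) powr (1 + 1 / real d)" unfolding powr_powr q_def by (simp add: algebra_simps)
   also have "b powr 2 = b\<^sup>2" using bp by simp
   finally show ?thesis unfolding b2 using K \<delta> by (simp add: powr_mult powr_powr)
  qed
  have e1: "rr i powr (real d - 1) * rr i powr (- (real d - 1) * (1 + 1 / real d)) = rr i powr (1 / real d - 1)"
  proof -
   have "(real d - 1) + (- (real d - 1) * (1 + 1 / real d)) = 1 / real d - 1" using d0 by (simp add: field_simps)
   thus ?thesis by (simp only: powr_add[symmetric])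
  qed
  have "rho i * (u i)\<^sup>2 powr q <= rho i * (8 * (B powr q + b powr q))" using A rho_pos[of i] by (intro mult_left_mono) auto
  also have "\<dots> = h * rr i powr (real d - 1) * (8 * B powr q) + 8 * (4 * (K * \<delta>)) powr (1 + 1 / real d) * (h * (rr i powr (real d - 1) * rr i powr (- (real d - 1) * (1 + 1 / real d))))"
   unfolding bq rp by (simp add: algebra_simps)
  also have "\<dots> <= h * \<delta> powr (real d - 1) * (8 * B powr q) + 8 * (4 * (K * \<delta>)) powr (1 + 1 / real d) * (h * rr i powr (1 / real d - 1))"
   unfolding e1 using h True rr_pos[of i] d by (intro add_right_mono mult_right_mono mult_left_mono powr_mono2) auto
  finally have C: "rho i * (u i)\<^sup>2 powr q <= h * \<delta> powr (real d - 1) * (8 * B powr q) + 8 * (4 * (K * \<delta>)) powr (1 + 1 / real d) * (h * rr i powr (1 / real d - 1))" .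
  have "B powr (1 + 2 / real d) * (rho i * (u i)\<^sup>2) >= 0" using h rr_pos[of i] by (intro mult_nonneg_nonneg) auto
  thus ?thesis using C True unfolding up by simp
 qed
 have cnt: "(\<Sum>i<L. if rr i < \<delta> then h * X else 0) <= \<delta> * X" if X: "X >= 0" for X
 proof -
  define n where "n = nat \<lfloor>\<delta> / h\<rfloor>"
  have nh: "real n * h <= \<delta>" unfolding n_def using \<delta> h by (simp add: of_nat_nat) (metis floor_divide_lower)
  have "(\<Sum>i<L. if rr i < \<delta> then h * X else 0) <= (\<Sum>i<L. if i < n then h * X else 0)"
  proof (rule sum_mono)
   fix i
   have "i < n" if "rr i < \<delta>"
   proof -
    have "real i + 1 < \<delta> / h" using that h by (simp add: rr_def field_simps)
    thus ?thesis unfolding n_def by linarith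
   qed
   thus "(if rr i < \<delta> then h * X else 0) <= (if i < n then h * X else 0)" using h X by auto
  qed
  also have "\<dots> = (\<Sum>i\<in>{i\<in>{..<L}. i < n}. h * X)" by (simp only: sum.inter_filter[OF finite_lessThan])
  also have "\<dots> <= (\<Sum>i<n. h * X)" using h X by (intro sum_mono2) auto
  also have "\<dots> = (real n * h) * X" by simp
  also have "\<dots> <= \<delta> * X" using nh X by (rule mult_right_mono)
  finally show ?thesis .
 qed
 have "(\<Sum>i<L. rho i * \<bar>u i\<bar> powr (4 + 4 / real d)) <= (\<Sum>i<L. B powr (1 + 2 / real d) * (rho i * (u i)\<^sup>2)
   + (if rr i < \<delta> then h * \<delta> powr (real d - 1) * (8 * B powr q) + 8 * (4 * (K * \<delta>)) powr (1 + 1 / real d) * (h * rr i powr (1 / real d - 1)) else 0))"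
  by (rule sum_mono) (rule term_bound)
 also have "\<dots> = B powr (1 + 2 / real d) * Q u + (\<Sum>i<L. if rr i < \<delta> then h * (\<delta> powr (real d - 1) * (8 * B powr q)) else 0)
   + 8 * (4 * (K * \<delta>)) powr (1 + 1 / real d) * (\<Sum>i<L. if rr i < \<delta> then h * rr i powr (1 / real d - 1) else 0)"
  unfolding Q_eq sum_distrib_left sum.distrib[symmetric] by (intro sum.cong) (auto simp: mult_ac)
 also have "\<dots> <= B powr (1 + 2 / real d) * m0 + \<delta> * (\<delta> powr (real d - 1) * (8 * B powr q))
   + 8 * (4 * (K * \<delta>)) powr (1 + 1 / real d) * (real d * \<delta> powr (1 / real d))"
  using u K \<delta> by (intro add_mono mult_left_mono cnt sum_rr_root) (auto simp: D_def)
 also have "B powr (1 + 2 / real d) * m0 = (m0 + 2) powr (1 + 2 / real d) * m0 * K"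
 proof -
  have "- real d * (1 + 2 / real d) = - (real d + 2)" using d0 by (simp add: field_simps)
  thus ?thesis unfolding B_def using m0 by (simp add: powr_mult powr_powr Kd')
 qed
 also have "\<delta> * (\<delta> powr (real d - 1) * (8 * B powr q)) = 8 * (m0 + 2) powr q * K"
 proof -
  have "\<delta> * \<delta> powr (real d - 1) = \<delta> powr real d" using \<delta> by (simp add: powr_diff)
  moreover have "\<delta> powr real d * (\<delta> powr (- real d)) powr q = K"
  proof -
   have "real d + - real d * q = - (real d + 2)" unfolding q_def using d0 by (simp add: field_simps)
   thus ?thesis unfolding powr_powr powr_add[symmetric] using Kd by (simp only:)
  qed
  ultimately have A: "\<delta> * \<delta> powr (real d - 1) * (\<delta> powr (- real d)) powr q = K" by (simp only:)
  have Bq: "B powr q = (m0 + 2) powr q * (\<delta> powr (- real d)) powr q" unfolding B_def using m0 by (simp add: powr_mult)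
  have "\<delta> * (\<delta> powr (real d - 1) * (8 * B powr q)) = 8 * (m0 + 2) powr q * (\<delta> * \<delta> powr (real d - 1) * (\<delta> powr (- real d)) powr q)"
   unfolding Bq by (simp only: mult_ac)
  thus ?thesis unfolding A .
 qed
 also have "8 * (4 * (K * \<delta>)) powr (1 + 1 / real d) * (real d * \<delta> powr (1 / real d)) = 8 * 4 powr (1 + 1 / real d) * real d * K"
 proof -
  have "(K * \<delta>) powr (1 + 1 / real d) * \<delta> powr (1 / real d) = K"
  proof -
   have "- (real d + 1) * (1 + 1 / real d) + 1 / real d = - (real d + 2)" using d0 by (simp add: field_simps)
   thus ?thesis unfolding Kdd powr_powr powr_add[symmetric] using Kd by (simp only:)
  qed
  thus ?thesis using K \<delta> by (simp add: powr_mult mult_ac)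
 qed
 also have "(m0 + 2) powr (1 + 2 / real d) * m0 * K + 8 * (m0 + 2) powr q * K + 8 * 4 powr (1 + 1 / real d) * real d * K = cGN * K"
  unfolding cGN_def q_def by (simp add: algebra_simps)
 finally show ?thesis .
qed

end

text \<open>The right-hand side of the semilinear equation for \<open>Th u\<close>: dividing the
  quasilinear equation by \<open>dTh u\<close> leaves minus the Laplacian of \<open>Th u\<close> on
  the left.\<close>

definition FF :: "(real => real) => real => real => real" where "FF g \<mu> u = (g u - \<mu> * u) / dTh u"

lemma FF_Th: "FF g \<mu> u * Th u = (g u - \<mu> * u) * psi u" by (simp add: FF_def psi_def)

text \<open>In terms of \<open>Th u\<close> the critical growth of \<open>g\<close> has only power
  \<open>1 + 2 / d\<close>: the division by \<open>dTh\<close> cancels one power of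
  \<open>u\<close>, and the remaining power of \<open>u^2\<close> is bounded by
  \<open>sq_le_Th\<close>.\<close>

lemma FF_bound:
 assumes g: "!!s. \<bar>g s\<bar> <= C * (\<bar>s\<bar> + \<bar>s\<bar> powr (3 + 4 / real d))" and \<mu>: "0 <= \<mu>" and C: "C >= 0"
 shows "\<bar>FF g \<mu> s\<bar> <= (C + \<mu>) * (\<bar>Th s\<bar> + (2 * \<bar>Th s\<bar>) powr (1 + 2 / real d))"
proof -
 have a: "\<bar>s\<bar> powr (3 + 4 / real d) / dTh s <= (2 * \<bar>Th s\<bar>) powr (1 + 2 / real d)"
 proof (cases "s = 0")
  case False
  have "\<bar>s\<bar> powr (3 + 4 / real d) = \<bar>s\<bar> powr (2 + 4 / real d) * \<bar>s\<bar>"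
  proof -
   have "3 + 4 / real d = (2 + 4 / real d) + 1" by simp
   hence "\<bar>s\<bar> powr (3 + 4 / real d) = \<bar>s\<bar> powr (2 + 4 / real d) * \<bar>s\<bar> powr 1" by (simp only: powr_add)
   thus ?thesis by simp
  qed
  also have "\<dots> <= \<bar>s\<bar> powr (2 + 4 / real d) * dTh s" by (intro mult_left_mono abs_le_dTh) simp
  finally have "\<bar>s\<bar> powr (3 + 4 / real d) / dTh s <= \<bar>s\<bar> powr (2 + 4 / real d)" by (simp add: divide_le_eq)
  also have "\<dots> = (\<bar>s\<bar> powr 2) powr (1 + 2 / real d)" unfolding powr_powr by (simp add: algebra_simps)
  also have "\<bar>s\<bar> powr 2 = s\<^sup>2" using False by simp
  also have "(s\<^sup>2) powr (1 + 2 / real d) <= (2 * \<bar>Th s\<bar>) powr (1 + 2 / real d)" by (intro powr_mono2 sq_le_Th) auto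
  finally show ?thesis .
 qed simp
 have b: "\<bar>s\<bar> / dTh s <= \<bar>Th s\<bar>"
 proof -
  have "\<bar>s\<bar> / dTh s <= \<bar>s\<bar> / 1" using dTh_ge_1[of s] by (intro divide_left_mono) auto
  thus ?thesis using abs_le_Th[of s] by simp
 qed
 have p0: "(2 * \<bar>Th s\<bar>) powr (1 + 2 / real d) >= 0" by simp
 have "\<bar>FF g \<mu> s\<bar> = \<bar>g s - \<mu> * s\<bar> / dTh s" by (simp add: FF_def abs_divide)
 also have "\<dots> <= (C * (\<bar>s\<bar> + \<bar>s\<bar> powr (3 + 4 / real d)) + \<mu> * \<bar>s\<bar>) / dTh s"
  using g[of s] \<mu> by (intro divide_right_mono order_trans[OF abs_triangle_ineq4] add_mono) (auto simp: abs_mult)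
 also have "\<dots> = C * (\<bar>s\<bar> / dTh s) + C * (\<bar>s\<bar> powr (3 + 4 / real d) / dTh s) + \<mu> * (\<bar>s\<bar> / dTh s)"
  by (simp add: add_divide_distrib algebra_simps)
 also have "\<dots> <= C * \<bar>Th s\<bar> + C * (2 * \<bar>Th s\<bar>) powr (1 + 2 / real d) + \<mu> * \<bar>Th s\<bar>"
  using a b C \<mu> by (intro add_mono mult_left_mono) auto
 also have "\<dots> <= (C + \<mu>) * (\<bar>Th s\<bar> + (2 * \<bar>Th s\<bar>) powr (1 + 2 / real d))"
  using mult_nonneg_nonneg[OF \<mu> p0] by (simp add: algebra_simps)
 finally show ?thesis .
qed

section \<open>Estimates for lattice solutions and their nodal domains\<close>

context rlattice
begin

definition crit :: "real => (nat => real) => bool" where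
 "crit \<mu> u \<longleftrightarrow> u \<in> D \<and> (\<forall>i<L. dE u i + \<mu> * rho i * u i = 0)"

lemma crit_D: "crit \<mu> u ==> u \<in> D" by (simp add: crit_def)

lemma crit_local:
 assumes "crit \<mu> u" "i < L"
 shows "kap i * (Th (u i) - Th (u (Suc i))) - kl i * (Th (u (i - 1)) - Th (u i)) = rho i * FF g \<mu> (u i)"
proof -
 have "dTh (u i) * (kap i * (Th (u i) - Th (u (Suc i))) + kl i * (Th (u i) - Th (u (i - 1)))) = rho i * (g (u i) - \<mu> * u i)"
  using assms unfolding crit_def dE_def rr_def by (auto simp: algebra_simps)
 hence "kap i * (Th (u i) - Th (u (Suc i))) + kl i * (Th (u i) - Th (u (i - 1))) = rho i * (g (u i) - \<mu> * u i) / dTh (u i)"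
  by (simp add: eq_divide_eq mult.commute)
 thus ?thesis unfolding FF_def by (simp add: algebra_simps)
qed

text \<open>No flux enters at index 0, so the local equations telescope; this is the lattice form of
  the once integrated radial equation.\<close>

lemma crit_flux:
 assumes "crit \<mu> u" "i < L"
 shows "kap i * (Th (u i) - Th (u (Suc i))) = (\<Sum>j\<le>i. rho j * FF g \<mu> (u j))"
 using assms(2)
proof (induction i)
 case 0
 thus ?case using crit_local[OF assms(1) 0] by (simp add: kl_def)
next
 case (Suc i)
 have "kl (Suc i) * (Th (u i) - Th (u (Suc i))) = kap i * (Th (u i) - Th (u (Suc i)))" by (simp add: kl_def rr_def)
 thus ?case using crit_local[OF assms(1) Suc.prems] Suc by simp
qed

lemma crit_test:
 assumes "crit \<mu> u" "w L = 0"
 shows "(\<Sum>i<L. kap i * (Th (u i) - Th (u (Suc i))) * (w i - w (Suc i))) = (\<Sum>i<L. rho i * FF g \<mu> (u i) * w i)"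
proof -
 have kl': "(if i = 0 then 0 else kap (i - 1)) = kl i" for i by (simp add: kl_def rr_def)
 have "(\<Sum>i<L. kap i * (Th (u i) - Th (u (Suc i))) * (w i - w (Suc i)))
  = (\<Sum>i<L. (kap i * (Th (u i) - Th (u (Suc i))) - kl i * (Th (u (i - 1)) - Th (u (Suc (i - 1))))) * w i)"
  using sum_by_parts[of kap "%i. Th (u i) - Th (u (Suc i))" w L] assms(2) unfolding kl' by simp
 also have "\<dots> = (\<Sum>i<L. rho i * FF g \<mu> (u i) * w i)"
 proof (rule sum.cong)
  fix i assume i: "i \<in> {..<L}"
  have "kl i * (Th (u (i - 1)) - Th (u (Suc (i - 1)))) = kl i * (Th (u (i - 1)) - Th (u i))" by (cases "i = 0") (auto simp: kl_def)
  thus "(kap i * (Th (u i) - Th (u (Suc i))) - kl i * (Th (u (i - 1)) - Th (u (Suc (i - 1))))) * w i = rho i * FF g \<mu> (u i) * w i"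
   using crit_local[OF assms(1), of i] i by (simp only: lessThan_iff)
 qed simp
 finally show ?thesis .
qed

lemma D_outside: "u \<in> D ==> i >= L ==> u i = 0" by (simp add: D_def)
lemma D_mass: "u \<in> D ==> Q u <= m0" by (simp add: D_def)

text \<open>Test with \<open>Th u\<close>; \<open>psi_ge\<close> keeps half of the multiplier term.
  Where the mass is full this bounds the multiplier.\<close>

lemma nehari:
 assumes c: "crit \<mu> u" and \<mu>: "\<mu> >= 0"
 shows "Vk u + \<mu> / 2 * Q u <= (\<Sum>i<L. rho i * (\<bar>g (u i)\<bar> * \<bar>u i\<bar>))"
proof -
 have "Vk u = (\<Sum>i<L. rho i * FF g \<mu> (u i) * Th (u i))"
  using crit_test[OF c, of "%i. Th (u i)"] D_outside[OF crit_D[OF c], of L] unfolding Vk_def Kin_def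
  by (simp add: power2_eq_square mult.assoc)
 also have "\<dots> <= (\<Sum>i<L. rho i * (\<bar>g (u i)\<bar> * \<bar>u i\<bar>) - \<mu> / 2 * (rho i * (u i)\<^sup>2))"
 proof (rule sum_mono)
  fix i
  have "g (u i) * psi (u i) <= \<bar>g (u i)\<bar> * \<bar>psi (u i)\<bar>" by (metis abs_ge_self abs_mult)
  also have "\<dots> <= \<bar>g (u i)\<bar> * \<bar>u i\<bar>" by (intro mult_left_mono psi_le) simp
  finally have a: "g (u i) * psi (u i) <= \<bar>g (u i)\<bar> * \<bar>u i\<bar>" .
  have "\<mu> * (u i * psi (u i)) >= \<mu> * ((u i)\<^sup>2 / 2)" using \<mu> by (intro mult_left_mono psi_ge)
  hence "FF g \<mu> (u i) * Th (u i) <= \<bar>g (u i)\<bar> * \<bar>u i\<bar> - \<mu> / 2 * (u i)\<^sup>2" unfolding FF_Th using a by (simp add: algebra_simps)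
  hence "rho i * (FF g \<mu> (u i) * Th (u i)) <= rho i * (\<bar>g (u i)\<bar> * \<bar>u i\<bar> - \<mu> / 2 * (u i)\<^sup>2)" using h rr_pos[of i] by (intro mult_left_mono) auto
  thus "rho i * FF g \<mu> (u i) * Th (u i) <= rho i * (\<bar>g (u i)\<bar> * \<bar>u i\<bar>) - \<mu> / 2 * (rho i * (u i)\<^sup>2)" by (simp add: algebra_simps)
 qed
 finally show ?thesis unfolding Q_eq by (simp add: sum_subtractf sum_distrib_left)
qed

lemma growth_sum:
 assumes g: "!!s. \<bar>g s\<bar> <= C * (\<bar>s\<bar> + \<bar>s\<bar> powr (3 + 4 / real d))" and C: "C >= 0" and u: "u \<in> D" and K: "Vk u <= K" "K >= 1"
 shows "(\<Sum>i<L. rho i * (\<bar>g (u i)\<bar> * \<bar>u i\<bar>)) <= C * (m0 + cGN * K)"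
proof -
 have "(\<Sum>i<L. rho i * (\<bar>g (u i)\<bar> * \<bar>u i\<bar>)) <= (\<Sum>i<L. C * (rho i * (u i)\<^sup>2) + C * (rho i * \<bar>u i\<bar> powr (4 + 4 / real d)))"
 proof (rule sum_mono)
  fix i
  have p: "\<bar>u i\<bar> powr (3 + 4 / real d) * \<bar>u i\<bar> = \<bar>u i\<bar> powr (4 + 4 / real d)"
  proof (cases "u i = 0")
   case False
   have "4 + 4 / real d = (3 + 4 / real d) + 1" by simp
   hence "\<bar>u i\<bar> powr (4 + 4 / real d) = \<bar>u i\<bar> powr (3 + 4 / real d) * \<bar>u i\<bar> powr 1" by (simp only: powr_add)
   thus ?thesis by simp
  qed simp
  have "\<bar>g (u i)\<bar> * \<bar>u i\<bar> <= C * (\<bar>u i\<bar> + \<bar>u i\<bar> powr (3 + 4 / real d)) * \<bar>u i\<bar>" using g by (intro mult_right_mono) auto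
  also have "\<dots> = C * (u i)\<^sup>2 + C * \<bar>u i\<bar> powr (4 + 4 / real d)" unfolding p[symmetric] by (simp add: algebra_simps power2_eq_square abs_mult_self_eq)
  finally have "rho i * (\<bar>g (u i)\<bar> * \<bar>u i\<bar>) <= rho i * (C * (u i)\<^sup>2 + C * \<bar>u i\<bar> powr (4 + 4 / real d))" using h rr_pos[of i] by (intro mult_left_mono) auto
  thus "rho i * (\<bar>g (u i)\<bar> * \<bar>u i\<bar>) <= C * (rho i * (u i)\<^sup>2) + C * (rho i * \<bar>u i\<bar> powr (4 + 4 / real d))" by (simp add: algebra_simps)
 qed
 also have "\<dots> = C * Q u + C * (\<Sum>i<L. rho i * \<bar>u i\<bar> powr (4 + 4 / real d))" unfolding Q_eq by (simp add: sum.distrib sum_distrib_left)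
 also have "\<dots> <= C * m0 + C * (cGN * K)" using gagliardo_nirenberg[OF u K] D_mass[OF u] C by (intro add_mono mult_left_mono) auto
 finally show ?thesis by (simp add: algebra_simps)
qed

lemma EE_eq: "EE u = Vk u / 2 - (\<Sum>i<L. rho i * G (u i))"
 unfolding EE_def Vk_def Kin_def sum_subtractf sum_divide_distrib rr_def ..

text \<open>At the critical power \<open>gagliardo_nirenberg\<close> is linear in the Dirichlet
  energy, so the potential term can be absorbed only with a small coefficient \<eta>; half of the
  kinetic energy pays for it. This is where (g3) will enter.\<close>

lemma kinetic_bound:
 assumes G: "!!s. G s <= A * s\<^sup>2 + \<eta> * \<bar>s\<bar> powr (4 + 4 / real d)" and A: "A >= 0" and \<eta>: "\<eta> >= 0" "\<eta> * cGN <= 1/4" and u: "u \<in> D" and E: "EE u <= 0"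
 shows "Vk u <= 4 * A * m0 + 1"
proof (cases "Vk u <= 1")
 case True
 have "4 * A * m0 >= 0" using A m0 by simp
 thus ?thesis using True by linarith
next
 case False
 have "(\<Sum>i<L. rho i * G (u i)) <= (\<Sum>i<L. A * (rho i * (u i)\<^sup>2) + \<eta> * (rho i * \<bar>u i\<bar> powr (4 + 4 / real d)))"
 proof (rule sum_mono)
  fix i
  have "rho i * G (u i) <= rho i * (A * (u i)\<^sup>2 + \<eta> * \<bar>u i\<bar> powr (4 + 4 / real d))" using h rr_pos[of i] by (intro mult_left_mono G) auto
  thus "rho i * G (u i) <= A * (rho i * (u i)\<^sup>2) + \<eta> * (rho i * \<bar>u i\<bar> powr (4 + 4 / real d))" by (simp add: algebra_simps)
 qed
 also have "\<dots> = A * Q u + \<eta> * (\<Sum>i<L. rho i * \<bar>u i\<bar> powr (4 + 4 / real d))" unfolding Q_eq by (simp add: sum.distrib sum_distrib_left)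
 also have "\<dots> <= A * m0 + \<eta> * (cGN * Vk u)"
  using gagliardo_nirenberg[OF u order_refl] False D_mass[OF u] A \<eta> by (intro add_mono mult_left_mono) auto
 also have "\<eta> * (cGN * Vk u) <= 1/4 * Vk u" using \<eta>(2) False by (simp add: mult.assoc[symmetric] mult_right_mono)
 finally have "(\<Sum>i<L. rho i * G (u i)) <= A * m0 + Vk u / 4" by simp
 thus ?thesis using E unfolding EE_eq by simp
qed

text \<open>Test with \<open>Th u\<close> times a cut-off that is 0 up to radius \<open>R\<close>
  and 1 from \<open>2 * R\<close> on. The coercive term with \<open>cc\<close> controls the tail,
  and the slope \<open>1 / R\<close> of the cut-off makes the error small.\<close>

lemma tail_bound:
 assumes c: "crit \<mu> u" and R: "R > 0" and cc: "cc > 0"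
  and far: "!!i. rr i >= R ==> (\<mu> * u i - g (u i)) * psi (u i) >= cc * (u i)\<^sup>2" "!!i. rr i >= R ==> \<bar>Th (u i)\<bar> <= 2 * \<bar>u i\<bar>"
 shows "(\<Sum>i<L. if rr i >= 2 * R then rho i * (u i)\<^sup>2 else 0) <= 2 / (cc * R) * (sqrt (Vk u) * sqrt m0)"
proof -
 have uD: "u \<in> D" by (rule crit_D[OF c])
 define \<eta> where "\<eta> i = clamp ((rr i - R) / R)" for i
 have \<eta>01: "0 <= \<eta> i" "\<eta> i <= 1" for i unfolding \<eta>_def by (rule clamp)+
 have \<eta>0: "\<eta> i = 0" if "rr i <= R" for i unfolding \<eta>_def using that R by (intro clamp(3) divide_nonpos_pos) auto
 have \<eta>1: "\<eta> i = 1" if "rr i >= 2 * R" for i unfolding \<eta>_def using that R by (intro clamp(4)) (simp add: le_divide_eq)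
 have \<eta>d: "\<bar>\<eta> i - \<eta> (Suc i)\<bar> <= h / R" for i
 proof -
  have "\<bar>\<eta> i - \<eta> (Suc i)\<bar> <= \<bar>(rr i - R) / R - (rr (Suc i) - R) / R\<bar>" unfolding \<eta>_def by (rule clamp)
  also have "(rr i - R) / R - (rr (Suc i) - R) / R = - (h / R)" by (simp add: rr_Suc diff_divide_distrib add_divide_distrib)
  finally show ?thesis using h R by simp
 qed
 define V where "V i = Th (u i)" for i
 \<comment> \<open>\<open>Th u\<close> is bounded by \<open>u\<close> only from radius
   \<open>R\<close> on; below it the cut-off has no slope, so \<open>V\<close> may be replaced by 0
   there.\<close>
 define W where "W i = (if rr i >= R then V i else 0)" for i
 have W: "W i * (\<eta> (i - 1) - \<eta> i) = V i * (\<eta> (i - 1) - \<eta> i)" if "i > 0" for i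
 proof (cases "rr i >= R")
  case False
  hence "\<eta> i = 0" "\<eta> (i - 1) = 0" using rr_mono[of "i - 1" i] by (auto intro!: \<eta>0)
  thus ?thesis by simp
 qed (simp add: W_def)
 have "(\<Sum>i<L. kap i * (V i - V (Suc i)) * (\<eta> i * V i - \<eta> (Suc i) * V (Suc i))) = (\<Sum>i<L. rho i * FF g \<mu> (u i) * (\<eta> i * V i))"
  unfolding V_def using D_outside[OF uD, of L] by (intro crit_test[OF c]) simp
 also have "\<dots> <= (\<Sum>i<L. - (cc * (rho i * (\<eta> i * (u i)\<^sup>2))))"
 proof (rule sum_mono)
  fix i
  have "\<eta> i * (FF g \<mu> (u i) * V i) <= \<eta> i * (- (cc * (u i)\<^sup>2))"
  proof (cases "rr i >= R")
   case True
   hence "FF g \<mu> (u i) * V i <= - (cc * (u i)\<^sup>2)" unfolding V_def FF_Th using far(1)[OF True] by (simp add: algebra_simps)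
   thus ?thesis using \<eta>01 by (intro mult_left_mono) auto
  next
   case False
   thus ?thesis using \<eta>0[of i] by simp
  qed
  hence "rho i * (\<eta> i * (FF g \<mu> (u i) * V i)) <= rho i * (\<eta> i * (- (cc * (u i)\<^sup>2)))"
   by (rule mult_left_mono) (rule less_imp_le[OF rho_pos])
  thus "rho i * FF g \<mu> (u i) * (\<eta> i * V i) <= - (cc * (rho i * (\<eta> i * (u i)\<^sup>2)))" by (simp add: mult_ac)
 qed
 finally have A: "cc * (\<Sum>i<L. rho i * (\<eta> i * (u i)\<^sup>2)) <= - (\<Sum>i<L. kap i * (V i - V (Suc i)) * (\<eta> i * V i - \<eta> (Suc i) * V (Suc i)))"
  by (simp add: sum_negf sum_distrib_left)
 also have "\<dots> <= (\<Sum>i<L. (sqrt (kap i) * \<bar>V i - V (Suc i)\<bar>) * (sqrt (rho (Suc i)) * \<bar>W (Suc i)\<bar>) / R)"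
  unfolding sum_negf[symmetric]
 proof (rule sum_mono)
  fix i
  have e: "(V i - V (Suc i)) * (\<eta> i * V i - \<eta> (Suc i) * V (Suc i)) = \<eta> i * (V i - V (Suc i))\<^sup>2 + (V i - V (Suc i)) * (W (Suc i) * (\<eta> i - \<eta> (Suc i)))"
  proof -
   have ww: "W (Suc i) * (\<eta> i - \<eta> (Suc i)) = V (Suc i) * (\<eta> i - \<eta> (Suc i))" using W[of "Suc i"] by simp
   show ?thesis unfolding ww by (simp add: power2_eq_square algebra_simps)
  qed
  have "\<bar>W (Suc i) * (\<eta> i - \<eta> (Suc i))\<bar> <= \<bar>W (Suc i)\<bar> * (h / R)" unfolding abs_mult by (intro mult_left_mono \<eta>d) simp
  hence "\<bar>(V i - V (Suc i)) * (W (Suc i) * (\<eta> i - \<eta> (Suc i)))\<bar> <= \<bar>V i - V (Suc i)\<bar> * (\<bar>W (Suc i)\<bar> * (h / R))" 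
   unfolding abs_mult[of "V i - V (Suc i)"] by (intro mult_left_mono) auto
  hence "- ((V i - V (Suc i)) * (W (Suc i) * (\<eta> i - \<eta> (Suc i)))) <= \<bar>V i - V (Suc i)\<bar> * (\<bar>W (Suc i)\<bar> * (h / R))"
   by (rule order_trans[OF abs_ge_minus_self])
  moreover have "\<eta> i * (V i - V (Suc i))\<^sup>2 >= 0" using \<eta>01 by simp
  ultimately have "- ((V i - V (Suc i)) * (\<eta> i * V i - \<eta> (Suc i) * V (Suc i))) <= \<bar>V i - V (Suc i)\<bar> * (\<bar>W (Suc i)\<bar> * (h / R))"
   unfolding e by linarith
  hence "kap i * - ((V i - V (Suc i)) * (\<eta> i * V i - \<eta> (Suc i) * V (Suc i))) <= kap i * (\<bar>V i - V (Suc i)\<bar> * (\<bar>W (Suc i)\<bar> * (h / R)))"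
   using h rr_pos[of i] by (intro mult_left_mono) auto
  also have "\<dots> = (h * kap i) * (\<bar>V i - V (Suc i)\<bar> * \<bar>W (Suc i)\<bar>) / R" by (simp add: mult_ac)
  also have "h * kap i = sqrt (kap i) * sqrt (rho i)"
  proof -
   have "sqrt (rho i) = h * sqrt (kap i)" unfolding rho_kap real_sqrt_mult using h by simp
   moreover have "sqrt (kap i) * sqrt (kap i) = kap i" using kap_pos[of i] by (simp only: real_sqrt_mult_self abs_of_pos)
   ultimately show ?thesis by (metis mult.left_commute)
  qed
  also have "(sqrt (kap i) * sqrt (rho i)) * (\<bar>V i - V (Suc i)\<bar> * \<bar>W (Suc i)\<bar>) / R <= (sqrt (kap i) * sqrt (rho (Suc i))) * (\<bar>V i - V (Suc i)\<bar> * \<bar>W (Suc i)\<bar>) / R"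
  proof -
   have "rho i <= rho (Suc i)" using h rr_mono[of i "Suc i"] rr_pos[of i] by (intro mult_left_mono power_mono) auto
   hence "sqrt (rho i) <= sqrt (rho (Suc i))" by (rule real_sqrt_le_mono)
   hence "sqrt (kap i) * sqrt (rho i) <= sqrt (kap i) * sqrt (rho (Suc i))"
    by (rule mult_left_mono) (rule real_sqrt_ge_zero[OF less_imp_le[OF kap_pos]])
   hence "(sqrt (kap i) * sqrt (rho i)) * (\<bar>V i - V (Suc i)\<bar> * \<bar>W (Suc i)\<bar>) <= (sqrt (kap i) * sqrt (rho (Suc i))) * (\<bar>V i - V (Suc i)\<bar> * \<bar>W (Suc i)\<bar>)"
    by (rule mult_right_mono) simp
   thus ?thesis by (rule divide_right_mono) (rule less_imp_le[OF R])
  qed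
  finally show "- (kap i * (V i - V (Suc i)) * (\<eta> i * V i - \<eta> (Suc i) * V (Suc i))) <= (sqrt (kap i) * \<bar>V i - V (Suc i)\<bar>) * (sqrt (rho (Suc i)) * \<bar>W (Suc i)\<bar>) / R"
   by (simp add: mult_ac)
 qed
 also have "\<dots> = (\<Sum>i<L. (sqrt (kap i) * \<bar>V i - V (Suc i)\<bar>) * (sqrt (rho (Suc i)) * \<bar>W (Suc i)\<bar>)) / R" by (simp add: sum_divide_distrib)
 also have "\<dots> <= (sqrt (Vk u) * (2 * sqrt m0)) / R"
 proof (rule divide_right_mono)
  have "(\<Sum>i<L. (sqrt (kap i) * \<bar>V i - V (Suc i)\<bar>) * (sqrt (rho (Suc i)) * \<bar>W (Suc i)\<bar>))
    = (\<Sum>i<L. \<bar>sqrt (kap i) * \<bar>V i - V (Suc i)\<bar>\<bar> * \<bar>sqrt (rho (Suc i)) * \<bar>W (Suc i)\<bar>\<bar>)"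
  proof (rule sum.cong)
   fix i
   have "sqrt (kap i) >= 0" "sqrt (rho (Suc i)) >= 0" using kap_pos[of i] rho_pos[of "Suc i"] by (simp_all only: real_sqrt_ge_zero less_imp_le)
   thus "(sqrt (kap i) * \<bar>V i - V (Suc i)\<bar>) * (sqrt (rho (Suc i)) * \<bar>W (Suc i)\<bar>) = \<bar>sqrt (kap i) * \<bar>V i - V (Suc i)\<bar>\<bar> * \<bar>sqrt (rho (Suc i)) * \<bar>W (Suc i)\<bar>\<bar>"
    by (simp only: abs_mult abs_of_nonneg abs_abs)
  qed simp
  also have "\<dots> <= sqrt (\<Sum>i<L. (sqrt (kap i) * \<bar>V i - V (Suc i)\<bar>)\<^sup>2) * sqrt (\<Sum>i<L. (sqrt (rho (Suc i)) * \<bar>W (Suc i)\<bar>)\<^sup>2)"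
   using L2_set_mult_ineq[of "%i. sqrt (kap i) * \<bar>V i - V (Suc i)\<bar>" "%i. sqrt (rho (Suc i)) * \<bar>W (Suc i)\<bar>" "{..<L}"] by (simp only: L2_set_def)
  also have "(\<Sum>i<L. (sqrt (kap i) * \<bar>V i - V (Suc i)\<bar>)\<^sup>2) = Vk u"
   unfolding Vk_def Kin_def V_def using kap_pos
   by (intro sum.cong) (simp_all only: power_mult_distrib power2_abs real_sqrt_pow2 less_imp_le)
  also have "(\<Sum>i<L. (sqrt (rho (Suc i)) * \<bar>W (Suc i)\<bar>)\<^sup>2) = (\<Sum>i<L. rho (Suc i) * (W (Suc i))\<^sup>2)"
   using rho_pos by (intro sum.cong) (simp_all only: power_mult_distrib power2_abs real_sqrt_pow2 less_imp_le)
  also have "sqrt (\<Sum>i<L. rho (Suc i) * (W (Suc i))\<^sup>2) <= sqrt (4 * m0)"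
  proof (rule real_sqrt_le_mono)
   have Wi: "rho i * (W i)\<^sup>2 <= 4 * (rho i * (u i)\<^sup>2)" for i
   proof -
    have "\<bar>W i\<bar> <= \<bar>2 * u i\<bar>" using far(2)[of i] unfolding W_def V_def by (simp add: abs_mult)
    hence "(W i)\<^sup>2 <= (2 * u i)\<^sup>2" by (simp only: abs_le_square_iff)
    hence "rho i * (W i)\<^sup>2 <= rho i * (2 * u i)\<^sup>2" using h rr_pos[of i] by (intro mult_left_mono) auto
    thus ?thesis by (simp add: power_mult_distrib)
   qed
   have "(\<Sum>i<L. rho (Suc i) * (W (Suc i))\<^sup>2) <= (\<Sum>i<L. 4 * (rho (Suc i) * (u (Suc i))\<^sup>2))" by (rule sum_mono) (rule Wi)
   also have "\<dots> <= 4 * (\<Sum>i<Suc L. rho i * (u i)\<^sup>2)"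
    unfolding sum.lessThan_Suc_shift sum_distrib_left[symmetric] using h rr_pos[of 0] by simp
   also have "\<dots> = 4 * Q u" unfolding Q_eq using D_outside[OF uD, of L] by simp
   finally show "(\<Sum>i<L. rho (Suc i) * (W (Suc i))\<^sup>2) <= 4 * m0" using D_mass[OF uD] by simp
  qed
  also have "sqrt (4 * m0) = 2 * sqrt m0" by (simp add: real_sqrt_mult)
  finally show "(\<Sum>i<L. (sqrt (kap i) * \<bar>V i - V (Suc i)\<bar>) * (sqrt (rho (Suc i)) * \<bar>W (Suc i)\<bar>)) <= sqrt (Vk u) * (2 * sqrt m0)"
   using Kin_nonneg[of "%i. Th (u i)"] unfolding Vk_def by (simp add: mult_left_mono)
 qed (use R in simp)
 finally have B: "cc * (\<Sum>i<L. rho i * (\<eta> i * (u i)\<^sup>2)) <= (sqrt (Vk u) * (2 * sqrt m0)) / R" .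
 have "(\<Sum>i<L. if rr i >= 2 * R then rho i * (u i)\<^sup>2 else 0) <= (\<Sum>i<L. rho i * (\<eta> i * (u i)\<^sup>2))"
  using \<eta>1 \<eta>01 h rr_pos by (intro sum_mono) (auto intro!: mult_nonneg_nonneg simp: less_imp_le)
 also have "\<dots> <= ((sqrt (Vk u) * (2 * sqrt m0)) / R) / cc"
  by (subst pos_le_divide_eq[OF cc]) (use B in \<open>simp only: mult.commute\<close>)
 finally show ?thesis by (simp add: mult_ac)
qed

text \<open>The nodal domain of \<open>a\<close>: the maximal run of indices around \<open>a\<close>
  on which \<open>u\<close> has sign \<sigma>.\<close>

definition blk :: "(nat => real) => real => nat => nat set" where
 "blk u \<sigma> a = {i. \<forall>l. min i a <= l \<and> l <= max i a --> \<sigma> * u l > 0}"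

lemma blk_self: "\<sigma> * u a > 0 ==> a \<in> blk u \<sigma> a"
 unfolding blk_def by (auto dest: antisym)

lemma blk_sign: "i \<in> blk u \<sigma> a ==> \<sigma> * u i > 0" unfolding blk_def by auto

lemma blk_between: "i \<in> blk u \<sigma> a ==> min i a <= l ==> l <= max i a ==> \<sigma> * u l > 0" unfolding blk_def by auto

lemma blk_step:
 assumes "i \<in> blk u \<sigma> a" "\<sigma> * u j > 0" "j = Suc i \<or> i = Suc j" shows "j \<in> blk u \<sigma> a"
 unfolding blk_def
proof safe
 fix l assume l: "min j a <= l" "l <= max j a"
 show "\<sigma> * u l > 0"
 proof (cases "l = j")
  case False
  hence "min i a <= l" "l <= max i a" using l assms(3) by auto
  thus ?thesis using blk_between[OF assms(1)] by blast
 qed (use assms in simp)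
qed

text \<open>Test with the restriction of \<open>Th u\<close> to a nodal domain. Across an edge that
  leaves the domain the outer value does not have the sign of the inner one, so cutting it off to 0
  only decreases the contribution of the edge.\<close>

lemma block_inequality:
 assumes c: "crit \<mu> u" and s: "\<sigma> = 1 \<or> \<sigma> = -1" and a: "\<sigma> * u a > 0"
 defines "w \<equiv> %i. if i \<in> blk u \<sigma> a then Th (u i) else 0"
 shows "Kin w <= (\<Sum>i<L. rho i * FF g \<mu> (u i) * w i)" "Kin w > 0" "!!i. i >= L ==> w i = 0"
proof -
 have out: "u i = 0" if "i >= L" for i using D_outside[OF crit_D[OF c] that] .
 show w0: "w i = 0" if "i >= L" for i unfolding w_def using out[OF that] by simp
 have opp: "Th (u i) * Th (u j) <= 0" if "\<sigma> * u i > 0" "\<sigma> * u j <= 0" for i j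
  using that s by (auto simp: mult_nonneg_nonpos mult_nonpos_nonneg)
 have e: "(Th (u i) - Th (u (Suc i))) * (w i - w (Suc i)) >= (w i - w (Suc i))\<^sup>2" for i
 proof -
  consider "i \<in> blk u \<sigma> a" "Suc i \<in> blk u \<sigma> a" | "i \<in> blk u \<sigma> a" "Suc i \<notin> blk u \<sigma> a"
   | "i \<notin> blk u \<sigma> a" "Suc i \<in> blk u \<sigma> a" | "i \<notin> blk u \<sigma> a" "Suc i \<notin> blk u \<sigma> a" by blast
  thus ?thesis
  proof cases
   case 1 thus ?thesis by (simp add: w_def power2_eq_square)
  next
   case 2
   hence "\<sigma> * u (Suc i) <= 0" using blk_step[OF 2(1), of "Suc i"] by force
   hence "Th (u (i)) * Th (u (Suc i)) <= 0" by (rule opp[OF blk_sign[OF 2(1)]])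
   hence "Th (u i) * Th (u (Suc i)) <= 0" by (simp only: mult.commute)
   thus ?thesis using 2 by (simp add: w_def power2_eq_square algebra_simps)
  next
   case 3
   hence "\<sigma> * u i <= 0" using blk_step[OF 3(2), of i] by force
   hence "Th (u (Suc i)) * Th (u (i)) <= 0" by (rule opp[OF blk_sign[OF 3(2)]])
   hence "Th (u i) * Th (u (Suc i)) <= 0" by (simp only: mult.commute)
   thus ?thesis using 3 by (simp add: w_def power2_eq_square algebra_simps)
  next
   case 4 thus ?thesis by (simp add: w_def)
  qed
 qed
 have "Kin w <= (\<Sum>i<L. kap i * (Th (u i) - Th (u (Suc i))) * (w i - w (Suc i)))"
  unfolding Kin_def mult.assoc using e by (intro sum_mono mult_left_mono) (auto intro: less_imp_le[OF kap_pos] simp del: times_divide_eq_left)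
 also have "\<dots> = (\<Sum>i<L. rho i * FF g \<mu> (u i) * w i)" by (rule crit_test[OF c]) (simp add: w0)
 finally show "Kin w <= (\<Sum>i<L. rho i * FF g \<mu> (u i) * w i)" .
 have "w a \<noteq> 0" using blk_self[of \<sigma> u a, OF a] a s by (auto simp: w_def)
 moreover have "w a = 0" if "Kin w = 0"
 proof -
  have aL: "a <= L" using a out[of a] by (cases "a <= L") auto
  have "\<bar>w a - w L\<bar> <= sqrt (Kin w * ((real L - real a) * h) / rr a ^ e)" by (rule telescope_bound[OF w0 aL])
  thus ?thesis using that w0[of L] by simp
 qed
 ultimately show "Kin w > 0" using Kin_nonneg[of w] by (cases "Kin w = 0") auto
qed

text \<open>Below amplitude \<open>s1\<close> the multiplier term outweighs \<open>g\<close>, so the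
  right side of \<open>block_inequality\<close> would be nonpositive while its left side is
  positive.\<close>

lemma block_amplitude:
 assumes c: "crit \<mu> u" and s: "\<sigma> = 1 \<or> \<sigma> = -1" and a: "\<sigma> * u a > 0"
  and g: "!!t. \<bar>t\<bar> < s1 ==> \<bar>g t\<bar> <= \<mu> * \<bar>t\<bar>"
 shows "\<exists>i\<in>blk u \<sigma> a. \<bar>u i\<bar> >= s1"
proof (rule ccontr)
 assume n: "\<not> ?thesis"
 note B = block_inequality[OF c s a]
 have "(\<Sum>i<L. rho i * FF g \<mu> (u i) * (if i \<in> blk u \<sigma> a then Th (u i) else 0)) <= 0"
 proof (rule sum_nonpos)
  fix i
  have "FF g \<mu> (u i) * Th (u i) <= 0" if "i \<in> blk u \<sigma> a"
  proof -
   have "\<bar>u i\<bar> < s1" using n that by force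
   hence "\<bar>g (u i)\<bar> * \<bar>psi (u i)\<bar> <= \<mu> * \<bar>u i\<bar> * \<bar>psi (u i)\<bar>" by (intro mult_right_mono g) auto
   moreover have "g (u i) * psi (u i) <= \<bar>g (u i)\<bar> * \<bar>psi (u i)\<bar>" by (metis abs_ge_self abs_mult)
   ultimately show ?thesis unfolding FF_Th using abs_mult_psi[of "u i"] by (simp add: algebra_simps)
  qed
  hence "rho i * (FF g \<mu> (u i) * (if i \<in> blk u \<sigma> a then Th (u i) else 0)) <= 0"
   by (intro mult_nonneg_nonpos[OF less_imp_le[OF rho_pos]]) auto
  thus "rho i * FF g \<mu> (u i) * (if i \<in> blk u \<sigma> a then Th (u i) else 0) <= 0" by (simp only: mult.assoc)
 qed
 thus False using B(1,2) by linarith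
qed

text \<open>A nodal domain cannot concentrate at the origin: its Dirichlet eigenvalue would beat the potential.\<close>

lemma block_not_small:
 assumes c: "crit \<mu> u" and s: "\<sigma> = 1 \<or> \<sigma> = -1" and a: "\<sigma> * u a > 0" and \<delta>: "\<delta> > 0"
  and F: "!!i. rr i < \<delta> ==> \<bar>FF g \<mu> (u i)\<bar> <= CF * rr i powr (1 / real d - 1) * \<bar>Th (u i)\<bar>" and CF: "CF >= 0"
  and small: "CF * \<delta> * (real d * \<delta> powr (1 / real d)) < 1"
 shows "\<exists>i\<in>blk u \<sigma> a. rr i >= \<delta>"
proof (rule ccontr)
 assume n: "\<not> ?thesis"
 define w where "w i = (if i \<in> blk u \<sigma> a then Th (u i) else 0)" for i
 have B: "Kin w <= (\<Sum>i<L. rho i * FF g \<mu> (u i) * w i)" "Kin w > 0" "!!i. i >= L ==> w i = 0"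
  using block_inequality[OF c s a] unfolding w_def[abs_def] by auto
 have bd: "rho i * FF g \<mu> (u i) * w i <= CF * Kin w * \<delta> * (if rr i < \<delta> then h * rr i powr (1 / real d - 1) else 0)" for i
 proof (cases "i \<in> blk u \<sigma> a")
  case True
  hence r: "rr i < \<delta>" using n by force
  obtain j where j: "i <= j" "\<delta> <= rr j" "(real j - real i) * h <= \<delta>" using index_reaching[OF r] by metis
  have "j \<notin> blk u \<sigma> a" using n j(2) by force
  hence wj: "w j = 0" by (simp add: w_def)
  have "\<bar>w i - w j\<bar> <= sqrt (Kin w * ((real j - real i) * h) / rr i ^ e)" by (rule telescope_bound[OF B(3) j(1)])
  also have "\<dots> <= sqrt (Kin w * \<delta> / rr i ^ e)"
   using B(2) j(3) rr_pos[of i] by (intro real_sqrt_le_mono divide_right_mono mult_left_mono) auto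
  finally have "\<bar>w i\<bar> <= sqrt (Kin w * \<delta> / rr i ^ e)" unfolding wj by simp
  hence "\<bar>w i\<bar>\<^sup>2 <= (sqrt (Kin w * \<delta> / rr i ^ e))\<^sup>2" by (intro power_mono) auto
  also have "\<dots> = Kin w * \<delta> / rr i ^ e" using B(2) \<delta> rr_pos[of i] by simp
  finally have w2: "(w i)\<^sup>2 <= Kin w * \<delta> / rr i ^ e" by simp
  have "FF g \<mu> (u i) * w i <= \<bar>FF g \<mu> (u i)\<bar> * \<bar>w i\<bar>" by (metis abs_ge_self abs_mult)
  also have "\<dots> <= CF * rr i powr (1 / real d - 1) * \<bar>w i\<bar> * \<bar>w i\<bar>" using F[OF r] True unfolding w_def by (intro mult_right_mono) auto
  also have "\<dots> = CF * rr i powr (1 / real d - 1) * (w i)\<^sup>2" by (simp add: power2_eq_square)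
  also have "\<dots> <= CF * rr i powr (1 / real d - 1) * (Kin w * \<delta> / rr i ^ e)" using w2 CF by (intro mult_left_mono) auto
  finally have "rho i * (FF g \<mu> (u i) * w i) <= rho i * (CF * rr i powr (1 / real d - 1) * (Kin w * \<delta> / rr i ^ e))"
   by (rule mult_left_mono) (rule less_imp_le[OF rho_pos])
  also have "\<dots> = CF * Kin w * \<delta> * (h * rr i powr (1 / real d - 1))" using rr_pos[of i] by (simp add: field_simps)
  finally show ?thesis using r by (simp only: mult.assoc if_True)
 next
  case False
  thus ?thesis using CF B(2) \<delta> h by (simp add: w_def)
 qed
 have "Kin w <= (\<Sum>i<L. CF * Kin w * \<delta> * (if rr i < \<delta> then h * rr i powr (1 / real d - 1) else 0))"
  by (rule order_trans[OF B(1)], rule sum_mono, rule bd)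
 also have "\<dots> <= CF * Kin w * \<delta> * (real d * \<delta> powr (1 / real d))"
  unfolding sum_distrib_left[symmetric] using CF B(2) \<delta> by (intro mult_left_mono sum_rr_root) auto
 also have "\<dots> = Kin w * (CF * \<delta> * (real d * \<delta> powr (1 / real d)))" by (simp only: mult_ac)
 also have "\<dots> < Kin w * 1" using small B(2) by (rule mult_strict_left_mono)
 finally show False by simp
qed

text \<open>Each domain contributes a point of amplitude \<open>s1\<close>. The innermost domain
  reaches radius \<delta> by \<open>block_not_small\<close>, so the points of all later ones lie
  beyond \<delta>; the point of the first may sit near the origin, which is why \<open>j = 0\<close>
  is excepted.\<close>

lemma nodal_points:
 assumes c: "crit \<mu> u" and al: "alt k u" and \<delta>: "\<delta> > 0"
  and F: "!!i. rr i < \<delta> ==> \<bar>FF g \<mu> (u i)\<bar> <= CF * rr i powr (1 / real d - 1) * \<bar>Th (u i)\<bar>" and CF: "CF >= 0"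
  and small: "CF * \<delta> * (real d * \<delta> powr (1 / real d)) < 1"
  and g: "!!t. \<bar>t\<bar> < s1 ==> \<bar>g t\<bar> <= \<mu> * \<bar>t\<bar>"
 obtains q \<sigma> where "\<sigma> = 1 \<or> \<sigma> = -1" "!!j. j < k ==> q j < q (Suc j)" "!!j. 1 <= j ==> j <= k ==> rr (q j) >= \<delta>"
  "!!j. j <= k ==> \<sigma> * (-1) ^ j * u (q j) >= s1 \<and> \<sigma> * (-1) ^ j * u (q j) > 0"
proof -
 obtain p \<sigma> where p: "\<sigma> = 1 \<or> \<sigma> = -1" "!!j. j < k ==> p j < p (Suc j)" "!!j. j <= k ==> \<sigma> * (-1) ^ j * u (p j) > 0"
  using altE[OF al] by metis
 have sg: "\<sigma> * (-1) ^ j = 1 \<or> \<sigma> * (-1) ^ j = -1" for j by (rule sign_cases[OF p(1)])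
 have "\<exists>q. \<forall>j\<le>k. q j \<in> blk u (\<sigma> * (-1) ^ j) (p j) \<and> \<bar>u (q j)\<bar> >= s1"
 proof -
  have "\<exists>i. j <= k --> i \<in> blk u (\<sigma> * (-1) ^ j) (p j) \<and> \<bar>u i\<bar> >= s1" for j
   using block_amplitude[OF c sg p(3) g, of j] by blast
  thus ?thesis by metis
 qed
 then obtain q where q: "!!j. j <= k ==> q j \<in> blk u (\<sigma> * (-1) ^ j) (p j)" "!!j. j <= k ==> \<bar>u (q j)\<bar> >= s1" by blast
 have qs: "\<sigma> * (-1) ^ j * u (q j) > 0" if "j <= k" for j using blk_sign[OF q(1)[OF that]] .
 \<comment> \<open>Domains of consecutive witnesses are ordered like the witnesses, since an overlap
   would give some point both signs.\<close>
 have sep: "x < y" if j: "j < k" and x: "x \<in> blk u (\<sigma> * (-1) ^ j) (p j)" and y: "y \<in> blk u (\<sigma> * (-1) ^ Suc j) (p (Suc j))" for x y j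
 proof (rule ccontr)
  assume "\<not> x < y"
  hence xy: "y <= x" by simp
  have pp: "p j < p (Suc j)" by (rule p(2)[OF j])
  have py: "p j < y"
  proof (rule ccontr)
   assume "\<not> p j < y"
   hence "\<sigma> * (-1) ^ Suc j * u (p j) > 0" using pp by (intro blk_between[OF y]) auto
   thus False using p(3)[of j] j by simp
  qed
  have "\<sigma> * (-1) ^ j * u y > 0" using py xy by (intro blk_between[OF x]) auto
  thus False using blk_sign[OF y] by simp
 qed
 have qm: "q j < q (Suc j)" if "j < k" for j using sep[OF that q(1) q(1)] that by simp
 show thesis
 proof (rule that[of \<sigma> q, OF p(1) qm])
  show "rr (q j) >= \<delta>" if j: "1 <= j" "j <= k" for j
  proof -
   have "\<exists>i\<in>blk u (\<sigma> * (-1) ^ 0) (p 0). rr i >= \<delta>"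
    by (rule block_not_small[OF c sg p(3) \<delta> F CF small]) auto
   then obtain i where i: "i \<in> blk u (\<sigma> * (-1) ^ 0) (p 0)" "rr i >= \<delta>" by blast
   have "i < q 1" using sep[of 0 i "q 1"] i(1) q(1)[of 1] j by simp
   moreover have "q 1 <= q j" using j
   proof (induction j rule: dec_induct)
    case (step m)
    thus ?case using qm[of m] by simp
   qed simp
   ultimately show ?thesis using i(2) rr_mono[of i "q j"] by simp
  qed
  show "\<sigma> * (-1) ^ j * u (q j) >= s1 \<and> \<sigma> * (-1) ^ j * u (q j) > 0" if "j <= k" for j
  proof -
   have "\<sigma> * (-1) ^ j * u (q j) = \<bar>u (q j)\<bar>" using qs[OF that] sg[of j] by auto
   thus ?thesis using q(2)[OF that] qs[OF that] by simp
  qed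
 qed
qed

end

section \<open>Passage to the limit\<close>

text \<open>Turns lattice functions into step functions: a radius in
  \<open>[i * h, (i + 1) * h)\<close> reads index \<open>i\<close>, whose lattice radius is the
  right end of that cell.\<close>

definition ix :: "real => real => nat" where "ix h t = nat \<lfloor>t / h\<rfloor>"

lemma ix_bounds: assumes "h > 0" "t >= 0" shows "real (ix h t) * h <= t" "t < (real (ix h t) + 1) * h"
proof -
 have "real (ix h t) = of_int \<lfloor>t / h\<rfloor>" unfolding ix_def using assms by simp
 hence "real (ix h t) <= t / h" "t / h < real (ix h t) + 1" by linarith+
 thus "real (ix h t) * h <= t" "t < (real (ix h t) + 1) * h" using assms by (simp_all add: field_simps)
qed

lemma ix_eq: assumes "h > 0" "real l * h <= t" "t < (real l + 1) * h" shows "ix h t = l"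
proof -
 have "real l <= t / h" "t / h < real l + 1" using assms by (simp_all add: field_simps)
 hence "\<lfloor>t / h\<rfloor> = int l" by linarith
 thus ?thesis by (simp add: ix_def)
qed

lemma has_integral_step_cell:
 fixes x c d Z :: real
 assumes "0 <= c" "c <= d" "d <= Z"
 shows "((%t. if c <= t \<and> t < d then x else 0) has_integral x * (d - c)) {0..Z}"
proof -
 have "((%t. x) has_integral x * (d - c)) {c..d}" using has_integral_const_real[of x c d] assms by (simp add: mult.commute)
 hence "((%t. if t \<in> {c..d} then x else 0) has_integral x * (d - c)) {0..Z}"
  using assms by (subst has_integral_restrict) auto
 thus ?thesis by (rule has_integral_spike_finite[of "{d}", rotated 2]) auto
qed

lemma has_integral_step:
 fixes \<xi> :: "nat => real"
 assumes h: "h > 0" and ij: "i <= j" "real j * h <= Z"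
 shows "((%t. if i <= ix h t \<and> ix h t < j then \<xi> (ix h t) else 0) has_integral h * (\<Sum>l\<in>{i..<j}. \<xi> l)) {0..Z}"
proof -
 define F where "F t = (\<Sum>l\<in>{i..<j}. if real l * h <= t \<and> t < (real l + 1) * h then \<xi> l else 0)" for t
 have "(F has_integral (\<Sum>l\<in>{i..<j}. \<xi> l * ((real l + 1) * h - real l * h))) {0..Z}"
  unfolding F_def
 proof (rule has_integral_sum)
  fix l assume l: "l \<in> {i..<j}"
  hence "real l + 1 <= real j" by auto
  hence "(real l + 1) * h <= real j * h" using h by (intro mult_right_mono) auto
  thus "((%t. if real l * h <= t \<and> t < (real l + 1) * h then \<xi> l else 0) has_integral \<xi> l * ((real l + 1) * h - real l * h)) {0..Z}"
   using ij h by (intro has_integral_step_cell) (auto simp: algebra_simps)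
 qed simp
 also have "(\<Sum>l\<in>{i..<j}. \<xi> l * ((real l + 1) * h - real l * h)) = h * (\<Sum>l\<in>{i..<j}. \<xi> l)"
  by (simp add: sum_distrib_left algebra_simps)
 finally show ?thesis
 proof (rule has_integral_eq[rotated])
  fix t assume t: "t \<in> {0..Z}"
  have "F t = (\<Sum>l\<in>{i..<j}. if l = ix h t then \<xi> l else 0)"
   unfolding F_def
  proof (rule sum.cong)
   fix l
   show "(if real l * h <= t \<and> t < (real l + 1) * h then \<xi> l else 0) = (if l = ix h t then \<xi> l else 0)"
   proof (cases "l = ix h t")
    case True
    thus ?thesis using ix_bounds[OF h, of t] t by simp
   next
    case False
    hence "\<not> (real l * h <= t \<and> t < (real l + 1) * h)" using ix_eq[OF h, of l t] by blast
    thus ?thesis unfolding if_not_P[OF False] by (rule if_not_P)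
   qed
  qed simp
  thus "F t = (if i <= ix h t \<and> ix h t < j then \<xi> (ix h t) else 0)" by simp
 qed
qed

text \<open>A lattice sum is the integral of a step function, so dominated convergence applies as
  soon as the steps converge inside the limiting interval.\<close>

theorem riemann_limit:
 fixes \<xi> :: "nat => nat => real" and X :: "real => real"
 assumes h: "!!n. h n > 0" and ab: "0 <= a" "a <= b" and ij: "!!n. i n <= j n"
  and il: "(%n. real (i n) * h n) \<longlonglongrightarrow> a" and jl: "(%n. real (j n) * h n) \<longlonglongrightarrow> b"
  and B: "!!n l. i n <= l ==> l < j n ==> \<bar>\<xi> n l\<bar> <= B"
  and lim: "!!t. a < t ==> t < b ==> (%n. \<xi> n (ix (h n) t)) \<longlonglongrightarrow> X t"
 shows "X integrable_on {a..b}" "(%n. h n * (\<Sum>l\<in>{i n..<j n}. \<xi> n l)) \<longlonglongrightarrow> integral {a..b} X"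
proof -
 obtain Z0 where Z0: "!!n. \<bar>real (j n) * h n\<bar> <= Z0"
  using convergent_imp_Bseq[OF convergentI[OF jl]] unfolding Bseq_def by auto
 define Z where "Z = max Z0 b"
 have Z: "real (j n) * h n <= Z" "b <= Z" for n using Z0[of n] unfolding Z_def by auto
 define B' where "B' = max B 0"
 \<comment> \<open>The ends of the sums move, so convergence may fail at \<open>a\<close> and
   \<open>b\<close>; both values are set to 0, which leaves the integral unchanged.\<close>
 define F where "F n t = (if t = a \<or> t = b then 0 else if i n <= ix (h n) t \<and> ix (h n) t < j n then \<xi> n (ix (h n) t) else 0)" for n t
 define X' where "X' t = (if t = a \<or> t = b then 0 else if t \<in> {a..b} then X t else 0)" for t
 have Fi: "(F n has_integral h n * (\<Sum>l\<in>{i n..<j n}. \<xi> n l)) {0..Z}" for n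
  by (rule has_integral_spike_finite[OF _ _ has_integral_step[where \<xi> = "\<xi> n" and h = "h n" and i = "i n" and j = "j n" and Z = Z, OF h ij Z(1)], of "{a, b}"]) (auto simp: F_def)
 have FB: "\<bar>F n t\<bar> <= B'" for n t unfolding F_def B'_def using B[of n "ix (h n) t"] by (auto simp: le_max_iff_disj)
 have Fl: "(%n. F n t) \<longlonglongrightarrow> X' t" if t: "t \<in> {0..Z}" for t
 proof -
  have t0: "t >= 0" using t by simp
  note ixb = ix_bounds[OF h t0]
  consider "t = a \<or> t = b" | "a < t" "t < b" | "t < a" | "t > b" by linarith
  thus ?thesis
  proof cases
   case 1 thus ?thesis by (simp add: F_def X'_def)
  next
   case 2
   have "\<forall>\<^sub>F n in sequentially. real (i n) * h n < t" "\<forall>\<^sub>F n in sequentially. real (j n) * h n > t"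
    using order_tendstoD(2)[OF il 2(1)] order_tendstoD(1)[OF jl 2(2)] by auto
   hence "\<forall>\<^sub>F n in sequentially. F n t = \<xi> n (ix (h n) t)"
   proof eventually_elim
    case (elim n)
    have "real (i n) * h n < (real (ix (h n) t) + 1) * h n" using elim(1) ixb(2)[of n] by linarith
    hence "real (i n) < real (ix (h n) t) + 1" using h[of n] by simp
    moreover have "real (ix (h n) t) * h n < real (j n) * h n" using elim(2) ixb(1)[of n] by linarith
    hence "real (ix (h n) t) < real (j n)" using h[of n] by simp
    ultimately show ?case unfolding F_def using 2 by auto
   qed
   moreover have "X' t = X t" unfolding X'_def using 2 by simp
   ultimately show ?thesis using lim[OF 2] by (simp add: tendsto_cong)
  next
   case 3
   have "\<forall>\<^sub>F n in sequentially. real (i n) * h n > t" using order_tendstoD(1)[OF il 3] .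
   hence "\<forall>\<^sub>F n in sequentially. F n t = 0"
   proof eventually_elim
    case (elim n)
    have "real (ix (h n) t) * h n < real (i n) * h n" using elim ixb(1)[of n] by linarith
    hence "ix (h n) t < i n" using h[of n] by simp
    thus ?case unfolding F_def by simp
   qed
   moreover have "X' t = 0" unfolding X'_def using 3 by simp
   ultimately show ?thesis by (simp add: tendsto_eventually)
  next
   case 4
   have "\<forall>\<^sub>F n in sequentially. real (j n) * h n < t" using order_tendstoD(2)[OF jl 4] .
   hence "\<forall>\<^sub>F n in sequentially. F n t = 0"
   proof eventually_elim
    case (elim n)
    have "real (j n) * h n < (real (ix (h n) t) + 1) * h n" using elim ixb(2)[of n] by linarith
    hence "real (j n) < real (ix (h n) t) + 1" using h[of n] by simp
    thus ?case unfolding F_def by auto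
   qed
   moreover have "X' t = 0" unfolding X'_def using 4 ab by simp
   ultimately show ?thesis by (simp add: tendsto_eventually)
  qed
 qed
 have D: "X' integrable_on {0..Z}" "(%n. integral {0..Z} (F n)) \<longlonglongrightarrow> integral {0..Z} X'"
  using dominated_convergence[of F "{0..Z}" "%_. B'" X'] Fi FB Fl by (auto simp: has_integral_integrable integrable_const_ivl)
 have XX: "((%t. if t \<in> {a..b} then X t else 0) has_integral integral {0..Z} X') {0..Z}"
  by (rule has_integral_spike_finite[OF _ _ integrable_integral[OF D(1)], of "{a, b}"]) (auto simp: X'_def)
 have "(X has_integral integral {0..Z} X') {a..b}"
  using XX by (subst (asm) has_integral_restrict) (use ab Z in auto)
 thus "X integrable_on {a..b}" "(%n. h n * (\<Sum>l\<in>{i n..<j n}. \<xi> n l)) \<longlonglongrightarrow> integral {a..b} X"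
  using D(2) integral_unique[OF Fi] by (auto simp: has_integral_integrable integral_unique)
qed

lemma tendsto_FF:
 assumes "continuous_on UNIV g" "(m \<longlongrightarrow> \<mu>) F" "(x \<longlongrightarrow> y) F"
 shows "((%n. FF g (m n) (x n)) \<longlongrightarrow> FF g \<mu> y) F"
proof -
 have "isCont g y" using assms(1) by (simp add: continuous_on_eq_continuous_at)
 hence "((%n. g (x n)) \<longlongrightarrow> g y) F" using assms(3) by (rule isCont_tendsto_compose)
 thus ?thesis unfolding FF_def by (intro tendsto_intros assms) auto
qed

text \<open>A sequence of lattice solutions with mesh tending to 0, radius tending to infinity and
  constants independent of \<open>n\<close>. Full mass is assumed only where the multiplier is
  positive.\<close>

locale approx =
 fixes d e k :: nat and g G :: "real => real" and m0 K M e0 Cg :: real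
  and h :: "nat => real" and L :: "nat => nat" and u :: "nat => nat => real" and \<mu> :: "nat => real"
 assumes rl: "!!n. rlattice e (h n) g G m0 d"
  and h1: "!!n. h n <= 1" and h0: "h \<longlonglongrightarrow> 0" and hL: "filterlim (%n. h n * real (L n)) at_top sequentially"
  and cr: "!!n. rlattice.crit (L n) e (h n) g m0 (\<mu> n) (u n)"
  and mu: "!!n. 0 <= \<mu> n" "!!n. \<mu> n <= M"
  and mass: "!!n. \<mu> n > 0 ==> lattice.Q (L n) (%i. h n * ((real i + 1) * h n) ^ e) (u n) = m0"
  and EEb: "!!n. lattice.EE (L n) (%i. h n * ((real i + 1) * h n) ^ e) (%i. ((real i + 1) * h n) ^ e / h n) G (u n) <= - e0"
  and Vk: "!!n. rlattice.Vk (L n) e (h n) (u n) <= K" and K1: "K >= 1"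
  and alts: "!!n. alt k (u n)" "!!n. \<not> alt (Suc k) (u n)"
  and growth: "!!s. \<bar>g s\<bar> <= Cg * (\<bar>s\<bar> + \<bar>s\<bar> powr (3 + 4 / real d))" "!!s. \<bar>G s\<bar> <= Cg * (s\<^sup>2 + \<bar>s\<bar> powr (4 + 4 / real d))" and Cg: "Cg >= 0"
  and small: "!!\<eta>. \<eta> > 0 ==> \<exists>s>0. \<forall>t. \<bar>t\<bar> < s --> \<bar>g t\<bar> <= \<eta> * \<bar>t\<bar> \<and> \<bar>G t\<bar> <= \<eta> * t\<^sup>2"
begin

definition rd :: "nat => nat => real" where "rd n i = (real i + 1) * h n"
definition CV :: real where "CV = sqrt m0 + 2 * m0 + 2 * sqrt K"
definition vs :: "nat => real => real" where "vs n t = Th (u n (ix (h n) t))"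

lemma h_pos: "h n > 0" using rlattice.h[OF rl] .
lemma d2: "d >= 2" using rlattice.d[OF rl] .
lemma de: "d = Suc e" using rlattice.de[OF rl] .
lemma de': "real d - 1 = real e" using de by simp
lemma m0_pos: "m0 > 0" using rl[of 0] unfolding rlattice_def lattice_def by simp
lemma g_cont: "continuous_on UNIV g" using rl[of 0] unfolding rlattice_def lattice_def by simp
lemma G_deriv: "(G has_real_derivative g s) (at s)" using rl[of 0] unfolding rlattice_def lattice_def by simp
lemma rrd: "rlattice.rr (h n) i = rd n i" unfolding rd_def by (rule rlattice.rr_def[OF rl])
lemma rd_pos: "rd n i > 0" using h_pos by (simp add: rd_def)
lemma rd_mono: "i <= j ==> rd n i <= rd n j" using h_pos[of n] by (simp add: rd_def)
lemma CV_pos: "CV > 0" unfolding CV_def using m0_pos K1 by (intro add_pos_nonneg add_pos_pos) auto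

lemma uD: "u n \<in> lattice.D (L n) (%i. h n * ((real i + 1) * h n) ^ e) m0"
 by (rule rlattice.crit_D[OF rl cr])

lemma pw: "\<bar>Th (u n i)\<bar> <= CV * rd n i powr (- real e / 2)"
 using rlattice.pointwise_bound[OF rl uD Vk, of n i] unfolding rrd CV_def de' .

lemma tel: "i <= j ==> (real j - real i) * h n <= \<delta> ==> \<bar>Th (u n i) - Th (u n j)\<bar> <= sqrt (K * \<delta> / rd n i ^ e)"
 using rlattice.Th_telescope[OF rl uD _ _ Vk, of i j n \<delta>] unfolding rrd .

definition Pn :: "nat => nat => real" where "Pn n i = (\<Sum>j\<le>i. h n * rd n j ^ e * FF g (\<mu> n) (u n j))"

lemma flux: "i < L n ==> rd n i ^ e / h n * (Th (u n i) - Th (u n (Suc i))) = Pn n i"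
 unfolding Pn_def using rlattice.crit_flux[OF rl cr, of i n] unfolding rrd .

lemma flux': "i < L n ==> Th (u n i) - Th (u n (Suc i)) = h n * (Pn n i / rd n i ^ e)"
 using flux[of i n] h_pos[of n] rd_pos[of n i] by (simp add: field_simps)

lemma Q_eq: "lattice.Q (L n) (%i. h n * ((real i + 1) * h n) ^ e) (u n) = (\<Sum>i<L n. h n * rd n i ^ e * (u n i)\<^sup>2)"
 using rlattice.Q_eq[OF rl, of "L n" n "u n"] unfolding rrd .

lemma mass_le: "(\<Sum>i<L n. h n * rd n i ^ e * (u n i)\<^sup>2) <= m0"
 using rlattice.D_mass[OF rl uD] unfolding Q_eq .

lemma mass_eq: "\<mu> n > 0 ==> (\<Sum>i<L n. h n * rd n i ^ e * (u n i)\<^sup>2) = m0"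
 using mass unfolding Q_eq .

lemma Vk_eq: "rlattice.Vk (L n) e (h n) (u n) = (\<Sum>i<L n. rd n i ^ e / h n * (Th (u n i) - Th (u n (Suc i)))\<^sup>2)"
 unfolding rlattice.Vk_def[OF rl] rlattice.Kin_def[OF rl] rrd ..

lemma energy: "(\<Sum>i<L n. rd n i ^ e / h n * (Th (u n i) - Th (u n (Suc i)))\<^sup>2) / 2 + e0 <= (\<Sum>i<L n. h n * rd n i ^ e * G (u n i))"
 using EEb[of n] unfolding rlattice.EE_eq[OF rl] Vk_eq rrd by simp

lemma ix_mono: "0 <= a ==> a <= b ==> ix (h n) a <= ix (h n) b"
 unfolding ix_def using h_pos[of n] by (intro nat_mono floor_mono divide_right_mono) auto

lemma rd_ix: assumes "t >= 0" shows "t < rd n (ix (h n) t)" "rd n (ix (h n) t) <= t + h n"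
 using ix_bounds[OF h_pos assms, of n] unfolding rd_def by (auto simp: algebra_simps)

lemma rd_ix_lim: assumes "t >= 0" shows "(%n. rd n (ix (h n) t)) \<longlonglongrightarrow> t"
proof (rule tendsto_sandwich)
 show "(%n. t) \<longlonglongrightarrow> t" by simp
 show "(%n. t + h n) \<longlonglongrightarrow> t" using tendsto_add[OF tendsto_const h0, of t] by simp
qed (use rd_ix[OF assms] in \<open>auto intro!: always_eventually less_imp_le\<close>)

lemma ix_h_lim: assumes "t >= 0" shows "(%n. real (ix (h n) t) * h n) \<longlonglongrightarrow> t"
proof -
 have "(%n. rd n (ix (h n) t) - h n) \<longlonglongrightarrow> t - 0" by (intro tendsto_diff rd_ix_lim assms h0)
 thus ?thesis by (simp add: rd_def algebra_simps)
qed

lemma ix_less_L: "\<forall>\<^sub>F n in sequentially. ix (h n) t < L n"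
proof -
 have "\<forall>\<^sub>F n in sequentially. h n * real (L n) > max t 0" using hL unfolding filterlim_at_top_dense by blast
 thus ?thesis
 proof eventually_elim
  case (elim n)
  have "t / h n < real (L n)" "0 < real (L n)" using elim h_pos[of n] by (auto simp: field_simps zero_less_mult_iff)
  thus ?case unfolding ix_def by linarith
 qed
qed

text \<open>Equicontinuity of Hoelder order 1/2 away from the origin, up to the mesh size; the bound
  on the Dirichlet energy is its only source.\<close>

lemma vs_cont: assumes "0 < a" "a <= b" shows "\<bar>vs n a - vs n b\<bar> <= sqrt (K * (b - a + h n) / a ^ e)"
proof -
 have "(real (ix (h n) b) - real (ix (h n) a)) * h n <= b - a + h n"
  using ix_bounds[OF h_pos, of a n] ix_bounds[OF h_pos, of b n] assms by (simp add: algebra_simps)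
 hence "\<bar>vs n a - vs n b\<bar> <= sqrt (K * (b - a + h n) / rd n (ix (h n) a) ^ e)"
  unfolding vs_def using assms by (intro tel ix_mono) auto
 also have "\<dots> <= sqrt (K * (b - a + h n) / a ^ e)"
  using assms rd_ix(1)[of a n] K1 h_pos[of n]
  by (intro real_sqrt_le_mono divide_left_mono power_mono mult_nonneg_nonneg mult_pos_pos zero_less_power) auto
 finally show ?thesis .
qed

lemma vs_pw: assumes "t > 0" shows "\<bar>vs n t\<bar> <= CV * t powr (- real e / 2)"
proof -
 have "rd n (ix (h n) t) powr (- real e / 2) <= t powr (- real e / 2)"
  using rd_ix(1)[of t n] assms by (intro powr_mono2') auto
 thus ?thesis unfolding vs_def using pw[of n "ix (h n) t"] CV_pos
  by (meson less_imp_le mult_left_mono order_trans)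
qed

text \<open>Arzela-Ascoli for functions that are equicontinuous only asymptotically: a subsequence
  converges at all positive rationals, and \<open>vs_cont\<close> carries the Cauchy property to
  every radius.\<close>

lemma convergent_subsequence:
 obtains s v mu0 where "strict_mono s" "!!t. t > 0 ==> (%n. vs (s n) t) \<longlonglongrightarrow> v t" "(%n. \<mu> (s n)) \<longlonglongrightarrow> mu0"
proof -
 define q where "q m = (real (fst (prod_decode m)) + 1) / (real (snd (prod_decode m)) + 1)" for m
 have qp: "q m > 0" for m unfolding q_def by (intro divide_pos_pos) auto
 have qd: "\<exists>m. x < q m \<and> q m < y" if xy: "0 < x" "x < y" for x y
 proof -
  obtain r where r: "r \<in> \<rat>" "x < r" "r < y" using Rats_dense_in_real[OF xy(2)] by blast
  obtain a b :: nat where ab: "b \<noteq> 0" "\<bar>r\<bar> = real a / real b" using Rats_abs_nat_div_natE[OF r(1)] by metis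
  have rr: "r = real a / real b" using ab r xy by simp
  have "0 < real a / real b" using rr r xy by linarith
  hence a0: "a \<noteq> 0" by (cases "a = 0") simp_all
  have "q (prod_encode (a - 1, b - 1)) = r" unfolding q_def rr using a0 ab by simp
  thus ?thesis using r by metis
 qed
 \<comment> \<open>Slot 0 carries the multiplier, so that it converges along the same subsequence as
   the profiles.\<close>
 define x where "x n i = (case i of 0 => \<mu> n | Suc m => vs n (q m))" for n i
 define B where "B i = (case i of 0 => M | Suc m => CV * q m powr (- real e / 2))" for i
 have xB: "\<bar>x n i\<bar> <= B i" for n i
  unfolding x_def B_def using mu[of n] vs_pw[OF qp] by (cases i) auto
 obtain l s where s: "strict_mono s" "!!i. (%n. x (s n) i) \<longlonglongrightarrow> l i" using bounded_fun_subseq[of x B] xB by metis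
 have muc: "(%n. \<mu> (s n)) \<longlonglongrightarrow> l 0" using s(2)[of 0] unfolding x_def by simp
 have qc: "Cauchy (%n. vs (s n) (q m))" for m using LIMSEQ_imp_Cauchy[OF s(2)[of "Suc m"]] unfolding x_def by simp
 have hs: "(%n. h (s n)) \<longlonglongrightarrow> 0" using LIMSEQ_subseq_LIMSEQ[OF h0 s(1)] by (simp add: o_def)
 have "convergent (%n. vs (s n) t)" if t: "t > 0" for t
 proof (rule Cauchy_convergent, rule CauchyI)
  fix \<epsilon> :: real assume \<epsilon>: "\<epsilon> > 0"
  define \<eta> where "\<eta> = (\<epsilon> / 4)\<^sup>2 * t ^ e / (2 * K)"
  have \<eta>: "\<eta> > 0" unfolding \<eta>_def using \<epsilon> t K1 by simp
  have \<eta>e: "sqrt (K * (2 * \<eta>) / t ^ e) = \<epsilon> / 4" unfolding \<eta>_def using \<epsilon> t K1 by simp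
  obtain m where m: "t < q m" "q m < t + \<eta>" using qd[OF t, of "t + \<eta>"] \<eta> by auto
  obtain N1 where N1: "!!n. n >= N1 ==> h (s n) < \<eta>" using order_tendstoD(2)[OF hs \<eta>] unfolding eventually_sequentially by blast
  obtain N2 where N2: "!!n n'. n >= N2 ==> n' >= N2 ==> norm (vs (s n) (q m) - vs (s n') (q m)) < \<epsilon> / 4"
   using CauchyD[OF qc[of m], of "\<epsilon> / 4"] \<epsilon> by auto
  have near: "\<bar>vs (s n) t - vs (s n) (q m)\<bar> <= \<epsilon> / 4" if "n >= N1" for n
  proof -
   have "\<bar>vs (s n) t - vs (s n) (q m)\<bar> <= sqrt (K * (q m - t + h (s n)) / t ^ e)" using vs_cont[OF t, of "q m" "s n"] m by simp
   also have "\<dots> <= sqrt (K * (2 * \<eta>) / t ^ e)"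
    using m N1[OF that] K1 t by (intro real_sqrt_le_mono divide_right_mono mult_left_mono) auto
   finally show ?thesis unfolding \<eta>e .
  qed
  show "\<exists>N. \<forall>n\<ge>N. \<forall>n'\<ge>N. norm (vs (s n) t - vs (s n') t) < \<epsilon>"
  proof (intro exI allI impI)
   fix n n' assume n: "n >= max N1 N2" and n': "n' >= max N1 N2"
   have "\<bar>vs (s n) t - vs (s n) (q m)\<bar> <= \<epsilon> / 4" "\<bar>vs (s n') t - vs (s n') (q m)\<bar> <= \<epsilon> / 4" using near n n' by auto
   moreover have "\<bar>vs (s n) (q m) - vs (s n') (q m)\<bar> < \<epsilon> / 4" using N2[of n n'] n n' by simp
   ultimately show "norm (vs (s n) t - vs (s n') t) < \<epsilon>" using \<epsilon> unfolding real_norm_def by linarith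
  qed
 qed
 thus thesis using that[OF s(1) _ muc, of "%t. lim (%n. vs (s n) t)"] by (simp add: convergent_LIMSEQ_iff)
qed

lemma approx_subseq:
 assumes "strict_mono s"
 shows "approx d e k g G m0 K M e0 Cg (%n. h (s n)) (%n. L (s n)) (%n. u (s n)) (%n. \<mu> (s n))"
proof (rule approx.intro)
 show "(%n. h (s n)) \<longlonglongrightarrow> 0" using LIMSEQ_subseq_LIMSEQ[OF h0 assms] by (simp add: o_def)
 show "filterlim (%n. h (s n) * real (L (s n))) at_top sequentially"
  by (rule filterlim_compose[OF hL filterlim_subseq[OF assms]])
qed (use rl h1 cr mu mass EEb Vk K1 alts growth Cg small in blast)+

end

text \<open>\<open>v\<close> is 0 at nonpositive arguments, so that sign alternations over all of
  \<open>real\<close> see positive radii only.\<close>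

locale conv = approx +
 fixes v :: "real => real" and mu0 :: real
 assumes vlim: "!!t. t > 0 ==> (%n. vs n t) \<longlonglongrightarrow> v t" and mulim: "\<mu> \<longlonglongrightarrow> mu0" and v_nonpos: "!!t. t <= 0 ==> v t = 0"
begin

lemma mu0_bounds: "0 <= mu0" "mu0 <= M"
 using LIMSEQ_le_const[OF mulim] LIMSEQ_le_const2[OF mulim] mu by blast+

lemma v_pw: "t > 0 ==> \<bar>v t\<bar> <= CV * t powr (- real e / 2)"
 using LIMSEQ_le_const2[OF tendsto_rabs[OF vlim]] vs_pw by blast

definition phi :: "real => real" where "phi s = s ^ e * FF g mu0 (Thi (v s))"
definition Psi :: "real => real" where "Psi t = integral {0..t} phi"
text \<open>Bounds the flux density \<open>r ^ e * FF\<close> for radii up to \<open>R\<close>. Both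
  exponents of \<open>R\<close> are nonnegative because \<open>d >= 2\<close>, so the density stays
  bounded at the origin although the decay bound blows up there.\<close>

definition CP :: "real => real" where
 "CP R = (Cg + M) * (CV * R powr (real e / 2) + (2 * CV) powr (1 + 2 / real d) * R powr (real e / 2 - real e / real d))"

lemma M_nonneg: "M >= 0" using mu by (meson order_trans)

lemma FF_le: "\<bar>FF g (\<mu> n) s\<bar> <= (Cg + M) * (\<bar>Th s\<bar> + (2 * \<bar>Th s\<bar>) powr (1 + 2 / real d))"
proof -
 have "\<bar>FF g (\<mu> n) s\<bar> <= (Cg + \<mu> n) * (\<bar>Th s\<bar> + (2 * \<bar>Th s\<bar>) powr (1 + 2 / real d))" by (rule FF_bound[OF growth(1) mu(1) Cg])
 also have "\<dots> <= (Cg + M) * (\<bar>Th s\<bar> + (2 * \<bar>Th s\<bar>) powr (1 + 2 / real d))" using mu by (intro mult_right_mono) auto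
 finally show ?thesis .
qed

lemma CP_bound: assumes "rd n i <= R" shows "\<bar>rd n i ^ e * FF g (\<mu> n) (u n i)\<bar> <= CP R"
proof -
 define r where "r = rd n i"
 have r: "r > 0" "r <= R" unfolding r_def using rd_pos assms by auto
 have re: "r ^ e = r powr real e" using r by (simp add: powr_realpow)
 define a where "a = \<bar>Th (u n i)\<bar>"
 have a: "0 <= a" "a <= CV * r powr (- real e / 2)" unfolding a_def r_def using pw by auto
 have 1: "r ^ e * a <= CV * R powr (real e / 2)"
 proof -
  have "r ^ e * a <= r powr real e * (CV * r powr (- real e / 2))" unfolding re using a by (intro mult_left_mono) auto
  also have "\<dots> = CV * (r powr real e * r powr (- real e / 2))" by simp
  also have "r powr real e * r powr (- real e / 2) = r powr (real e / 2)" by (simp add: powr_add[symmetric])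
  also have "r powr (real e / 2) <= R powr (real e / 2)" using r by (intro powr_mono2) auto
  finally show ?thesis using CV_pos by simp
 qed
 have 2: "r ^ e * (2 * a) powr (1 + 2 / real d) <= (2 * CV) powr (1 + 2 / real d) * R powr (real e / 2 - real e / real d)"
 proof -
  have "(2 * a) powr (1 + 2 / real d) <= ((2 * CV) * r powr (- real e / 2)) powr (1 + 2 / real d)" using a by (intro powr_mono2) auto
  also have "\<dots> = (2 * CV) powr (1 + 2 / real d) * r powr ((- real e / 2) * (1 + 2 / real d))" using CV_pos by (simp add: powr_mult powr_powr)
  finally have "r ^ e * (2 * a) powr (1 + 2 / real d) <= r powr real e * ((2 * CV) powr (1 + 2 / real d) * r powr ((- real e / 2) * (1 + 2 / real d)))"
   unfolding re by (intro mult_left_mono) auto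
  also have "\<dots> = (2 * CV) powr (1 + 2 / real d) * (r powr real e * r powr ((- real e / 2) * (1 + 2 / real d)))" by simp
  also have "r powr real e * r powr ((- real e / 2) * (1 + 2 / real d)) = r powr (real e / 2 - real e / real d)"
  proof -
   have "real e + (- real e / 2) * (1 + 2 / real d) = real e / 2 - real e / real d" by (simp add: field_simps)
   thus ?thesis by (simp only: powr_add[symmetric])
  qed
  also have "r powr (real e / 2 - real e / real d) <= R powr (real e / 2 - real e / real d)"
  proof -
   have "real e / real d <= real e / 2" using d2 by (intro divide_left_mono) auto
   thus ?thesis using r by (intro powr_mono2) auto
  qed
  finally show ?thesis using CV_pos by simp
 qed
 have "\<bar>r ^ e * FF g (\<mu> n) (u n i)\<bar> <= r ^ e * ((Cg + M) * (a + (2 * a) powr (1 + 2 / real d)))"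
  unfolding abs_mult a_def using r FF_le[of n "u n i"] by (simp add: mult_left_mono)
 also have "\<dots> = (Cg + M) * (r ^ e * a + r ^ e * (2 * a) powr (1 + 2 / real d))" by (simp add: algebra_simps)
 also have "\<dots> <= CP R" unfolding CP_def using 1 2 Cg M_nonneg by (intro mult_left_mono add_mono) auto
 finally show ?thesis unfolding r_def .
qed

lemma CP_nonneg: "CP R >= 0" unfolding CP_def using Cg M_nonneg CV_pos by (intro mult_nonneg_nonneg add_nonneg_nonneg) auto

lemma Pn_bound: assumes "rd n i <= R" shows "\<bar>Pn n i\<bar> <= R * CP R"
proof -
 have "\<bar>Pn n i\<bar> <= (\<Sum>j\<le>i. \<bar>h n * rd n j ^ e * FF g (\<mu> n) (u n j)\<bar>)" unfolding Pn_def by (rule sum_abs)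
 also have "\<dots> <= (\<Sum>j\<le>i. h n * CP R)"
 proof (rule sum_mono)
  fix j assume "j \<in> {..i}"
  hence "rd n j <= R" using rd_mono[of j i n] assms by simp
  hence "\<bar>rd n j ^ e * FF g (\<mu> n) (u n j)\<bar> <= CP R" by (rule CP_bound)
  hence "h n * \<bar>rd n j ^ e * FF g (\<mu> n) (u n j)\<bar> <= h n * CP R" by (rule mult_left_mono) (rule less_imp_le[OF h_pos])
  thus "\<bar>h n * rd n j ^ e * FF g (\<mu> n) (u n j)\<bar> <= h n * CP R" using h_pos[of n] by (simp add: abs_mult mult.assoc)
 qed
 also have "\<dots> = rd n i * CP R" by (simp add: rd_def algebra_simps)
 also have "\<dots> <= R * CP R" using assms CP_nonneg by (rule mult_right_mono)
 finally show ?thesis .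
qed

lemma u_lim: "t > 0 ==> (%n. u n (ix (h n) t)) \<longlonglongrightarrow> Thi (v t)"
 using tendsto_Thi[OF vlim] unfolding vs_def by simp

lemma Pn_lim: assumes t: "t > 0" shows "phi integrable_on {0..t}" "(%n. Pn n (ix (h n) t)) \<longlonglongrightarrow> Psi t"
proof -
 have c: "real (Suc (ix (h n) t)) * h n = rd n (ix (h n) t)" for n by (simp add: rd_def algebra_simps)
 have b: "\<bar>rd n l ^ e * FF g (\<mu> n) (u n l)\<bar> <= CP (t + 1)" if "l < Suc (ix (h n) t)" for n l
  using rd_mono[of l "ix (h n) t" n] rd_ix(2)[of t n] h1[of n] t that by (intro CP_bound) auto
 have p: "(%n. rd n (ix (h n) s) ^ e * FF g (\<mu> n) (u n (ix (h n) s))) \<longlonglongrightarrow> phi s" if "0 < s" for s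
  unfolding phi_def using that by (intro tendsto_mult tendsto_power rd_ix_lim tendsto_FF[OF g_cont mulim] u_lim) auto
 have il: "(%n. real 0 * h n) \<longlonglongrightarrow> 0" by simp
 have jl: "(%n. real (Suc (ix (h n) t)) * h n) \<longlonglongrightarrow> t" unfolding c using t by (intro rd_ix_lim) auto
 have t0: "(0::real) <= t" using t by simp
 note R = riemann_limit[of h 0 t "%_. 0" "%n. Suc (ix (h n) t)" "%n l. rd n l ^ e * FF g (\<mu> n) (u n l)" "CP (t + 1)" phi,
   OF h_pos order_refl t0 le0 il jl b p]
 show "phi integrable_on {0..t}" using R(1) by simp
 have e: "h n * (\<Sum>l\<in>{0..<Suc (ix (h n) t)}. rd n l ^ e * FF g (\<mu> n) (u n l)) = Pn n (ix (h n) t)" for n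
  unfolding Pn_def sum_distrib_left by (rule sum.cong) auto
 show "(%n. Pn n (ix (h n) t)) \<longlonglongrightarrow> Psi t" using R(2) unfolding e Psi_def by simp
qed

lemma window_limit:
 assumes ab: "0 < a" "a <= b" and B: "!!n l. a <= rd n l ==> rd n l <= b + 1 ==> \<bar>\<xi> n l\<bar> <= B"
  and p: "!!t. a < t ==> t < b ==> (%n. \<xi> n (ix (h n) t)) \<longlonglongrightarrow> X t"
 shows "X integrable_on {a..b}" "(%n. h n * (\<Sum>l\<in>{ix (h n) a..<ix (h n) b}. \<xi> n l)) \<longlonglongrightarrow> integral {a..b} X"
proof -
 have a0: "0 <= a" using ab by simp
 have ij: "ix (h n) a <= ix (h n) b" for n using ab by (intro ix_mono) auto
 have il: "(%n. real (ix (h n) a) * h n) \<longlonglongrightarrow> a" "(%n. real (ix (h n) b) * h n) \<longlonglongrightarrow> b" using ab by (auto intro!: ix_h_lim)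
 have b: "\<bar>\<xi> n l\<bar> <= B" if "ix (h n) a <= l" "l < ix (h n) b" for n l
  using rd_mono[OF that(1)] rd_mono[OF less_imp_le[OF that(2)]] rd_ix(1)[of a n] rd_ix(2)[of b n] h1[of n] ab
  by (intro B) (meson a0 less_imp_le order_trans, smt (verit) a0)
 note R = riemann_limit[of h a b "%n. ix (h n) a" "%n. ix (h n) b" \<xi> B X, OF h_pos a0 ab(2) ij il b p]
 show "X integrable_on {a..b}" "(%n. h n * (\<Sum>l\<in>{ix (h n) a..<ix (h n) b}. \<xi> n l)) \<longlonglongrightarrow> integral {a..b} X" using R by auto
qed

text \<open>Limit of the telescoped flux identity: the difference quotients are expressed by the
  fluxes, which converge pointwise by \<open>Pn_lim\<close>.\<close>

lemma v_difference:
 assumes ab: "0 < a" "a <= b"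
 shows "(%s. Psi s / s ^ e) integrable_on {a..b}" "v a - v b = integral {a..b} (%s. Psi s / s ^ e)"
proof -
 have B: "\<bar>Pn n l / rd n l ^ e\<bar> <= (b + 1) * CP (b + 1) / a ^ e" if "a <= rd n l" "rd n l <= b + 1" for n l
  unfolding abs_divide using Pn_bound[OF that(2)] that ab by (intro frac_le) (auto intro!: power_mono)
 have p: "(%n. Pn n (ix (h n) t) / rd n (ix (h n) t) ^ e) \<longlonglongrightarrow> Psi t / t ^ e" if "a < t" for t
  using that ab by (intro tendsto_divide tendsto_power rd_ix_lim Pn_lim(2)) auto
 note R = window_limit[of a b "%n l. Pn n l / rd n l ^ e", OF ab B p]
 show "(%s. Psi s / s ^ e) integrable_on {a..b}" using R(1) by simp
 have "\<forall>\<^sub>F n in sequentially. h n * (\<Sum>l\<in>{ix (h n) a..<ix (h n) b}. Pn n l / rd n l ^ e) = vs n a - vs n b"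
  using ix_less_L[of b]
 proof eventually_elim
  case (elim n)
  have "h n * (\<Sum>l\<in>{ix (h n) a..<ix (h n) b}. Pn n l / rd n l ^ e) = (\<Sum>l\<in>{ix (h n) a..<ix (h n) b}. Th (u n l) - Th (u n (Suc l)))"
   unfolding sum_distrib_left using elim by (intro sum.cong) (auto simp: flux')
  also have "\<dots> = - (\<Sum>l\<in>{ix (h n) a..<ix (h n) b}. Th (u n (Suc l)) - Th (u n l))" by (simp add: sum_negf[symmetric])
  also have "\<dots> = - (Th (u n (ix (h n) b)) - Th (u n (ix (h n) a)))" using ix_mono[of a b n] ab by (subst sum_Suc_diff') auto
  finally show ?case by (simp add: vs_def)
 qed
 hence "(%n. vs n a - vs n b) \<longlonglongrightarrow> integral {a..b} (%s. Psi s / s ^ e)" using R(2) by (simp add: tendsto_cong)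
 moreover have "(%n. vs n a - vs n b) \<longlonglongrightarrow> v a - v b" using ab by (intro tendsto_intros vlim) auto
 ultimately show "v a - v b = integral {a..b} (%s. Psi s / s ^ e)" using LIMSEQ_unique by blast
qed

end

section \<open>Convergence of energy and mass\<close>

context conv
begin

text \<open>Written through the flux, the Dirichlet energy is a sum of pointwise convergent terms;
  so it converges on annuli, not merely in the lower semicontinuous sense.\<close>

lemma kinetic_limit:
 assumes ab: "0 < a" "a <= b"
 shows "(%s. (Psi s)\<^sup>2 / s ^ e) integrable_on {a..b}"
  "(%n. \<Sum>l\<in>{ix (h n) a..<ix (h n) b}. rd n l ^ e / h n * (Th (u n l) - Th (u n (Suc l)))\<^sup>2) \<longlonglongrightarrow> integral {a..b} (%s. (Psi s)\<^sup>2 / s ^ e)"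
proof -
 have B: "\<bar>(Pn n l)\<^sup>2 / rd n l ^ e\<bar> <= ((b + 1) * CP (b + 1))\<^sup>2 / a ^ e" if "a <= rd n l" "rd n l <= b + 1" for n l
 proof -
  have "\<bar>Pn n l\<bar> <= \<bar>(b + 1) * CP (b + 1)\<bar>" using Pn_bound[OF that(2)] by linarith
  hence "(Pn n l)\<^sup>2 <= ((b + 1) * CP (b + 1))\<^sup>2" by (simp only: abs_le_square_iff)
  thus ?thesis unfolding abs_divide using that ab by (intro frac_le) (auto intro!: power_mono)
 qed
 have p: "(%n. (Pn n (ix (h n) t))\<^sup>2 / rd n (ix (h n) t) ^ e) \<longlonglongrightarrow> (Psi t)\<^sup>2 / t ^ e" if "a < t" for t
  using that ab by (intro tendsto_divide tendsto_power rd_ix_lim Pn_lim(2)) auto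
 note R = window_limit[of a b "%n l. (Pn n l)\<^sup>2 / rd n l ^ e", OF ab B p]
 show "(%s. (Psi s)\<^sup>2 / s ^ e) integrable_on {a..b}" using R(1) by simp
 have "\<forall>\<^sub>F n in sequentially. h n * (\<Sum>l\<in>{ix (h n) a..<ix (h n) b}. (Pn n l)\<^sup>2 / rd n l ^ e)
   = (\<Sum>l\<in>{ix (h n) a..<ix (h n) b}. rd n l ^ e / h n * (Th (u n l) - Th (u n (Suc l)))\<^sup>2)"
  using ix_less_L[of b]
 proof eventually_elim
  case (elim n)
  show ?case unfolding sum_distrib_left
  proof (rule sum.cong)
   fix l assume "l \<in> {ix (h n) a..<ix (h n) b}"
   hence "l < L n" using elim by simp
   thus "h n * ((Pn n l)\<^sup>2 / rd n l ^ e) = rd n l ^ e / h n * (Th (u n l) - Th (u n (Suc l)))\<^sup>2"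
    using h_pos[of n] rd_pos[of n l] by (simp add: flux' power2_eq_square)
  qed simp
 qed
 thus "(%n. \<Sum>l\<in>{ix (h n) a..<ix (h n) b}. rd n l ^ e / h n * (Th (u n l) - Th (u n (Suc l)))\<^sup>2) \<longlonglongrightarrow> integral {a..b} (%s. (Psi s)\<^sup>2 / s ^ e)"
  using R(2) by (simp add: tendsto_cong)
qed

lemma u_bound: assumes "0 < a" "a <= rd n l" shows "\<bar>u n l\<bar> <= CV * a powr (- real e / 2)"
proof -
 have "rd n l powr (- real e / 2) <= a powr (- real e / 2)" using assms by (intro powr_mono2') auto
 hence "CV * rd n l powr (- real e / 2) <= CV * a powr (- real e / 2)" using CV_pos by (intro mult_left_mono) auto
 thus ?thesis using pw[of n l] abs_le_Th[of "u n l"] by linarith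
qed

lemma mass_limit:
 assumes ab: "0 < a" "a <= b"
 shows "(%s. s ^ e * (Thi (v s))\<^sup>2) integrable_on {a..b}"
  "(%n. \<Sum>l\<in>{ix (h n) a..<ix (h n) b}. h n * rd n l ^ e * (u n l)\<^sup>2) \<longlonglongrightarrow> integral {a..b} (%s. s ^ e * (Thi (v s))\<^sup>2)"
proof -
 have B: "\<bar>rd n l ^ e * (u n l)\<^sup>2\<bar> <= (b + 1) ^ e * (CV * a powr (- real e / 2))\<^sup>2" if "a <= rd n l" "rd n l <= b + 1" for n l
 proof -
  have "\<bar>u n l\<bar> <= \<bar>CV * a powr (- real e / 2)\<bar>" using u_bound[OF ab(1) that(1)] by linarith
  hence "(u n l)\<^sup>2 <= (CV * a powr (- real e / 2))\<^sup>2" by (simp only: abs_le_square_iff)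
  thus ?thesis unfolding abs_mult using that ab by (intro mult_mono) (auto intro!: power_mono)
 qed
 have p: "(%n. rd n (ix (h n) t) ^ e * (u n (ix (h n) t))\<^sup>2) \<longlonglongrightarrow> t ^ e * (Thi (v t))\<^sup>2" if "a < t" for t
  using that ab by (intro tendsto_mult tendsto_power rd_ix_lim u_lim) auto
 note R = window_limit[of a b "%n l. rd n l ^ e * (u n l)\<^sup>2", OF ab B p]
 show "(%s. s ^ e * (Thi (v s))\<^sup>2) integrable_on {a..b}" using R(1) by simp
 show "(%n. \<Sum>l\<in>{ix (h n) a..<ix (h n) b}. h n * rd n l ^ e * (u n l)\<^sup>2) \<longlonglongrightarrow> integral {a..b} (%s. s ^ e * (Thi (v s))\<^sup>2)"
  using R(2) by (simp add: sum_distrib_left mult.assoc)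
qed

lemma G_limit:
 assumes ab: "0 < a" "a <= b"
 shows "(%s. s ^ e * G (Thi (v s))) integrable_on {a..b}"
  "(%n. \<Sum>l\<in>{ix (h n) a..<ix (h n) b}. h n * rd n l ^ e * G (u n l)) \<longlonglongrightarrow> integral {a..b} (%s. s ^ e * G (Thi (v s)))"
proof -
 define U where "U = CV * a powr (- real e / 2)"
 have B: "\<bar>rd n l ^ e * G (u n l)\<bar> <= (b + 1) ^ e * (Cg * (U\<^sup>2 + \<bar>U\<bar> powr (4 + 4 / real d)))" if "a <= rd n l" "rd n l <= b + 1" for n l
 proof -
  have ul: "\<bar>u n l\<bar> <= \<bar>U\<bar>" using u_bound[OF ab(1) that(1)] unfolding U_def by linarith
  hence "(u n l)\<^sup>2 <= U\<^sup>2" by (simp only: abs_le_square_iff)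
  moreover have "\<bar>u n l\<bar> powr (4 + 4 / real d) <= \<bar>U\<bar> powr (4 + 4 / real d)" using ul by (intro powr_mono2) auto
  ultimately have "\<bar>G (u n l)\<bar> <= Cg * (U\<^sup>2 + \<bar>U\<bar> powr (4 + 4 / real d))"
   using growth(2)[of "u n l"] Cg by (meson add_mono mult_left_mono order_trans)
  thus ?thesis unfolding abs_mult using that ab by (intro mult_mono) (auto intro!: power_mono)
 qed
 have p: "(%n. rd n (ix (h n) t) ^ e * G (u n (ix (h n) t))) \<longlonglongrightarrow> t ^ e * G (Thi (v t))" if "a < t" for t
  using that ab by (intro tendsto_mult tendsto_power rd_ix_lim isCont_tendsto_compose[OF DERIV_isCont[OF G_deriv]] u_lim) auto
 note R = window_limit[of a b "%n l. rd n l ^ e * G (u n l)", OF ab B p]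
 show "(%s. s ^ e * G (Thi (v s))) integrable_on {a..b}" using R(1) by simp
 show "(%n. \<Sum>l\<in>{ix (h n) a..<ix (h n) b}. h n * rd n l ^ e * G (u n l)) \<longlonglongrightarrow> integral {a..b} (%s. s ^ e * G (Thi (v s)))"
  using R(2) by (simp add: sum_distrib_left mult.assoc)
qed

text \<open>A majorant of the mass and critical densities in terms of \<open>Th\<close>, for which
  the decay bound is available.\<close>

definition ww :: "real => real" where "ww x = 2 * \<bar>Th x\<bar> + (2 * \<bar>Th x\<bar>) powr (2 + 2 / real d)"
definition C0 :: real where "C0 = (2 * CV + (2 * CV) powr (2 + 2 / real d)) * real d"

lemma ww_ge: "x\<^sup>2 + \<bar>x\<bar> powr (4 + 4 / real d) <= ww x"
proof -
 have "\<bar>x\<bar> powr (4 + 4 / real d) <= (2 * \<bar>Th x\<bar>) powr (2 + 2 / real d)"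
 proof (cases "x = 0")
  case False
  have "\<bar>x\<bar> powr (4 + 4 / real d) = (\<bar>x\<bar> powr 2) powr (2 + 2 / real d)" unfolding powr_powr by (simp add: algebra_simps)
  also have "\<bar>x\<bar> powr 2 = x\<^sup>2" using False by simp
  also have "(x\<^sup>2) powr (2 + 2 / real d) <= (2 * \<bar>Th x\<bar>) powr (2 + 2 / real d)" by (intro powr_mono2 sq_le_Th) auto
  finally show ?thesis .
 qed simp
 thus ?thesis unfolding ww_def using sq_le_Th[of x] by linarith
qed

lemma C0_nonneg: "C0 >= 0" unfolding C0_def using CV_pos by (intro mult_nonneg_nonneg add_nonneg_nonneg) auto

text \<open>By the decay bound the critical density is of order \<open>r powr (1 / d - 1)\<close>,
  since \<open>e - e / 2 * (2 + 2 / d) = 1 / d - 1\<close>. The sum near the origin is therefore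
  small uniformly in \<open>n\<close>.\<close>

lemma near_origin:
 assumes a: "0 < a" "a <= 1"
 shows "(\<Sum>i<L n. if rd n i < a then h n * rd n i ^ e * ww (u n i) else 0) <= C0 * a powr (1 / real d)"
proof -
 define c where "c = 2 * CV + (2 * CV) powr (2 + 2 / real d)"
 have c0: "c >= 0" unfolding c_def using CV_pos by (intro add_nonneg_nonneg) auto
 have d0: "real d > 0" using d2 by simp
 have "(\<Sum>i<L n. if rd n i < a then h n * rd n i ^ e * ww (u n i) else 0) <= (\<Sum>i<L n. c * (if rd n i < a then h n * rd n i powr (1 / real d - 1) else 0))"
 proof (rule sum_mono)
  fix i
  show "(if rd n i < a then h n * rd n i ^ e * ww (u n i) else 0) <= c * (if rd n i < a then h n * rd n i powr (1 / real d - 1) else 0)"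
  proof (cases "rd n i < a")
   case True
   define r where "r = rd n i"
   have r: "0 < r" "r <= 1" unfolding r_def using rd_pos True a by auto
   have re: "r ^ e = r powr real e" using r by (simp add: powr_realpow)
   have V: "\<bar>Th (u n i)\<bar> <= CV * r powr (- real e / 2)" unfolding r_def by (rule pw)
   have 1: "r ^ e * (2 * \<bar>Th (u n i)\<bar>) <= 2 * CV * r powr (1 / real d - 1)"
   proof -
    have "r ^ e * (2 * \<bar>Th (u n i)\<bar>) <= r powr real e * (2 * (CV * r powr (- real e / 2)))" unfolding re using V by (intro mult_left_mono) auto
    also have "\<dots> = 2 * CV * (r powr real e * r powr (- real e / 2))" by simp
    also have "r powr real e * r powr (- real e / 2) = r powr (real e / 2)" by (simp add: powr_add[symmetric])
    also have "r powr (real e / 2) <= r powr (1 / real d - 1)"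
    proof (rule powr_mono')
     have "1 / real d <= 1" using d2 by simp
     thus "1 / real d - 1 <= real e / 2" by (smt (verit) divide_nonneg_nonneg of_nat_0_le_iff)
    qed (use r in auto)
    finally show ?thesis using CV_pos by simp
   qed
   have 2: "r ^ e * (2 * \<bar>Th (u n i)\<bar>) powr (2 + 2 / real d) <= (2 * CV) powr (2 + 2 / real d) * r powr (1 / real d - 1)"
   proof -
    have "(2 * \<bar>Th (u n i)\<bar>) powr (2 + 2 / real d) <= ((2 * CV) * r powr (- real e / 2)) powr (2 + 2 / real d)" using V by (intro powr_mono2) auto
    also have "\<dots> = (2 * CV) powr (2 + 2 / real d) * r powr ((- real e / 2) * (2 + 2 / real d))" using CV_pos by (simp add: powr_mult powr_powr)
    finally have "r ^ e * (2 * \<bar>Th (u n i)\<bar>) powr (2 + 2 / real d) <= r powr real e * ((2 * CV) powr (2 + 2 / real d) * r powr ((- real e / 2) * (2 + 2 / real d)))"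
     unfolding re by (intro mult_left_mono) auto
    also have "\<dots> = (2 * CV) powr (2 + 2 / real d) * (r powr real e * r powr ((- real e / 2) * (2 + 2 / real d)))" by simp
    also have "r powr real e * r powr ((- real e / 2) * (2 + 2 / real d)) = r powr (1 / real d - 1)"
    proof -
     have "real e = real d - 1" using de by simp
     hence "real e + (- real e / 2) * (2 + 2 / real d) = 1 / real d - 1" using d0 by (simp add: field_simps)
     thus ?thesis by (simp only: powr_add[symmetric])
    qed
    finally show ?thesis .
   qed
   have "r ^ e * ww (u n i) <= c * r powr (1 / real d - 1)" unfolding ww_def c_def using 1 2 by (simp add: algebra_simps)
   hence "h n * (r ^ e * ww (u n i)) <= h n * (c * r powr (1 / real d - 1))" by (rule mult_left_mono) (rule less_imp_le[OF h_pos])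
   thus ?thesis using True unfolding r_def by (simp add: mult_ac)
  qed simp
 qed
 also have "\<dots> <= c * (real d * a powr (1 / real d))"
  unfolding sum_distrib_left[symmetric] using rlattice.sum_rr_root[OF rl[of n] a(1), of "L n"] c0 unfolding rrd by (intro mult_left_mono)
 finally show ?thesis unfolding C0_def c_def by (simp add: mult.assoc)
qed

lemma far_small:
 assumes "s > 0"
 obtains R0 where "R0 >= 1" "!!n i. rd n i >= R0 ==> \<bar>u n i\<bar> < s"
proof -
 have e0: "real e > 0" using d2 de by simp
 define y where "y = CV / s + 1"
 have y: "y >= 1" "CV < s * y" unfolding y_def using CV_pos assms by (auto simp: field_simps)
 define R0 where "R0 = y powr (2 / real e)"
 have R1: "R0 >= 1" unfolding R0_def using y e0 by (intro ge_one_powr_ge_zero) auto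
 have "R0 powr (- real e / 2) = y powr (-1)" unfolding R0_def powr_powr using e0 by simp
 hence Re: "R0 powr (- real e / 2) = 1 / y" using y by (simp add: powr_minus_divide)
 have "\<bar>u n i\<bar> < s" if "rd n i >= R0" for n i
 proof -
  have "\<bar>u n i\<bar> <= CV * (1 / y)" using u_bound[of R0 n i] that R1 unfolding Re by simp
  also have "\<dots> < s" using y by (simp add: field_simps)
  finally show ?thesis .
 qed
 thus thesis using that R1 by blast
qed

lemma window_split:
 assumes "0 < a" "a <= b" "ix (h n) b < L n"
 shows "(\<Sum>i<L n. f i) <= (\<Sum>i<L n. if rd n i < 2 * a then \<bar>f i\<bar> else 0) + (\<Sum>i\<in>{ix (h n) a..<ix (h n) b}. f i) + (\<Sum>i<L n. if rd n i >= b then \<bar>f i\<bar> else (0::real))"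
proof -
 have "(\<Sum>i\<in>{ix (h n) a..<ix (h n) b}. f i) = (\<Sum>i\<in>{i\<in>{..<L n}. ix (h n) a <= i \<and> i < ix (h n) b}. f i)"
  using assms(3) by (intro sum.cong) auto
 also have "\<dots> = (\<Sum>i<L n. if ix (h n) a <= i \<and> i < ix (h n) b then f i else 0)" by (simp only: sum.inter_filter[OF finite_lessThan])
 finally have w: "(\<Sum>i\<in>{ix (h n) a..<ix (h n) b}. f i) = (\<Sum>i<L n. if ix (h n) a <= i \<and> i < ix (h n) b then f i else 0)" .
 show ?thesis unfolding w sum.distrib[symmetric]
 proof (rule sum_mono)
  fix i
  have 1: "rd n i < 2 * a" if "i < ix (h n) a"
  proof -
   have "real i + 1 <= real (ix (h n) a)" using that by linarith
   hence "rd n i <= real (ix (h n) a) * h n" unfolding rd_def using h_pos[of n] by (intro mult_right_mono) auto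
   thus ?thesis using ix_bounds(1)[OF h_pos, of a n] assms by linarith
  qed
  have 2: "rd n i >= b" if "i >= ix (h n) b"
   using rd_mono[OF that, of n] rd_ix(1)[of b n] assms by linarith
  show "f i <= (if rd n i < 2 * a then \<bar>f i\<bar> else 0) + (if ix (h n) a <= i \<and> i < ix (h n) b then f i else 0) + (if rd n i >= b then \<bar>f i\<bar> else 0)"
   using 1 2 by (cases "i < ix (h n) a"; cases "i >= ix (h n) b") auto
 qed
qed

lemma exists_small_root: assumes "\<eta> > 0" "C >= 0"
 obtains a0 where "0 < a0" "a0 <= 1/2" "!!a. 0 < a ==> a <= a0 ==> C * (2 * a) powr (1 / real d) <= \<eta>"
proof -
 have d0: "real d > 0" using d2 by simp
 define z where "z = min 1 (\<eta> / (C + 1))"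
 have z: "0 < z" "z <= 1" unfolding z_def using assms by auto
 have Cz: "C * z <= \<eta>"
 proof -
  have "C * z <= C * (\<eta> / (C + 1))" unfolding z_def using assms by (intro mult_left_mono) auto
  also have "\<dots> <= \<eta>" using assms by (simp add: field_simps)
  finally show ?thesis .
 qed
 have "z powr real d <= 1" using z by (simp add: powr_le1)
 show thesis
 proof (rule that[of "z powr real d / 2"])
  fix a assume a: "0 < a" "a <= z powr real d / 2"
  have "(2 * a) powr (1 / real d) <= (z powr real d) powr (1 / real d)" using a by (intro powr_mono2) auto
  also have "\<dots> = z" unfolding powr_powr using d0 z by simp
  finally have "C * (2 * a) powr (1 / real d) <= C * z" using assms by (intro mult_left_mono)
  thus "C * (2 * a) powr (1 / real d) <= \<eta>" using Cz by linarith
 qed (use z \<open>z powr real d <= 1\<close> in auto)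
qed

text \<open>The tail of \<open>G\<close> is small because \<open>G\<close> is small compared with
  the square near 0 and the mass is bounded; the sign of the multiplier does not enter. This
  matters, since the inequality serves to prove that the multiplier is positive.\<close>

theorem energy_limit:
 assumes \<eta>: "\<eta> > 0"
 obtains a0 R0 where "0 < a0" "a0 <= R0" "!!a b. 0 < a ==> a <= a0 ==> b >= R0 ==>
  integral {a..b} (%s. (Psi s)\<^sup>2 / s ^ e) / 2 + e0 <= integral {a..b} (%s. s ^ e * G (Thi (v s))) + \<eta>"
proof -
 obtain a0 where a0: "0 < a0" "a0 <= 1/2" "!!a. 0 < a ==> a <= a0 ==> (Cg * C0) * (2 * a) powr (1 / real d) <= \<eta> / 2"
  using exists_small_root[of "\<eta> / 2" "Cg * C0"] \<eta> Cg C0_nonneg by auto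
 obtain s where s: "s > 0" "!!t. \<bar>t\<bar> < s ==> \<bar>G t\<bar> <= \<eta> / (2 * m0) * t\<^sup>2" using small[of "\<eta> / (2 * m0)"] \<eta> m0_pos by auto
 obtain R0 where R0: "R0 >= 1" "!!n i. rd n i >= R0 ==> \<bar>u n i\<bar> < s" using far_small[OF s(1)] by blast
 show thesis
 proof (rule that[OF a0(1)])
  show "a0 <= R0" using a0 R0 by simp
  fix a b assume a: "0 < a" "a <= a0" and b: "b >= R0"
  have ab: "a <= b" using a b a0 R0 by linarith
  show "integral {a..b} (%s. (Psi s)\<^sup>2 / s ^ e) / 2 + e0 <= integral {a..b} (%s. s ^ e * G (Thi (v s))) + \<eta>"
  proof (rule tendsto_le[OF trivial_limit_sequentially])
   show "(%n. (\<Sum>l\<in>{ix (h n) a..<ix (h n) b}. rd n l ^ e / h n * (Th (u n l) - Th (u n (Suc l)))\<^sup>2) / 2 + e0) \<longlonglongrightarrow> integral {a..b} (%s. (Psi s)\<^sup>2 / s ^ e) / 2 + e0"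
    by (intro tendsto_add tendsto_divide kinetic_limit(2)[OF a(1) ab] tendsto_const) simp
   show "(%n. (\<Sum>l\<in>{ix (h n) a..<ix (h n) b}. h n * rd n l ^ e * G (u n l)) + \<eta>) \<longlonglongrightarrow> integral {a..b} (%s. s ^ e * G (Thi (v s))) + \<eta>"
    by (intro tendsto_add G_limit(2)[OF a(1) ab] tendsto_const)
   show "\<forall>\<^sub>F n in sequentially. (\<Sum>l\<in>{ix (h n) a..<ix (h n) b}. rd n l ^ e / h n * (Th (u n l) - Th (u n (Suc l)))\<^sup>2) / 2 + e0 <= (\<Sum>l\<in>{ix (h n) a..<ix (h n) b}. h n * rd n l ^ e * G (u n l)) + \<eta>"
    using ix_less_L[of b]
   proof eventually_elim
    case (elim n)
    have hr: "h n * rd n i ^ e >= 0" for i using h_pos[of n] rd_pos[of n i] by simp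
    have hG: "\<bar>h n * rd n i ^ e * G (u n i)\<bar> = h n * rd n i ^ e * \<bar>G (u n i)\<bar>" for i
     by (simp only: abs_mult[of "h n * rd n i ^ e"] abs_of_nonneg[OF hr])
    have "(\<Sum>l\<in>{ix (h n) a..<ix (h n) b}. rd n l ^ e / h n * (Th (u n l) - Th (u n (Suc l)))\<^sup>2) <= (\<Sum>i<L n. rd n i ^ e / h n * (Th (u n i) - Th (u n (Suc i)))\<^sup>2)"
     using elim h_pos[of n] rd_pos[of n] by (intro sum_mono2 mult_nonneg_nonneg) (auto intro!: divide_nonneg_pos simp: less_imp_le)
    hence "(\<Sum>l\<in>{ix (h n) a..<ix (h n) b}. rd n l ^ e / h n * (Th (u n l) - Th (u n (Suc l)))\<^sup>2) / 2 + e0 <= (\<Sum>i<L n. h n * rd n i ^ e * G (u n i))"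
     using energy[of n] by linarith
    also have "\<dots> <= (\<Sum>i<L n. if rd n i < 2 * a then \<bar>h n * rd n i ^ e * G (u n i)\<bar> else 0) + (\<Sum>i\<in>{ix (h n) a..<ix (h n) b}. h n * rd n i ^ e * G (u n i)) + (\<Sum>i<L n. if rd n i >= b then \<bar>h n * rd n i ^ e * G (u n i)\<bar> else 0)"
     by (rule window_split[OF a(1) ab elim])
    also have "(\<Sum>i<L n. if rd n i < 2 * a then \<bar>h n * rd n i ^ e * G (u n i)\<bar> else 0) <= \<eta> / 2"
    proof -
     have "(\<Sum>i<L n. if rd n i < 2 * a then \<bar>h n * rd n i ^ e * G (u n i)\<bar> else 0) <= (\<Sum>i<L n. Cg * (if rd n i < 2 * a then h n * rd n i ^ e * ww (u n i) else 0))"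
     proof (rule sum_mono)
      fix i
      have "\<bar>G (u n i)\<bar> <= Cg * ww (u n i)" using growth(2)[of "u n i"] mult_left_mono[OF ww_ge[of "u n i"] Cg] by linarith
      hence "h n * rd n i ^ e * \<bar>G (u n i)\<bar> <= h n * rd n i ^ e * (Cg * ww (u n i))" by (rule mult_left_mono[OF _ hr])
      thus "(if rd n i < 2 * a then \<bar>h n * rd n i ^ e * G (u n i)\<bar> else 0) <= Cg * (if rd n i < 2 * a then h n * rd n i ^ e * ww (u n i) else 0)"
       unfolding hG by (simp add: mult_ac)
     qed
     also have "\<dots> = Cg * (\<Sum>i<L n. if rd n i < 2 * a then h n * rd n i ^ e * ww (u n i) else 0)" by (simp add: sum_distrib_left)
     also have "\<dots> <= Cg * (C0 * (2 * a) powr (1 / real d))" using near_origin[of "2 * a" n] a a0 Cg by (intro mult_left_mono) auto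
     also have "\<dots> <= \<eta> / 2" using a0(3)[OF a] by (simp only: mult.assoc)
     finally show ?thesis .
    qed
    also have "(\<Sum>i<L n. if rd n i >= b then \<bar>h n * rd n i ^ e * G (u n i)\<bar> else 0) <= \<eta> / 2"
    proof -
     have "(\<Sum>i<L n. if rd n i >= b then \<bar>h n * rd n i ^ e * G (u n i)\<bar> else 0) <= (\<Sum>i<L n. \<eta> / (2 * m0) * (h n * rd n i ^ e * (u n i)\<^sup>2))"
     proof (rule sum_mono)
      fix i
      have nn: "0 <= \<eta> / (2 * m0) * (h n * rd n i ^ e * (u n i)\<^sup>2)" using hr[of i] \<eta> m0_pos by simp
      have "h n * rd n i ^ e * \<bar>G (u n i)\<bar> <= h n * rd n i ^ e * (\<eta> / (2 * m0) * (u n i)\<^sup>2)" if "rd n i >= b"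
       using s(2)[OF R0(2)[of n i]] that b by (intro mult_left_mono[OF _ hr]) auto
      thus "(if rd n i >= b then \<bar>h n * rd n i ^ e * G (u n i)\<bar> else 0) <= \<eta> / (2 * m0) * (h n * rd n i ^ e * (u n i)\<^sup>2)"
       using nn unfolding hG by (simp add: mult_ac)
     qed
     also have "\<dots> <= \<eta> / (2 * m0) * m0" unfolding sum_distrib_left[symmetric] using mass_le[of n] \<eta> m0_pos by (intro mult_left_mono) auto
     also have "\<dots> = \<eta> / 2" using m0_pos by simp
     finally show ?thesis .
    qed
    finally show ?case by simp
   qed
  qed
 qed
qed

theorem mass_upper: assumes ab: "0 < a" "a <= b" shows "integral {a..b} (%s. s ^ e * (Thi (v s))\<^sup>2) <= m0"
proof (rule tendsto_upperbound[OF mass_limit(2)[OF ab] _ trivial_limit_sequentially])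
 show "\<forall>\<^sub>F n in sequentially. (\<Sum>l\<in>{ix (h n) a..<ix (h n) b}. h n * rd n l ^ e * (u n l)\<^sup>2) <= m0"
  using ix_less_L[of b]
 proof eventually_elim
  case (elim n)
  have "(\<Sum>l\<in>{ix (h n) a..<ix (h n) b}. h n * rd n l ^ e * (u n l)\<^sup>2) <= (\<Sum>l<L n. h n * rd n l ^ e * (u n l)\<^sup>2)"
   using elim h_pos[of n] rd_pos[of n] by (intro sum_mono2) (auto intro!: mult_nonneg_nonneg simp: less_imp_le)
  thus ?case using mass_le[of n] by linarith
 qed
qed

theorem kinetic_upper: assumes ab: "0 < a" "a <= b" shows "integral {a..b} (%s. (Psi s)\<^sup>2 / s ^ e) <= K"
proof (rule tendsto_upperbound[OF kinetic_limit(2)[OF ab] _ trivial_limit_sequentially])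
 show "\<forall>\<^sub>F n in sequentially. (\<Sum>l\<in>{ix (h n) a..<ix (h n) b}. rd n l ^ e / h n * (Th (u n l) - Th (u n (Suc l)))\<^sup>2) <= K"
  using ix_less_L[of b]
 proof eventually_elim
  case (elim n)
  have "(\<Sum>l\<in>{ix (h n) a..<ix (h n) b}. rd n l ^ e / h n * (Th (u n l) - Th (u n (Suc l)))\<^sup>2) <= (\<Sum>i<L n. rd n i ^ e / h n * (Th (u n i) - Th (u n (Suc i)))\<^sup>2)"
   using elim h_pos[of n] rd_pos[of n] by (intro sum_mono2 mult_nonneg_nonneg) (auto intro!: divide_nonneg_pos simp: less_imp_le)
  thus ?case using Vk[of n] unfolding Vk_eq by linarith
 qed
qed

text \<open>Decay alone does not control the tail of the mass; the positive limit multiplier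
  provides the coercive term for \<open>tail_bound\<close>.\<close>

theorem mass_lower:
 assumes m: "mu0 > 0" and \<eta>: "\<eta> > 0"
 obtains a0 R0 where "0 < a0" "a0 <= R0" "!!a b. 0 < a ==> a <= a0 ==> b >= R0 ==> m0 - \<eta> <= integral {a..b} (%s. s ^ e * (Thi (v s))\<^sup>2)"
proof -
 obtain a0 where a0: "0 < a0" "a0 <= 1/2" "!!a. 0 < a ==> a <= a0 ==> C0 * (2 * a) powr (1 / real d) <= \<eta> / 2"
  using exists_small_root[of "\<eta> / 2" C0] \<eta> C0_nonneg by auto
 obtain s where s: "s > 0" "!!t. \<bar>t\<bar> < s ==> \<bar>g t\<bar> <= mu0 / 4 * \<bar>t\<bar>" using small[of "mu0 / 4"] m by auto
 \<comment> \<open>Below 1/2 the quadratic bound on \<open>Th\<close> gives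
   \<open>\<bar>Th u\<bar> <= 2 * \<bar>u\<bar>\<close>, as \<open>tail_bound\<close>
   requires.\<close>
 define s' where "s' = min s (1/2)"
 have s': "s' > 0" unfolding s'_def using s by simp
 obtain R1 where R1: "R1 >= 1" "!!n i. rd n i >= R1 ==> \<bar>u n i\<bar> < s'" using far_small[OF s'] by blast
 \<comment> \<open>For large \<open>n\<close> the multiplier exceeds \<open>mu0 / 2\<close>; the
   nonlinearity consumes \<open>mu0 / 4\<close>, and \<open>psi_ge\<close> halves the rest.\<close>
 define cc where "cc = mu0 / 8"
 have cc: "cc > 0" unfolding cc_def using m by simp
 define R where "R = max R1 (4 / cc * (sqrt K * sqrt m0) / \<eta>)"
 have R: "R >= R1" "R > 0" unfolding R_def using R1 by auto
 have Rt: "2 / (cc * R) * (sqrt K * sqrt m0) <= \<eta> / 2"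
 proof -
  have "4 / cc * (sqrt K * sqrt m0) / \<eta> <= R" unfolding R_def by simp
  hence "4 / cc * (sqrt K * sqrt m0) <= R * \<eta>" by (subst (asm) pos_divide_le_eq[OF \<eta>])
  thus ?thesis using cc R(2) by (simp add: field_simps)
 qed
 have mun: "\<forall>\<^sub>F n in sequentially. \<mu> n > mu0 / 2" by (rule order_tendstoD(1)[OF mulim]) (use m in simp)
 show thesis
 proof (rule that[of a0 "2 * R"])
  show "0 < a0" by (rule a0)
  show "a0 <= 2 * R" using a0 R R1 by linarith
  fix a b assume a: "0 < a" "a <= a0" and b: "b >= 2 * R"
  have ab: "a <= b" using a b a0 R R1 by linarith
  have ev: "\<forall>\<^sub>F n in sequentially. m0 - \<eta> <= (\<Sum>l\<in>{ix (h n) a..<ix (h n) b}. h n * rd n l ^ e * (u n l)\<^sup>2)"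
   using ix_less_L[of b] mun
  proof eventually_elim
   case (elim n)
   have hr: "h n * rd n i ^ e >= 0" for i using h_pos[of n] rd_pos[of n i] by simp
   have ab': "\<bar>h n * rd n i ^ e * (u n i)\<^sup>2\<bar> = h n * rd n i ^ e * (u n i)\<^sup>2" for i using hr[of i] by simp
   have "m0 = (\<Sum>i<L n. h n * rd n i ^ e * (u n i)\<^sup>2)" using mass_eq[of n] elim(2) m by simp
   also have "\<dots> <= (\<Sum>i<L n. if rd n i < 2 * a then h n * rd n i ^ e * (u n i)\<^sup>2 else 0) + (\<Sum>i\<in>{ix (h n) a..<ix (h n) b}. h n * rd n i ^ e * (u n i)\<^sup>2) + (\<Sum>i<L n. if rd n i >= b then h n * rd n i ^ e * (u n i)\<^sup>2 else 0)"
    using window_split[OF a(1) ab elim(1), of "%i. h n * rd n i ^ e * (u n i)\<^sup>2"] unfolding ab' .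
   also have "(\<Sum>i<L n. if rd n i < 2 * a then h n * rd n i ^ e * (u n i)\<^sup>2 else 0) <= \<eta> / 2"
   proof -
    have "(\<Sum>i<L n. if rd n i < 2 * a then h n * rd n i ^ e * (u n i)\<^sup>2 else 0) <= (\<Sum>i<L n. if rd n i < 2 * a then h n * rd n i ^ e * ww (u n i) else 0)"
    proof (rule sum_mono)
     fix i
     have "(u n i)\<^sup>2 <= ww (u n i)" using ww_ge[of "u n i"] powr_ge_zero[of "\<bar>u n i\<bar>" "4 + 4 / real d"] by linarith
     hence "h n * rd n i ^ e * (u n i)\<^sup>2 <= h n * rd n i ^ e * ww (u n i)" by (rule mult_left_mono[OF _ hr])
     thus "(if rd n i < 2 * a then h n * rd n i ^ e * (u n i)\<^sup>2 else 0) <= (if rd n i < 2 * a then h n * rd n i ^ e * ww (u n i) else 0)" by simp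
    qed
    also have "\<dots> <= C0 * (2 * a) powr (1 / real d)" using near_origin[of "2 * a" n] a a0 by simp
    finally show ?thesis using a0(3)[OF a] by linarith
   qed
   also have "(\<Sum>i<L n. if rd n i >= b then h n * rd n i ^ e * (u n i)\<^sup>2 else 0) <= \<eta> / 2"
   proof -
    have "(\<Sum>i<L n. if rd n i >= b then h n * rd n i ^ e * (u n i)\<^sup>2 else 0) <= (\<Sum>i<L n. if 2 * R <= rd n i then h n * rd n i ^ e * (u n i)\<^sup>2 else 0)"
     using b hr by (intro sum_mono) auto
    also have "\<dots> <= 2 / (cc * R) * (sqrt (rlattice.Vk (L n) e (h n) (u n)) * sqrt m0)"
    proof (rule rlattice.tail_bound[OF rl cr R(2) cc, unfolded rrd])
     fix i assume i: "R <= rd n i"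
     have us: "\<bar>u n i\<bar> < s'" using R1(2)[of n i] i R by simp
     hence "\<bar>g (u n i)\<bar> <= mu0 / 4 * \<bar>u n i\<bar>" by (intro s) (simp add: s'_def)
     hence "\<bar>g (u n i)\<bar> * \<bar>psi (u n i)\<bar> <= mu0 / 4 * \<bar>u n i\<bar> * \<bar>psi (u n i)\<bar>" by (intro mult_right_mono) auto
     hence 1: "\<bar>g (u n i)\<bar> * \<bar>psi (u n i)\<bar> <= mu0 / 4 * (u n i * psi (u n i))" using abs_mult_psi[of "u n i"] by (simp add: mult.assoc)
     have 2: "g (u n i) * psi (u n i) <= \<bar>g (u n i)\<bar> * \<bar>psi (u n i)\<bar>" by (metis abs_ge_self abs_mult)
     have up: "u n i * psi (u n i) >= (u n i)\<^sup>2 / 2" by (rule psi_ge)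
     hence up0: "u n i * psi (u n i) >= 0" by (smt (verit) divide_nonneg_nonneg zero_le_power2)
     have "\<mu> n * (u n i * psi (u n i)) >= mu0 / 2 * (u n i * psi (u n i))" using elim(2) up0 by (intro mult_right_mono) auto
     hence "(\<mu> n * u n i - g (u n i)) * psi (u n i) >= mu0 / 4 * (u n i * psi (u n i))" using 1 2 by (simp add: algebra_simps)
     moreover have "mu0 / 4 * (u n i * psi (u n i)) >= mu0 / 4 * ((u n i)\<^sup>2 / 2)" using up m by (intro mult_left_mono) auto
     ultimately show "cc * (u n i)\<^sup>2 <= (\<mu> n * u n i - g (u n i)) * psi (u n i)" unfolding cc_def by simp
     have "2 * (u n i)\<^sup>2 <= \<bar>u n i\<bar>"
     proof -
      have "2 * (\<bar>u n i\<bar> * \<bar>u n i\<bar>) <= 2 * (1/2 * \<bar>u n i\<bar>)" using us unfolding s'_def by (intro mult_left_mono mult_right_mono) auto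
      thus ?thesis by (simp add: power2_eq_square)
     qed
     thus "\<bar>Th (u n i)\<bar> <= 2 * \<bar>u n i\<bar>" using Th_le_quadratic[of "u n i"] by linarith
    qed
    also have "\<dots> <= 2 / (cc * R) * (sqrt K * sqrt m0)" using Vk[of n] cc R(2) m0_pos by (intro mult_left_mono mult_right_mono) auto
    finally show ?thesis using Rt by linarith
   qed
   finally show ?case by linarith
  qed
  show "m0 - \<eta> <= integral {a..b} (%s. s ^ e * (Thi (v s))\<^sup>2)"
   by (rule tendsto_lowerbound[OF mass_limit(2)[OF a(1) ab] ev trivial_limit_sequentially])
 qed
qed

end

section \<open>Sign alternations of the limit\<close>

context conv
begin

lemma sgn_u_lim:
 assumes t: "t > 0" and c: "c * v t > 0"
 shows "\<forall>\<^sub>F n in sequentially. c * u n (ix (h n) t) > 0"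
proof -
 have "sgn (c * Thi (v t)) = sgn (c * v t)" by (simp add: sgn_mult sgn_Thi)
 hence "sgn (c * Thi (v t)) = 1" using c by simp
 hence "c * Thi (v t) > 0" by (simp only: sgn_1_pos)
 moreover have "(%n. c * u n (ix (h n) t)) \<longlonglongrightarrow> c * Thi (v t)" by (intro tendsto_intros u_lim t)
 ultimately show ?thesis by (simp add: order_tendstoD)
qed

text \<open>Strict signs at finitely many radii are inherited by the lattice functions for large
  \<open>n\<close>, and radii with opposite signs then fall into different cells.\<close>

theorem v_not_alt: "\<not> alt (Suc k) v"
proof
 assume "alt (Suc k) v"
 then obtain p s where p: "s = 1 \<or> s = -1" "!!j. j < Suc k ==> p j < p (Suc j)" "!!j. j <= Suc k ==> s * (-1) ^ j * v (p j) > 0"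
  by (rule altE) metis
 have pos: "p j > 0" if "j <= Suc k" for j using p(3)[OF that] v_nonpos[of "p j"] by (cases "p j <= 0") auto
 have "\<forall>\<^sub>F n in sequentially. \<forall>j\<in>{..Suc k}. s * (-1) ^ j * u n (ix (h n) (p j)) > 0"
  by (rule eventually_ball_finite) (auto intro!: sgn_u_lim pos p(3))
 then obtain n where n: "!!j. j <= Suc k ==> s * (-1) ^ j * u n (ix (h n) (p j)) > 0"
  using eventually_happens'[OF sequentially_bot] by (metis (no_types, lifting) atMost_iff)
 have "alt (Suc k) (u n)"
 proof (rule altI[of s _ "%j. ix (h n) (p j)"])
  fix j assume j: "j < Suc k"
  have "ix (h n) (p j) <= ix (h n) (p (Suc j))" using p(2)[OF j] pos[of j] j by (intro ix_mono) auto
  moreover have "ix (h n) (p j) \<noteq> ix (h n) (p (Suc j))"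
  proof
   assume e: "ix (h n) (p j) = ix (h n) (p (Suc j))"
   have "s * (-1) ^ j * u n (ix (h n) (p j)) > 0" "s * (-1) ^ Suc j * u n (ix (h n) (p (Suc j))) > 0" using n[of j] n[of "Suc j"] j by simp_all
   thus False unfolding e by simp
  qed
  ultimately show "ix (h n) (p j) < ix (h n) (p (Suc j))" by simp
 qed (use p n in auto)
 thus False using alts(2) by blast
qed

text \<open>Equicontinuity upgrades pointwise convergence to convergence along moving radii, as long
  as these stay away from the origin.\<close>

lemma moving_point:
 assumes s: "strict_mono s" and l: "(%n. rd (s n) (q n)) \<longlonglongrightarrow> l" and \<delta>: "\<delta> > 0" "!!n. rd (s n) (q n) >= \<delta>"
 shows "(%n. Th (u (s n) (q n))) \<longlonglongrightarrow> v l"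
proof -
 have hs: "(%n. h (s n)) \<longlonglongrightarrow> 0" using LIMSEQ_subseq_LIMSEQ[OF h0 s] by (simp add: o_def)
 have l\<delta>: "l >= \<delta>" by (rule LIMSEQ_le_const[OF l]) (use \<delta> in auto)
 define x where "x n = real (q n) * h (s n)" for n
 have xr: "x n = rd (s n) (q n) - h (s n)" for n unfolding x_def rd_def by (simp add: algebra_simps)
 have ixx: "ix (h (s n)) (x n) = q n" for n
  by (rule ix_eq) (use h_pos[of "s n"] in \<open>auto simp: x_def algebra_simps\<close>)
 have xl: "x \<longlonglongrightarrow> l" using tendsto_diff[OF l hs] unfolding xr[abs_def] by simp
 have B: "\<forall>\<^sub>F n in sequentially. norm (vs (s n) (x n) - vs (s n) l) <= sqrt (K * (\<bar>x n - l\<bar> + h (s n)) / (\<delta> / 2) ^ e)"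
  using order_tendstoD(1)[OF xl, of "\<delta> / 2"]
 proof (rule eventually_mono)
  show "\<delta> / 2 < l" using l\<delta> \<delta> by simp
  fix n assume x: "x n > \<delta> / 2"
  have key: "\<bar>vs (s n) a - vs (s n) b\<bar> <= sqrt (K * (\<bar>x n - l\<bar> + h (s n)) / (\<delta> / 2) ^ e)" if ab: "\<delta> / 2 < a" "a <= b" "b - a = \<bar>x n - l\<bar>" for a b
  proof -
   have "\<bar>vs (s n) a - vs (s n) b\<bar> <= sqrt (K * (b - a + h (s n)) / a ^ e)" using ab \<delta> by (intro vs_cont) auto
   also have "\<dots> <= sqrt (K * (b - a + h (s n)) / (\<delta> / 2) ^ e)"
    using ab \<delta> K1 h_pos[of "s n"] by (intro real_sqrt_le_mono divide_left_mono power_mono mult_nonneg_nonneg mult_pos_pos zero_less_power) auto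
   finally show ?thesis unfolding ab(3) .
  qed
  show "norm (vs (s n) (x n) - vs (s n) l) <= sqrt (K * (\<bar>x n - l\<bar> + h (s n)) / (\<delta> / 2) ^ e)"
  proof (cases "x n <= l")
   case True thus ?thesis using key[of "x n" l] x by simp
  next
   case False thus ?thesis using key[of l "x n"] l\<delta> \<delta> by (simp add: abs_minus_commute)
  qed
 qed
 have "(%n. sqrt (K * (\<bar>x n - l\<bar> + h (s n)) / (\<delta> / 2) ^ e)) \<longlonglongrightarrow> sqrt (K * (\<bar>l - l\<bar> + 0) / (\<delta> / 2) ^ e)"
  using \<delta> by (intro tendsto_intros xl hs) auto
 hence "(%n. vs (s n) (x n) - vs (s n) l) \<longlonglongrightarrow> 0" using Lim_null_comparison[OF B] by simp
 moreover have "(%n. vs (s n) l) \<longlonglongrightarrow> v l" using LIMSEQ_subseq_LIMSEQ[OF vlim s] l\<delta> \<delta> by (simp add: o_def)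
 ultimately have "(%n. (vs (s n) (x n) - vs (s n) l) + vs (s n) l) \<longlonglongrightarrow> 0 + v l" by (rule tendsto_add)
 thus ?thesis unfolding vs_def ixx by simp
qed

text \<open>By the decay bound the ratio of the nonlinearity to \<open>Th u\<close> is of order
  \<open>r powr (1 / d - 1)\<close>: the potential that \<open>block_not_small\<close> compares with
  the Dirichlet energy.\<close>

lemma FF_near_origin:
 assumes r: "rd n i <= 1"
 shows "\<bar>FF g (\<mu> n) (u n i)\<bar> <= ((Cg + M) * (1 + 2 * (2 * CV) powr (2 / real d))) * rd n i powr (1 / real d - 1) * \<bar>Th (u n i)\<bar>"
proof -
 define r where "r = rd n i"
 define T where "T = \<bar>Th (u n i)\<bar>"
 have r0: "r > 0" unfolding r_def by (rule rd_pos)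
 have d0: "real d > 0" using d2 by simp
 have T0: "T >= 0" unfolding T_def by simp
 have a: "1 <= r powr (1 / real d - 1)"
 proof -
  have "1 / real d - 1 <= 0" using d2 by (simp add: field_simps)
  hence "1 powr (1 / real d - 1) <= r powr (1 / real d - 1)" using r r0 unfolding r_def[symmetric] by (intro powr_mono2') auto
  thus ?thesis by simp
 qed
 have b: "(2 * T) powr (1 + 2 / real d) <= 2 * (2 * CV) powr (2 / real d) * r powr (1 / real d - 1) * T"
 proof (cases "T = 0")
  case False
  have "(2 * T) powr (2 / real d) <= (2 * CV * r powr (- real e / 2)) powr (2 / real d)"
   using pw[of n i] T0 unfolding T_def r_def by (intro powr_mono2) auto
  also have "\<dots> = (2 * CV) powr (2 / real d) * r powr ((- real e / 2) * (2 / real d))"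
   using CV_pos r0 by (simp add: powr_mult powr_powr)
  also have "(- real e / 2) * (2 / real d) = 1 / real d - 1" using d0 de by (simp add: field_simps)
  finally have "2 * T * (2 * T) powr (2 / real d) <= 2 * T * ((2 * CV) powr (2 / real d) * r powr (1 / real d - 1))"
   using T0 by (intro mult_left_mono) auto
  moreover have "(2 * T) powr (1 + 2 / real d) = 2 * T * (2 * T) powr (2 / real d)" using False T0 by (simp add: powr_add)
  ultimately show ?thesis by (simp add: mult_ac)
 qed simp
 have "\<bar>FF g (\<mu> n) (u n i)\<bar> <= (Cg + M) * (T + (2 * T) powr (1 + 2 / real d))" unfolding T_def by (rule FF_le)
 also have "\<dots> <= (Cg + M) * (r powr (1 / real d - 1) * T + 2 * (2 * CV) powr (2 / real d) * r powr (1 / real d - 1) * T)"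
  using mult_right_mono[OF a T0] b Cg M_nonneg by (intro mult_left_mono add_mono) auto
 finally show ?thesis unfolding r_def T_def by (simp add: algebra_simps)
qed

text \<open>The nodal points with index at least 1 stay between \<delta> and \<open>R0\<close>, so
  along a subsequence they converge to radii where \<open>v\<close> keeps amplitude
  \<open>s1\<close>. The point with index 0 may be lost at the origin, which costs one
  alternation.\<close>

theorem v_alt:
 assumes m: "mu0 > 0" and k: "k >= 1"
 shows "alt (k - 1) v"
proof -
 define CF where "CF = (Cg + M) * (1 + 2 * (2 * CV) powr (2 / real d))"
 have CF: "CF >= 0" unfolding CF_def using Cg M_nonneg by (intro mult_nonneg_nonneg) auto
 \<comment> \<open>Makes the smallness condition \<open>sm\<close> hold with a factor 1/2 to spare;
   the cap 1 keeps \<open>\<delta> powr (1 / d)\<close> at most 1.\<close>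
 define \<delta> where "\<delta> = min 1 (1 / (2 * (CF + 1) * real d))"
 have d0: "real d > 0" using d2 by simp
 have \<delta>: "\<delta> > 0" "\<delta> <= 1" unfolding \<delta>_def using CF d0 by auto
 have sm: "CF * \<delta> * (real d * \<delta> powr (1 / real d)) < 1"
 proof -
  have "\<delta> powr (1 / real d) <= 1" using powr_mono2[of "1 / real d" \<delta> 1] \<delta> d0 by simp
  hence "CF * \<delta> * (real d * \<delta> powr (1 / real d)) <= CF * \<delta> * (real d * 1)" using CF \<delta> d0 by (intro mult_left_mono) auto
  also have "\<dots> <= CF * (1 / (2 * (CF + 1) * real d)) * (real d * 1)" using CF d0 unfolding \<delta>_def by (intro mult_right_mono mult_left_mono) auto
  also have "\<dots> < 1" using CF d0 by (simp add: divide_simps)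
  finally show ?thesis .
 qed
 obtain s1 where s1: "s1 > 0" "!!t. \<bar>t\<bar> < s1 ==> \<bar>g t\<bar> <= mu0 / 2 * \<bar>t\<bar>" using small[of "mu0 / 2"] m by auto
 obtain R0 where R0: "R0 >= 1" "!!n i. rd n i >= R0 ==> \<bar>u n i\<bar> < s1" using far_small[OF s1(1)] by blast
 have "\<forall>\<^sub>F n in sequentially. \<mu> n > mu0 / 2" by (rule order_tendstoD(1)[OF mulim]) (use m in simp)
 then obtain N where N: "!!n. n >= N ==> \<mu> n > mu0 / 2" unfolding eventually_sequentially by blast
 define P where "P n q \<sigma> \<longleftrightarrow> (\<sigma> = 1 \<or> \<sigma> = -1) \<and> (\<forall>j<k. q j < q (Suc j)) \<and> (\<forall>j. 1 <= j --> j <= k --> rd n (q j) >= \<delta>) \<and> (\<forall>j\<le>k. \<sigma> * (-1) ^ j * u n (q j) >= s1)"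
  for n q and \<sigma> :: real
 have "\<exists>q \<sigma>. n >= N --> P n q \<sigma>" for n
 proof (cases "n >= N")
  case True
  have F: "\<bar>FF g (\<mu> n) (u n i)\<bar> <= CF * rlattice.rr (h n) i powr (1 / real d - 1) * \<bar>Th (u n i)\<bar>" if "rlattice.rr (h n) i < \<delta>" for i
   using FF_near_origin[of n i] that \<delta>(2) unfolding rrd CF_def by simp
  have gg: "\<bar>g t\<bar> <= \<mu> n * \<bar>t\<bar>" if "\<bar>t\<bar> < s1" for t
   using s1(2)[OF that] mult_right_mono[of "mu0 / 2" "\<mu> n" "\<bar>t\<bar>"] N[OF True] by simp
  show ?thesis
  proof (rule rlattice.nodal_points[OF rl[of n] cr[of n] alts(1)[of n] \<delta>(1) F CF sm gg, unfolded rrd])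
   fix q \<sigma>
   assume "\<sigma> = 1 \<or> \<sigma> = -1" "!!j. j < k ==> q j < q (Suc j)" "!!j. 1 <= j ==> j <= k ==> rd n (q j) >= \<delta>"
    "!!j. j <= k ==> \<sigma> * (-1) ^ j * u n (q j) >= s1 \<and> \<sigma> * (-1) ^ j * u n (q j) > 0"
   thus ?thesis unfolding P_def by (intro exI[of _ q] exI[of _ \<sigma>]) simp
  qed
 qed blast
 then obtain q \<sigma> where "!!n. n >= N ==> P n (q n) (\<sigma> n)" by metis
 hence q: "!!n. n >= N ==> \<sigma> n = 1 \<or> \<sigma> n = (-1::real)" "!!n j. n >= N ==> j < k ==> q n j < q n (Suc j)"
  "!!n j. n >= N ==> 1 <= j ==> j <= k ==> rd n (q n j) >= \<delta>" "!!n j. n >= N ==> j <= k ==> \<sigma> n * (-1) ^ j * u n (q n j) >= s1"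
  unfolding P_def by blast+
 have sg: "\<sigma> n * (-1) ^ j = 1 \<or> \<sigma> n * (-1) ^ j = -1" if "n >= N" for n j by (rule sign_cases[OF q(1)[OF that]])
 have qR: "rd n (q n j) < R0" if "n >= N" "j <= k" for n j
  using R0(2)[of n "q n j"] q(4)[OF that] sg[OF that(1), of j] s1(1) by (cases "rd n (q n j) >= R0") auto
 have qT: "\<sigma> n * (-1) ^ j * Th (u n (q n j)) >= s1" if "n >= N" "j <= k" for n j
 proof -
  have "\<sigma> n * (-1) ^ j * u n (q n j) > 0" using q(4)[OF that] s1 by linarith
  hence "sgn (\<sigma> n * (-1) ^ j * u n (q n j)) = 1" by (simp only: sgn_1_pos)
  moreover have "sgn (\<sigma> n * (-1) ^ j * Th (u n (q n j))) = sgn (\<sigma> n * (-1) ^ j * u n (q n j))" by (simp only: sgn_mult sgn_Th)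
  ultimately have "sgn (\<sigma> n * (-1) ^ j * Th (u n (q n j))) = 1" by simp
  hence "\<sigma> n * (-1) ^ j * Th (u n (q n j)) > 0" by (simp add: sgn_1_pos)
  hence "\<sigma> n * (-1) ^ j * Th (u n (q n j)) = \<bar>Th (u n (q n j))\<bar>" using sg[OF that(1), of j] by auto
  moreover have "s1 <= \<bar>u n (q n j)\<bar>" using q(4)[OF that] sg[OF that(1), of j] by auto
  ultimately show ?thesis using abs_le_Th[of "u n (q n j)"] by linarith
 qed
 \<comment> \<open>Slot 0 stores the global sign and slot \<open>j\<close> the radius of the point
   \<open>j\<close>, so a single bounded sequence yields a common subsequence.\<close>
 define x where "x n j = (if n >= N \<and> j <= k then (if j = 0 then \<sigma> n else rd n (q n j)) else 0)" for n j
 have xB: "\<bar>x n j\<bar> <= R0" for n j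
  using q(1)[of n] qR[of n j] R0(1) rd_pos[of n "q n j"] by (auto simp: x_def)
 obtain l s where s: "strict_mono s" "!!j. (%n. x (s n) j) \<longlonglongrightarrow> l j" using bounded_fun_subseq[of x "%_. R0"] xB by metis
 define s' where "s' n = s (n + N)" for n
 have s': "strict_mono s'" using s(1) unfolding s'_def strict_mono_def by simp
 have sN: "s' n >= N" for n unfolding s'_def using seq_suble[OF s(1), of "n + N"] by linarith
 have xl: "(%n. x (s' n) j) \<longlonglongrightarrow> l j" for j using LIMSEQ_ignore_initial_segment[OF s(2)[of j], of N] unfolding s'_def .
 have \<sigma>l: "(%n. \<sigma> (s' n)) \<longlonglongrightarrow> l 0" using xl[of 0] sN by (simp add: x_def)
 have ql: "(%n. rd (s' n) (q (s' n) j)) \<longlonglongrightarrow> l j" if "1 <= j" "j <= k" for j using xl[of j] sN that by (simp add: x_def)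
 have "(%n. (\<sigma> (s' n))\<^sup>2) \<longlonglongrightarrow> (l 0)\<^sup>2" by (intro tendsto_intros \<sigma>l)
 moreover have "(\<sigma> (s' n))\<^sup>2 = 1" for n using q(1)[OF sN, of n] by auto
 ultimately have "(%n. 1) \<longlonglongrightarrow> (l 0)\<^sup>2" by simp
 hence "(l 0)\<^sup>2 = 1" by (simp add: LIMSEQ_const_iff)
 hence l0: "l 0 = 1 \<or> l 0 = -1" by (simp add: power2_eq_1_iff)
 have vl: "l 0 * (-1) ^ j * v (l j) >= s1" if j: "1 <= j" "j <= k" for j
 proof (rule LIMSEQ_le_const)
  have "(%n. Th (u (s' n) (q (s' n) j))) \<longlonglongrightarrow> v (l j)" by (rule moving_point[OF s' ql[OF j] \<delta>(1) q(3)[OF sN j]])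
  thus "(%n. \<sigma> (s' n) * (-1) ^ j * Th (u (s' n) (q (s' n) j))) \<longlonglongrightarrow> l 0 * (-1) ^ j * v (l j)" by (intro tendsto_intros \<sigma>l)
  show "\<exists>N. \<forall>n\<ge>N. s1 <= \<sigma> (s' n) * (-1) ^ j * Th (u (s' n) (q (s' n) j))" using qT[OF sN j(2)] by blast
 qed
 show ?thesis
 proof (rule altI[of "- l 0" _ "%j. l (Suc j)"])
  show "- l 0 = 1 \<or> - l 0 = -1" using l0 by auto
  show "- l 0 * (-1) ^ j * v (l (Suc j)) > 0" if "j <= k - 1" for j
  proof -
   have "Suc j <= k" using that k by simp
   from less_le_trans[OF s1(1) vl[OF _ this]] have "0 < l 0 * (-1) ^ Suc j * v (l (Suc j))" by simp
   thus ?thesis by simp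
  qed
  fix j assume j: "j < k - 1"
  have "l (Suc j) <= l (Suc (Suc j))"
  proof (rule LIMSEQ_le[OF ql ql])
   show "\<exists>N. \<forall>n\<ge>N. rd (s' n) (q (s' n) (Suc j)) <= rd (s' n) (q (s' n) (Suc (Suc j)))"
    using rd_mono[OF less_imp_le[OF q(2)[OF sN]]] j by auto
  qed (use j in auto)
  moreover have "l (Suc j) \<noteq> l (Suc (Suc j))" 
  proof
   assume e: "l (Suc j) = l (Suc (Suc j))"
   have jk: "Suc j <= k" "Suc (Suc j) <= k" "1 <= Suc j" "1 <= Suc (Suc j)" using j by simp_all
   note less_le_trans[OF s1(1) vl[OF jk(3,1)]] less_le_trans[OF s1(1) vl[OF jk(4,2)]]
   thus False unfolding e by simp
  qed
  ultimately show "l (Suc j) < l (Suc (Suc j))" by simp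
 qed
qed

end

section \<open>The limit equation\<close>

text \<open>Both \<open>W - v\<close> and \<open>W + v\<close> are nonincreasing. With explicit
  powers as \<open>W\<close> this integrates bounds on the slope of \<open>v\<close>.\<close>

lemma derivative_comparison:
 fixes v W :: "real => real"
 assumes "t <= T" and v: "!!s. t <= s ==> s <= T ==> (v has_real_derivative v' s) (at s)"
  and W: "!!s. t <= s ==> s <= T ==> (W has_real_derivative W' s) (at s)"
  and le: "!!s. t <= s ==> s <= T ==> \<bar>v' s\<bar> <= - W' s"
 shows "\<bar>v t - v T\<bar> <= W t - W T"
proof -
 have "W T - v T <= W t - v t"
 proof (rule DERIV_nonpos_imp_nonincreasing[OF assms(1), where f = "%s. W s - v s"])
  show "\<exists>y. ((%s. W s - v s) has_real_derivative y) (at x) \<and> y <= 0" if "t <= x" "x <= T" for x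
   using DERIV_diff[OF W[OF that] v[OF that]] le[OF that] by (intro exI[of _ "W' x - v' x"]) auto
 qed
 moreover have "W T + v T <= W t + v t"
 proof (rule DERIV_nonpos_imp_nonincreasing[OF assms(1), where f = "%s. W s + v s"])
  show "\<exists>y. ((%s. W s + v s) has_real_derivative y) (at x) \<and> y <= 0" if "t <= x" "x <= T" for x
   using DERIV_add[OF W[OF that] v[OF that]] le[OF that] by (intro exI[of _ "W' x + v' x"]) auto
 qed
 ultimately show ?thesis by linarith
qed

context conv
begin

abbreviation "Fv s \<equiv> FF g mu0 (Thi (v s))"

lemma FF0_le: "\<bar>FF g mu0 s\<bar> <= (Cg + M) * (\<bar>Th s\<bar> + (2 * \<bar>Th s\<bar>) powr (1 + 2 / real d))"
proof -
 have "\<bar>FF g mu0 s\<bar> <= (Cg + mu0) * (\<bar>Th s\<bar> + (2 * \<bar>Th s\<bar>) powr (1 + 2 / real d))" by (rule FF_bound[OF growth(1) mu0_bounds(1) Cg])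
 also have "\<dots> <= (Cg + M) * (\<bar>Th s\<bar> + (2 * \<bar>Th s\<bar>) powr (1 + 2 / real d))" using mu0_bounds by (intro mult_right_mono) auto
 finally show ?thesis .
qed

lemma v_isCont: assumes t: "t > 0" shows "isCont v t"
proof -
 have "continuous_on {t/2..t+1} (%x. v (t/2) - integral {t/2..x} (%s. Psi s / s ^ e))"
  using t by (intro continuous_intros indefinite_integral_continuous_1 v_difference(1)) auto
 moreover have "v (t/2) - integral {t/2..x} (%s. Psi s / s ^ e) = v x" if "x \<in> {t/2..t+1}" for x
  using v_difference(2)[of "t/2" x] that t by simp
 ultimately have "continuous_on {t/2..t+1} v" by (rule continuous_on_eq)
 thus ?thesis by (rule continuous_on_interior) (use t in simp)
qed

lemma Fv_isCont: assumes t: "t > 0" shows "isCont (%s. Fv s) t"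
 using v_isCont[OF t] unfolding isCont_def by (intro tendsto_FF[OF g_cont tendsto_const] tendsto_Thi)

lemma phi_isCont: assumes t: "t > 0" shows "isCont phi t"
 unfolding phi_def[abs_def] by (intro continuous_intros Fv_isCont t)

lemma Psi_deriv: assumes t: "t > 0" shows "(Psi has_real_derivative phi t) (at t)"
proof -
 have "((%x. integral {0..x} phi) has_vector_derivative phi t) (at t within {0..t+1})"
  by (rule integral_has_vector_derivative_continuous_at[where S = "{}", simplified]) (use t in \<open>auto intro!: Pn_lim(1) continuous_at_imp_continuous_at_within phi_isCont\<close>)
 hence "(Psi has_vector_derivative phi t) (at t)" unfolding Psi_def[abs_def] using t by (simp add: at_within_Icc_at)
 thus ?thesis by (simp add: has_real_derivative_iff_has_vector_derivative)
qed

lemma Psi_isCont: "t > 0 ==> isCont Psi t" by (rule DERIV_isCont[OF Psi_deriv])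

lemma v_deriv: assumes t: "t > 0" shows "(v has_real_derivative - (Psi t / t ^ e)) (at t)"
proof -
 have "((%x. integral {t/2..x} (%s. Psi s / s ^ e)) has_vector_derivative Psi t / t ^ e) (at t within {t/2..t+1})"
 proof (rule integral_has_vector_derivative_continuous_at[where S = "{}", simplified])
  show "(%s. Psi s / s ^ e) integrable_on {t/2..t+1}" by (rule v_difference(1)) (use t in auto)
  show "continuous (at t within {t/2..t+1}) (%s. Psi s / s ^ e)"
   by (rule continuous_at_imp_continuous_at_within) (intro isCont_divide isCont_power Psi_isCont t continuous_ident, use t in simp)
 qed (use t in auto)
 hence "((%x. integral {t/2..x} (%s. Psi s / s ^ e)) has_real_derivative Psi t / t ^ e) (at t)"
  using t by (simp add: at_within_Icc_at has_real_derivative_iff_has_vector_derivative)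
 hence "((%x. v (t/2) - integral {t/2..x} (%s. Psi s / s ^ e)) has_real_derivative 0 - Psi t / t ^ e) (at t)"
  by (intro DERIV_diff DERIV_const)
 hence D: "((%x. v (t/2) - integral {t/2..x} (%s. Psi s / s ^ e)) has_real_derivative - (Psi t / t ^ e)) (at t)" by simp
 show ?thesis
 proof (rule has_field_derivative_transform_within_open[OF D])
  show "open {t/2<..<t+1}" "t \<in> {t/2<..<t+1}" using t by auto
  show "v (t/2) - integral {t/2..x} (%s. Psi s / s ^ e) = v x" if "x \<in> {t/2<..<t+1}" for x
   using v_difference(2)[of "t/2" x] that t by simp
 qed
qed

lemma e1: "e >= 1" using d2 de by simp
lemma phi_0: "phi 0 = 0" unfolding phi_def using e1 by simp

lemma Psi_bound:
 assumes t: "t > 0" and B: "B >= 0" "!!s. 0 < s ==> s <= t ==> \<bar>phi s\<bar> <= B"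
 shows "\<bar>Psi t\<bar> <= B * t"
proof -
 have "norm (Psi t) <= B * measure lborel {0..t}"
 proof (rule has_integral_bound_real[OF B(1), where S = "{}"])
  show "(phi has_integral Psi t) {0..t}" unfolding Psi_def by (rule integrable_integral[OF Pn_lim(1)[OF t]])
  show "norm (phi x) <= B" if "x \<in> {0..t} - {}" for x
   using that B(2)[of x] phi_0 B(1) by (cases "x = 0") auto
 qed simp
 thus ?thesis using t by simp
qed

text \<open>For \<open>\<alpha> <= e / 2\<close> the superlinear part of the nonlinearity costs at
  most \<open>e / d = 1 - 1 / d\<close> further powers, because
  \<open>2 * \<alpha> / d <= e / d\<close>. Integration over the ball gains one power, so the slope
  has order \<open>1 / d - \<alpha>\<close>.\<close>

lemma bootstrap_step:
 assumes v: "!!s. 0 < s ==> s <= 1 ==> \<bar>v s\<bar> <= C * s powr (- \<alpha>)" and C: "C >= 0" and \<alpha>: "0 <= \<alpha>" "\<alpha> <= real e / 2"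
 obtains C1 where "C1 >= 0" "!!t. 0 < t ==> t <= 1 ==> \<bar>Psi t / t ^ e\<bar> <= C1 * t powr (1 / real d - \<alpha>)"
proof -
 define C1 where "C1 = (Cg + M) * (C + (2 * C) powr (1 + 2 / real d))"
 have C1: "C1 >= 0" unfolding C1_def using Cg M_nonneg C by simp
 have d0: "real d >= 2" using d2 by simp
 have de: "real e = real d - 1" using de by simp
 define \<gamma> where "\<gamma> = real e - \<alpha> - real e / real d"
 have "real e / real d <= real e / 2" using d0 by (intro divide_left_mono) auto
 hence \<gamma>: "\<gamma> >= 0" unfolding \<gamma>_def using \<alpha> by linarith
 have ed: "real e / real d = 1 - 1 / real d" using d0 de by (simp add: field_simps)
 have F: "\<bar>Fv s\<bar> <= C1 * s powr (- \<alpha> - real e / real d)" if s: "0 < s" "s <= 1" for s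
 proof -
  have "0 <= real e / real d" by simp
  hence a: "s powr (- \<alpha>) <= s powr (- \<alpha> - real e / real d)" using s by (intro powr_mono') auto
  have "\<alpha> * (2 / real d) <= real e / 2 * (2 / real d)" using \<alpha> by (intro mult_right_mono) auto
  hence b': "- \<alpha> - real e / real d <= - \<alpha> * (1 + 2 / real d)" by (simp add: algebra_simps)
  have "(2 * \<bar>v s\<bar>) powr (1 + 2 / real d) <= (2 * C * s powr (- \<alpha>)) powr (1 + 2 / real d)"
   using v[OF s] by (intro powr_mono2) auto
  also have "\<dots> = (2 * C) powr (1 + 2 / real d) * s powr (- \<alpha> * (1 + 2 / real d))" using C s by (simp add: powr_mult powr_powr)
  also have "\<dots> <= (2 * C) powr (1 + 2 / real d) * s powr (- \<alpha> - real e / real d)"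
   using s by (intro mult_left_mono powr_mono'[OF b']) auto
  finally have b: "(2 * \<bar>v s\<bar>) powr (1 + 2 / real d) <= (2 * C) powr (1 + 2 / real d) * s powr (- \<alpha> - real e / real d)" .
  have "\<bar>Fv s\<bar> <= (Cg + M) * (\<bar>v s\<bar> + (2 * \<bar>v s\<bar>) powr (1 + 2 / real d))" using FF0_le[of "Thi (v s)"] by simp
  also have "\<dots> <= (Cg + M) * (C * s powr (- \<alpha> - real e / real d) + (2 * C) powr (1 + 2 / real d) * s powr (- \<alpha> - real e / real d))"
   using Cg M_nonneg order_trans[OF v[OF s] mult_left_mono[OF a C]] b by (intro mult_left_mono add_mono) auto
  finally show ?thesis unfolding C1_def by (simp add: algebra_simps)
 qed
 show thesis
 proof (rule that[OF C1])
  fix t :: real assume t: "0 < t" "t <= 1"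
  have "\<bar>phi s\<bar> <= C1 * t powr \<gamma>" if s: "0 < s" "s <= t" for s
  proof -
   have "\<bar>phi s\<bar> = s ^ e * \<bar>Fv s\<bar>" unfolding phi_def abs_mult using s by simp
   also have "\<dots> <= s ^ e * (C1 * s powr (- \<alpha> - real e / real d))" using F[of s] s t by (intro mult_left_mono) auto
   also have "\<dots> = C1 * (s powr real e * s powr (- \<alpha> - real e / real d))" using s by (simp add: powr_realpow)
   also have "s powr real e * s powr (- \<alpha> - real e / real d) = s powr \<gamma>"
   proof -
    have "real e + (- \<alpha> - real e / real d) = \<gamma>" unfolding \<gamma>_def by simp
    thus ?thesis by (simp only: powr_add[symmetric])
   qed
   also have "C1 * s powr \<gamma> <= C1 * t powr \<gamma>" using s \<gamma> C1 by (intro mult_left_mono powr_mono2) auto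
   finally show ?thesis .
  qed
  hence "\<bar>Psi t\<bar> <= C1 * t powr \<gamma> * t" using C1 by (intro Psi_bound[OF t(1)]) auto
  hence "\<bar>Psi t / t ^ e\<bar> <= C1 * t powr \<gamma> * t / t ^ e" unfolding abs_divide using t by (simp add: divide_right_mono)
  also have "\<dots> = C1 * (t powr \<gamma> * t powr 1 / t powr real e)" using t by (simp add: powr_realpow)
  also have "t powr \<gamma> * t powr 1 / t powr real e = t powr (\<gamma> + 1 - real e)" by (simp only: powr_add powr_diff)
  also have "\<gamma> + 1 - real e = 1 / real d - \<alpha>" unfolding \<gamma>_def ed by simp
  finally show "\<bar>Psi t / t ^ e\<bar> <= C1 * t powr (1 / real d - \<alpha>)" .
 qed
qed

text \<open>Each round integrates the slope and lowers the exponent by 1. Once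
  \<open>\<alpha> <= 1\<close> the slope has the integrable order \<open>1 / d - 1\<close> and
  \<open>v\<close> is bounded.\<close>

lemma v_bounded_aux:
 "\<alpha> <= 1 + real n ==> 0 <= \<alpha> ==> \<alpha> <= real e / 2 ==> C >= 0 ==> (!!s. 0 < s ==> s <= 1 ==> \<bar>v s\<bar> <= C * s powr (- \<alpha>)) ==>
  \<exists>B\<ge>0. \<forall>s. 0 < s --> s <= 1 --> \<bar>v s\<bar> <= B"
proof (induction n arbitrary: \<alpha> C)
 case 0
 obtain C1 where C1: "C1 >= 0" "!!t. 0 < t ==> t <= 1 ==> \<bar>Psi t / t ^ e\<bar> <= C1 * t powr (1 / real d - \<alpha>)"
  using bootstrap_step[OF 0(5,4,2,3)] by blast
 have d0: "real d > 0" using d2 by simp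
 have "\<bar>v s\<bar> <= \<bar>v 1\<bar> + C1 * real d" if s: "0 < s" "s <= 1" for s
 proof -
  have "\<bar>v s - v 1\<bar> <= - C1 * real d * s powr (1 / real d) - (- C1 * real d * 1 powr (1 / real d))"
  proof (rule derivative_comparison[OF s(2), where v' = "%s. - (Psi s / s ^ e)" and W' = "%s. - C1 * s powr (1 / real d - 1)"])
   fix t assume t: "s <= t" "t <= 1"
   have t0: "t > 0" using s t by simp
   show "(v has_real_derivative - (Psi t / t ^ e)) (at t)" by (rule v_deriv[OF t0])
   show "((%x. - C1 * real d * x powr (1 / real d)) has_real_derivative - C1 * t powr (1 / real d - 1)) (at t)"
    using t0 d0 by (auto intro!: derivative_eq_intros simp: powr_diff field_simps)
   have "\<bar>Psi t / t ^ e\<bar> <= C1 * t powr (1 / real d - \<alpha>)" by (rule C1(2)[OF t0 t(2)])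
   also have "\<dots> <= C1 * t powr (1 / real d - 1)" using t t0 0(1) C1(1) by (intro mult_left_mono powr_mono') auto
   finally show "\<bar>- (Psi t / t ^ e)\<bar> <= - (- C1 * t powr (1 / real d - 1))" by simp
  qed
  moreover have "0 <= C1 * real d * s powr (1 / real d)" using C1(1) by simp
  ultimately have "\<bar>v s - v 1\<bar> <= C1 * real d" by simp
  thus ?thesis by linarith
 qed
 thus ?case using C1(1) by (intro exI[of _ "\<bar>v 1\<bar> + C1 * real d"]) auto
next
 case (Suc n)
 show ?case
 proof (cases "\<alpha> <= 1 + real n")
  case True thus ?thesis by (rule Suc.IH[OF _ Suc.prems(2,3,4,5)])
 next
  case False
  hence a1: "\<alpha> - 1 > 0" by simp
  obtain C1 where C1: "C1 >= 0" "!!t. 0 < t ==> t <= 1 ==> \<bar>Psi t / t ^ e\<bar> <= C1 * t powr (1 / real d - \<alpha>)"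
   using bootstrap_step[OF Suc.prems(5,4,2,3)] by blast
  define c where "c = C1 / (\<alpha> - 1)"
  have c: "c >= 0" "c * (\<alpha> - 1) = C1" unfolding c_def using C1(1) a1 by auto
  show ?thesis
  proof (rule Suc.IH[of "\<alpha> - 1" "\<bar>v 1\<bar> + c"])
   fix s :: real assume s: "0 < s" "s <= 1"
   have "\<bar>v s - v 1\<bar> <= c * s powr (1 - \<alpha>) - c * 1 powr (1 - \<alpha>)"
   proof (rule derivative_comparison[OF s(2), where v' = "%s. - (Psi s / s ^ e)" and W' = "%s. c * ((1 - \<alpha>) * s powr (1 - \<alpha> - 1))"])
    fix t assume t: "s <= t" "t <= 1"
    have t0: "t > 0" using s t by simp
    show "(v has_real_derivative - (Psi t / t ^ e)) (at t)" by (rule v_deriv[OF t0])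
    show "((%x. c * x powr (1 - \<alpha>)) has_real_derivative c * ((1 - \<alpha>) * t powr (1 - \<alpha> - 1))) (at t)"
     using t0 by (intro DERIV_cmult has_real_derivative_powr)
    have "\<bar>Psi t / t ^ e\<bar> <= C1 * t powr (1 / real d - \<alpha>)" by (rule C1(2)[OF t0 t(2)])
    also have "\<dots> <= C1 * t powr (- \<alpha>)" using t t0 C1(1) by (intro mult_left_mono powr_mono') auto
    also have "\<dots> = - (c * ((1 - \<alpha>) * t powr (1 - \<alpha> - 1)))" unfolding c(2)[symmetric] by (simp add: algebra_simps)
    finally show "\<bar>- (Psi t / t ^ e)\<bar> <= - (c * ((1 - \<alpha>) * t powr (1 - \<alpha> - 1)))" by simp
   qed
   hence "\<bar>v s\<bar> <= \<bar>v 1\<bar> + c * s powr (1 - \<alpha>)" using c(1) by simp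
   also have "\<dots> <= \<bar>v 1\<bar> * s powr (1 - \<alpha>) + c * s powr (1 - \<alpha>)"
   proof -
    have "1 powr (1 - \<alpha>) <= s powr (1 - \<alpha>)" using s a1 by (intro powr_mono2') auto
    hence "\<bar>v 1\<bar> * 1 <= \<bar>v 1\<bar> * s powr (1 - \<alpha>)" by (intro mult_left_mono) auto
    thus ?thesis by simp
   qed
   finally show "\<bar>v s\<bar> <= (\<bar>v 1\<bar> + c) * s powr (- (\<alpha> - 1))" by (simp add: algebra_simps)
  qed (use Suc.prems a1 c in auto)
 qed
qed

lemma near_zero:
 obtains CB where "CB >= 0" "!!t. 0 < t ==> t <= 1 ==> \<bar>Psi t / t ^ e\<bar> <= CB * t"
proof -
 obtain n where n: "real e / 2 <= real n" using real_arch_simple by blast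
 obtain B where B: "B >= 0" "!!s. 0 < s ==> s <= 1 ==> \<bar>v s\<bar> <= B"
  using v_bounded_aux[of "real e / 2" n CV] n v_pw CV_pos by auto
 define CB where "CB = (Cg + M) * (B + (2 * B) powr (1 + 2 / real d))"
 have CB: "CB >= 0" unfolding CB_def using B Cg M_nonneg by simp
 have F: "\<bar>Fv s\<bar> <= CB" if s: "0 < s" "s <= 1" for s
 proof -
  have "\<bar>Fv s\<bar> <= (Cg + M) * (\<bar>v s\<bar> + (2 * \<bar>v s\<bar>) powr (1 + 2 / real d))" using FF0_le[of "Thi (v s)"] by simp
  also have "\<dots> <= CB" unfolding CB_def using B(2)[OF s] Cg M_nonneg by (intro mult_left_mono add_mono powr_mono2) auto
  finally show ?thesis .
 qed
 show thesis
 proof (rule that[OF CB])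
  fix t :: real assume t: "0 < t" "t <= 1"
  have "\<bar>phi s\<bar> <= t ^ e * CB" if s: "0 < s" "s <= t" for s
   unfolding phi_def abs_mult using F[of s] s t CB by (intro mult_mono) (auto simp: power_mono)
  hence "\<bar>Psi t\<bar> <= t ^ e * CB * t" using CB t by (intro Psi_bound) auto
  thus "\<bar>Psi t / t ^ e\<bar> <= CB * t" unfolding abs_divide using t by (simp add: field_simps)
 qed
qed

text \<open>The slope has order \<open>t\<close>, so \<open>v\<close> approaches its limit
  quadratically; this rate makes the function on Euclidean space differentiable at the
  origin.\<close>

lemma limit_at_zero:
 obtains v0 CB where "CB >= 0" "!!t. 0 < t ==> t <= 1 ==> \<bar>Psi t / t ^ e\<bar> <= CB * t" "!!t. 0 < t ==> t <= 1 ==> \<bar>v t - v0\<bar> <= CB * t\<^sup>2"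
proof -
 obtain CB where CB: "CB >= 0" "!!t. 0 < t ==> t <= 1 ==> \<bar>Psi t / t ^ e\<bar> <= CB * t" using near_zero by blast
 have 1: "\<bar>v s - v t\<bar> <= - CB * s\<^sup>2 - (- CB * t\<^sup>2)" if st: "0 < s" "s <= t" "t <= 1" for s t
 proof (rule derivative_comparison[OF st(2), where v' = "%s. - (Psi s / s ^ e)" and W' = "%s. - CB * (2 * s)"])
  fix x assume x: "s <= x" "x <= t"
  show "(v has_real_derivative - (Psi x / x ^ e)) (at x)" using x st by (intro v_deriv) auto
  show "((%x. - CB * x\<^sup>2) has_real_derivative - CB * (2 * x)) (at x)" by (auto intro!: derivative_eq_intros)
  have "0 <= CB * x" using CB(1) x st by simp
  thus "\<bar>- (Psi x / x ^ e)\<bar> <= - (- CB * (2 * x))" using CB(2)[of x] x st by simp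
 qed
 have 2: "\<bar>v s - v t\<bar> <= \<bar>CB * s\<^sup>2 - CB * t\<^sup>2\<bar>" if "0 < s" "s <= 1" "0 < t" "t <= 1" for s t
  using 1[of s t] 1[of t s] that by (cases "s <= t") auto
 define x where "x n = 1 / (real n + 1)" for n
 have x: "0 < x n" "x n <= 1" for n unfolding x_def by auto
 have x0: "x \<longlonglongrightarrow> 0" unfolding x_def[abs_def] using LIMSEQ_inverse_real_of_nat by (simp add: inverse_eq_divide add.commute)
 have wl: "(%n. CB * (x n)\<^sup>2) \<longlonglongrightarrow> CB * 0\<^sup>2" by (intro tendsto_intros x0)
 have "Cauchy (%n. v (x n))"
 proof (rule metric_CauchyI)
  fix \<epsilon> :: real assume "\<epsilon> > 0"
  then obtain N where N: "!!m n. m >= N ==> n >= N ==> dist (CB * (x m)\<^sup>2) (CB * (x n)\<^sup>2) < \<epsilon>"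
   using metric_CauchyD[OF LIMSEQ_imp_Cauchy[OF wl]] by blast
  show "\<exists>N. \<forall>m\<ge>N. \<forall>n\<ge>N. dist (v (x m)) (v (x n)) < \<epsilon>"
  proof (intro exI allI impI)
   fix m n assume "m >= N" "n >= N"
   from N[OF this] show "dist (v (x m)) (v (x n)) < \<epsilon>" unfolding dist_real_def using 2[OF x(1,2)[of m] x(1,2)[of n]] by linarith
  qed
 qed
 then obtain v0 where v0: "(%n. v (x n)) \<longlonglongrightarrow> v0" using Cauchy_convergent convergent_def by blast
 show thesis
 proof (rule that[OF CB])
  fix t :: real assume t: "0 < t" "t <= 1"
  have "\<bar>v t - v0\<bar> <= \<bar>CB * t\<^sup>2 - CB * 0\<^sup>2\<bar>"
  proof (rule LIMSEQ_le)
   show "(%n. \<bar>v t - v (x n)\<bar>) \<longlonglongrightarrow> \<bar>v t - v0\<bar>" by (intro tendsto_intros v0)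
   show "(%n. \<bar>CB * t\<^sup>2 - CB * (x n)\<^sup>2\<bar>) \<longlonglongrightarrow> \<bar>CB * t\<^sup>2 - CB * 0\<^sup>2\<bar>" by (intro tendsto_intros x0)
   show "\<exists>N. \<forall>n\<ge>N. \<bar>v t - v (x n)\<bar> <= \<bar>CB * t\<^sup>2 - CB * (x n)\<^sup>2\<bar>" using 2[OF t x] by blast
  qed
  thus "\<bar>v t - v0\<bar> <= CB * t\<^sup>2" using CB(1) by (simp add: abs_of_nonneg)
 qed (use CB in auto)
qed

text \<open>\<open>Psi t / t ^ d\<close> is \<open>1 / d\<close> times the mean of the right-hand
  side over the ball of radius \<open>t\<close>, so continuity at 0 determines the limit.\<close>

lemma flux_at_zero:
 assumes v0: "(v \<longlongrightarrow> v0) (at_right 0)"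
 shows "((%t. Psi t / t ^ d) \<longlongrightarrow> FF g mu0 (Thi v0) / real d) (at_right 0)"
proof (rule tendstoI)
 fix \<epsilon> :: real assume \<epsilon>: "\<epsilon> > 0"
 define F0 where "F0 = FF g mu0 (Thi v0)"
 have "((%s. Fv s) \<longlongrightarrow> F0) (at_right 0)" unfolding F0_def by (intro tendsto_FF[OF g_cont tendsto_const] tendsto_Thi v0)
 hence "\<forall>\<^sub>F s in at_right 0. dist (Fv s) F0 < \<epsilon> / 2" by (rule tendstoD) (use \<epsilon> in simp)
 then obtain b where b: "b > 0" "!!s. 0 < s ==> s < b ==> \<bar>Fv s - F0\<bar> < \<epsilon> / 2"
  unfolding eventually_at_right_field dist_real_def by auto
 have "dist (Psi t / t ^ d) (F0 / real d) < \<epsilon>" if t: "0 < t" "t < b" for t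
 proof -
  have 1: "(phi has_integral Psi t) {0..t}" unfolding Psi_def by (rule integrable_integral[OF Pn_lim(1)[OF t(1)]])
  have "((%s. s ^ e) has_integral (t ^ d / real d - 0 ^ d / real d)) {0..t}"
  proof (rule fundamental_theorem_of_calculus)
   show "((%s. s ^ d / real d) has_vector_derivative x ^ e) (at x within {0..t})" for x
   proof -
    have "((%s. s ^ d / real d) has_real_derivative x ^ e) (at x within {0..t})"
     using DERIV_cdivide[OF DERIV_pow[of d x "{0..t}"], of "real d"] d2 de by simp
    thus ?thesis by (simp add: has_real_derivative_iff_has_vector_derivative)
   qed
  qed (use t in simp)
  hence "((%s. F0 * s ^ e) has_integral F0 * (t ^ d / real d)) {0..t}"
   using d2 by (intro has_integral_mult_right) (simp add: zero_power)
  from has_integral_diff[OF 1 this]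
  have "norm (Psi t - F0 * (t ^ d / real d)) <= t ^ e * (\<epsilon> / 2) * measure lborel {0..t}"
  proof (rule has_integral_bound_real[where S = "{}", rotated 2])
    fix x assume x: "x \<in> {0..t} - {}"
    show "norm (phi x - F0 * x ^ e) <= t ^ e * (\<epsilon> / 2)"
    proof (cases "x = 0")
     case True thus ?thesis using phi_0 e1 t \<epsilon> by (simp add: zero_power)
    next
     case False
     have "norm (phi x - F0 * x ^ e) = x ^ e * \<bar>Fv x - F0\<bar>"
     proof -
      have "phi x - F0 * x ^ e = x ^ e * (Fv x - F0)" unfolding phi_def by (simp add: algebra_simps)
      thus ?thesis using x by (simp add: abs_mult)
     qed
     also have "\<dots> <= t ^ e * (\<epsilon> / 2)" using x False t b(2)[of x] by (intro mult_mono) (auto simp: power_mono)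
     finally show ?thesis .
    qed
  qed (use t \<epsilon> in simp_all)
  hence "\<bar>Psi t - F0 * (t ^ d / real d)\<bar> <= t ^ d * (\<epsilon> / 2)" using t de by (simp add: mult_ac)
  moreover have "Psi t / t ^ d - F0 / real d = (Psi t - F0 * (t ^ d / real d)) / t ^ d" using t by (simp add: diff_divide_distrib)
  ultimately have "\<bar>Psi t / t ^ d - F0 / real d\<bar> <= \<epsilon> / 2" using t by (simp add: abs_divide divide_le_eq mult.commute)
  thus ?thesis unfolding dist_real_def using \<epsilon> by linarith
 qed
 thus "\<forall>\<^sub>F t in at_right 0. dist (Psi t / t ^ d) (FF g mu0 (Thi v0) / real d) < \<epsilon>"
  unfolding eventually_at_right_field F0_def[symmetric] using b(1) by blast
qed

lemma flux_derivative:
 assumes t: "t > 0"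
 shows "((%t. Psi t / t ^ d) has_real_derivative (Fv t - real d * (Psi t / t ^ d)) / t) (at t)"
proof -
 have "((%t. Psi t / t ^ d) has_real_derivative (phi t * t ^ d - Psi t * (real d * t ^ (d - 1))) / (t ^ d * t ^ d)) (at t)"
  using t by (intro DERIV_divide Psi_deriv) (auto intro!: derivative_eq_intros)
 also have "(phi t * t ^ d - Psi t * (real d * t ^ (d - 1))) / (t ^ d * t ^ d) = (Fv t - real d * (Psi t / t ^ d)) / t"
  using t by (simp add: phi_def de field_simps)
 finally show ?thesis .
qed

end

text \<open>What the Euclidean part needs from the limit, freed from the lattice. The function
  \<open>y\<close> is \<open>- p' / t\<close>; it extends continuously to 0, so the gradient can be
  written as a multiple of \<open>x\<close> without division by the norm. \<open>mass_le\<close> and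
  \<open>mass_ge\<close> together fix the improper mass integral at \<open>m0\<close>.\<close>

locale profile =
 fixes d e :: nat and g :: "real => real" and mu m0 K B :: real and p y :: "real => real"
 assumes de: "d = Suc e" and e1: "e >= 1" and g_cont: "continuous_on UNIV g"
  and y_cont: "continuous_on {0..} y"
  and p_deriv: "!!t. t > 0 ==> (p has_real_derivative - (t * y t)) (at t)"
  and p_zero: "!!t. 0 <= t ==> t <= 1 ==> \<bar>p t - p 0\<bar> <= B * t\<^sup>2"
  and y_deriv: "!!t. t > 0 ==> (y has_real_derivative (FF g mu (Thi (p t)) - real d * y t) / t) (at t)"
  and y_zero: "real d * y 0 = FF g mu (Thi (p 0))"
  and kinetic: "!!a b. 0 < a ==> a <= b ==> integral {a..b} (%s. s ^ e * (s * y s)\<^sup>2) <= K"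
  and mass_le: "!!a b. 0 < a ==> a <= b ==> integral {a..b} (%s. s ^ e * (Thi (p s))\<^sup>2) <= m0"
  and mass_ge: "!!\<eta>. \<eta> > 0 ==> \<exists>a b. 0 < a \<and> a <= b \<and> m0 - \<eta> <= integral {a..b} (%s. s ^ e * (Thi (p s))\<^sup>2)"

section \<open>Behaviour at the origin and the Pohozaev argument\<close>

context conv
begin

lemma limits_at_zero:
 obtains v0 CB where "CB >= 0" "(v \<longlongrightarrow> v0) (at_right 0)" "((%t. Psi t / t ^ e) \<longlongrightarrow> 0) (at_right 0)" "!!t. 0 < t ==> t <= 1 ==> \<bar>v t - v0\<bar> <= CB * t\<^sup>2"
proof -
 obtain v0 CB where CB: "CB >= 0" "!!t. 0 < t ==> t <= 1 ==> \<bar>Psi t / t ^ e\<bar> <= CB * t" "!!t. 0 < t ==> t <= 1 ==> \<bar>v t - v0\<bar> <= CB * t\<^sup>2"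
  by (rule limit_at_zero) (rule that; iprover)
 have ev: "\<forall>\<^sub>F t in at_right 0. 0 < t \<and> t <= (1::real)"
  unfolding eventually_at_right_field by (intro exI[of _ 1]) auto
 have a: "((%t. v t - v0) \<longlongrightarrow> 0) (at_right 0)"
 proof (rule Lim_null_comparison)
  show "\<forall>\<^sub>F t in at_right 0. norm (v t - v0) <= CB * t\<^sup>2" using ev by eventually_elim (use CB in auto)
  have "((%t. CB * t\<^sup>2) \<longlongrightarrow> CB * 0\<^sup>2) (at_right 0)" by (intro tendsto_intros)
  thus "((%t. CB * t\<^sup>2) \<longlongrightarrow> 0) (at_right 0)" by simp
 qed
 have b: "((%t. Psi t / t ^ e) \<longlongrightarrow> 0) (at_right 0)"
 proof (rule Lim_null_comparison)
  show "\<forall>\<^sub>F t in at_right 0. norm (Psi t / t ^ e) <= CB * t" using ev by eventually_elim (use CB(2) in \<open>simp del: abs_divide\<close>)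
  have "((%t. CB * t) \<longlongrightarrow> CB * 0) (at_right 0)" by (intro tendsto_intros)
  thus "((%t. CB * t) \<longlongrightarrow> 0) (at_right 0)" by simp
 qed
 show thesis by (rule that[OF CB(1) _ b CB(3)]) (use a in \<open>simp add: LIM_zero_iff\<close>)
qed

lemma slope_deriv:
 assumes t: "t > 0"
 shows "((%t. Psi t / t ^ e) has_real_derivative Fv t - real e * (Psi t / t ^ e) / t) (at t)"
proof -
 have "((%t. Psi t / t ^ e) has_real_derivative (phi t * t ^ e - Psi t * (real e * t ^ (e - 1))) / (t ^ e * t ^ e)) (at t)"
  using t by (intro DERIV_divide Psi_deriv) (auto intro!: derivative_eq_intros)
 also have "(phi t * t ^ e - Psi t * (real e * t ^ (e - 1))) / (t ^ e * t ^ e) = Fv t - real e * (Psi t / t ^ e) / t"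
 proof -
  obtain f where f: "e = Suc f" using e1 by (cases e) auto
  have "(t ^ e * F * t ^ e - P * (real e * t ^ (e - 1))) / (t ^ e * t ^ e) = F - real e * (P / t ^ e) / t" for F P
   unfolding f using t by (simp add: field_simps)
  thus ?thesis unfolding phi_def .
 qed
 finally show ?thesis .
qed

lemma potential_deriv:
 assumes t: "t > 0" and m: "mu0 = 0"
 shows "((%t. G (Thi (v t))) has_real_derivative - (Fv t * (Psi t / t ^ e))) (at t)"
proof -
 have "((%t. Thi (v t)) has_real_derivative 1 / dTh (Thi (v t)) * - (Psi t / t ^ e)) (at t)"
  by (rule DERIV_chain2[OF Thi_has_derivative v_deriv[OF t]])
 from DERIV_chain2[OF G_deriv this] show ?thesis unfolding FF_def m by (simp add: field_simps)
qed

text \<open>The Pohozaev function: \<open>t ^ d\<close> times the mechanical energy of the radial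
  equation without multiplier.\<close>

definition Poh :: "real => real" where "Poh t = t ^ d * ((Psi t / t ^ e)\<^sup>2 / 2 + G (Thi (v t)))"

lemma Poh_deriv:
 assumes t: "t > 0" and m: "mu0 = 0"
 shows "(Poh has_real_derivative real d * (t ^ e * G (Thi (v t))) - (real d / 2 - 1) * ((Psi t)\<^sup>2 / t ^ e)) (at t)"
proof -
 define w where "w = Psi t / t ^ e"
 define f where "f = Fv t"
 define Gt where "Gt = G (Thi (v t))"
 have 1: "((%t. t ^ d) has_real_derivative real d * t ^ e) (at t)" using DERIV_pow[of d t] de by simp
 have 2: "((%t. (Psi t / t ^ e)\<^sup>2 / 2) has_real_derivative 2 * w * (f - real e * w / t) / 2) (at t)"
  using DERIV_cdivide[OF DERIV_power[OF slope_deriv[OF t], of 2], of 2] unfolding w_def f_def by (simp add: mult_ac)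
 have 3: "((%t. G (Thi (v t))) has_real_derivative - (f * w)) (at t)" unfolding w_def f_def by (rule potential_deriv[OF t m])
 have "(Poh has_real_derivative real d * t ^ e * (w\<^sup>2 / 2 + Gt) + (2 * w * (f - real e * w / t) / 2 + - (f * w)) * t ^ d) (at t)"
  unfolding Poh_def[abs_def] w_def Gt_def using DERIV_mult[OF 1 DERIV_add[OF 2 3]] unfolding w_def .
 also have "real d * t ^ e * (w\<^sup>2 / 2 + Gt) + (2 * w * (f - real e * w / t) / 2 + - (f * w)) * t ^ d = real d * (t ^ e * Gt) - (real d / 2 - 1) * (t ^ e * w\<^sup>2)"
  using t unfolding de by (simp add: field_simps power2_eq_square)
 also have "t ^ e * w\<^sup>2 = (Psi t)\<^sup>2 / t ^ e" unfolding w_def using t by (simp add: power2_eq_square)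
 finally show ?thesis unfolding Gt_def .
qed

lemma Poh_tendsto: "(Poh \<longlongrightarrow> 0) (at_right 0)"
proof -
 obtain v0 CB where "CB >= 0" and v0: "(v \<longlongrightarrow> v0) (at_right 0)" and w: "((%t. Psi t / t ^ e) \<longlongrightarrow> 0) (at_right 0)"
  and "!!t. 0 < t ==> t <= 1 ==> \<bar>v t - v0\<bar> <= CB * t\<^sup>2"
  by (rule limits_at_zero) (rule that; iprover)
 have Gc: "isCont G x" for x by (rule DERIV_isCont[OF G_deriv])
 have "(Poh \<longlongrightarrow> 0 ^ d * (0\<^sup>2 / 2 + G (Thi v0))) (at_right 0)"
  unfolding Poh_def[abs_def] by (intro tendsto_intros w isCont_tendsto_compose[OF Gc] tendsto_Thi v0) auto
 thus ?thesis using d2 by (simp add: zero_power)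
qed

text \<open>With multiplier 0 the Pohozaev identity and the negative energy force
  \<open>Poh b >= c\<close> for large \<open>b\<close>. Divided by \<open>b\<close>, this bounds the
  energy density below by \<open>c / b\<close>, whose integral diverges logarithmically, while
  Dirichlet energy and mass bound the integral of the density.\<close>

theorem mu0_pos:
 assumes e0: "e0 > 0"
 shows "mu0 > 0"
proof (rule ccontr)
 assume "\<not> mu0 > 0"
 hence m: "mu0 = 0" using mu0_bounds(1) by simp
 have d2': "real d >= 2" using d2 by simp
 obtain a0 R0 where a0: "0 < a0" "a0 <= R0" "!!a b. 0 < a ==> a <= a0 ==> b >= R0 ==>
  integral {a..b} (%s. (Psi s)\<^sup>2 / s ^ e) / 2 + e0 <= integral {a..b} (%s. s ^ e * G (Thi (v s))) + e0 / 2"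
  by (rule energy_limit[OF half_gt_zero[OF e0]]) (rule that; iprover)
 \<comment> \<open>The energy inequality contributes \<open>real d * e0 / 2\<close>; half of it
   compensates a possibly negative \<open>Poh a\<close>.\<close>
 define c where "c = real d * e0 / 4"
 have c: "c > 0" unfolding c_def using e0 d2' by simp
 have "\<forall>\<^sub>F t in at_right 0. Poh t > - c" by (rule order_tendstoD(1)[OF Poh_tendsto]) (use c in simp)
 then obtain b0 where b0: "b0 > 0" "!!t. 0 < t ==> t < b0 ==> Poh t > - c" unfolding eventually_at_right_field by auto
 define a where "a = min a0 (b0 / 2)"
 have a: "0 < a" "a <= a0" "a < b0" unfolding a_def using a0 b0 by auto
 have Pb: "Poh b >= c" if b: "b >= R0" for b
 proof -
  have ab: "a <= b" using a a0 b by linarith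
  define IK where "IK = integral {a..b} (%s. (Psi s)\<^sup>2 / s ^ e)"
  define IG where "IG = integral {a..b} (%s. s ^ e * G (Thi (v s)))"
  have IK: "IK >= 0" unfolding IK_def using a by (intro integral_nonneg kinetic_limit(1)[OF a(1) ab]) auto
  have "((%t. real d * (t ^ e * G (Thi (v t))) - (real d / 2 - 1) * ((Psi t)\<^sup>2 / t ^ e)) has_integral Poh b - Poh a) {a..b}"
  proof (rule fundamental_theorem_of_calculus[OF ab])
   fix x assume "x \<in> {a..b}"
   hence "x > 0" using a by simp
   from has_field_derivative_at_within[OF Poh_deriv[OF this m]]
   show "(Poh has_vector_derivative real d * (x ^ e * G (Thi (v x))) - (real d / 2 - 1) * ((Psi x)\<^sup>2 / x ^ e)) (at x within {a..b})"
    by (simp only: has_real_derivative_iff_has_vector_derivative)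
  qed
  moreover have "((%t. real d * (t ^ e * G (Thi (v t))) - (real d / 2 - 1) * ((Psi t)\<^sup>2 / t ^ e)) has_integral real d * IG - (real d / 2 - 1) * IK) {a..b}"
   unfolding IG_def IK_def by (intro has_integral_diff has_integral_mult_right integrable_integral kinetic_limit(1)[OF a(1) ab] G_limit(1)[OF a(1) ab])
  ultimately have "Poh b - Poh a = real d * IG - (real d / 2 - 1) * IK" by (rule has_integral_unique)
  moreover have "IK / 2 + e0 / 2 <= IG" using a0(3)[OF a(1,2) b] unfolding IK_def IG_def by linarith
  hence "real d * (IK / 2 + e0 / 2) <= real d * IG" by (rule mult_left_mono) simp
  hence "IK + real d * e0 / 2 <= real d * IG - (real d / 2 - 1) * IK" by (simp add: algebra_simps)
  ultimately show ?thesis using IK b0(2)[OF a(1,3)] unfolding c_def by linarith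
 qed
 obtain s where s: "s > 0" "!!t. \<bar>t\<bar> < s ==> \<bar>G t\<bar> <= t\<^sup>2" using small[of 1] by auto
 have "((%t. CV * t powr (- real e / 2)) \<longlongrightarrow> CV * 0) at_top"
  using e1 by (intro tendsto_mult tendsto_const tendsto_neg_powr filterlim_ident) auto
 hence "\<forall>\<^sub>F t in at_top. CV * t powr (- real e / 2) < s" by (rule order_tendstoD(2)) (use s in simp)
 then obtain R1 where R1: "!!t. t >= R1 ==> CV * t powr (- real e / 2) < s" unfolding eventually_at_top_linorder by blast
 define A where "A = max (max R0 R1) 1"
 have A: "A >= R0" "A >= R1" "A >= 1" unfolding A_def by auto
 have bd: "c * ln b - c * ln A <= K / 2 + m0" if b: "A <= b" for b
 proof -
  have A0: "0 < A" using A by simp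
  have "((%x. c / x) has_integral c * ln b - c * ln A) {A..b}"
  proof (rule fundamental_theorem_of_calculus[OF b])
   fix x assume "x \<in> {A..b}"
   hence "x > 0" using A by simp
   hence "((%x. c * ln x) has_real_derivative c / x) (at x within {A..b})" by (auto intro!: derivative_eq_intros)
   thus "((%x. c * ln x) has_vector_derivative c / x) (at x within {A..b})" by (simp add: has_real_derivative_iff_has_vector_derivative)
  qed
  moreover have "((%s. (Psi s)\<^sup>2 / s ^ e / 2 + s ^ e * (Thi (v s))\<^sup>2) has_integral
   integral {A..b} (%s. (Psi s)\<^sup>2 / s ^ e) / 2 + integral {A..b} (%s. s ^ e * (Thi (v s))\<^sup>2)) {A..b}"
   by (intro has_integral_add has_integral_divide integrable_integral kinetic_limit(1)[OF A0 b] mass_limit(1)[OF A0 b])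
  ultimately have "c * ln b - c * ln A <= integral {A..b} (%s. (Psi s)\<^sup>2 / s ^ e) / 2 + integral {A..b} (%s. s ^ e * (Thi (v s))\<^sup>2)"
  proof (rule has_integral_le)
   fix x assume "x \<in> {A..b}"
   hence x: "x >= R0" "x >= R1" "x > 0" using A by auto
   have "c <= x ^ d * ((Psi x / x ^ e)\<^sup>2 / 2 + G (Thi (v x)))" using Pb[OF x(1)] unfolding Poh_def .
   hence "c / x <= x ^ d * ((Psi x / x ^ e)\<^sup>2 / 2 + G (Thi (v x))) / x" using x by (intro divide_right_mono) auto
   also have "\<dots> = (Psi x)\<^sup>2 / x ^ e / 2 + x ^ e * G (Thi (v x))"
    unfolding de using x by (simp add: field_simps power2_eq_square)
   also have "x ^ e * G (Thi (v x)) <= x ^ e * (Thi (v x))\<^sup>2"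
   proof (rule mult_left_mono)
    have "\<bar>Thi (v x)\<bar> < s" using abs_Thi_le[of "v x"] v_pw[OF x(3)] R1[OF x(2)] by linarith
    thus "G (Thi (v x)) <= (Thi (v x))\<^sup>2" using s(2)[of "Thi (v x)"] by linarith
   qed (use x in simp)
   finally show "c / x <= (Psi x)\<^sup>2 / x ^ e / 2 + x ^ e * (Thi (v x))\<^sup>2" by simp
  qed
  thus ?thesis using kinetic_upper[OF A0 b] mass_upper[OF A0 b] by linarith
 qed
 \<comment> \<open>Makes the logarithmic integral from \<open>A\<close> to \<open>b\<close> exceed
   its bound by exactly 1.\<close>
 define b where "b = A * exp ((K / 2 + m0 + 1) / c)"
 have "(K / 2 + m0 + 1) / c >= 0" using K1 m0_pos c by simp
 hence "A * 1 <= b" unfolding b_def using A by (intro mult_left_mono) auto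
 hence "A <= b" by simp
 moreover have "ln b = ln A + (K / 2 + m0 + 1) / c" unfolding b_def using A by (simp add: ln_mult)
 ultimately have "c * (ln A + (K / 2 + m0 + 1) / c) - c * ln A <= K / 2 + m0" using bd by metis
 moreover have "c * (ln A + (K / 2 + m0 + 1) / c) = c * ln A + (K / 2 + m0 + 1)" unfolding distrib_left using c by simp
 ultimately show False by linarith
qed

theorem limit_profile:
 assumes m: "mu0 > 0"
 obtains p y B where "profile d e g mu0 m0 K B p y" "!!t. t > 0 ==> p t = v t"
proof -
 obtain v0 CB where CB: "CB >= 0" and v0: "(v \<longlongrightarrow> v0) (at_right 0)" and "((%t. Psi t / t ^ e) \<longlongrightarrow> 0) (at_right 0)"
  and q: "!!t. 0 < t ==> t <= 1 ==> \<bar>v t - v0\<bar> <= CB * t\<^sup>2"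
  by (rule limits_at_zero) (rule that; iprover)
 define p where "p t = (if t <= 0 then v0 else v t)" for t
 define y where "y t = (if t <= 0 then FF g mu0 (Thi v0) / real d else Psi t / t ^ d)" for t
 have pd: "(p has_real_derivative D) (at t)" if "t > 0" "(v has_real_derivative D) (at t)" for t D
  by (rule has_field_derivative_transform_within_open[OF that(2), of "{0<..}"]) (use that in \<open>auto simp: p_def\<close>)
 have yd: "(y has_real_derivative D) (at t)" if "t > 0" "((%t. Psi t / t ^ d) has_real_derivative D) (at t)" for t D
  by (rule has_field_derivative_transform_within_open[OF that(2), of "{0<..}"]) (use that in \<open>auto simp: y_def\<close>)
 have ty: "t * y t = Psi t / t ^ e" if "t > 0" for t using that unfolding y_def de by simp
 have kin: "integral {a..b} (%s. s ^ e * (s * y s)\<^sup>2) = integral {a..b} (%s. (Psi s)\<^sup>2 / s ^ e)" if a: "0 < a" for a b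
 proof (rule Henstock_Kurzweil_Integration.integral_cong)
  fix s assume "s \<in> {a..b}"
  hence "s > 0" using a by simp
  thus "s ^ e * (s * y s)\<^sup>2 = (Psi s)\<^sup>2 / s ^ e" unfolding ty[OF \<open>s > 0\<close>] by (simp add: power2_eq_square)
 qed
 have mass: "integral {a..b} (%s. s ^ e * (Thi (p s))\<^sup>2) = integral {a..b} (%s. s ^ e * (Thi (v s))\<^sup>2)" if a: "0 < a" for a b
  by (rule Henstock_Kurzweil_Integration.integral_cong) (use a in \<open>auto simp: p_def\<close>)
 have "profile d e g mu0 m0 K CB p y"
 proof
  show "d = Suc e" by (rule de)
  show "1 <= e" by (rule e1)
  show "continuous_on UNIV g" by (rule g_cont)
  show "continuous_on {0..} y" unfolding continuous_on_def
  proof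
   fix t :: real assume t: "t \<in> {0..}"
   show "(y \<longlongrightarrow> y t) (at t within {0..})"
   proof (cases "t = 0")
    case True
    have "\<forall>\<^sub>F t in at_right 0. y t = Psi t / t ^ d" unfolding eventually_at_right_field by (intro exI[of _ 1]) (auto simp: y_def)
    hence "(y \<longlongrightarrow> FF g mu0 (Thi v0) / real d) (at_right 0)" using flux_at_zero[OF v0] by (simp add: tendsto_cong)
    thus ?thesis unfolding True at_within_Ici_at_right by (simp add: y_def)
   next
    case False
    hence t0: "t > 0" using t by simp
    have "isCont y t" by (rule DERIV_isCont[OF yd[OF t0 flux_derivative[OF t0]]])
    thus ?thesis unfolding isCont_def by (rule tendsto_within_subset) simp
   qed
  qed
  show "(p has_real_derivative - (t * y t)) (at t)" if t: "t > 0" for t unfolding ty[OF t] by (rule pd[OF t v_deriv[OF t]])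
  show "\<bar>p t - p 0\<bar> <= CB * t\<^sup>2" if "0 <= t" "t <= 1" for t using q[of t] that by (cases "t = 0") (auto simp: p_def)
  show "(y has_real_derivative (FF g mu0 (Thi (p t)) - real d * y t) / t) (at t)" if t: "t > 0" for t
   by (rule yd[OF t]) (use flux_derivative[OF t] t in \<open>simp add: p_def y_def\<close>)
  show "real d * y 0 = FF g mu0 (Thi (p 0))" using d2 by (simp add: y_def p_def)
  show "integral {a..b} (%s. s ^ e * (s * y s)\<^sup>2) <= K" if "0 < a" "a <= b" for a b unfolding kin[OF that(1)] by (rule kinetic_upper[OF that])
  show "integral {a..b} (%s. s ^ e * (Thi (p s))\<^sup>2) <= m0" if "0 < a" "a <= b" for a b unfolding mass[OF that(1)] by (rule mass_upper[OF that])
  show "\<exists>a b. 0 < a \<and> a <= b \<and> m0 - \<eta> <= integral {a..b} (%s. s ^ e * (Thi (p s))\<^sup>2)" if \<eta>: "\<eta> > 0" for \<eta>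
  proof -
   obtain a0 R0 where a0: "0 < a0" "a0 <= R0" "!!a b. 0 < a ==> a <= a0 ==> b >= R0 ==> m0 - \<eta> <= integral {a..b} (%s. s ^ e * (Thi (v s))\<^sup>2)"
    using mass_lower[OF m \<eta>] by blast
   show ?thesis using a0(3)[OF a0(1) order_refl order_refl] a0(1,2) unfolding mass[OF a0(1), symmetric] by blast
  qed
 qed
 thus thesis by (rule that) (simp add: p_def)
qed

end

section \<open>Integration over Euclidean space\<close>

lemma pd_eq: "(f has_derivative f') (at x) ==> pd i f x = f' (axis i 1)"
 unfolding pd_def by (simp only: frechet_derivative_at[symmetric])

lemma pd_outside:
 fixes W :: "real^'n::finite => real"
 assumes supp: "!!x. norm x > R ==> W x = 0" and x: "norm x > R"
 shows "pd i W x = 0"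
proof -
 have "(W has_derivative (%h. 0)) (at x)"
 proof (rule has_derivative_transform_within_open[of "%x. 0"])
  show "open {x :: real^'n. norm x > R}" by (intro open_Collect_less continuous_intros)
 qed (use x supp in auto)
 thus ?thesis by (simp add: pd_eq)
qed

lemma integrable_continuous_bounded_support:
 fixes W :: "real^'n::finite => real"
 assumes c: "continuous_on UNIV W" and supp: "!!x. norm x > R ==> W x = 0"
 shows "integrable lborel W" "integrable lebesgue W"
proof -
 have "integrable lborel (%x. indicator (cball 0 R) x *\<^sub>R W x)"
  by (rule borel_integrable_compact) (auto intro: continuous_on_subset[OF c])
 also have "(%x. indicator (cball 0 R) x *\<^sub>R W x) = W"
  using supp by (auto simp: fun_eq_iff indicator_def not_le)
 finally show 1: "integrable lborel W" .
 have "W \<in> borel_measurable borel" by (rule borel_measurable_continuous_onI[OF c])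
 thus "integrable lebesgue W" using 1 by (simp add: integrable_completion)
qed

text \<open>Difference quotients integrate to 0 by translation invariance of Lebesgue measure, and
  by the mean value theorem they converge to the partial derivative under a common bound on a
  ball.\<close>

theorem integral_pd_zero:
 fixes W :: "real^'n::finite => real"
 assumes D: "!!x. W differentiable (at x)" and c: "continuous_on UNIV (pd i W)" and supp: "!!x. norm x > R ==> W x = 0"
 shows "integrable lebesgue (pd i W)" "(\<integral>x. pd i W x \<partial>lebesgue) = 0"
proof -
 define a :: "real^'n" where "a = axis i 1"
 have na: "norm a = 1" unfolding a_def by (simp add: norm_axis_1)
 have Wc: "continuous_on UNIV W" using D by (simp add: continuous_at_imp_continuous_on differentiable_imp_continuous_within)
 have supp': "pd i W x = 0" if "norm x > R" for x by (rule pd_outside[OF supp that])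
 show i1: "integrable lebesgue (pd i W)" by (rule integrable_continuous_bounded_support(2)[OF c supp'])
 have bW: "W \<in> borel_measurable borel" by (rule borel_measurable_continuous_onI[OF Wc])
 have bP: "pd i W \<in> borel_measurable borel" by (rule borel_measurable_continuous_onI[OF c])
 have Wi: "integrable lborel W" by (rule integrable_continuous_bounded_support(1)[OF Wc supp])
 have line: "((%s. W (x + s *\<^sub>R a)) has_real_derivative pd i W (x + s *\<^sub>R a)) (at s)" for x s
 proof -
  have "(W has_derivative frechet_derivative W (at (x + s *\<^sub>R a))) (at (x + s *\<^sub>R a))" using D frechet_derivative_works by blast
  moreover have "((%s. x + s *\<^sub>R a) has_derivative (%s. s *\<^sub>R a)) (at s)" by (auto intro!: derivative_eq_intros)
  ultimately have "((%s. W (x + s *\<^sub>R a)) has_derivative (%t. frechet_derivative W (at (x + s *\<^sub>R a)) (t *\<^sub>R a))) (at s)"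
   using has_derivative_compose by blast
  moreover have "frechet_derivative W (at (x + s *\<^sub>R a)) (t *\<^sub>R a) = pd i W (x + s *\<^sub>R a) * t" for t
   using linear_scale[OF linear_frechet_derivative[OF D]] unfolding pd_def a_def by simp
  ultimately show ?thesis by (simp add: has_field_derivative_def)
 qed
 have "compact (pd i W ` cball 0 (R + 2))" by (rule compact_continuous_image[OF continuous_on_subset[OF c]]) auto
 hence "bounded (pd i W ` cball 0 (R + 2))" by (rule compact_imp_bounded)
 hence "\<exists>C. \<forall>z\<in>pd i W ` cball 0 (R + 2). norm z <= C" by (simp only: bounded_iff)
 then obtain C where C': "\<forall>z\<in>pd i W ` cball 0 (R + 2). norm z <= C" ..
 have C: "\<bar>pd i W x\<bar> <= C" if "norm x <= R + 2" for x
  using bspec[OF C' imageI[of x "cball 0 (R + 2)"]] that by simp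
 define t where "t n = 1 / (real n + 1)" for n
 have t: "0 < t n" "t n <= 1" for n unfolding t_def by auto
 have t0: "t \<longlonglongrightarrow> 0" unfolding t_def[abs_def] using LIMSEQ_inverse_real_of_nat by (simp add: inverse_eq_divide add.commute)
 define q where "q n x = (W (x + t n *\<^sub>R a) - W x) / t n" for n x
 have ql: "(%n. q n x) \<longlonglongrightarrow> pd i W x" for x
 proof -
  have "((%s. (W (x + s *\<^sub>R a) - W (x + 0 *\<^sub>R a)) / (s - 0)) \<longlongrightarrow> pd i W (x + 0 *\<^sub>R a)) (at 0)"
   using line[of x 0] by (simp only: has_field_derivative_iff)
  moreover have "filterlim t (at 0) sequentially" using t0 t by (auto simp: filterlim_at less_imp_neq[symmetric] intro!: always_eventually)
  ultimately have "(%n. (W (x + t n *\<^sub>R a) - W (x + 0 *\<^sub>R a)) / (t n - 0)) \<longlonglongrightarrow> pd i W (x + 0 *\<^sub>R a)" by (rule filterlim_compose)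
  thus ?thesis unfolding q_def by simp
 qed
 have qb: "\<bar>q n x\<bar> <= indicator (cball 0 (R + 1)) x *\<^sub>R C" for n x
 proof (cases "norm x <= R + 1")
  case True
  obtain z where z: "0 < z" "z < t n" "W (x + t n *\<^sub>R a) - W (x + 0 *\<^sub>R a) = (t n - 0) * pd i W (x + z *\<^sub>R a)"
   using MVT2[OF t(1)[of n], of "%s. W (x + s *\<^sub>R a)" "%s. pd i W (x + s *\<^sub>R a)"] line by auto
  have "norm (x + z *\<^sub>R a) <= norm x + \<bar>z\<bar> * norm a" using norm_triangle_ineq[of x "z *\<^sub>R a"] by simp
  hence "norm (x + z *\<^sub>R a) <= R + 2" using True z t[of n] na by simp
  moreover have "q n x = pd i W (x + z *\<^sub>R a)" unfolding q_def using z t[of n] by simp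
  ultimately show ?thesis using C True by simp
 next
  case False
  have "norm x <= norm (x + t n *\<^sub>R a) + \<bar>t n\<bar> * norm a" using norm_triangle_ineq4[of "x + t n *\<^sub>R a" "t n *\<^sub>R a"] by simp
  hence "norm (x + t n *\<^sub>R a) > R" using False na t[of n] by simp
  thus ?thesis using supp[of x] supp[of "x + t n *\<^sub>R a"] False unfolding q_def by simp
 qed
 have tr: "integrable lborel (%x. W (x + s *\<^sub>R a))" "(\<integral>x. W (x + s *\<^sub>R a) \<partial>lborel) = (\<integral>x. W x \<partial>lborel)" for s
 proof -
  have e: "(lborel :: (real^'n) measure) = distr lborel borel ((+) (s *\<^sub>R a))" by (rule lborel_distr_plus[symmetric])
  have "integrable (distr lborel borel ((+) (s *\<^sub>R a))) W" using Wi e by simp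
  thus "integrable lborel (%x. W (x + s *\<^sub>R a))" using bW by (subst (asm) integrable_distr_eq) (auto simp: add.commute)
  have "(\<integral>x. W x \<partial>lborel) = (\<integral>x. W x \<partial>distr lborel borel ((+) (s *\<^sub>R a)))" using e by simp
  also have "\<dots> = (\<integral>x. W (s *\<^sub>R a + x) \<partial>lborel)" using bW by (intro integral_distr) auto
  finally show "(\<integral>x. W (x + s *\<^sub>R a) \<partial>lborel) = (\<integral>x. W x \<partial>lborel)" by (simp add: add.commute)
 qed
 have q0: "(\<integral>x. q n x \<partial>lborel) = 0" for n
  unfolding q_def using tr[of "t n"] Wi by simp
 have qm: "q n \<in> borel_measurable lborel" for n
  using borel_measurable_integrable[OF tr(1)[of "t n"]] bW unfolding q_def[abs_def] by (intro borel_measurable_divide borel_measurable_diff) auto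
 have "(%n. \<integral>x. q n x \<partial>lborel) \<longlonglongrightarrow> (\<integral>x. pd i W x \<partial>lborel)"
 proof (rule integral_dominated_convergence[where w = "%x. indicator (cball 0 (R + 1)) x *\<^sub>R C"])
  show "integrable lborel (%x. indicator (cball 0 (R + 1)) x *\<^sub>R C)" by (rule borel_integrable_compact) auto
 qed (use bP qm ql qb in auto)
 hence "(\<integral>x. pd i W x \<partial>lborel) = 0" unfolding q0 by (simp add: LIMSEQ_const_iff)
 thus "(\<integral>x. pd i W x \<partial>lebesgue) = 0" using bP by (simp add: integral_completion)
qed

text \<open>Both measures are determined by their values on half lines; there one is the volume of a
  ball and the other the integral of its derivative in the radius.\<close>

lemma distr_norm_lborel:
 fixes d :: nat and c :: real
 defines "d \<equiv> DIM('a::euclidean_space)"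
 assumes c: "c = real d * unit_ball_vol (real d)"
 shows "distr (lborel :: 'a measure) borel norm = density lborel (%r. ennreal (c * r ^ (d - 1)) * indicator {0..} r)"
proof -
 have d: "d > 0" unfolding d_def by simp
 have c0: "c >= 0" unfolding c by simp
 have L: "emeasure (distr (lborel :: 'a measure) borel norm) {..a} = (if a < 0 then 0 else ennreal (unit_ball_vol (real d) * a ^ d))" for a
 proof -
  have "emeasure (distr (lborel :: 'a measure) borel norm) {..a} = emeasure (lborel :: 'a measure) (cball 0 a)"
   by (subst emeasure_distr) (auto intro!: arg_cong2[where f = emeasure] simp: vimage_def)
  thus ?thesis unfolding d_def by (cases "a < 0") (auto simp: emeasure_cball)
 qed
 have Rr: "emeasure (density lborel (%r. ennreal (c * r ^ (d - 1)) * indicator {0..} r)) {..a} = (if a < 0 then 0 else ennreal (unit_ball_vol (real d) * a ^ d))" for a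
 proof -
  have "emeasure (density lborel (%r. ennreal (c * r ^ (d - 1)) * indicator {0..} r)) {..a} = (\<integral>\<^sup>+r. ennreal (c * r ^ (d - 1)) * indicator {0..} r * indicator {..a} r \<partial>lborel)"
   by (rule emeasure_density) auto
  also have "\<dots> = (\<integral>\<^sup>+r. ennreal (c * r ^ (d - 1)) * indicator {0..a} r \<partial>lborel)"
   by (rule nn_integral_cong) (auto simp: indicator_def)
  also have "\<dots> = (if a < 0 then 0 else ennreal (unit_ball_vol (real d) * a ^ d))"
  proof (cases "a < 0")
   case False
   have "((%r. c * r ^ (d - 1)) has_integral unit_ball_vol (real d) * a ^ d - unit_ball_vol (real d) * 0 ^ d) {0..a}"
   proof (rule fundamental_theorem_of_calculus)
    fix x
    have "((%r. unit_ball_vol (real d) * r ^ d) has_real_derivative c * x ^ (d - 1)) (at x within {0..a})"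
     unfolding c using DERIV_cmult[OF DERIV_pow[of d x "{0..a}"], of "unit_ball_vol (real d)"] by (simp add: mult_ac)
    thus "((%r. unit_ball_vol (real d) * r ^ d) has_vector_derivative c * x ^ (d - 1)) (at x within {0..a})"
     by (simp only: has_real_derivative_iff_has_vector_derivative)
   qed (use False in simp)
   hence "((%r. c * r ^ (d - 1)) has_integral unit_ball_vol (real d) * a ^ d) {0..a}" using d by (simp add: zero_power)
   thus ?thesis using False c0 by (subst nn_integral_has_integral_lebesgue') auto
  qed simp
  finally show ?thesis .
 qed
 show ?thesis
 proof (rule measure_eqI_generator_eq[where E = "range (%a::real. {..a})" and \<Omega> = UNIV and A = "%n. {..real n}"])
  show "Int_stable (range (%a::real. {..a}))" by (auto simp: Int_stable_def)
  have s: "sets (borel :: real measure) = sigma_sets UNIV (range (%a::real. {..a}))"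
   by (subst borel_eq_atMost) simp
  show "sets (distr (lborel :: 'a measure) borel norm) = sigma_sets UNIV (range (%a::real. {..a}))" using s by simp
  show "sets (density lborel (%r. ennreal (c * r ^ (d - 1)) * indicator {0..} r)) = sigma_sets UNIV (range (%a::real. {..a}))" using s by simp
  show "(\<Union>i. {..real i}) = UNIV" using real_arch_simple by auto
  show "emeasure (distr (lborel :: 'a measure) borel norm) {..real i} \<noteq> \<infinity>" for i unfolding L by simp
  show "emeasure (distr (lborel :: 'a measure) borel norm) X = emeasure (density lborel (%r. ennreal (c * r ^ (d - 1)) * indicator {0..} r)) X"
   if "X \<in> range (%a::real. {..a})" for X using that L Rr by auto
 qed auto
qed

lemma nn_integral_radial:
 fixes f :: "real => real"
 assumes f: "f \<in> borel_measurable borel" and c: "c = real DIM('a) * unit_ball_vol (real DIM('a))"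
 shows "(\<integral>\<^sup>+x. ennreal (f (norm (x::'a::euclidean_space))) \<partial>lebesgue) = ennreal c * (\<integral>\<^sup>+r. ennreal (r ^ (DIM('a) - 1) * f r) * indicator {0<..} r \<partial>lborel)"
proof -
 have c0: "c >= 0" unfolding c by simp
 have "(\<integral>\<^sup>+x. ennreal (f (norm (x::'a))) \<partial>lebesgue) = (\<integral>\<^sup>+r. ennreal (f r) \<partial>distr (lborel :: 'a measure) borel norm)"
  using f by (subst nn_integral_distr) (auto simp: nn_integral_completion)
 also have "\<dots> = (\<integral>\<^sup>+r. ennreal (c * r ^ (DIM('a) - 1)) * indicator {0..} r * ennreal (f r) \<partial>lborel)"
  unfolding distr_norm_lborel[OF c] using f by (subst nn_integral_density) auto
 also have "\<dots> = (\<integral>\<^sup>+r. ennreal c * (ennreal (r ^ (DIM('a) - 1) * f r) * indicator {0<..} r) \<partial>lborel)"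
 proof (rule nn_integral_cong_AE)
  have "AE r in lborel. r \<noteq> (0::real)" by (rule AE_lborel_singleton)
  thus "AE r in lborel. ennreal (c * r ^ (DIM('a) - 1)) * indicator {0..} r * ennreal (f r) = ennreal c * (ennreal (r ^ (DIM('a) - 1) * f r) * indicator {0<..} r)"
  proof eventually_elim
   case (elim r)
   thus ?case using c0 by (cases "r > 0") (auto simp: ennreal_mult' ennreal_mult'' mult_ac indicator_def)
  qed
 qed
 also have "\<dots> = ennreal c * (\<integral>\<^sup>+r. ennreal (r ^ (DIM('a) - 1) * f r) * indicator {0<..} r \<partial>lborel)"
  using f by (intro nn_integral_cmult) auto
 finally show ?thesis .
qed

text \<open>Monotone convergence along the intervals \<open>A n\<close>, which exhaust the positive
  half line.\<close>

lemma nn_integral_half_line: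
 fixes f :: "real => real"
 assumes f: "f \<in> borel_measurable borel" "!!r. r > 0 ==> f r >= 0" "!!a b. 0 < a ==> f integrable_on {a..b}"
  and le: "!!a b. 0 < a ==> a <= b ==> integral {a..b} f <= m"
 shows "(\<integral>\<^sup>+r. ennreal (f r) * indicator {0<..} r \<partial>lborel) <= ennreal m"
  and "(!!\<eta>. \<eta> > 0 ==> \<exists>a b. 0 < a \<and> a <= b \<and> m - \<eta> <= integral {a..b} f) ==> (\<integral>\<^sup>+r. ennreal (f r) * indicator {0<..} r \<partial>lborel) = ennreal m"
proof -
 have w: "(\<integral>\<^sup>+r. ennreal (f r) * indicator {a..b} r \<partial>lborel) = ennreal (integral {a..b} f)" if a: "0 < a" for a b
  by (rule nn_integral_has_integral_lebesgue') (use f a in \<open>auto intro: integrable_integral\<close>)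
 define A where "A n = {1 / (real n + 1)..real n + 1}" for n
 have Am: "A n \<subseteq> A k" if "n <= k" for n k using that unfolding A_def by (auto simp: field_simps intro: order_trans)
 have AU: "\<exists>n. r \<in> A n" if r: "r > 0" for r
 proof -
  obtain n where n: "max r (1 / r) <= real n" using real_arch_simple by blast
  have "1 / (real n + 1) <= r"
  proof -
   have "1 / r <= real n + 1" using n by simp
   thus ?thesis using r by (simp add: field_simps)
  qed
  thus ?thesis using n unfolding A_def by (intro exI[of _ n]) auto
 qed
 have "(\<integral>\<^sup>+r. ennreal (f r) * indicator {0<..} r \<partial>lborel) = (\<integral>\<^sup>+r. (SUP n. ennreal (f r) * indicator (A n) r) \<partial>lborel)"
 proof (rule nn_integral_cong)
  fix r :: real
  show "ennreal (f r) * indicator {0<..} r = (SUP n. ennreal (f r) * indicator (A n) r)"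
  proof (cases "r > 0")
   case True
   obtain n where n: "r \<in> A n" using AU[OF True] by blast
   show ?thesis
   proof (rule antisym)
    show "ennreal (f r) * indicator {0<..} r <= (SUP n. ennreal (f r) * indicator (A n) r)"
     by (rule SUP_upper2[of n]) (use n True in auto)
    show "(SUP n. ennreal (f r) * indicator (A n) r) <= ennreal (f r) * indicator {0<..} r"
     using True by (intro SUP_least) (auto simp: indicator_def)
   qed
  next
   case False
   have "r \<notin> A n" for n
   proof
    assume "r \<in> A n"
    moreover have "0 < 1 / (real n + 1)" by simp
    ultimately show False using False unfolding A_def by (meson atLeastAtMost_iff less_le_trans)
   qed
   thus ?thesis using False by simp
  qed
 qed
 also have "\<dots> = (SUP n. \<integral>\<^sup>+r. ennreal (f r) * indicator (A n) r \<partial>lborel)"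
 proof (rule nn_integral_monotone_convergence_SUP)
  show "incseq (%n r. ennreal (f r) * indicator (A n) r)"
   by (intro incseq_SucI le_funI mult_left_mono) (use Am[OF le_SucI[OF order_refl]] in \<open>auto simp: indicator_def\<close>)
  show "(%r. ennreal (f r) * indicator (A n) r) \<in> borel_measurable lborel" for n unfolding A_def using f(1) by auto
 qed
 also have "\<dots> <= ennreal m"
 proof (rule SUP_least)
  fix n
  have "(\<integral>\<^sup>+r. ennreal (f r) * indicator (A n) r \<partial>lborel) = ennreal (integral (A n) f)" unfolding A_def by (rule w) simp
  also have "\<dots> <= ennreal m" unfolding A_def
  proof (intro ennreal_leI le)
   have "1 / (real n + 1) <= 1" by simp
   thus "1 / (real n + 1) <= real n + 1" by linarith
  qed simp
  finally show "(\<integral>\<^sup>+r. ennreal (f r) * indicator (A n) r \<partial>lborel) <= ennreal m" .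
 qed
 finally show up: "(\<integral>\<^sup>+r. ennreal (f r) * indicator {0<..} r \<partial>lborel) <= ennreal m" .
 assume ge: "!!\<eta>. \<eta> > 0 ==> \<exists>a b. 0 < a \<and> a <= b \<and> m - \<eta> <= integral {a..b} f"
 show "(\<integral>\<^sup>+r. ennreal (f r) * indicator {0<..} r \<partial>lborel) = ennreal m"
 proof (rule antisym[OF up ennreal_le_epsilon])
  fix \<eta> :: real assume \<eta>: "\<eta> > 0"
  obtain a b where a: "0 < a" "a <= b" "m - \<eta> <= integral {a..b} f" using ge[OF \<eta>] by blast
  have I0: "0 <= integral {a..b} f" using a f by (intro integral_nonneg f(3)) auto
  have "ennreal m <= ennreal (integral {a..b} f + \<eta>)" using a by (intro ennreal_leI) simp
  also have "\<dots> = ennreal (integral {a..b} f) + ennreal \<eta>" using I0 \<eta> by (simp add: ennreal_plus)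
  also have "ennreal (integral {a..b} f) <= (\<integral>\<^sup>+r. ennreal (f r) * indicator {0<..} r \<partial>lborel)"
   unfolding w[OF a(1), symmetric] using a by (intro nn_integral_mono mult_left_mono) (auto simp: indicator_def)
  finally show "ennreal m <= (\<integral>\<^sup>+r. ennreal (f r) * indicator {0<..} r \<partial>lborel) + ennreal \<eta>" by simp
 qed
qed

section \<open>From radial profiles to weak solutions\<close>

lemma test_fun_smooth:
 fixes \<phi> :: "real^'n::finite => real"
 assumes "test_fun \<phi>"
 shows "\<phi> differentiable (at x)" "continuous_on UNIV \<phi>" "continuous_on UNIV (pd i \<phi>)"
proof -
 have "Ck (Suc (Suc 0)) \<phi>" using assms unfolding test_fun_def smooth_def by blast
 hence a: "\<phi> differentiable_on UNIV" "!!i. pd i \<phi> differentiable_on UNIV" by auto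
 thus "\<phi> differentiable (at x)" by (simp add: differentiable_on_eq_differentiable_at)
 show "continuous_on UNIV \<phi>" "continuous_on UNIV (pd i \<phi>)" using a by (auto intro: differentiable_imp_continuous_on)
qed

lemma test_fun_support:
 fixes \<phi> :: "real^'n::finite => real"
 assumes "test_fun \<phi>"
 obtains R where "!!x. norm x > R ==> \<phi> x = 0"
proof -
 obtain R where "\<forall>x\<in>{x. \<phi> x \<noteq> 0}. norm x <= R" using assms unfolding test_fun_def bounded_iff by blast
 hence "\<phi> x = 0" if "norm x > R" for x using that by (metis mem_Collect_eq not_le)
 thus thesis by (rule that)
qed

lemma frechet_pd: "\<phi> differentiable (at x) ==> (\<phi> has_derivative frechet_derivative \<phi> (at x)) (at x)"
 using frechet_derivative_works by blast

locale radial_profile = profile d e g mu m0 K B p y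
 for d e :: nat and g :: "real => real" and mu m0 K B :: real and p y :: "real => real" and dim :: "'n::finite itself" +
 assumes dn: "d = CARD('n)"
begin

definition V :: "real^'n => real" where "V x = p (norm x)"
definition U :: "real^'n => real" where "U x = Thi (V x)"
definition DU :: "real^'n => real^'n" where "DU x = (- y (norm x) / dTh (U x)) *\<^sub>R x"
text \<open>Minus the partial derivative of \<open>V\<close> in direction \<open>i\<close>, in a
  form that makes sense at the origin.\<close>

definition Z :: "'n => real^'n => real" where "Z i x = y (norm x) * x $ i"

lemma norm_deriv: "x \<noteq> 0 ==> (norm has_derivative (%h. h \<bullet> x / norm x)) (at (x :: real^'n))"
 using has_derivative_norm[of x] by (simp add: sgn_div_norm divide_inverse mult.commute)

text \<open>Away from 0 this is the chain rule; at the origin the quadratic approach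
  \<open>p_zero\<close> gives derivative 0.\<close>

lemma V_deriv: "(V has_derivative (%h. - y (norm x) * (h \<bullet> x))) (at x)"
proof (cases "x = 0")
 case False
 have "((%x. p (norm x)) has_derivative (%h. (h \<bullet> x / norm x) * - (norm x * y (norm x)))) (at x)"
  using has_derivative_compose[OF norm_deriv[OF False] p_deriv[of "norm x", unfolded has_field_derivative_def]] False by (simp add: mult_ac)
 also have "(%h. (h \<bullet> x / norm x) * - (norm x * y (norm x))) = (%h. - y (norm x) * (h \<bullet> x))" using False by (simp add: fun_eq_iff)
 finally show ?thesis unfolding V_def[abs_def] .
next
 case True
 have "(V has_derivative (%h. 0)) (at 0)"
  unfolding has_derivative_at
 proof (intro conjI bounded_linear_zero)
  have ev: "\<forall>\<^sub>F h in at (0 :: real^'n). norm (norm (V (0 + h) - V 0 - 0) / norm h) <= \<bar>B\<bar> * norm h"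
  proof -
   have "\<forall>\<^sub>F h in at (0 :: real^'n). dist h 0 < 1" unfolding eventually_at by (intro exI[of _ 1]) auto
   thus ?thesis
   proof eventually_elim
    case (elim h)
    have "\<bar>p (norm h) - p 0\<bar> <= B * (norm h)\<^sup>2" using elim by (intro p_zero) auto
    also have "\<dots> <= \<bar>B\<bar> * (norm h)\<^sup>2" by (intro mult_right_mono) auto
    finally show ?case unfolding V_def by (cases "h = 0") (simp_all add: divide_le_eq power2_eq_square mult_ac)
   qed
  qed
  have lim: "((%h :: real^'n. \<bar>B\<bar> * norm h) \<longlongrightarrow> \<bar>B\<bar> * norm (0 :: real^'n)) (at 0)" by (rule tendsto_mult[OF tendsto_const tendsto_norm[OF tendsto_ident_at]])
  show "((%h. norm (V (0 + h) - V 0 - 0) / norm h) \<longlongrightarrow> 0) (at 0)"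
   by (rule Lim_null_comparison[OF ev]) (use lim in simp)
 qed
 thus ?thesis unfolding True by simp
qed

lemma V_cont: "continuous_on UNIV V"
 by (intro continuous_at_imp_continuous_on ballI has_derivative_continuous[OF V_deriv])

lemma U_cont: "continuous_on UNIV U"
 unfolding continuous_on_def U_def[abs_def] using V_cont[unfolded continuous_on_def] by (auto intro!: tendsto_Thi)

lemma yn_cont: "continuous_on UNIV (%x :: real^'n. y (norm x))"
 by (rule continuous_on_compose2[OF y_cont]) (auto intro!: continuous_intros)

lemma dTh_cont: "continuous_on UNIV (%x. dTh (U x))"
 unfolding dTh_def by (intro continuous_intros U_cont)

lemma dTh_pos: "dTh s > 0" using dTh_ge_1[of s] by linarith

lemma U_deriv: "(U has_derivative (%h. h \<bullet> DU x)) (at x)"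
proof -
 have "(U has_derivative (%h. (- y (norm x) * (h \<bullet> x)) * (1 / dTh (U x)))) (at x)"
  unfolding U_def[abs_def] using has_derivative_compose[OF V_deriv Thi_has_derivative[of "V x", unfolded has_field_derivative_def]] by (simp add: mult_ac U_def)
 thus ?thesis unfolding DU_def by (simp add: mult_ac)
qed

lemma DU_cont: "continuous_on UNIV (%x. DU x $ i)"
 unfolding DU_def using dTh_pos by (auto intro!: continuous_intros yn_cont dTh_cont simp: less_imp_neq[symmetric])

lemma norm_DU: "(norm (DU x))\<^sup>2 * (dTh (U x))\<^sup>2 = (norm x * y (norm x))\<^sup>2"
 unfolding DU_def using dTh_pos[of "U x"] by (simp add: power_mult_distrib power_divide)

lemma weak_gradient: "weak_grad U DU"
 unfolding weak_grad_def
proof (intro allI impI)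
 fix \<phi> :: "real^'n => real" and i assume t: "test_fun \<phi>"
 obtain R where R: "!!x. norm x > R ==> \<phi> x = 0" using test_fun_support[OF t] by blast
 have W: "((%x. U x * \<phi> x) has_derivative (%h. U x * frechet_derivative \<phi> (at x) h + (h \<bullet> DU x) * \<phi> x)) (at x)" for x
  by (rule has_derivative_mult[OF U_deriv frechet_pd[OF test_fun_smooth(1)[OF t]]])
 have P: "pd i (%x. U x * \<phi> x) = (%x. U x * pd i \<phi> x + DU x $ i * \<phi> x)"
  using pd_eq[OF W] by (auto simp: pd_def inner_axis' inner_axis fun_eq_iff)
 have 1: "integrable lebesgue (%x. U x * pd i \<phi> x)"
  by (rule integrable_continuous_bounded_support(2)[where R = R]) (auto intro!: continuous_intros U_cont test_fun_smooth[OF t] simp: pd_outside[OF R])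
 have 2: "integrable lebesgue (%x. DU x $ i * \<phi> x)"
  by (rule integrable_continuous_bounded_support(2)[where R = R]) (auto intro!: continuous_on_mult DU_cont test_fun_smooth[OF t] simp: R)
 have "(\<integral>x. pd i (%x. U x * \<phi> x) x \<partial>lebesgue) = 0"
 proof (rule integral_pd_zero(2)[where R = R])
  show "continuous_on UNIV (pd i (%x. U x * \<phi> x))" unfolding P by (intro continuous_on_add continuous_on_mult U_cont DU_cont test_fun_smooth[OF t])
 qed (use W R in \<open>auto simp: differentiable_def\<close>)
 hence "(\<integral>x. U x * pd i \<phi> x \<partial>lebesgue) + (\<integral>x. DU x $ i * \<phi> x \<partial>lebesgue) = 0" unfolding P using 1 2 by simp
 thus "integrable lebesgue (%x. U x * pd i \<phi> x) \<and> integrable lebesgue (%x. DU x $ i * \<phi> x) \<and>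
   (\<integral>x. U x * pd i \<phi> x \<partial>lebesgue) = - (\<integral>x. DU x $ i * \<phi> x \<partial>lebesgue)" using 1 2 by simp
qed

definition F :: "real^'n => real" where "F x = FF g mu (U x)"
text \<open>The partial derivative of \<open>Z i\<close> in direction \<open>i\<close>. The quotient
  in the second term has no limit at the origin, but its factor tends to 0 by
  \<open>y_zero\<close>.\<close>

definition dZ :: "'n => real^'n => real" where
 "dZ i x = y (norm x) + (if x = 0 then 0 else (x $ i)\<^sup>2 / (norm x)\<^sup>2 * (F x - real d * y (norm x)))"

lemma F_cont: "continuous_on UNIV F"
 unfolding F_def[abs_def] FF_def using dTh_pos by (intro continuous_intros U_cont dTh_cont continuous_on_compose2[OF g_cont U_cont]) (auto simp: less_imp_neq[symmetric])

lemma F_zero: "F 0 = real d * y 0" unfolding F_def U_def V_def using y_zero by simp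

lemma Z_deriv: "\<exists>Z'. (Z i has_derivative Z') (at x) \<and> Z' (axis i 1) = dZ i x"
proof (cases "x = 0")
 case False
 define D where "D = (F x - real d * y (norm x)) / norm x"
 have yd: "(y has_derivative (%h. D * h)) (at (norm x))"
 proof -
  have "norm x > 0" using False by simp
  from y_deriv[OF this] show ?thesis unfolding D_def F_def U_def V_def has_field_derivative_def .
 qed
 have "((%x. y (norm x)) has_derivative (%h. D * (h \<bullet> x / norm x))) (at x)"
  by (rule has_derivative_compose[OF norm_deriv[OF False] yd])
 from has_derivative_mult[OF this bounded_linear_imp_has_derivative[OF bounded_linear_vec_nth[of i]]]
 have "(Z i has_derivative (%h. y (norm x) * h $ i + D * (h \<bullet> x / norm x) * x $ i)) (at x)" unfolding Z_def[abs_def] .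
 moreover have "y (norm x) * axis i (1::real) $ i + D * (axis i 1 \<bullet> x / norm x) * x $ i = dZ i x"
 proof -
  have "axis i 1 \<bullet> x = x $ i" "axis i (1::real) $ i = 1" by (simp_all add: inner_axis')
  thus ?thesis unfolding dZ_def D_def using False by (simp add: power2_eq_square)
 qed
 ultimately show ?thesis by blast
next
 case True
 have "(Z i has_derivative (%h. y 0 * h $ i)) (at 0)"
  unfolding has_derivative_at
 proof (intro conjI)
  show "bounded_linear (%h. y 0 * h $ i)" by (intro bounded_linear_const_mult bounded_linear_vec_nth)
  have le: "norm (norm (Z i (0 + h) - Z i 0 - y 0 * h $ i) / norm h) <= \<bar>y (norm h) - y 0\<bar>" for h
  proof -
   have "\<bar>y (norm h) - y 0\<bar> * \<bar>h $ i\<bar> <= \<bar>y (norm h) - y 0\<bar> * norm h" by (intro mult_left_mono component_le_norm_cart) simp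
   moreover have "norm (Z i (0 + h) - Z i 0 - y 0 * h $ i) = \<bar>y (norm h) - y 0\<bar> * \<bar>h $ i\<bar>" unfolding Z_def by (simp add: abs_mult[symmetric] left_diff_distrib)
   ultimately show ?thesis by (cases "h = 0") (simp_all add: divide_le_eq)
  qed
  have lim: "((%h :: real^'n. \<bar>y (norm h) - y 0\<bar>) \<longlongrightarrow> 0) (at 0)"
  proof -
   have "((%h :: real^'n. y (norm h)) \<longlongrightarrow> y (norm (0 :: real^'n))) (at 0)" using yn_cont unfolding continuous_on_def by blast
   hence "((%h :: real^'n. \<bar>y (norm h) - y 0\<bar>) \<longlongrightarrow> \<bar>y (norm (0 :: real^'n)) - y 0\<bar>) (at 0)" by (intro tendsto_intros)
   thus ?thesis by simp
  qed
  show "((%h. norm (Z i (0 + h) - Z i 0 - y 0 * h $ i) / norm h) \<longlongrightarrow> 0) (at 0)"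
   by (rule Lim_null_comparison[OF _ lim]) (rule always_eventually, intro allI le)
 qed
 moreover have "y 0 * axis i (1::real) $ i = dZ i 0" unfolding dZ_def by simp
 ultimately show ?thesis unfolding True by blast
qed

lemma dZ_cont: "continuous_on UNIV (dZ i)"
 unfolding continuous_on_def
proof
 fix x :: "real^'n"
 have yl: "((%x :: real^'n. y (norm x)) \<longlongrightarrow> y (norm x)) (at x)" and Fl: "(F \<longlongrightarrow> F x) (at x)" for x
  using yn_cont F_cont unfolding continuous_on_def by auto
 show "(dZ i \<longlongrightarrow> dZ i x) (at x)"
 proof (cases "x = 0")
  case False
  have "\<forall>\<^sub>F z in at x. z \<noteq> 0" by (rule tendsto_imp_eventually_ne[OF tendsto_ident_at False])
  hence ev: "\<forall>\<^sub>F z in at x. dZ i z = y (norm z) + (z $ i)\<^sup>2 / (norm z)\<^sup>2 * (F z - real d * y (norm z))"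
   by eventually_elim (simp add: dZ_def)
  have dx: "dZ i x = y (norm x) + (x $ i)\<^sup>2 / (norm x)\<^sup>2 * (F x - real d * y (norm x))" using False by (simp add: dZ_def)
  show ?thesis unfolding tendsto_cong[OF ev] dx
   using False by (intro tendsto_intros yl Fl) auto
 next
  case True
  have "((%z. dZ i z - y (norm z)) \<longlongrightarrow> 0) (at 0)"
  proof (rule Lim_null_comparison[OF always_eventually])
   show "\<forall>z. norm (dZ i z - y (norm z)) <= \<bar>F z - real d * y (norm z)\<bar>"
   proof
    fix z
    have "(z $ i)\<^sup>2 <= (norm z)\<^sup>2" using component_le_norm_cart[of z i] by (simp add: abs_le_square_iff[symmetric])
    hence "(z $ i)\<^sup>2 / (norm z)\<^sup>2 <= 1" by (simp add: divide_le_eq)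
    hence "(z $ i)\<^sup>2 / (norm z)\<^sup>2 * \<bar>F z - real d * y (norm z)\<bar> <= 1 * \<bar>F z - real d * y (norm z)\<bar>" by (intro mult_right_mono) auto
    thus "norm (dZ i z - y (norm z)) <= \<bar>F z - real d * y (norm z)\<bar>" unfolding dZ_def by (auto simp: abs_mult)
   qed
   have "((%z. \<bar>F z - real d * y (norm z)\<bar>) \<longlongrightarrow> \<bar>F 0 - real d * y (norm (0 :: real^'n))\<bar>) (at 0)" by (intro tendsto_intros yl Fl)
   thus "((%z. \<bar>F z - real d * y (norm z)\<bar>) \<longlongrightarrow> 0) (at 0)" using F_zero by simp
  qed
  from tendsto_add[OF this yl] show ?thesis unfolding True by (simp add: dZ_def[of i 0])
 qed
qed

lemma sum_dZ: "(\<Sum>i\<in>UNIV. dZ i x) = F x"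
proof (cases "x = 0")
 case True thus ?thesis unfolding dZ_def using F_zero dn by simp
next
 case False
 have "(\<Sum>i\<in>UNIV. (x $ i)\<^sup>2) = (norm x)\<^sup>2" unfolding power2_norm_eq_inner inner_vec_def by (simp add: power2_eq_square)
 hence "(\<Sum>i\<in>UNIV. (x $ i)\<^sup>2 / (norm x)\<^sup>2 * (F x - real d * y (norm x))) = F x - real d * y (norm x)"
  unfolding sum_distrib_right[symmetric] sum_divide_distrib[symmetric] using False by simp
 thus ?thesis unfolding dZ_def using False dn by (simp add: sum.distrib)
qed

text \<open>The integrand is the divergence of \<phi> times \<open>1 + 2 * U^2\<close> times the
  gradient of \<open>U\<close>. As \<open>Z i\<close> equals \<open>- dTh U\<close> times the
  component of \<open>DU\<close>, this field is \<open>W i\<close>, and \<open>dZ\<close> is the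
  only second derivative involved.\<close>

lemma weak_equation:
 assumes t: "test_fun \<phi>"
 defines "I \<equiv> (%x. (1 + 2 * (U x)\<^sup>2) * (DU x \<bullet> grad \<phi> x) + 2 * U x * (norm (DU x))\<^sup>2 * \<phi> x + mu * U x * \<phi> x - g (U x) * \<phi> x)"
 shows "integrable lebesgue I" "(\<integral>x. I x \<partial>lebesgue) = 0"
proof -
 obtain R where R: "!!x. norm x > R ==> \<phi> x = 0" using test_fun_support[OF t] by blast
 define W where "W i x = - (\<phi> x * dTh (U x) * Z i x)" for i x
 define P where "P i x = - ((pd i \<phi> x * dTh (U x) + \<phi> x * (2 * U x / dTh (U x) * DU x $ i)) * Z i x + \<phi> x * dTh (U x) * dZ i x)" for i x
 have W: "\<exists>W'. (W i has_derivative W') (at x) \<and> W' (axis i 1) = P i x" for i x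
 proof -
  obtain Z' where Z': "(Z i has_derivative Z') (at x)" "Z' (axis i 1) = dZ i x" using Z_deriv by blast
  have T: "((%x. dTh (U x)) has_derivative (%h. 2 * U x / dTh (U x) * (h \<bullet> DU x))) (at x)"
   by (rule has_derivative_compose[OF U_deriv dTh_has_derivative[of "U x", unfolded has_field_derivative_def]])
  note D = has_derivative_minus[OF has_derivative_mult[OF has_derivative_mult[OF frechet_pd[OF test_fun_smooth(1)[OF t]] T] Z'(1)]]
  hence "(W i has_derivative (%h. - (\<phi> x * dTh (U x) * Z' h + (\<phi> x * (2 * U x / dTh (U x) * (h \<bullet> DU x)) + frechet_derivative \<phi> (at x) h * dTh (U x)) * Z i x))) (at x)"
   unfolding W_def[abs_def] .
  moreover have "- (\<phi> x * dTh (U x) * Z' (axis i 1) + (\<phi> x * (2 * U x / dTh (U x) * (axis i 1 \<bullet> DU x)) + frechet_derivative \<phi> (at x) (axis i 1) * dTh (U x)) * Z i x) = P i x"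
   unfolding P_def Z'(2) by (simp add: pd_def inner_axis' add.commute)
  ultimately show ?thesis by blast
 qed
 have pdW: "pd i (W i) = P i" for i
 proof
  fix x
  obtain W' where "(W i has_derivative W') (at x)" "W' (axis i 1) = P i x" using W by blast
  thus "pd i (W i) x = P i x" using pd_eq by metis
 qed
 have Zc: "continuous_on UNIV (Z i)" for i unfolding Z_def by (intro continuous_intros yn_cont)
 have Pc: "continuous_on UNIV (P i)" for i
  unfolding P_def using dTh_pos
  by (intro continuous_on_minus continuous_on_add continuous_on_mult continuous_on_divide continuous_on_const DU_cont Zc dZ_cont dTh_cont U_cont test_fun_smooth[OF t])
   (auto simp: less_imp_neq[symmetric])
 have Wd: "W i differentiable (at x)" for i x using W[of i x] unfolding differentiable_def by blast
 have W0: "W i x = 0" if "norm x > R" for i x using R[OF that] by (simp add: W_def)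
 have PI: "integrable lebesgue (P i)" "(\<integral>x. P i x \<partial>lebesgue) = 0" for i
  using integral_pd_zero[OF Wd, of i i R] unfolding pdW using Pc W0 by auto
 have I: "I x = (\<Sum>i\<in>UNIV. P i x)" for x
 proof -
  define T where "T = dTh (U x)"
  have T: "T > 0" "T\<^sup>2 = 1 + 2 * (U x)\<^sup>2" unfolding T_def by (rule dTh_pos) (rule dTh_sq)
  have ZD: "Z i x = - T * DU x $ i" for i unfolding Z_def DU_def T_def using dTh_pos[of "U x"] by simp
  have "P i x = T\<^sup>2 * (DU x $ i * pd i \<phi> x) + 2 * U x * \<phi> x * (DU x $ i * DU x $ i) - \<phi> x * T * dZ i x" for i
   unfolding P_def ZD T_def[symmetric] using T(1) by (simp add: field_simps power2_eq_square)
  hence "(\<Sum>i\<in>UNIV. P i x) = T\<^sup>2 * (\<Sum>i\<in>UNIV. DU x $ i * pd i \<phi> x) + 2 * U x * \<phi> x * (\<Sum>i\<in>UNIV. DU x $ i * DU x $ i) - \<phi> x * T * (\<Sum>i\<in>UNIV. dZ i x)"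
   by (simp add: sum.distrib sum_subtractf sum_distrib_left)
  also have "(\<Sum>i\<in>UNIV. DU x $ i * pd i \<phi> x) = DU x \<bullet> grad \<phi> x" by (simp add: inner_vec_def grad_def)
  also have "(\<Sum>i\<in>UNIV. DU x $ i * DU x $ i) = (norm (DU x))\<^sup>2" by (simp add: power2_norm_eq_inner inner_vec_def)
  also have "(\<Sum>i\<in>UNIV. dZ i x) = F x" by (rule sum_dZ)
  also have "\<phi> x * T * F x = \<phi> x * (g (U x) - mu * U x)" unfolding F_def FF_def T_def using dTh_pos[of "U x"] by simp
  finally show ?thesis unfolding I_def T(2) by (simp add: algebra_simps)
 qed
 have Ieq: "I = (%x. \<Sum>i\<in>UNIV. P i x)" using I by (simp add: fun_eq_iff)
 show "integrable lebesgue I" unfolding Ieq by (intro Bochner_Integration.integrable_sum PI)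
 have "(\<integral>x. (\<Sum>i\<in>UNIV. P i x) \<partial>lebesgue) = (\<Sum>i\<in>UNIV. \<integral>x. P i x \<partial>lebesgue)" by (rule Bochner_Integration.integral_sum) (rule PI)
 thus "(\<integral>x. I x \<partial>lebesgue) = 0" unfolding Ieq PI by simp
qed

text \<open>Radial integration multiplies \<open>m0\<close> by the area \<open>c\<close> of the unit
  sphere. The integrals of the squared gradient and of the quasilinear term are finite because
  \<open>1 + 2 * U^2\<close> times the squared gradient of \<open>U\<close> is the squared gradient
  of \<open>V\<close>.\<close>

theorem radial_solution:
 defines "c \<equiv> real d * unit_ball_vol (real d)"
 shows "Defs.radial_solution g (c * m0) U" "continuous_on UNIV U"
proof -
 show Uc: "continuous_on UNIV U" by (rule U_cont)
 have c0: "c >= 0" unfolding c_def by simp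
 have cc: "c = real DIM(real^'n) * unit_ball_vol (real DIM(real^'n))" unfolding c_def dn by simp
 have ee: "DIM(real^'n) - 1 = e" using de dn by simp
 have pc: "isCont p t" if "t > 0" for t using DERIV_isCont[OF p_deriv[OF that]] .
 have yc: "isCont y t" if "t > 0" for t using DERIV_isCont[OF y_deriv[OF that]] .
 have nn: "(\<integral>\<^sup>+x. ennreal (f (norm (x::real^'n))) \<partial>lebesgue) = ennreal c * (\<integral>\<^sup>+r. ennreal (r ^ e * f r) * indicator {0<..} r \<partial>lborel)"
  if "f \<in> borel_measurable borel" for f :: "real => real"
  using nn_integral_radial[OF that cc] unfolding ee .
 \<comment> \<open>The constant extension to \<open>r <= 0\<close> makes the function Borel on the
   whole line; its value at 0 has to be the right one, because \<open>U 0\<close> is read off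
   there.\<close>
 define u where "u r = (if r > 0 then Thi (p r) else Thi (p 0))" for r
 define w where "w r = (if r > 0 then r * y r else 0)" for r
 have um: "u \<in> borel_measurable borel"
  unfolding u_def by (intro measurable_If_restrict_space_iff[THEN iffD2] conjI borel_measurable_continuous_on_restrict continuous_at_imp_continuous_on ballI)
   (auto intro!: continuous_intros isCont_o2[OF pc] simp: isCont_def tendsto_Thi pc[unfolded isCont_def])
 have wm: "w \<in> borel_measurable borel"
  unfolding w_def by (intro measurable_If_restrict_space_iff[THEN iffD2] conjI borel_measurable_continuous_on_restrict continuous_at_imp_continuous_on ballI)
   (auto intro!: continuous_intros yc)
 have Uu: "U x = u (norm x)" for x unfolding U_def V_def u_def by simp
 have ww: "(norm x * y (norm x))\<^sup>2 = (w (norm x))\<^sup>2" for x :: "real^'n" unfolding w_def by simp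
 have cont: "(%r. r ^ e * (u r)\<^sup>2) integrable_on {a..b}" "(%r. r ^ e * (w r)\<^sup>2) integrable_on {a..b}"
  "integral {a..b} (%r. r ^ e * (u r)\<^sup>2) = integral {a..b} (%r. r ^ e * (Thi (p r))\<^sup>2)"
  "integral {a..b} (%r. r ^ e * (w r)\<^sup>2) = integral {a..b} (%r. r ^ e * (r * y r)\<^sup>2)" if a: "0 < a" for a b
 proof -
  have "continuous_on {a..b} p" "continuous_on {a..b} y" using a by (auto intro!: continuous_at_imp_continuous_on pc yc)
  hence "continuous_on {a..b} (%r. r ^ e * (Thi (p r))\<^sup>2)" "continuous_on {a..b} (%r. r ^ e * (r * y r)\<^sup>2)"
   by (auto intro!: continuous_intros)
  note c = this[THEN integrable_continuous_real]
  show "(%r. r ^ e * (u r)\<^sup>2) integrable_on {a..b}" by (rule integrable_eq[OF c(1)]) (use a in \<open>auto simp: u_def\<close>)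
  show "(%r. r ^ e * (w r)\<^sup>2) integrable_on {a..b}" by (rule integrable_eq[OF c(2)]) (use a in \<open>auto simp: w_def\<close>)
  show "integral {a..b} (%r. r ^ e * (u r)\<^sup>2) = integral {a..b} (%r. r ^ e * (Thi (p r))\<^sup>2)"
   by (rule Henstock_Kurzweil_Integration.integral_cong) (use a in \<open>auto simp: u_def\<close>)
  show "integral {a..b} (%r. r ^ e * (w r)\<^sup>2) = integral {a..b} (%r. r ^ e * (r * y r)\<^sup>2)"
   by (rule Henstock_Kurzweil_Integration.integral_cong) (use a in \<open>auto simp: w_def\<close>)
 qed
 have "(\<integral>\<^sup>+x. ennreal ((U x)\<^sup>2) \<partial>lebesgue) = ennreal c * (\<integral>\<^sup>+r. ennreal (r ^ e * (u r)\<^sup>2) * indicator {0<..} r \<partial>lborel)"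
  unfolding Uu by (rule nn[of "%r. (u r)\<^sup>2"]) (use um in measurable)
 also have "(\<integral>\<^sup>+r. ennreal (r ^ e * (u r)\<^sup>2) * indicator {0<..} r \<partial>lborel) = ennreal m0"
 proof (rule nn_integral_half_line(2))
  show "(%r. r ^ e * (u r)\<^sup>2) \<in> borel_measurable borel" using um by measurable
  show "integral {a..b} (%r. r ^ e * (u r)\<^sup>2) <= m0" if "0 < a" "a <= b" for a b unfolding cont(3)[OF that(1)] by (rule mass_le[OF that])
  show "\<exists>a b. 0 < a \<and> a <= b \<and> m0 - \<eta> <= integral {a..b} (%r. r ^ e * (u r)\<^sup>2)" if \<eta>: "\<eta> > 0" for \<eta>
  proof -
   obtain a b where "0 < a" "a <= b" "m0 - \<eta> <= integral {a..b} (%r. r ^ e * (Thi (p r))\<^sup>2)" using mass_ge[OF \<eta>] by blast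
   thus ?thesis using cont(3)[of a b] by (intro exI[of _ a] exI[of _ b]) simp
  qed
 qed (use cont in auto)
 also have "ennreal c * ennreal m0 = ennreal (c * m0)" using c0 by (simp add: ennreal_mult')
 finally have UM: "(\<integral>\<^sup>+x. ennreal ((U x)\<^sup>2) \<partial>lebesgue) = ennreal (c * m0)" .
 have m0: "m0 >= 0" using order_trans[OF _ mass_le[of 1 1]] by simp
 have WM: "(\<integral>\<^sup>+x. ennreal ((norm x * y (norm (x::real^'n)))\<^sup>2) \<partial>lebesgue) < \<infinity>"
 proof -
  have "(\<integral>\<^sup>+x. ennreal ((w (norm (x::real^'n)))\<^sup>2) \<partial>lebesgue) = ennreal c * (\<integral>\<^sup>+r. ennreal (r ^ e * (w r)\<^sup>2) * indicator {0<..} r \<partial>lborel)"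
   by (rule nn[of "%r. (w r)\<^sup>2"]) (use wm in measurable)
  also have "\<dots> <= ennreal c * ennreal K"
  proof (intro mult_left_mono nn_integral_half_line(1))
   show "(%r. r ^ e * (w r)\<^sup>2) \<in> borel_measurable borel" using wm by measurable
   show "integral {a..b} (%r. r ^ e * (w r)\<^sup>2) <= K" if "0 < a" "a <= b" for a b unfolding cont(4)[OF that(1)] by (rule kinetic[OF that])
  qed (use cont in auto)
  also have "\<dots> < \<infinity>" by (simp add: ennreal_mult_less_top)
  finally show ?thesis unfolding ww .
 qed
 have meas: "f \<in> borel_measurable lebesgue" if "continuous_on UNIV f" for f :: "real^'n => real"
  using borel_measurable_continuous_onI[OF that] by (simp add: measurable_completion)
 have int: "integrable lebesgue f" if "continuous_on UNIV f" "!!x. 0 <= f x" "!!x. f x <= (norm x * y (norm x))\<^sup>2" for f :: "real^'n => real"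
 proof (rule integrableI_nonneg[OF meas[OF that(1)]])
  have "(\<integral>\<^sup>+x. ennreal (f x) \<partial>lebesgue) <= (\<integral>\<^sup>+x. ennreal ((norm x * y (norm (x :: real^'n)))\<^sup>2) \<partial>lebesgue)"
   by (intro nn_integral_mono ennreal_leI that(3))
  also note WM
  finally show "(\<integral>\<^sup>+x. ennreal (f x) \<partial>lebesgue) < \<infinity>" .
 qed (use that(2) in simp)
 have DUn: "(norm (DU x))\<^sup>2 = (\<Sum>i\<in>UNIV. (DU x $ i)\<^sup>2)" for x unfolding power2_norm_eq_inner inner_vec_def by (simp add: power2_eq_square)
 have DUnc: "continuous_on UNIV (%x. (norm (DU x))\<^sup>2)" unfolding DUn by (intro continuous_intros DU_cont)
 have bnd: "(U x)\<^sup>2 * (norm (DU x))\<^sup>2 <= (norm x * y (norm x))\<^sup>2" "(DU x $ i)\<^sup>2 <= (norm x * y (norm x))\<^sup>2" for x i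
 proof -
  have q: "(norm x * y (norm x))\<^sup>2 = (norm (DU x))\<^sup>2 + 2 * ((U x)\<^sup>2 * (norm (DU x))\<^sup>2)"
   unfolding norm_DU[symmetric] dTh_sq by (simp add: algebra_simps)
  have n: "0 <= (norm (DU x))\<^sup>2" "0 <= (U x)\<^sup>2 * (norm (DU x))\<^sup>2" by simp_all
  thus "(U x)\<^sup>2 * (norm (DU x))\<^sup>2 <= (norm x * y (norm x))\<^sup>2" unfolding q by linarith
  have "(DU x $ i)\<^sup>2 <= (norm (DU x))\<^sup>2" using component_le_norm_cart[of "DU x" i] by (simp add: abs_le_square_iff[symmetric])
  thus "(DU x $ i)\<^sup>2 <= (norm x * y (norm x))\<^sup>2" unfolding q using n by linarith
 qed
 have U2: "integrable lebesgue (%x. (U x)\<^sup>2)"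
  by (rule integrableI_nonneg) (auto intro!: meas continuous_intros Uc simp: UM)
 have "is_solution g (c * m0) mu U"
  unfolding is_solution_def Let_def
 proof (intro exI[of _ DU] conjI allI impI)
  show "L2 U" unfolding L2_def using U2 meas[OF Uc] by blast
  show "weak_grad U DU" by (rule weak_gradient)
  show "L2 (%x. DU x $ i)" for i unfolding L2_def
   using meas[OF DU_cont] by (auto intro!: int continuous_intros DU_cont bnd)
  show "integrable lebesgue (%x. (U x)\<^sup>2 * (norm (DU x))\<^sup>2)" by (intro int continuous_on_mult DUnc continuous_on_power Uc bnd) simp
  have "ennreal (\<integral>x. (U x)\<^sup>2 \<partial>lebesgue) = ennreal (c * m0)" using nn_integral_eq_integral[OF U2] UM by simp
  thus "(\<integral>x. (U x)\<^sup>2 \<partial>lebesgue) = c * m0" using c0 m0 by (subst (asm) ennreal_inj) auto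
 qed (use weak_equation in blast)+
 moreover have "radial U" unfolding radial_def U_def V_def by simp
 ultimately show "Defs.radial_solution g (c * m0) U" unfolding radial_solution_def by blast
qed

end

lemma continuous_AE_eq:
 fixes f h :: "real^'n::finite => real"
 assumes "continuous_on UNIV f" "continuous_on UNIV h" "AE x in lebesgue. f x = h x"
 shows "f x = h x"
proof -
 have "closed {x. f x = h x}" by (rule closed_Collect_eq[OF assms(1,2)])
 from mem_closed_if_AE_lebesgue[OF this] assms(3) show ?thesis by simp
qed

section \<open>Existence of nodal solutions\<close>

locale nonlinearity =
 fixes d :: nat and g G :: "real => real"
 assumes d2: "d >= 2" and g_cont: "continuous_on UNIV g" and G_deriv: "!!s. (G has_real_derivative g s) (at s)"
  and G_0: "G 0 = 0" and g_odd: "!!s. g (- s) = - g s"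
  and g_small: "((%s. g s / s) \<longlongrightarrow> 0) (at 0)"
  and g_large: "((%s. \<bar>g s\<bar> / \<bar>s\<bar> powr (4 + 4 / real d - 1)) \<longlongrightarrow> 0) at_infinity"
begin

lemma G_even: "G (- s) = G s"
proof -
 have D: "((%s. G (- s) - G s) has_real_derivative 0) (at x)" for x
 proof -
  have "((%s. G (- s)) has_real_derivative g (- x) * (- 1)) (at x)"
   by (rule DERIV_chain2[OF G_deriv]) (auto intro!: derivative_eq_intros)
  from DERIV_diff[OF this G_deriv] show ?thesis by (simp add: g_odd)
 qed
 have "G (- s) - G s = G (- 0) - G 0" by (rule DERIV_isconst_all) (use D in blast)
 thus ?thesis by simp
qed

lemma g_0: "g 0 = 0" using g_odd[of 0] by simp

lemma G_le: assumes "!!t. \<bar>t\<bar> <= \<bar>s\<bar> ==> \<bar>g t\<bar> <= B" shows "\<bar>G s\<bar> <= B * \<bar>s\<bar>"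
proof -
 have "norm (G s - G 0) <= B * norm (s - 0)"
 proof (rule field_differentiable_bound[of "{- \<bar>s\<bar>..\<bar>s\<bar>}" G g])
  show "(G has_field_derivative g z) (at z within {- \<bar>s\<bar>..\<bar>s\<bar>})" for z by (rule has_field_derivative_at_within[OF G_deriv])
  show "norm (g z) <= B" if "z \<in> {- \<bar>s\<bar>..\<bar>s\<bar>}" for z using assms[of z] that by auto
 qed auto
 thus ?thesis using G_0 by simp
qed

lemma small:
 assumes \<eta>: "\<eta> > 0"
 shows "\<exists>s>0. \<forall>t. \<bar>t\<bar> < s --> \<bar>g t\<bar> <= \<eta> * \<bar>t\<bar> \<and> \<bar>G t\<bar> <= \<eta> * t\<^sup>2"
proof -
 obtain s where s: "s > 0" "!!t. t \<noteq> 0 ==> \<bar>t\<bar> < s ==> \<bar>g t / t\<bar> < \<eta>"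
  using LIM_D[OF g_small \<eta>] by auto
 have 1: "\<bar>g t\<bar> <= \<eta> * \<bar>t\<bar>" if "\<bar>t\<bar> < s" for t
  using s(2)[OF _ that] g_0 by (cases "t = 0") (auto simp: field_simps)
 have 2: "\<bar>G t\<bar> <= \<eta> * t\<^sup>2" if t: "\<bar>t\<bar> < s" for t
 proof -
  have "\<bar>G t\<bar> <= (\<eta> * \<bar>t\<bar>) * \<bar>t\<bar>"
  proof (rule G_le)
   fix z assume z: "\<bar>z\<bar> <= \<bar>t\<bar>"
   have "\<bar>g z\<bar> <= \<eta> * \<bar>z\<bar>" using z t by (intro 1) simp
   also have "\<dots> <= \<eta> * \<bar>t\<bar>" using z \<eta> by (intro mult_left_mono) auto
   finally show "\<bar>g z\<bar> <= \<eta> * \<bar>t\<bar>" .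
  qed
  thus ?thesis by (simp add: power2_eq_square mult.assoc)
 qed
 show ?thesis using s(1) 1 2 by blast
qed

text \<open>(g3) makes the coefficient of the critical power arbitrarily small and (g2) handles
  small arguments. On the compact middle range arguments are at least \<open>s1\<close>, so the
  maximum of \<open>g\<close> is absorbed into the linear term.\<close>

lemma g_growth:
 assumes \<eta>: "\<eta> > 0"
 obtains C where "C >= 0" "!!s. \<bar>g s\<bar> <= C * \<bar>s\<bar> + \<eta> * \<bar>s\<bar> powr (3 + 4 / real d)"
proof -
 obtain s1 where s1: "s1 > 0" "!!t. \<bar>t\<bar> < s1 ==> \<bar>g t\<bar> <= \<bar>t\<bar>" using small[of 1] by auto
 have "\<forall>\<^sub>F s in at_infinity. \<bar>g s\<bar> / \<bar>s\<bar> powr (4 + 4 / real d - 1) < \<eta>" by (rule order_tendstoD(2)[OF g_large \<eta>])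
 then obtain T where T: "!!s. \<bar>s\<bar> >= T ==> \<bar>g s\<bar> / \<bar>s\<bar> powr (4 + 4 / real d - 1) < \<eta>" unfolding eventually_at_infinity by auto
 have "compact (g ` {- \<bar>T\<bar>..\<bar>T\<bar>})" by (rule compact_continuous_image[OF continuous_on_subset[OF g_cont]]) auto
 hence "bounded (g ` {- \<bar>T\<bar>..\<bar>T\<bar>})" by (rule compact_imp_bounded)
 hence "\<exists>B. \<forall>z\<in>g ` {- \<bar>T\<bar>..\<bar>T\<bar>}. norm z <= B" by (simp only: bounded_iff)
 then obtain B where B: "\<forall>z\<in>g ` {- \<bar>T\<bar>..\<bar>T\<bar>}. norm z <= B" ..
 have BT: "\<bar>g s\<bar> <= B" if "\<bar>s\<bar> <= \<bar>T\<bar>" for s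
 proof -
  have "- \<bar>T\<bar> <= s" "s <= \<bar>T\<bar>" using that by linarith+
  thus ?thesis using bspec[OF B imageI[of s "{- \<bar>T\<bar>..\<bar>T\<bar>}"]] by simp
 qed
 have B0: "B >= 0" using BT[of 0] by simp
 show thesis
 proof (rule that[of "1 + B / s1"])
  show "0 <= 1 + B / s1" using B0 s1 by simp
  fix s
  have e: "0 <= \<eta> * \<bar>s\<bar> powr (3 + 4 / real d)" using \<eta> by simp
  have Bs: "0 <= B / s1 * \<bar>s\<bar>" using B0 s1 by simp
  consider "\<bar>s\<bar> < s1" | "\<bar>s\<bar> >= s1" "\<bar>s\<bar> <= \<bar>T\<bar>" | "\<bar>s\<bar> > \<bar>T\<bar>" "\<bar>s\<bar> >= s1" by linarith
  thus "\<bar>g s\<bar> <= (1 + B / s1) * \<bar>s\<bar> + \<eta> * \<bar>s\<bar> powr (3 + 4 / real d)"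
  proof cases
   case 1 thus ?thesis using s1(2)[OF 1] e Bs by (simp add: distrib_right)
  next
   case 2
   have "B / s1 * s1 <= B / s1 * \<bar>s\<bar>" using 2 B0 s1 by (intro mult_left_mono) auto
   hence "B <= B / s1 * \<bar>s\<bar>" using s1 by simp
   thus ?thesis using BT[OF 2(2)] e by (simp add: distrib_right)
  next
   case 3
   have "\<bar>g s\<bar> / \<bar>s\<bar> powr (3 + 4 / real d) < \<eta>" using T[of s] 3 by (simp add: algebra_simps)
   moreover have "\<bar>s\<bar> powr (3 + 4 / real d) > 0" using 3 s1 by simp
   ultimately have "\<bar>g s\<bar> < \<eta> * \<bar>s\<bar> powr (3 + 4 / real d)" by (simp add: divide_less_eq)
   thus ?thesis using Bs by (simp add: distrib_right)
  qed
 qed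
qed

lemma G_growth:
 assumes C: "C >= 0" "\<eta> >= 0" "!!s. \<bar>g s\<bar> <= C * \<bar>s\<bar> + \<eta> * \<bar>s\<bar> powr (3 + 4 / real d)"
 shows "\<bar>G s\<bar> <= C * s\<^sup>2 + \<eta> * \<bar>s\<bar> powr (4 + 4 / real d)"
proof -
 have "\<bar>G s\<bar> <= (C * \<bar>s\<bar> + \<eta> * \<bar>s\<bar> powr (3 + 4 / real d)) * \<bar>s\<bar>"
 proof (rule G_le)
  fix t assume t: "\<bar>t\<bar> <= \<bar>s\<bar>"
  have "\<bar>g t\<bar> <= C * \<bar>t\<bar> + \<eta> * \<bar>t\<bar> powr (3 + 4 / real d)" by (rule C(3))
  also have "\<dots> <= C * \<bar>s\<bar> + \<eta> * \<bar>s\<bar> powr (3 + 4 / real d)" using t C(1,2) by (intro add_mono mult_left_mono powr_mono2) auto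
  finally show "\<bar>g t\<bar> <= C * \<bar>s\<bar> + \<eta> * \<bar>s\<bar> powr (3 + 4 / real d)" .
 qed
 also have "\<dots> = C * s\<^sup>2 + \<eta> * (\<bar>s\<bar> powr (3 + 4 / real d) * \<bar>s\<bar>)"
 proof -
  have "\<bar>s\<bar> * \<bar>s\<bar> = s\<^sup>2" by (simp add: power2_eq_square)
  thus ?thesis by (simp only: distrib_right mult.assoc)
 qed
 also have "\<bar>s\<bar> powr (3 + 4 / real d) * \<bar>s\<bar> = \<bar>s\<bar> powr (4 + 4 / real d)"
 proof (cases "s = 0")
  case False
  have "4 + 4 / real d = (3 + 4 / real d) + 1" by simp
  thus ?thesis using False by (simp only: powr_add) simp
 qed simp
 finally show ?thesis .
qed

lemma rlattice:
 assumes "h > 0" "m0 > 0"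
 shows "rlattice (d - 1) h g G m0 d"
proof (unfold_locales)
 show "\<exists>C. \<forall>s. \<bar>s\<bar> <= T --> \<bar>g s\<bar> <= C * \<bar>s\<bar>" for T
 proof -
  obtain C where C: "C >= 0" "!!s. \<bar>g s\<bar> <= C * \<bar>s\<bar> + 1 * \<bar>s\<bar> powr (3 + 4 / real d)" using g_growth[of 1] by auto
  have "\<bar>g s\<bar> <= (C + \<bar>T\<bar> powr (2 + 4 / real d)) * \<bar>s\<bar>" if s: "\<bar>s\<bar> <= T" for s
  proof -
   have "\<bar>s\<bar> powr (3 + 4 / real d) = \<bar>s\<bar> powr (2 + 4 / real d) * \<bar>s\<bar>"
   proof (cases "s = 0")
    case False
    have "3 + 4 / real d = (2 + 4 / real d) + 1" by simp
    thus ?thesis using False by (simp only: powr_add) simp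
   qed simp
   also have "\<dots> <= \<bar>T\<bar> powr (2 + 4 / real d) * \<bar>s\<bar>" using s by (intro mult_right_mono powr_mono2) auto
   finally show ?thesis using C(2)[of s] by (simp add: distrib_right)
  qed
  thus ?thesis by blast
 qed
 show "G (- s) = G s" for s by (rule G_even)
qed (use assms d2 g_cont G_deriv G_0 in auto)

theorem nodal_profile:
 assumes m0: "m0 > 0" and k: "k >= 1" and s: "s > 0" and w: "w > 0" "4 * w <= l"
  and \<Gamma>: "!!t. 0 <= t ==> t <= s ==> - G t <= \<Gamma>" and Gs: "G s >= 0" and e0: "e0 > 0"
  and E: "(real k + 1) * (8 * w * ((3 * real k + 4) * l) ^ (d - 1) * ((dTh s * s / w)\<^sup>2 / 2 + \<Gamma>)) + e0 <= G s * (l - w) * l ^ (d - 1)"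
  and mass: "((3 * real k + 4) * l) ^ d * s\<^sup>2 <= m0"
 obtains mu K B p y where "profile d (d - 1) g mu m0 K B p y"
  "alt (k - 1) (%t. if t > 0 then p t else 0)" "\<not> alt (Suc k) (%t. if t > 0 then p t else 0)"
proof -
 define X where "X = (3 * real k + 4) * l"
 have X: "X >= 0" unfolding X_def using w by simp
 \<comment> \<open>The mesh stays below the ramp width, as the bumps require, and tends to 0;
   \<open>L\<close> is then chosen so that the lattice contains all bumps and its radius grows at
   least like \<open>n\<close>.\<close>
 define h where "h n = min 1 w / (real n + 1)" for n
 define L where "L n = nat \<lceil>(X + real n) / h n\<rceil>" for n
 have h: "h n > 0" "h n <= 1" "h n <= w" for n
 proof -
  have m: "min 1 w > 0" "min 1 w <= 1" "min 1 w <= w" using w by auto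
  show "h n > 0" unfolding h_def using m by simp
  have "h n <= min 1 w / 1" unfolding h_def by (rule divide_left_mono) (use m in auto)
  thus "h n <= 1" "h n <= w" using m by auto
 qed
 have hL: "X + real n <= h n * real (L n)" for n
 proof -
  have "(X + real n) / h n <= real (L n)" unfolding L_def by linarith
  thus ?thesis using h(1)[of n] by (simp add: field_simps)
 qed
 have rl: "rlattice (d - 1) (h n) g G m0 d" for n by (rule rlattice[OF h(1) m0])
 have "\<exists>u \<mu>. rlattice.crit (L n) (d - 1) (h n) g m0 \<mu> u \<and> 0 <= \<mu> \<and> (0 < \<mu> --> lattice.Q (L n) (%i. h n * ((real i + 1) * h n) ^ (d - 1)) u = m0) \<and>
  lattice.EE (L n) (%i. h n * ((real i + 1) * h n) ^ (d - 1)) (%i. ((real i + 1) * h n) ^ (d - 1) / h n) G u <= - e0 \<and> alt k u \<and> \<not> alt (Suc k) u" for n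
 proof (rule rlattice.bump_solution[OF rl[of n] s h(3)[of n] w(2) \<Gamma> Gs _ e0 E mass, where L = "L n"])
  show "(3 * real k + 4) * l <= h n * real (L n)" using hL[of n] unfolding X_def by linarith
  fix v \<mu>
  assume v: "v \<in> lattice.D (L n) (%i. h n * ((real i + 1) * h n) ^ (d - 1)) m0" "0 <= \<mu>"
   "!!i. i < L n ==> lattice.dE (%i. h n * ((real i + 1) * h n) ^ (d - 1)) (%i. ((real i + 1) * h n) ^ (d - 1) / h n) g v i + \<mu> * (h n * rlattice.rr (h n) i ^ (d - 1)) * v i = 0"
   "0 < \<mu> ==> lattice.Q (L n) (%i. h n * ((real i + 1) * h n) ^ (d - 1)) v = m0"
   "lattice.EE (L n) (%i. h n * ((real i + 1) * h n) ^ (d - 1)) (%i. ((real i + 1) * h n) ^ (d - 1) / h n) G v <= - e0" "alt k v" "\<not> alt (Suc k) v"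
  have "rlattice.crit (L n) (d - 1) (h n) g m0 \<mu> v" unfolding rlattice.crit_def[OF rl] using v(1,3) by blast
  thus ?thesis using v by blast
 qed
 then obtain u \<mu> where u: "!!n. rlattice.crit (L n) (d - 1) (h n) g m0 (\<mu> n) (u n)" "!!n. 0 <= \<mu> n"
  "!!n. 0 < \<mu> n ==> lattice.Q (L n) (%i. h n * ((real i + 1) * h n) ^ (d - 1)) (u n) = m0"
  "!!n. lattice.EE (L n) (%i. h n * ((real i + 1) * h n) ^ (d - 1)) (%i. ((real i + 1) * h n) ^ (d - 1) / h n) G (u n) <= - e0"
  "!!n. alt k (u n)" "!!n. \<not> alt (Suc k) (u n)" by metis
 define c where "c = rlattice.cGN m0 d"
 have c: "c > 0" unfolding c_def rlattice.cGN_def[OF rl[of 0]] using m0 by (intro add_nonneg_pos mult_nonneg_nonneg) (auto intro!: add_pos_nonneg)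
 have d0: "1 / (4 * c) > 0" using c by simp
 \<comment> \<open>With the coefficient \<open>1 / (4 * c)\<close> of the critical power,
   \<open>kinetic_bound\<close> can absorb the potential energy.\<close>
 obtain A where A: "A >= 0" "!!s. \<bar>g s\<bar> <= A * \<bar>s\<bar> + 1 / (4 * c) * \<bar>s\<bar> powr (3 + 4 / real d)" by (rule g_growth[OF d0]; iprover)
 have GA: "G s <= A * s\<^sup>2 + 1 / (4 * c) * \<bar>s\<bar> powr (4 + 4 / real d)" for s
  using G_growth[OF A(1) less_imp_le[OF d0] A(2), of s] by linarith
 define K where "K = 4 * A * m0 + 1"
 have K1: "K >= 1" unfolding K_def using A m0 by simp
 obtain C1 where C1: "C1 >= 0" "!!s. \<bar>g s\<bar> <= C1 * \<bar>s\<bar> + 1 * \<bar>s\<bar> powr (3 + 4 / real d)" by (rule g_growth[OF zero_less_one]; iprover)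
 define Cg where "Cg = C1 + 1"
 have Cg: "Cg >= 0" unfolding Cg_def using C1 by simp
 have gg: "\<bar>g s\<bar> <= Cg * (\<bar>s\<bar> + \<bar>s\<bar> powr (3 + 4 / real d))" for s
 proof -
  have "0 <= C1 * \<bar>s\<bar> powr (3 + 4 / real d)" "0 <= \<bar>s\<bar>" using C1 by simp_all
  thus ?thesis using C1(2)[of s] unfolding Cg_def by (simp only: distrib_left distrib_right mult_1_left)
 qed
 have GG: "\<bar>G s\<bar> <= Cg * (s\<^sup>2 + \<bar>s\<bar> powr (4 + 4 / real d))" for s
 proof -
  have "0 <= C1 * \<bar>s\<bar> powr (4 + 4 / real d)" "0 <= s\<^sup>2" using C1 by simp_all
  thus ?thesis using G_growth[OF C1(1) zero_le_one C1(2), of s] unfolding Cg_def by (simp only: distrib_left distrib_right mult_1_left)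
 qed
 have Vk: "rlattice.Vk (L n) (d - 1) (h n) (u n) <= K" for n
  unfolding K_def
 proof (rule rlattice.kinetic_bound[OF rl[of n] GA A(1) less_imp_le[OF d0]])
  show "1 / (4 * c) * rlattice.cGN m0 d <= 1 / 4" unfolding c_def[symmetric] using c by simp
  show "u n \<in> lattice.D (L n) (%i. h n * ((real i + 1) * h n) ^ (d - 1)) m0" by (rule rlattice.crit_D[OF rl u(1)])
  show "lattice.EE (L n) (%i. h n * ((real i + 1) * h n) ^ (d - 1)) (%i. ((real i + 1) * h n) ^ (d - 1) / h n) G (u n) <= 0"
   using u(4)[of n] e0 by linarith
 qed
 have Vk0: "0 <= rlattice.Vk (L n) (d - 1) (h n) (u n)" for n
  unfolding rlattice.Vk_def[OF rl] by (rule rlattice.Kin_nonneg[OF rl])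
 \<comment> \<open>\<open>nehari\<close> combined with \<open>growth_sum\<close>, solved for the
   multiplier at full mass \<open>m0\<close>.\<close>
 define M where "M = 2 * (Cg * (m0 + c * K)) / m0"
 have M: "\<mu> n <= M" for n
 proof (cases "\<mu> n > 0")
  case True
  have "\<mu> n / 2 * m0 <= Cg * (m0 + c * K)"
   using rlattice.nehari[OF rl u(1) u(2), of n] rlattice.growth_sum[OF rl gg Cg rlattice.crit_D[OF rl u(1)] Vk K1, of n] Vk0[of n]
   unfolding u(3)[OF True] c_def[symmetric] by linarith
  thus ?thesis unfolding M_def using m0 by (simp add: field_simps)
 next
  case False
  have "0 <= M" unfolding M_def using Cg m0 c K1 by simp
  thus ?thesis using False by linarith
 qed
 have h0: "h \<longlonglongrightarrow> 0"
 proof -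
  have "(%n. min 1 w * inverse (real (Suc n))) \<longlonglongrightarrow> min 1 w * 0" by (intro tendsto_mult tendsto_const LIMSEQ_inverse_real_of_nat)
  thus ?thesis unfolding h_def[abs_def] by (simp add: divide_inverse add.commute)
 qed
 have hLt: "filterlim (%n. h n * real (L n)) at_top sequentially"
 proof (rule filterlim_at_top_mono[OF filterlim_real_sequentially])
  have "real n <= h n * real (L n)" for n using hL[of n] X by linarith
  thus "\<forall>\<^sub>F n in sequentially. real n <= h n * real (L n)" by simp
 qed
 have ap: "approx d (d - 1) k g G m0 K M e0 Cg h L u \<mu>"
  by (rule approx.intro) (fact rl h(2) h0 hLt u M Vk K1 gg GG Cg small)+
 obtain sq v mu where sq: "strict_mono sq" "!!t. 0 < t ==> (%n. approx.vs h u (sq n) t) \<longlonglongrightarrow> v t" "(%n. \<mu> (sq n)) \<longlonglongrightarrow> mu"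
  by (rule approx.convergent_subsequence[OF ap]; iprover)
 note ap' = approx.approx_subseq[OF ap sq(1)]
 define v' where "v' t = (if t > 0 then v t else 0)" for t
 have cv: "conv d (d - 1) k g G m0 K M e0 Cg (%n. h (sq n)) (%n. L (sq n)) (%n. u (sq n)) (%n. \<mu> (sq n)) v' mu"
  unfolding conv_def conv_axioms_def
 proof (intro conjI allI impI ap')
  show "(%n. approx.vs (%n. h (sq n)) (%n. u (sq n)) n t) \<longlonglongrightarrow> v' t" if t: "t > 0" for t
   using sq(2)[OF t] t unfolding approx.vs_def[OF ap] approx.vs_def[OF ap'] v'_def by simp
 qed (use sq(3) in \<open>auto simp: v'_def\<close>)
 have mu: "mu > 0" by (rule conv.mu0_pos[OF cv e0])
 obtain p y B where p: "profile d (d - 1) g mu m0 K B p y" "!!t. t > 0 ==> p t = v' t"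
  by (rule conv.limit_profile[OF cv mu]; iprover)
 have pv: "(%t. if t > 0 then p t else 0) = v'" using p(2) by (auto simp: fun_eq_iff v'_def)
 show thesis by (rule that[OF p(1)]) (unfold pv, rule conv.v_alt[OF cv mu k], rule conv.v_not_alt[OF cv])
qed

end

text \<open>By radial symmetry the direction is immaterial; the value 0 for \<open>r <= 0\<close>
  matches the convention for limit profiles.\<close>

definition ray :: "(real^'n::finite => real) => real => real" where
 "ray f r = (if r > 0 then f (r *\<^sub>R axis undefined 1) else 0)"

text \<open>The number of sign changes is known only to be \<open>k - 1\<close> or \<open>k\<close>,
  because one may be lost at the origin.\<close>

definition nodal_solution :: "(real => real) => real => nat => (real^'n::finite => real) => bool" where
 "nodal_solution g m k U \<longleftrightarrow> radial_solution g m U \<and> continuous_on UNIV U \<and> alt (k - 1) (ray U) \<and> \<not> alt (Suc k) (ray U)"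

text \<open>The parameters \<open>2 * i + 1\<close> leave the counts \<open>2 * i\<close> and
  \<open>2 * i + 1\<close>, which are disjoint for different \<open>i\<close>. Continuity upgrades
  equality almost everywhere to equality, so the counts can be compared.\<close>

lemma nodal_solutions_distinct:
 fixes U W :: "real^'n::finite => real"
 assumes U: "nodal_solution g m (2 * i + 1) U" and W: "nodal_solution g m (2 * j + 1) W" and ij: "i \<noteq> j"
 shows "\<not> (AE x in lebesgue. U x = W x)"
proof
 assume ae: "AE x in lebesgue. U x = W x"
 have eq: "U = W"
  using continuous_AE_eq[OF _ _ ae] U W unfolding nodal_solution_def by (auto simp: fun_eq_iff)
 have lt: False if "nodal_solution g m (2 * i + 1) U" "nodal_solution g m (2 * j + 1) U" "i < j" for i j
 proof -
  have "alt (2 * j) (ray U)" using that(2) unfolding nodal_solution_def by simp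
  hence "alt (Suc (2 * i + 1)) (ray U)" by (rule alt_mono) (use that(3) in simp)
  thus False using that(1) unfolding nodal_solution_def by blast
 qed
 thus False using U W ij unfolding eq by (meson nat_neq_iff)
qed

section \<open>Choice of the test configurations for large and for arbitrary mass\<close>

context nonlinearity
begin

definition vol :: real where "vol = real d * unit_ball_vol (real d)"

lemma vol_pos: "vol > 0" unfolding vol_def using d2 by (intro mult_pos_pos unit_ball_vol_pos) auto

lemma nodal_solution_exists:
 assumes dn: "d = CARD('n::finite)" and m: "m > 0" and k: "k >= 1" and s: "s > 0" and w: "w > 0" "4 * w <= l"
  and \<Gamma>: "!!t. 0 <= t ==> t <= s ==> - G t <= \<Gamma>" and Gs: "G s >= 0" and e0: "e0 > 0"
  and E: "(real k + 1) * (8 * w * ((3 * real k + 4) * l) ^ (d - 1) * ((dTh s * s / w)\<^sup>2 / 2 + \<Gamma>)) + e0 <= G s * (l - w) * l ^ (d - 1)"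
  and mass: "vol * (((3 * real k + 4) * l) ^ d * s\<^sup>2) <= m"
 shows "\<exists>U :: real^'n => real. nodal_solution g m k U"
proof -
 have m0: "m / vol > 0" using m vol_pos by simp
 have mass': "((3 * real k + 4) * l) ^ d * s\<^sup>2 <= m / vol" using mass vol_pos by (simp add: pos_le_divide_eq mult.commute)
 obtain mu K B p y where p: "profile d (d - 1) g mu (m / vol) K B p y"
  "alt (k - 1) (%t. if t > 0 then p t else 0)" "\<not> alt (Suc k) (%t. if t > 0 then p t else 0)"
  by (rule nodal_profile[OF m0 k s w \<Gamma> Gs e0 E mass'])
 have rp: "radial_profile TYPE('n) d (d - 1) g mu (m / vol) K B p y"
  unfolding radial_profile_def radial_profile_axioms_def using p(1) dn by simp
 define U :: "real^'n => real" where "U = radial_profile.U p"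
 have "real d * unit_ball_vol (real d) * (m / vol) = m" unfolding vol_def[symmetric] using vol_pos by simp
 hence rs: "radial_solution g m U" using radial_profile.radial_solution(1)[OF rp] unfolding U_def by simp
 have Uc: "continuous_on UNIV U" unfolding U_def by (rule radial_profile.radial_solution(2)[OF rp])
 have r: "ray U r = (if r > 0 then Thi (p r) else 0)" for r
  unfolding ray_def U_def radial_profile.U_def[OF rp] radial_profile.V_def[OF rp] by (simp add: norm_axis_1)
 have sg: "sgn (ray U r) = sgn (if r > 0 then p r else 0)" for r unfolding r by (simp add: sgn_Thi)
 have "alt (k - 1) (ray U)" by (rule alt_sgn_cong[OF p(2)]) (rule sg)
 moreover have "\<not> alt (Suc k) (ray U)"
 proof
  assume "alt (Suc k) (ray U)"
  hence "alt (Suc k) (%t. if t > 0 then p t else 0)" by (rule alt_sgn_cong) (rule sg[symmetric])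
  thus False using p(3) by blast
 qed
 ultimately show ?thesis using rs Uc unfolding nodal_solution_def by blast
qed

text \<open>Fix the height \<open>s\<close> and ramp width 1 and enlarge \<open>l\<close>: the ramps
  cost a multiple of \<open>l ^ (d - 1)\<close>, the plateau gains a multiple of
  \<open>l ^ d\<close>. The threshold is the mass bound of the resulting configuration.\<close>

theorem large_mass:
 assumes dn: "d = CARD('n::finite)" and k: "k >= 1" and s: "s > 0" "G s > 0"
 shows "\<exists>mk\<ge>0. \<forall>m>mk. \<exists>U :: real^'n => real. nodal_solution g m k U"
proof -
 obtain C1 where C1: "C1 >= 0" "!!s. \<bar>g s\<bar> <= C1 * \<bar>s\<bar> + 1 * \<bar>s\<bar> powr (3 + 4 / real d)" by (rule g_growth[OF zero_less_one]; iprover)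
 define \<Gamma> where "\<Gamma> = C1 * s\<^sup>2 + 1 * s powr (4 + 4 / real d)"
 have \<Gamma>: "- G t <= \<Gamma>" if t: "0 <= t" "t <= s" for t
 proof -
  have "- G t <= C1 * t\<^sup>2 + 1 * \<bar>t\<bar> powr (4 + 4 / real d)" using G_growth[OF C1(1) zero_le_one C1(2), of t] by linarith
  also have "\<dots> <= \<Gamma>" unfolding \<Gamma>_def using t C1(1) by (intro add_mono mult_left_mono power_mono powr_mono2) auto
  finally show ?thesis .
 qed
 have \<Gamma>0: "\<Gamma> >= 0" using \<Gamma>[of 0] s G_0 by simp
 define C where "C = (real k + 1) * (8 * (3 * real k + 4) ^ (d - 1) * ((dTh s * s / 1)\<^sup>2 / 2 + \<Gamma>))"
 have C: "C >= 0" unfolding C_def using \<Gamma>0 by (intro mult_nonneg_nonneg add_nonneg_nonneg) auto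
 \<comment> \<open>Solved from \<open>G s * (l - 1) >= C + 1\<close>; the summand 4 ensures
   \<open>4 * w <= l\<close> for \<open>w = 1\<close>.\<close>
 define l where "l = 4 + (C + 1) / G s"
 have "(C + 1) / G s >= 0" using C s by simp
 hence l: "l >= 4" unfolding l_def by simp
 have "G s * (3 + (C + 1) / G s) = G s * 3 + (C + 1)"
 proof -
  have "G s \<noteq> 0" using s by simp
  hence "(C + 1) / G s * G s = C + 1" using nonzero_eq_divide_eq[of "G s" "(C + 1) / G s" "C + 1"] by simp
  thus ?thesis by (simp only: distrib_left mult.commute[of "G s" "(C + 1) / G s"])
 qed
 hence Gl: "G s * (l - 1) >= C + 1" unfolding l_def using s by (simp add: algebra_simps)
 have l1: "l ^ (d - 1) >= 1" using l by (intro one_le_power) simp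
 have E: "(real k + 1) * (8 * 1 * ((3 * real k + 4) * l) ^ (d - 1) * ((dTh s * s / 1)\<^sup>2 / 2 + \<Gamma>)) + 1 <= G s * (l - 1) * l ^ (d - 1)"
 proof -
  have "(real k + 1) * (8 * 1 * ((3 * real k + 4) * l) ^ (d - 1) * ((dTh s * s / 1)\<^sup>2 / 2 + \<Gamma>)) + 1 = C * l ^ (d - 1) + 1"
   unfolding C_def power_mult_distrib by (simp add: mult_ac)
  also have "\<dots> <= (C + 1) * l ^ (d - 1)" using l1 by (simp add: distrib_right)
  also have "\<dots> <= G s * (l - 1) * l ^ (d - 1)" using Gl l1 by (intro mult_right_mono) auto
  finally show ?thesis .
 qed
 show ?thesis
 proof (intro exI[of _ "vol * (((3 * real k + 4) * l) ^ d * s\<^sup>2)"] conjI allI impI)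
  show b: "0 <= vol * (((3 * real k + 4) * l) ^ d * s\<^sup>2)" using vol_pos l by simp
  fix m assume m: "m > vol * (((3 * real k + 4) * l) ^ d * s\<^sup>2)"
  have "m > 0" using b m by linarith
  thus "\<exists>U :: real^'n => real. nodal_solution g m k U"
   by (rule nodal_solution_exists[OF dn _ k s(1) zero_less_one _ \<Gamma> _ zero_less_one E]) (use l s m in auto)
 qed
qed

text \<open>Integrate (g6) from 0: the derivative of \<open>A * t powr q\<close> is
  \<open>A * q * t powr (q - 1)\<close>, which \<open>g\<close> exceeds near 0.\<close>

lemma G_lower:
 assumes g6: "filterlim (%s. g s / (\<bar>s\<bar> powr (2 + 4 / real d - 2) * s)) at_top (at 0)" and A: "A >= 0"
 obtains \<delta> where "\<delta> > 0" "!!t. 0 <= t ==> t < \<delta> ==> G t >= A * t powr (2 + 4 / real d)"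
proof -
 define q where "q = 2 + 4 / real d"
 have q: "q > 1" unfolding q_def by (simp add: add_pos_nonneg)
 have "\<forall>\<^sub>F s in at 0. A * q <= g s / (\<bar>s\<bar> powr (q - 2) * s)" using g6 unfolding filterlim_at_top q_def by blast
 then obtain \<delta> where \<delta>: "\<delta> > 0" "!!s. s \<noteq> 0 ==> \<bar>s\<bar> < \<delta> ==> A * q <= g s / (\<bar>s\<bar> powr (q - 2) * s)"
  unfolding eventually_at dist_real_def by auto
 have gl: "g s >= A * (q * s powr (q - 1))" if s: "0 < s" "s < \<delta>" for s
 proof -
  have "q - 1 = (q - 2) + 1" by simp
  hence "s powr (q - 1) = s powr (q - 2) * s powr 1" by (simp only: powr_add)
  hence e: "\<bar>s\<bar> powr (q - 2) * s = s powr (q - 1)" using s by simp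
  show ?thesis using \<delta>(2)[of s] s unfolding e by (simp add: pos_le_divide_eq mult_ac)
 qed
 have "A * t powr q <= G t" if t: "0 <= t" "t < \<delta>" for t
 proof (cases "t = 0")
  case True thus ?thesis using G_0 by simp
 next
  case False
  have "G 0 - A * 0 powr q <= G t - A * t powr q"
  proof (rule DERIV_nonneg_imp_increasing_open[where f = "%t. G t - A * t powr q"])
   show "0 <= t" by (rule t)
   show "\<exists>y. ((%t. G t - A * t powr q) has_real_derivative y) (at x) \<and> 0 <= y" if x: "0 < x" "x < t" for x
    using DERIV_diff[OF G_deriv DERIV_cmult[OF has_real_derivative_powr[OF x(1)]], of A q] gl[of x] x t by (intro exI[of _ "g x - A * (q * x powr (q - 1))"]) auto
   have "continuous_on {0..t} G" by (rule DERIV_continuous_on[OF has_field_derivative_at_within[OF G_deriv]])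
   thus "continuous_on {0..t} (%t. G t - A * t powr q)" using q by (intro continuous_intros continuous_on_powr') auto
  qed
  thus ?thesis using G_0 by simp
 qed
 thus thesis using that[OF \<delta>(1)] unfolding q_def by blast
qed

text \<open>The mass ties the radius \<open>Y\<close> to the height \<open>s\<close> by
  \<open>Y ^ d * s^2 = m0\<close>. Ramp cost and plateau gain then scale alike in \<open>s\<close>,
  because \<open>Y^2 * s powr (4 / d)\<close> is constant, and the arbitrarily large factor supplied
  by (g6) decides.\<close>

theorem all_masses:
 assumes dn: "d = CARD('n::finite)" and k: "k >= 1" and m: "m > 0"
  and g6: "filterlim (%s. g s / (\<bar>s\<bar> powr (2 + 4 / real d - 2) * s)) at_top (at 0)"
 shows "\<exists>U :: real^'n => real. nodal_solution g m k U"
proof -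
 define m0 where "m0 = m / vol"
 have m0: "m0 > 0" unfolding m0_def using m vol_pos by simp
 define X where "X = 4 * (3 * real k + 4)"
 have X: "X > 0" unfolding X_def by simp
 \<comment> \<open>The 12 is half of the 8 in the ramp estimate times 3, the bound of
   \<open>dTh s\<close> squared for \<open>s <= 1\<close>.\<close>
 define E where "E = (real k + 1) * 12 * (3 * real k + 4) ^ (d - 1)"
 have E: "E >= 0" unfolding E_def by simp
 \<comment> \<open>Chosen so that \<open>key\<close> comes out: the plateau covers the ramp cost
   \<open>E\<close> and a further 1, which becomes \<open>e0\<close>.\<close>
 define A where "A = (E + 1) * X\<^sup>2 / (3 * m0 powr (2 / real d))"
 have A: "A >= 0" unfolding A_def using E by simp
 obtain \<delta> where \<delta>: "\<delta> > 0" "!!t. 0 <= t ==> t < \<delta> ==> G t >= A * t powr (2 + 4 / real d)" by (rule G_lower[OF g6 A]; iprover)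
 define s where "s = min 1 (\<delta> / 2)"
 have s: "0 < s" "s <= 1" "s < \<delta>" unfolding s_def using \<delta>(1) by auto
 have G0: "G t >= 0" if "0 <= t" "t <= s" for t
 proof -
  have "0 <= A * t powr (2 + 4 / real d)" using A by simp
  thus ?thesis using \<delta>(2)[of t] that s by linarith
 qed
 define Y where "Y = (m0 / s\<^sup>2) powr (1 / real d)"
 have d0: "real d > 0" using d2 by simp
 have Y: "Y > 0" unfolding Y_def using m0 s by simp
 have Yd: "Y ^ d = m0 / s\<^sup>2"
 proof -
  have "Y ^ d = Y powr real d" using Y by (simp add: powr_realpow)
  also have "\<dots> = m0 / s\<^sup>2" unfolding Y_def powr_powr using d0 m0 s by simp
  finally show ?thesis .
 qed
 have Y2: "Y\<^sup>2 * s powr (4 / real d) = m0 powr (2 / real d)"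
 proof -
  have "Y\<^sup>2 = Y powr 2" using Y by simp
  also have "\<dots> = (m0 / s\<^sup>2) powr (2 / real d)" unfolding Y_def powr_powr by simp
  also have "\<dots> = m0 powr (2 / real d) / (s\<^sup>2) powr (2 / real d)" using m0 s by (simp add: powr_divide)
  also have "(s\<^sup>2) powr (2 / real d) = (s powr 2) powr (2 / real d)" using s by simp
  also have "\<dots> = s powr (4 / real d)" unfolding powr_powr by simp
  finally show ?thesis using s by simp
 qed
 define w where "w = Y / X"
 have w: "w > 0" unfolding w_def using X Y by simp
 have XY: "(3 * real k + 4) * (4 * w) = Y" unfolding w_def X_def by (simp add: field_simps)
 have key: "G s * (3 * w\<^sup>2) >= (E + 1) * s\<^sup>2"
 proof -
  have "(E + 1) * s\<^sup>2 = A * (3 * (Y\<^sup>2 * s powr (4 / real d)) / X\<^sup>2) * s\<^sup>2"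
   unfolding Y2 A_def using X m0 by simp
  also have "\<dots> = A * (s\<^sup>2 * s powr (4 / real d)) * (3 * w\<^sup>2)" unfolding w_def by (simp add: power_divide mult_ac)
  also have "s\<^sup>2 * s powr (4 / real d) = s powr (2 + 4 / real d)" using s by (simp add: powr_add)
  also have "A * s powr (2 + 4 / real d) * (3 * w\<^sup>2) <= G s * (3 * w\<^sup>2)" using \<delta>(2)[of s] s by (intro mult_right_mono) auto
  finally show ?thesis .
 qed
 define e0 where "e0 = s\<^sup>2 / w * (4 * w) ^ (d - 1)"
 have e0: "e0 > 0" unfolding e0_def using s w by simp
 have EE: "(real k + 1) * (8 * w * ((3 * real k + 4) * (4 * w)) ^ (d - 1) * ((dTh s * s / w)\<^sup>2 / 2 + 0)) + e0 <= G s * (4 * w - w) * (4 * w) ^ (d - 1)"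
 proof -
  have "s\<^sup>2 <= 1" using s by (simp add: power_le_one)
  hence dT: "(dTh s)\<^sup>2 <= 3" unfolding dTh_sq by simp
  have "(real k + 1) * (8 * w * ((3 * real k + 4) * (4 * w)) ^ (d - 1) * ((dTh s * s / w)\<^sup>2 / 2 + 0))
   = (real k + 1) * 4 * (3 * real k + 4) ^ (d - 1) * (s\<^sup>2 / w) * (4 * w) ^ (d - 1) * (dTh s)\<^sup>2"
   using w by (simp add: power_mult_distrib power_divide) (simp add: power2_eq_square)
  also have "\<dots> <= (real k + 1) * 4 * (3 * real k + 4) ^ (d - 1) * (s\<^sup>2 / w) * (4 * w) ^ (d - 1) * 3"
   using dT w by (intro mult_left_mono) auto
  also have "\<dots> = E * e0" unfolding E_def e0_def by (simp add: mult_ac)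
  finally have "(real k + 1) * (8 * w * ((3 * real k + 4) * (4 * w)) ^ (d - 1) * ((dTh s * s / w)\<^sup>2 / 2 + 0)) + e0 <= (E + 1) * e0"
   by (simp add: distrib_right)
  also have "(E + 1) * e0 = (E + 1) * s\<^sup>2 * ((4 * w) ^ (d - 1) / w)" unfolding e0_def by simp
  also have "\<dots> <= G s * (3 * w\<^sup>2) * ((4 * w) ^ (d - 1) / w)" using key w by (intro mult_right_mono) auto
  also have "\<dots> = G s * (4 * w - w) * (4 * w) ^ (d - 1)" using w by (simp add: power2_eq_square)
  finally show ?thesis .
 qed
 have mass: "vol * (((3 * real k + 4) * (4 * w)) ^ d * s\<^sup>2) <= m"
  unfolding XY Yd using s vol_pos by (simp add: m0_def)
 show ?thesis
  by (rule nodal_solution_exists[OF dn m k s(1) w order_refl _ _ e0 EE mass]) (use G0 s in auto)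
qed

end

text \<open>A lower limit equal to plus infinity is divergence to infinity, hence
  \<open>filterlim\<close> to \<open>at_top\<close>. Solutions are drawn from the odd parameters
  \<open>2 * j + 1\<close>, which \<open>nodal_solutions_distinct\<close> separates.\<close>

theorem theorem1p5:
  fixes g :: "real \<Rightarrow> real"
  assumes N2: "CARD('n::finite) \<ge> 2"
    and g1: "continuous_on UNIV g"
    and g2: "((\<lambda>s. g s / s) \<longlongrightarrow> 0) (at 0)"
    and g3: "((\<lambda>s. \<bar>g s\<bar> / \<bar>s\<bar> powr (4 + 4 / real CARD('n) - 1)) \<longlongrightarrow> 0) at_infinity"
    and g4: "\<exists>s0>0. integral {0..s0} g > 0"
    and g5: "\<And>s. g (- s) = - g s"
  shows "(\<forall>k::nat. \<exists>mk\<ge>0. \<forall>m>mk.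
            at_least_k_radial_solutions g m k TYPE(real^'n \<Rightarrow> real))
       \<and> (filterlim (\<lambda>s. g s / (\<bar>s\<bar> powr (2 + 4 / real CARD('n) - 2) * s)) at_top (at 0)
          \<longrightarrow> (\<forall>m>0. infinitely_many_radial_solutions g m TYPE(real^'n \<Rightarrow> real)))"
proof -
 \<comment> \<open>A primitive on the whole line: the integral over \<open>{0..s}\<close> is 0 for
   negative \<open>s\<close> and would not be differentiable with derivative \<open>g\<close>
   there.\<close>
 have "\<exists>H. \<forall>x. - \<infinity> < ereal x --> ereal x < \<infinity> --> (H has_vector_derivative g x) (at x)"
  by (rule einterval_antiderivative) (use g1 in \<open>auto simp: continuous_on_eq_continuous_at\<close>)
 then obtain H where H: "!!x. (H has_real_derivative g x) (at x)"
  by (auto simp: has_real_derivative_iff_has_vector_derivative)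
 define G where "G s = H s - H 0" for s
 have GD: "(G has_real_derivative g s) (at s)" for s
  using DERIV_diff[OF H[of s] DERIV_const[of "H 0"]] unfolding G_def by simp
 interpret nonlinearity "CARD('n)" g G
  by unfold_locales (use N2 g1 g2 g3 g5 GD in \<open>auto simp: G_def\<close>)
 obtain s0 where s0: "s0 > 0" "integral {0..s0} g > 0" using g4 by blast
 have "(g has_integral G s0 - G 0) {0..s0}"
  by (rule fundamental_theorem_of_calculus) (use s0 has_field_derivative_at_within[OF GD] in \<open>auto simp flip: has_real_derivative_iff_has_vector_derivative\<close>)
 hence G0: "G s0 > 0" using s0(2) G_0 by (simp add: integral_unique)
 show ?thesis
 proof (intro conjI allI impI)
  fix k
  have "\<exists>mk. mk >= 0 \<and> (\<forall>m>mk. \<exists>U :: real^'n => real. nodal_solution g m (2 * j + 1) U)" for j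
   using large_mass[OF refl _ s0(1) G0, of "2 * j + 1"] by auto
  then obtain M where M: "!!j. M j >= 0" "!!j m. m > M j ==> \<exists>U :: real^'n => real. nodal_solution g m (2 * j + 1) U"
   by metis
  show "\<exists>mk\<ge>0. \<forall>m>mk. at_least_k_radial_solutions g m k TYPE(real^'n => real)"
  \<comment> \<open>The thresholds are nonnegative, so their sum bounds each of them and one
    threshold serves all \<open>k\<close> solutions.\<close>
  proof (intro exI[of _ "\<Sum>j<k. M j"] conjI allI impI)
   show "0 <= (\<Sum>j<k. M j)" using M(1) by (intro sum_nonneg) auto
   fix m assume m: "m > (\<Sum>j<k. M j)"
   have "\<exists>U :: real^'n => real. j < k --> nodal_solution g m (2 * j + 1) U" for j
   proof (cases "j < k")
    case True
    hence "M j <= (\<Sum>j<k. M j)" using M(1) by (intro member_le_sum) auto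
    thus ?thesis using M(2)[of j m] m by auto
   qed blast
   then obtain us :: "nat => real^'n => real" where us: "!!j. j < k ==> nodal_solution g m (2 * j + 1) (us j)" by metis
   show "at_least_k_radial_solutions g m k TYPE(real^'n => real)"
    unfolding at_least_k_radial_solutions_def
    by (intro exI[of _ us] conjI allI impI nodal_solutions_distinct us) (use us in \<open>auto simp: nodal_solution_def\<close>)
  qed
 next
  fix m :: real assume g6: "filterlim (%s. g s / (\<bar>s\<bar> powr (2 + 4 / real CARD('n) - 2) * s)) at_top (at 0)" and m: "m > 0"
  have "\<exists>U :: real^'n => real. nodal_solution g m (2 * j + 1) U" for j
   by (rule all_masses[OF refl _ m g6]) simp
  then obtain us :: "nat => real^'n => real" where us: "!!j. nodal_solution g m (2 * j + 1) (us j)" by metis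
  show "infinitely_many_radial_solutions g m TYPE(real^'n => real)"
   unfolding infinitely_many_radial_solutions_def
   by (intro exI[of _ us] conjI allI impI nodal_solutions_distinct us) (use us in \<open>auto simp: nodal_solution_def\<close>)
 qed
qed

end
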